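(* Let $k\ge1$. Then the embedding $H^k_{\mathbb S,\Gamma_t}(\operatorname{Rot},\Omega)\cap H^{k,k-1}_{\mathbb S,\Gamma_n}(\operatorname{divDiv},\Omega)\hookrightarrow H^k_{\mathbb S,\Gamma}(\Omega)$ is compact (the intersection normed by $\|S\|_{H^k}+\|\operatorname{Rot}S\|_{H^k}+\|\operatorname{divDiv}S\|_{H^{k-1}}$, the target by the $H^k(\Omega)$-norm).
   Context: Let $\Omega\subset\mathbb{R}^3$ be a bounded strong Lipschitz domain with boundary $\Gamma$, $\Gamma_t\subset\Gamma$ a relatively open strong Lipschitz boundary part, $\Gamma_n:=\Gamma\setminus\overline{\Gamma_t}$. For relatively open $\Sigma\subset\Gamma$, $C^\infty_\Sigma(\Omega)$ denotes restrictions to $\Omega$ of smooth compactly supported (scalar/matrix valued) functions on $\mathbb R^3$ with support at positive distance to $\Sigma$; $L^2_{\mathbb S}$ symmetric $3\times3$ matrix fields, $C^\infty_{\mathbb S,\Sigma}:=C^\infty_\Sigma\cap L^2_{\mathbb S}$. $H^k_\Sigma(\Omega)$: closure of $C^\infty_\Sigma(\Omega)$ in $H^k(\Omega)$; $H^k_{\mathbb S,\Sigma}:=H^k_\Sigma\cap L^2_{\mathbb S}$. Operators (distributional): $\operatorname{Rot},\operatorname{Div}$ row-wise $\operatorname{curl},\operatorname{div}$; $\operatorname{divDiv}S:=\operatorname{div}\operatorname{Div}S$. $H_{\mathbb S,\Sigma}(\operatorname{Rot})$, $H_{\mathbb S,\Sigma}(\operatorname{divDiv})$: closures of $C^\infty_{\mathbb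 S,\Sigma}$ in the graph norms of $\{S\in L^2_{\mathbb S}:\operatorname{Rot}S\in L^2\}$, $\{S\in L^2_{\mathbb S}:\operatorname{divDiv}S\in L^2\}$. $H^k_{\mathbb S,\Sigma}(\operatorname{Rot}):=\{S\in H^k_\Sigma\cap H_{\mathbb S,\Sigma}(\operatorname{Rot}):\operatorname{Rot}S\in H^k_\Sigma\}$; $H^{k,k-1}_{\mathbb S,\Sigma}(\operatorname{divDiv}):=\{S\in H^k_\Sigma\cap H_{\mathbb S,\Sigma}(\operatorname{divDiv}):\operatorname{divDiv}S\in H^{k-1}_\Sigma\}$. *)

theory Defs
  imports "HOL-Analysis.Analysis"
begin

definition partial :: "3 \<Rightarrow> (real^3 \<Rightarrow> real) \<Rightarrow> real^3 \<Rightarrow> real" where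
  "partial i f x = frechet_derivative f (at x) (axis i 1)"

fun Ck :: "nat \<Rightarrow> (real^3 \<Rightarrow> real) \<Rightarrow> bool" where
  "Ck 0 f = continuous_on UNIV f"
| "Ck (Suc n) f = ((\<forall>x. f differentiable (at x)) \<and> (\<forall>i. Ck n (partial i f)))"

definition smooth :: "(real^3 \<Rightarrow> real) \<Rightarrow> bool" where
  "smooth f \<longleftrightarrow> (\<forall>n. Ck n f)"

fun pd :: "3 list \<Rightarrow> (real^3 \<Rightarrow> real) \<Rightarrow> real^3 \<Rightarrow> real" where
  "pd [] f = f"
| "pd (i # is) f = partial i (pd is f)"

definition csupp :: "(real^3 \<Rightarrow> real) \<Rightarrow> (real^3) set" where
  "csupp f = closure {x. f x \<noteq> 0}"

definition test :: "(real^3) set \<Rightarrow> (real^3 \<Rightarrow> real) \<Rightarrow> bool" where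
  "test \<Omega> \<phi> \<longleftrightarrow> smooth \<phi> \<and> compact (csupp \<phi>) \<and> csupp \<phi> \<subseteq> \<Omega>"

text \<open>C^infinity_Sigma(Omega) (restrictions to Omega are implicit, since only
  values on Omega enter): smooth, compact support at positive distance to Sigma.\<close>
definition Csig :: "(real^3) set \<Rightarrow> (real^3 \<Rightarrow> real) \<Rightarrow> bool" where
  "Csig \<Sigma> \<phi> \<longleftrightarrow> smooth \<phi> \<and> compact (csupp \<phi>) \<and>
     (\<exists>\<epsilon>>0. \<forall>x\<in>csupp \<phi>. \<forall>y\<in>\<Sigma>. \<epsilon> \<le> dist x y)"

definition L2 :: "(real^3) set \<Rightarrow> (real^3 \<Rightarrow> real) \<Rightarrow> bool" where
  "L2 \<Omega> g \<longleftrightarrow> g \<in> borel_measurable (lebesgue_on \<Omega>) \<and>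
     integrable (lebesgue_on \<Omega>) (\<lambda>x. (g x)^2)"

definition L2norm :: "(real^3) set \<Rightarrow> (real^3 \<Rightarrow> real) \<Rightarrow> real" where
  "L2norm \<Omega> g = sqrt (LINT x|lebesgue_on \<Omega>. (g x)^2)"

definition wderiv :: "(real^3) set \<Rightarrow> 3 list \<Rightarrow> (real^3 \<Rightarrow> real) \<Rightarrow> (real^3 \<Rightarrow> real) \<Rightarrow> bool" where
  "wderiv \<Omega> is f g \<longleftrightarrow> (\<forall>\<phi>. test \<Omega> \<phi> \<longrightarrow>
     (LINT x|lebesgue_on \<Omega>. f x * pd is \<phi> x) =
     (-1) ^ length is * (LINT x|lebesgue_on \<Omega>. g x * \<phi> x))"

definition Hk_mem :: "(real^3) set \<Rightarrow> nat \<Rightarrow> (real^3 \<Rightarrow> real) \<Rightarrow> bool" where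
  "Hk_mem \<Omega> k f \<longleftrightarrow> L2 \<Omega> f \<and>
     (\<forall>is::3 list. length is \<le> k \<longrightarrow> (\<exists>g. L2 \<Omega> g \<and> wderiv \<Omega> is f g))"

text \<open>The (a.e. unique) weak derivative.\<close>
definition D :: "(real^3) set \<Rightarrow> 3 list \<Rightarrow> (real^3 \<Rightarrow> real) \<Rightarrow> real^3 \<Rightarrow> real" where
  "D \<Omega> is f = (SOME g. L2 \<Omega> g \<and> wderiv \<Omega> is f g)"

definition Hk_norm :: "(real^3) set \<Rightarrow> nat \<Rightarrow> (real^3 \<Rightarrow> real) \<Rightarrow> real" where
  "Hk_norm \<Omega> k f = sqrt (\<Sum>is\<in>{is::3 list. length is \<le> k}.
       (LINT x|lebesgue_on \<Omega>. (D \<Omega> is f x)^2))"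

definition Hk :: "(real^3) set \<Rightarrow> nat \<Rightarrow> (real^3) set \<Rightarrow> (real^3 \<Rightarrow> real) \<Rightarrow> bool" where
  "Hk \<Omega> k \<Sigma> f \<longleftrightarrow> Hk_mem \<Omega> k f \<and>
     (\<exists>\<phi>. (\<forall>n. Csig \<Sigma> (\<phi> n)) \<and> (\<lambda>n. Hk_norm \<Omega> k (\<lambda>x. \<phi> n x - f x)) \<longlonglongrightarrow> 0)"

definition comp :: "(real^3 \<Rightarrow> real^3^3) \<Rightarrow> 3 \<Rightarrow> 3 \<Rightarrow> real^3 \<Rightarrow> real" where
  "comp S i j = (\<lambda>x. S x $ i $ j)"

definition MHk :: "(real^3) set \<Rightarrow> nat \<Rightarrow> (real^3) set \<Rightarrow> (real^3 \<Rightarrow> real^3^3) \<Rightarrow> bool" where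
  "MHk \<Omega> k \<Sigma> S \<longleftrightarrow> (\<forall>i j. Hk \<Omega> k \<Sigma> (comp S i j))"

definition MHk_norm :: "(real^3) set \<Rightarrow> nat \<Rightarrow> (real^3 \<Rightarrow> real^3^3) \<Rightarrow> real" where
  "MHk_norm \<Omega> k S = sqrt (\<Sum>i\<in>UNIV. \<Sum>j\<in>UNIV. (Hk_norm \<Omega> k (comp S i j))^2)"

definition ML2 :: "(real^3) set \<Rightarrow> (real^3 \<Rightarrow> real^3^3) \<Rightarrow> bool" where
  "ML2 \<Omega> S \<longleftrightarrow> (\<forall>i j. L2 \<Omega> (comp S i j))"

definition ML2norm :: "(real^3) set \<Rightarrow> (real^3 \<Rightarrow> real^3^3) \<Rightarrow> real" where
  "ML2norm \<Omega> S = sqrt (\<Sum>i\<in>UNIV. \<Sum>j\<in>UNIV. (L2norm \<Omega> (comp S i j))^2)"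

definition symfield :: "(real^3) set \<Rightarrow> (real^3 \<Rightarrow> real^3^3) \<Rightarrow> bool" where
  "symfield \<Omega> S \<longleftrightarrow> (\<forall>x\<in>\<Omega>. transpose (S x) = S x)"

definition frob :: "real^3^3 \<Rightarrow> real^3^3 \<Rightarrow> real" where
  "frob A B = (\<Sum>i\<in>UNIV. \<Sum>j\<in>UNIV. A $ i $ j * B $ i $ j)"

definition Rot_c :: "(real^3 \<Rightarrow> real^3^3) \<Rightarrow> real^3 \<Rightarrow> real^3^3" where
  "Rot_c S x = (\<chi> i j. partial (j + 1) (comp S i (j + 2)) x - partial (j + 2) (comp S i (j + 1)) x)"

definition divDiv_c :: "(real^3 \<Rightarrow> real^3^3) \<Rightarrow> real^3 \<Rightarrow> real" where
  "divDiv_c S x = (\<Sum>i\<in>UNIV. \<Sum>j\<in>UNIV. pd [i, j] (comp S i j) x)"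

definition weak_Rot :: "(real^3) set \<Rightarrow> (real^3 \<Rightarrow> real^3^3) \<Rightarrow> (real^3 \<Rightarrow> real^3^3) \<Rightarrow> bool" where
  "weak_Rot \<Omega> S R \<longleftrightarrow> (\<forall>\<Phi>. (\<forall>i j. test \<Omega> (comp \<Phi> i j)) \<longrightarrow>
     (LINT x|lebesgue_on \<Omega>. frob (S x) (Rot_c \<Phi> x)) = (LINT x|lebesgue_on \<Omega>. frob (R x) (\<Phi> x)))"

definition weak_divDiv :: "(real^3) set \<Rightarrow> (real^3 \<Rightarrow> real^3^3) \<Rightarrow> (real^3 \<Rightarrow> real) \<Rightarrow> bool" where
  "weak_divDiv \<Omega> S g \<longleftrightarrow> (\<forall>\<phi>. test \<Omega> \<phi> \<longrightarrow>
     (LINT x|lebesgue_on \<Omega>. (\<Sum>i\<in>UNIV. \<Sum>j\<in>UNIV. S x $ i $ j * pd [i, j] \<phi> x)) =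
     (LINT x|lebesgue_on \<Omega>. g x * \<phi> x))"

definition RotW :: "(real^3) set \<Rightarrow> (real^3 \<Rightarrow> real^3^3) \<Rightarrow> real^3 \<Rightarrow> real^3^3" where
  "RotW \<Omega> S = (SOME R. ML2 \<Omega> R \<and> weak_Rot \<Omega> S R)"

definition divDivW :: "(real^3) set \<Rightarrow> (real^3 \<Rightarrow> real^3^3) \<Rightarrow> real^3 \<Rightarrow> real" where
  "divDivW \<Omega> S = (SOME g. L2 \<Omega> g \<and> weak_divDiv \<Omega> S g)"

definition CSsig :: "(real^3) set \<Rightarrow> (real^3 \<Rightarrow> real^3^3) \<Rightarrow> bool" where
  "CSsig \<Sigma> \<Phi> \<longleftrightarrow> (\<forall>i j. Csig \<Sigma> (comp \<Phi> i j)) \<and> (\<forall>x. transpose (\<Phi> x) = \<Phi> x)"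

definition H_Rot :: "(real^3) set \<Rightarrow> (real^3) set \<Rightarrow> (real^3 \<Rightarrow> real^3^3) \<Rightarrow> bool" where
  "H_Rot \<Omega> \<Sigma> S \<longleftrightarrow> symfield \<Omega> S \<and> ML2 \<Omega> S \<and>
     (\<exists>R. ML2 \<Omega> R \<and> weak_Rot \<Omega> S R \<and>
        (\<exists>\<Phi>. (\<forall>n. CSsig \<Sigma> (\<Phi> n)) \<and>
           (\<lambda>n. ML2norm \<Omega> (\<lambda>x. \<Phi> n x - S x)) \<longlonglongrightarrow> 0 \<and>
           (\<lambda>n. ML2norm \<Omega> (\<lambda>x. Rot_c (\<Phi> n) x - R x)) \<longlonglongrightarrow> 0))"

definition H_divDiv :: "(real^3) set \<Rightarrow> (real^3) set \<Rightarrow> (real^3 \<Rightarrow> real^3^3) \<Rightarrow> bool" where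
  "H_divDiv \<Omega> \<Sigma> S \<longleftrightarrow> symfield \<Omega> S \<and> ML2 \<Omega> S \<and>
     (\<exists>g. L2 \<Omega> g \<and> weak_divDiv \<Omega> S g \<and>
        (\<exists>\<Phi>. (\<forall>n. CSsig \<Sigma> (\<Phi> n)) \<and>
           (\<lambda>n. ML2norm \<Omega> (\<lambda>x. \<Phi> n x - S x)) \<longlonglongrightarrow> 0 \<and>
           (\<lambda>n. L2norm \<Omega> (\<lambda>x. divDiv_c (\<Phi> n) x - g x)) \<longlonglongrightarrow> 0))"

definition HkRot :: "(real^3) set \<Rightarrow> nat \<Rightarrow> (real^3) set \<Rightarrow> (real^3 \<Rightarrow> real^3^3) \<Rightarrow> bool" where
  "HkRot \<Omega> k \<Sigma> S \<longleftrightarrow> MHk \<Omega> k \<Sigma> S \<and> H_Rot \<Omega> \<Sigma> S \<and> MHk \<Omega> k \<Sigma> (RotW \<Omega> S)"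

definition HkdivDiv :: "(real^3) set \<Rightarrow> nat \<Rightarrow> (real^3) set \<Rightarrow> (real^3 \<Rightarrow> real^3^3) \<Rightarrow> bool" where
  "HkdivDiv \<Omega> k \<Sigma> S \<longleftrightarrow> MHk \<Omega> k \<Sigma> S \<and> H_divDiv \<Omega> \<Sigma> S \<and> Hk \<Omega> (k - 1) \<Sigma> (divDivW \<Omega> S)"

definition HkS :: "(real^3) set \<Rightarrow> nat \<Rightarrow> (real^3) set \<Rightarrow> (real^3 \<Rightarrow> real^3^3) \<Rightarrow> bool" where
  "HkS \<Omega> k \<Sigma> S \<longleftrightarrow> MHk \<Omega> k \<Sigma> S \<and> symfield \<Omega> S"

definition lipschitz2 :: "(real \<Rightarrow> real \<Rightarrow> real) \<Rightarrow> bool" where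
  "lipschitz2 h \<longleftrightarrow> (\<exists>L. \<forall>a b c d. \<bar>h a b - h c d\<bar> \<le> L * sqrt ((a - c)^2 + (b - d)^2))"

definition lipschitz1 :: "(real \<Rightarrow> real) \<Rightarrow> bool" where
  "lipschitz1 g \<longleftrightarrow> (\<exists>L. \<forall>a b. \<bar>g a - g b\<bar> \<le> L * \<bar>a - b\<bar>)"

definition lip_chart :: "(real^3) set \<Rightarrow> real^3 \<Rightarrow> (real^3) set \<Rightarrow> (real^3 \<Rightarrow> real^3) \<Rightarrow>
    (real \<Rightarrow> real \<Rightarrow> real) \<Rightarrow> bool" where
  "lip_chart \<Omega> x U T h \<longleftrightarrow> open U \<and> x \<in> U \<and> orthogonal_transformation T \<and> lipschitz2 h \<and>
     \<Omega> \<inter> U = {z\<in>U. T (z - x) $ 3 < h (T (z - x) $ 1) (T (z - x) $ 2)}"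

definition strong_lipschitz_domain :: "(real^3) set \<Rightarrow> bool" where
  "strong_lipschitz_domain \<Omega> \<longleftrightarrow> open \<Omega> \<and> connected \<Omega> \<and> bounded \<Omega> \<and> \<Omega> \<noteq> {} \<and>
     (\<forall>x\<in>frontier \<Omega>. \<exists>U T h. lip_chart \<Omega> x U T h)"

text \<open>Strong Lipschitz boundary part: at every point of the relative boundary of Gamma_t
  in Gamma, in a Lipschitz chart of Omega, Gamma_t is the part of the graph lying on one
  side of a Lipschitz curve.\<close>
definition strong_lipschitz_boundary_part :: "(real^3) set \<Rightarrow> (real^3) set \<Rightarrow> bool" where
  "strong_lipschitz_boundary_part \<Omega> \<Gamma>t \<longleftrightarrow>
     \<Gamma>t \<subseteq> frontier \<Omega> \<and> openin (top_of_set (frontier \<Omega>)) \<Gamma>t \<and>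
     (\<forall>x\<in>closure \<Gamma>t - \<Gamma>t. \<exists>U T h g. lip_chart \<Omega> x U T h \<and> lipschitz1 g \<and>
        \<Gamma>t \<inter> U = {z\<in>U. T (z - x) $ 3 = h (T (z - x) $ 1) (T (z - x) $ 2) \<and>
                        T (z - x) $ 1 < g (T (z - x) $ 2)})"

end

theory Submission
  imports Defs "HOL-Library.Diagonal_Subsequence" "HOL-Real_Asymp.Real_Asymp" "HOL-Complex_Analysis.Great_Picard"
begin

text \<open>The embedding itself is a scalar statement: a function in \<open>H\<^sup>k\<close> that vanishes to order \<open>k\<close> on both
  boundary parts vanishes on all of the boundary. Extended by zero it has weak derivatives on $\mathbb{R}^3$
  away from the interface of the two parts. The interface is a Lipschitz curve, has codimension two and is
  therefore removable. The extension can then be localised, pushed into the domain along the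
  Lipschitz graph and mollified.

  For the compactness only the full boundary condition on \<open>S\<close> matters. Let \<open>T\<close> be a derivative of \<open>S\<close> of
  order \<open>k - 1\<close>. Then $\|\nabla T\|^2 = \|\mathrm{Rot}\, T\|^2 + \|\mathrm{Div}\, T\|^2$. Integration by parts gives
  $\|\mathrm{Rot}\, T\|^2 \le C \|T\| \|\nabla \mathrm{Rot}\, T\|$. By symmetry of \<open>T\<close> the difference
  $\mathrm{Div}\, T - \nabla \mathrm{tr}\, T$ is a combination of entries of $\mathrm{Rot}\, T$, and
  $\langle \mathrm{Div}\, T, \nabla \mathrm{tr}\, T \rangle = - \langle \mathrm{divDiv}\, T, \mathrm{tr}\, T \rangle$.
  Hence $\|\nabla T\|^2 \le C \|T\| (\|\mathrm{Rot}\, T\|_{H^1} + \|\mathrm{divDiv}\, T\|)$, and Rellich's theorem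
  for the lower order derivatives yields convergence of the highest ones.\<close>

subsection \<open>Calculus of smooth functions\<close>

text \<open>The boundary is only Lipschitz and no traces are used: a boundary condition always means
  approximability by smooth functions whose supports avoid part of the boundary, so each integration
  by parts is done on approximants and then passed to the limit in L2. The estimate for the gradient
  of T has the factor ||T|| and otherwise involves bounds only, not convergence, of Rot and divDiv.
  Applied to differences of members of a bounded sequence, it turns L2 convergence of the
  derivatives of order k - 1 into convergence of those of order k. This also explains the orders k
  and k - 1 in the norm: for T of order k - 1, the gradient of Rot T has to be in L2, whereas divDiv
  T is merely paired with the trace of T. In gluing the two boundary conditions the obstacle is the
  interface, where no cutoff separates the two kinds of approximants. Cutoffs shrinking to a curve
  have gradients that stay bounded in L2 but are not shown to become small, and the function itself
  is not known to be bounded. The commutator vanishes because the L2 norm of the function over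
  shrinking neighbourhoods of the curve tends to zero.\<close>

lemma partial_eq:
  assumes "(f has_derivative f') (at x)"
  shows "partial i f x = f' (axis i 1)"
  using frechet_derivative_at[OF assms] by (simp add: partial_def)

lemma axis_sum: "(x::real^3) = (\<Sum>i\<in>UNIV. (x $ i) *\<^sub>R axis i 1)"
  using basis_expansion[of x] by (simp add: scalar_mult_eq_scaleR)

lemma frechet_derivative_partial:
  fixes f :: "real^3 \<Rightarrow> real"
  assumes "f differentiable (at x)"
  shows "(f has_derivative (\<lambda>h. \<Sum>i\<in>UNIV. h $ i * partial i f x)) (at x)"
proof -
  let ?D = "frechet_derivative f (at x)"
  have d: "(f has_derivative ?D) (at x)"
    using assms frechet_derivative_works by blast
  interpret l: linear ?D
    using has_derivative_linear[OF d] .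
  have "?D h = (\<Sum>i\<in>UNIV. h $ i * partial i f x)" for h
    by (subst axis_sum[of h]) (simp add: l.sum l.scaleR partial_def)
  then have "?D = (\<lambda>h. \<Sum>i\<in>UNIV. h $ i * partial i f x)" by auto
  with d show ?thesis by metis
qed

lemma Ck_continuous: "Ck n f \<Longrightarrow> continuous_on UNIV f"
  by (cases n) (auto simp: continuous_on_eq_continuous_at differentiable_imp_continuous_within)

lemma Ck_SucD: "Ck (Suc n) f \<Longrightarrow> Ck n f"
proof (induction n arbitrary: f)
  case 0
  then show ?case using Ck_continuous[of "Suc 0" f] by simp
qed auto

text \<open>This makes smoothness accessible to induction on lists of derivatives. From right to
  left, order \<open>n\<close> is obtained by way of order \<open>Suc n\<close>, because
  differentiability is a clause of the successor case while continuity has to be derived from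
  it.\<close>

lemma smooth_iff: "smooth f \<longleftrightarrow> (\<forall>x. f differentiable (at x)) \<and> (\<forall>i. smooth (partial i f))"
proof
  assume "smooth f"
  then show "(\<forall>x. f differentiable (at x)) \<and> (\<forall>i. smooth (partial i f))"
    unfolding smooth_def by (metis Ck.simps(2))
next
  assume r: "(\<forall>x. f differentiable (at x)) \<and> (\<forall>i. smooth (partial i f))"
  have "Ck n f" for n
  proof (rule Ck_SucD)
    show "Ck (Suc n) f" using r by (simp add: smooth_def)
  qed
  then show "smooth f" by (simp add: smooth_def)
qed

lemma smooth_differentiable: "smooth f \<Longrightarrow> f differentiable (at x)"
  using smooth_iff by blast

lemma smooth_partial: "smooth f \<Longrightarrow> smooth (partial i f)"
  using smooth_iff by blast

lemma smooth_pd: "smooth f \<Longrightarrow> smooth (pd is f)"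
  by (induction "is") (auto intro: smooth_partial)

lemma smooth_continuous: "smooth f \<Longrightarrow> continuous_on S f"
  by (metis Ck_continuous smooth_def continuous_on_subset subset_UNIV)

lemma smooth_borel [measurable_dest]: "smooth f \<Longrightarrow> f \<in> borel_measurable borel"
  by (intro borel_measurable_continuous_onI smooth_continuous)

lemma smooth_has_derivative:
  "smooth f \<Longrightarrow> (f has_derivative (\<lambda>h. \<Sum>i\<in>UNIV. h $ i * partial i f x)) (at x)"
  by (intro frechet_derivative_partial smooth_differentiable)

lemma partial_const: "partial i (\<lambda>x. c) = (\<lambda>x. 0)"
  by (rule ext, subst partial_eq[of _ "\<lambda>_. 0"]) auto

lemma partial_add:
  assumes "f differentiable (at x)" "g differentiable (at x)"
  shows "partial i (\<lambda>x. f x + g x) x = partial i f x + partial i g x"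
  using assms unfolding partial_def frechet_derivative_works
  by (subst frechet_derivative_at[symmetric, OF has_derivative_add]) auto

lemma partial_mult:
  fixes f g :: "real^3 \<Rightarrow> real"
  assumes "f differentiable (at x)" "g differentiable (at x)"
  shows "partial i (\<lambda>x. f x * g x) x = partial i f x * g x + f x * partial i g x"
  using assms unfolding partial_def frechet_derivative_works
  by (subst frechet_derivative_at[symmetric, OF has_derivative_mult]) auto

lemma partial_affine:
  fixes f :: "real^3 \<Rightarrow> real"
  assumes "f differentiable (at (a + c *\<^sub>R x))"
  shows "partial i (\<lambda>x. f (a + c *\<^sub>R x)) x = c * partial i f (a + c *\<^sub>R x)"
proof -
  let ?D = "frechet_derivative f (at (a + c *\<^sub>R x))"
  have d: "(f has_derivative ?D) (at (a + c *\<^sub>R x))"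
    using assms frechet_derivative_works by blast
  have "((\<lambda>x. f (a + c *\<^sub>R x)) has_derivative (\<lambda>h. ?D (c *\<^sub>R h))) (at x)"
    by (rule has_derivative_compose[of "\<lambda>x. a + c *\<^sub>R x" "\<lambda>h. c *\<^sub>R h" x UNIV f, OF _ d])
      (auto intro!: derivative_eq_intros)
  then have "partial i (\<lambda>x. f (a + c *\<^sub>R x)) x = ?D (c *\<^sub>R axis i 1)"
    by (rule partial_eq)
  also have "\<dots> = c * ?D (axis i 1)"
    using linear_cmul[OF has_derivative_linear[OF d]] by simp
  finally show ?thesis by (simp add: partial_def)
qed

lemma Ck_const: "Ck n (\<lambda>x. c)"
  by (induction n arbitrary: c) (auto simp: partial_const)

lemma Ck_add: "Ck n f \<Longrightarrow> Ck n g \<Longrightarrow> Ck n (\<lambda>x. f x + g x)"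
proof (induction n arbitrary: f g)
  case 0
  then show ?case by (auto intro: continuous_intros)
next
  case (Suc n)
  then have "partial i (\<lambda>x. f x + g x) = (\<lambda>x. partial i f x + partial i g x)" for i
    by (intro ext partial_add) auto
  with Suc show ?case by auto
qed

lemma Ck_mult: "Ck n f \<Longrightarrow> Ck n g \<Longrightarrow> Ck n (\<lambda>x. f x * g x)"
proof (induction n arbitrary: f g)
  case 0
  then show ?case by (auto intro: continuous_intros)
next
  case (Suc n)
  then have "partial i (\<lambda>x. f x * g x) = (\<lambda>x. partial i f x * g x + f x * partial i g x)" for i
    by (intro ext partial_mult) auto
  moreover have "Ck n (\<lambda>x. partial i f x * g x + f x * partial i g x)" for i
    using Suc.prems Ck_SucD[OF Suc.prems(1)] Ck_SucD[OF Suc.prems(2)]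
    by (intro Ck_add Suc.IH) auto
  ultimately show ?case using Suc.prems by auto
qed

lemma Ck_affine: "Ck n f \<Longrightarrow> Ck n (\<lambda>x. f (a + c *\<^sub>R x))"
proof (induction n arbitrary: f)
  case 0
  then have "continuous_on UNIV (f \<circ> (\<lambda>x. a + c *\<^sub>R x))"
    by (intro continuous_on_compose) (auto intro!: continuous_intros intro: continuous_on_subset)
  then show ?case by (simp add: o_def)
next
  case (Suc n)
  then have "partial i (\<lambda>x. f (a + c *\<^sub>R x)) = (\<lambda>x. c * partial i f (a + c *\<^sub>R x))" for i
    by (intro ext partial_affine) auto
  moreover have "Ck n (\<lambda>x. c * partial i f (a + c *\<^sub>R x))" for i
    using Suc by (intro Ck_mult[OF Ck_const]) auto
  moreover have "(\<lambda>x. f (a + c *\<^sub>R x)) differentiable (at x)" for x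
  proof -
    have "(f \<circ> (\<lambda>x. a + c *\<^sub>R x)) differentiable (at x)"
      using Suc.prems by (intro differentiable_chain_at) auto
    then show ?thesis by (simp add: o_def)
  qed
  ultimately show ?case by auto
qed

lemma smooth_const: "smooth (\<lambda>x. c)"
  by (simp add: smooth_def Ck_const)

lemma smooth_add: "smooth f \<Longrightarrow> smooth g \<Longrightarrow> smooth (\<lambda>x. f x + g x)"
  by (simp add: smooth_def Ck_add)

lemma smooth_mult: "smooth f \<Longrightarrow> smooth g \<Longrightarrow> smooth (\<lambda>x. f x * g x)"
  by (simp add: smooth_def Ck_mult)

lemma smooth_affine: "smooth f \<Longrightarrow> smooth (\<lambda>x. f (a + c *\<^sub>R x))"
  by (simp add: smooth_def Ck_affine)

lemma smooth_cmult: "smooth f \<Longrightarrow> smooth (\<lambda>x. c * f x)"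
  by (intro smooth_mult smooth_const)

lemma smooth_diff: "smooth f \<Longrightarrow> smooth g \<Longrightarrow> smooth (\<lambda>x. f x - g x)"
  using smooth_add[OF _ smooth_cmult[of g "-1"], of f] by simp

lemma partial_smooth_add:
  "smooth f \<Longrightarrow> smooth g \<Longrightarrow> partial i (\<lambda>x. f x + g x) = (\<lambda>x. partial i f x + partial i g x)"
  by (intro ext partial_add) (auto intro: smooth_differentiable)

lemma partial_smooth_mult:
  "smooth f \<Longrightarrow> smooth g \<Longrightarrow>
    partial i (\<lambda>x. f x * g x) = (\<lambda>x. partial i f x * g x + f x * partial i g x)"
  by (intro ext partial_mult) (auto intro: smooth_differentiable)

lemma partial_smooth_cmult:
  "smooth f \<Longrightarrow> partial i (\<lambda>x. c * f x) = (\<lambda>x. c * partial i f x)"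
  by (simp add: partial_smooth_mult smooth_const partial_const)

lemma partial_smooth_affine:
  "smooth f \<Longrightarrow> partial i (\<lambda>x. f (a + c *\<^sub>R x)) = (\<lambda>x. c * partial i f (a + c *\<^sub>R x))"
  by (intro ext partial_affine) (auto intro: smooth_differentiable)

lemma partial_smooth_diff:
  assumes "smooth f" "smooth g"
  shows "partial i (\<lambda>x. f x - g x) = (\<lambda>x. partial i f x - partial i g x)"
proof -
  have "partial i (\<lambda>x. f x + -1 * g x) = (\<lambda>x. partial i f x + -1 * partial i g x)"
    using assms smooth_cmult[of g "-1"] partial_smooth_cmult[of g i "-1"]
    by (subst partial_smooth_add) auto
  then show ?thesis by simp
qed

lemma pd_add: "smooth f \<Longrightarrow> smooth g \<Longrightarrow> pd is (\<lambda>x. f x + g x) = (\<lambda>x. pd is f x + pd is g x)"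
  by (induction "is") (auto simp: partial_smooth_add smooth_pd)

lemma pd_cmult: "smooth f \<Longrightarrow> pd is (\<lambda>x. c * f x) = (\<lambda>x. c * pd is f x)"
  by (induction "is") (auto simp: partial_smooth_cmult smooth_pd)

lemma pd_append: "pd (is @ js) f = pd is (pd js f)"
  by (induction "is") auto

text \<open>No differentiability is assumed: \<open>frechet_derivative\<close> is a choice among all
  derivatives at the point, and two functions that agree nearby have the same ones to choose
  from.\<close>

lemma partial_cong_open:
  assumes "open U" "x \<in> U" "\<And>y. y \<in> U \<Longrightarrow> f y = g y"
  shows "partial i f x = partial i g x"
proof -
  have "(f has_derivative D) (at x) \<longleftrightarrow> (g has_derivative D) (at x)" for D
    using has_derivative_transform_within_open[of f D x UNIV U g]
      has_derivative_transform_within_open[of g D x UNIV U f] assms by auto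
  then show ?thesis
    unfolding partial_def frechet_derivative_def by simp
qed

lemma pd_cong_open:
  assumes "open U" "x \<in> U" "\<And>y. y \<in> U \<Longrightarrow> f y = g y"
  shows "pd is f x = pd is g x"
  using assms(2)
proof (induction "is" arbitrary: x)
  case Nil
  then show ?case using assms by simp
next
  case (Cons i "is")
  have "partial i (pd is f) x = partial i (pd is g) x"
    by (rule partial_cong_open[OF assms(1) Cons.prems]) (rule Cons.IH)
  then show ?case by simp
qed

lemma csupp_nonzero: "x \<notin> csupp f \<Longrightarrow> f x = 0"
  using closure_subset[of "{x. f x \<noteq> 0}"] by (auto simp: csupp_def)

lemma closed_csupp: "closed (csupp f)"
  by (simp add: csupp_def)

lemma csupp_subset: "closed S \<Longrightarrow> (\<And>x. x \<notin> S \<Longrightarrow> f x = 0) \<Longrightarrow> csupp f \<subseteq> S"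
  unfolding csupp_def by (rule closure_minimal) auto

lemma compact_csupp_subset:
  assumes "compact S" "\<And>x. x \<notin> S \<Longrightarrow> f x = 0"
  shows "compact (csupp f)"
proof -
  have "csupp f \<subseteq> S"
    by (rule csupp_subset[OF compact_imp_closed[OF assms(1)] assms(2)])
  then have "csupp f = S \<inter> csupp f" by blast
  then show ?thesis using compact_Int_closed[OF assms(1) closed_csupp, of f] by simp
qed

lemma pd_zero_off_csupp: "x \<notin> csupp f \<Longrightarrow> pd is f x = 0"
proof -
  assume x: "x \<notin> csupp f"
  have "pd is f x = pd is (\<lambda>_. 0) x"
    by (rule pd_cong_open[of "- csupp f"]) (use x closed_csupp csupp_nonzero in auto)
  also have "pd is (\<lambda>_. 0) = (\<lambda>_. 0)"
    by (induction "is") (auto simp: partial_const)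
  finally show ?thesis by simp
qed

lemma csupp_pd: "csupp (pd is f) \<subseteq> csupp f"
  by (rule csupp_subset[OF closed_csupp pd_zero_off_csupp])

text \<open>Test functions of the whole space. Keeping them apart from \<open>test\<close> lets the
  support condition enter only where the domain matters.\<close>

definition test0 :: "(real^3 \<Rightarrow> real) \<Rightarrow> bool" where
  "test0 \<phi> \<longleftrightarrow> smooth \<phi> \<and> compact (csupp \<phi>)"

lemma test_iff: "test \<Omega> \<phi> \<longleftrightarrow> test0 \<phi> \<and> csupp \<phi> \<subseteq> \<Omega>"
  by (auto simp: test_def test0_def)

lemma test0D: "test0 \<phi> \<Longrightarrow> smooth \<phi>" "test0 \<phi> \<Longrightarrow> compact (csupp \<phi>)"
  by (auto simp: test0_def)

lemma test0I: "smooth \<phi> \<Longrightarrow> compact S \<Longrightarrow> (\<And>x. x \<notin> S \<Longrightarrow> \<phi> x = 0) \<Longrightarrow> test0 \<phi>"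
  using compact_csupp_subset by (auto simp: test0_def)

lemma test0_pd: "test0 \<phi> \<Longrightarrow> test0 (pd is \<phi>)"
  by (rule test0I[of _ "csupp \<phi>"]) (auto simp: test0_def smooth_pd pd_zero_off_csupp)

lemma test0_partial: "test0 \<phi> \<Longrightarrow> test0 (partial i \<phi>)"
  using test0_pd[of \<phi> "[i]"] by simp

lemma test_pd: "test \<Omega> \<phi> \<Longrightarrow> test \<Omega> (pd is \<phi>)"
  unfolding test_iff using test0_pd csupp_pd by (meson order.trans)

lemma test_partial: "test \<Omega> \<phi> \<Longrightarrow> test \<Omega> (partial i \<phi>)"
  using test_pd[of \<Omega> \<phi> "[i]"] by simp

lemma test0_mult:
  assumes "smooth \<eta>" "test0 \<phi>"
  shows "test0 (\<lambda>x. \<eta> x * \<phi> x)"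
  by (rule test0I[of _ "csupp \<phi>"]) (use assms in \<open>auto simp: test0_def smooth_mult csupp_nonzero\<close>)

lemma test_mult:
  assumes "smooth \<eta>" "test \<Omega> \<phi>"
  shows "test \<Omega> (\<lambda>x. \<eta> x * \<phi> x)"
proof -
  have "csupp (\<lambda>x. \<eta> x * \<phi> x) \<subseteq> csupp \<phi>"
    by (rule csupp_subset[OF closed_csupp]) (simp add: csupp_nonzero)
  with assms show ?thesis by (auto simp: test_iff test0_mult)
qed

lemma test0_add:
  assumes "test0 \<phi>" "test0 \<psi>"
  shows "test0 (\<lambda>x. \<phi> x + \<psi> x)"
  by (rule test0I[of _ "csupp \<phi> \<union> csupp \<psi>"])
    (use assms in \<open>auto simp: test0_def smooth_add csupp_nonzero\<close>)

lemma test_add: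
  assumes "test \<Omega> \<phi>" "test \<Omega> \<psi>"
  shows "test \<Omega> (\<lambda>x. \<phi> x + \<psi> x)"
proof -
  have "csupp (\<lambda>x. \<phi> x + \<psi> x) \<subseteq> csupp \<phi> \<union> csupp \<psi>"
    by (rule csupp_subset) (auto simp: closed_csupp csupp_nonzero)
  with assms show ?thesis by (auto simp: test_iff test0_add)
qed

lemma test0_affine:
  assumes "test0 \<phi>" "c \<noteq> 0"
  shows "test0 (\<lambda>x. \<phi> (a + c *\<^sub>R x))"
proof (rule test0I)
  show "smooth (\<lambda>x. \<phi> (a + c *\<^sub>R x))" using assms smooth_affine test0D by blast
  let ?S = "(\<lambda>y. (1/c) *\<^sub>R (y - a)) ` csupp \<phi>"
  show "compact ?S"
    by (intro compact_continuous_image continuous_intros test0D assms)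
  fix x assume "x \<notin> ?S"
  moreover have "x = (1/c) *\<^sub>R ((a + c *\<^sub>R x) - a)" using assms by simp
  ultimately have "a + c *\<^sub>R x \<notin> csupp \<phi>" by blast
  then show "\<phi> (a + c *\<^sub>R x) = 0" by (rule csupp_nonzero)
qed

lemma test0_bounded:
  assumes "test0 \<phi>"
  obtains B where "B > 0" "\<And>x. \<bar>\<phi> x\<bar> \<le> B"
proof -
  have "bounded (\<phi> ` csupp \<phi>)"
    by (intro compact_imp_bounded compact_continuous_image smooth_continuous test0D assms)
  then obtain B where B: "B > 0" "\<forall>x\<in>csupp \<phi>. \<bar>\<phi> x\<bar> \<le> B"
    by (auto simp: bounded_pos)
  have "\<bar>\<phi> x\<bar> \<le> B" for x
    using B csupp_nonzero[of x \<phi>] by (cases "x \<in> csupp \<phi>") auto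
  with B that show ?thesis by blast
qed

section \<open>Mean value theorem along lines and symmetry of second derivatives\<close>

lemma DERIV_line:
  assumes "smooth h"
  shows "((\<lambda>t. h (y + t *\<^sub>R v)) has_real_derivative (\<Sum>i\<in>UNIV. v $ i * partial i h (y + t *\<^sub>R v))) (at t)"
proof -
  have "((\<lambda>t. h (y + t *\<^sub>R v)) has_derivative
     (\<lambda>u. \<Sum>i\<in>UNIV. (u *\<^sub>R v) $ i * partial i h (y + t *\<^sub>R v))) (at t)"
    by (rule has_derivative_compose[where g = h, OF _ smooth_has_derivative[OF assms]])
      (auto intro!: derivative_eq_intros)
  also have "(\<lambda>u. \<Sum>i\<in>UNIV. (u *\<^sub>R v) $ i * partial i h (y + t *\<^sub>R v))
    = (\<lambda>u. (\<Sum>i\<in>UNIV. v $ i * partial i h (y + t *\<^sub>R v)) * u)"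
    by (rule ext) (simp add: sum_distrib_left sum_distrib_right ac_simps)
  finally show ?thesis by (simp add: has_field_derivative_def)
qed

lemma DERIV_axis:
  "smooth h \<Longrightarrow> ((\<lambda>t. h (y + t *\<^sub>R axis k 1)) has_real_derivative partial k h (y + t *\<^sub>R axis k 1)) (at t)"
  using DERIV_line[of h y "axis k 1" t] by (simp add: axis_def if_distrib if_distribR cong: if_cong)

text \<open>Schwarz: the second difference quotient is, by two applications of the mean value theorem,
  a value of either mixed derivative at a nearby point.\<close>

lemma second_difference:
  fixes f :: "real^3 \<Rightarrow> real"
  assumes f: "smooth f" and s: "s > 0"
  obtains a b where "0 < a" "a < s" "0 < b" "b < s"
    "f (x + s *\<^sub>R axis i 1 + s *\<^sub>R axis j 1) - f (x + s *\<^sub>R axis i 1)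
      - f (x + s *\<^sub>R axis j 1) + f x = s * s * partial j (partial i f) (x + a *\<^sub>R axis i 1 + b *\<^sub>R axis j 1)"
proof -
  let ?g = "\<lambda>t. f ((x + s *\<^sub>R axis j 1) + t *\<^sub>R axis i 1) - f (x + t *\<^sub>R axis i 1)"
  have "\<exists>a. 0 < a \<and> a < s \<and> ?g s - ?g 0 = (s - 0) *
     (partial i f ((x + s *\<^sub>R axis j 1) + a *\<^sub>R axis i 1) - partial i f (x + a *\<^sub>R axis i 1))"
    by (rule MVT2[OF s]) (intro DERIV_diff DERIV_axis f)
  then obtain a where a: "0 < a" "a < s" and ga: "?g s - ?g 0 = (s - 0) *
     (partial i f ((x + s *\<^sub>R axis j 1) + a *\<^sub>R axis i 1) - partial i f (x + a *\<^sub>R axis i 1))" by blast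
  let ?k = "\<lambda>t. partial i f ((x + a *\<^sub>R axis i 1) + t *\<^sub>R axis j 1)"
  have "\<exists>b. 0 < b \<and> b < s \<and> ?k s - ?k 0 = (s - 0) *
     partial j (partial i f) ((x + a *\<^sub>R axis i 1) + b *\<^sub>R axis j 1)"
    by (rule MVT2[OF s]) (intro DERIV_axis smooth_partial f)
  then obtain b where b: "0 < b" "b < s" and kb: "?k s - ?k 0 = (s - 0) *
     partial j (partial i f) ((x + a *\<^sub>R axis i 1) + b *\<^sub>R axis j 1)" by blast
  show thesis
    by (rule that[OF a b]) (use ga kb in \<open>simp add: algebra_simps\<close>)
qed

lemma partial_commute:
  assumes f: "smooth f"
  shows "partial i (partial j f) = partial j (partial i f)"
proof
  fix x
  define P where "P = partial j (partial i f)"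
  define Q where "Q = partial i (partial j f)"
  have cont: "isCont P x" "isCont Q x"
    unfolding P_def Q_def using f
    by (auto intro!: differentiable_imp_continuous_within smooth_differentiable smooth_partial)
  have "\<bar>P x - Q x\<bar> \<le> e" if e: "e > 0" for e
  proof -
    obtain d1 where d1: "d1 > 0" "\<And>y. dist y x < d1 \<Longrightarrow> dist (P y) (P x) < e/2"
      using cont(1) e half_gt_zero unfolding continuous_at_eps_delta by (metis dist_commute)
    obtain d2 where d2: "d2 > 0" "\<And>y. dist y x < d2 \<Longrightarrow> dist (Q y) (Q x) < e/2"
      using cont(2) e half_gt_zero unfolding continuous_at_eps_delta by (metis dist_commute)
    \<comment> \<open>Halved because the intermediate points are displaced by up to
      \<open>a + b\<close>, which is below \<open>2 * s\<close>.\<close>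
    define s where "s = min d1 d2 / 2"
    have s: "s > 0" using d1 d2 by (simp add: s_def)
    have near: "dist (x + a *\<^sub>R axis k 1 + b *\<^sub>R axis l 1) x < min d1 d2"
      if "0 < a" "a < s" "0 < b" "b < s" for a b k l
    proof -
      have "norm (a *\<^sub>R axis k (1::real) + b *\<^sub>R axis l 1 :: real^3) \<le> a + b"
        by (rule order.trans[OF norm_triangle_ineq]) (use that in simp)
      then show ?thesis using that by (simp add: dist_norm s_def add.assoc)
    qed
    obtain a b where 1: "0 < a" "a < s" "0 < b" "b < s"
      "f (x + s *\<^sub>R axis i 1 + s *\<^sub>R axis j 1) - f (x + s *\<^sub>R axis i 1)
      - f (x + s *\<^sub>R axis j 1) + f x = s * s * P (x + a *\<^sub>R axis i 1 + b *\<^sub>R axis j 1)"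
      using second_difference[OF f s] unfolding P_def by metis
    obtain a' b' where 2: "0 < a'" "a' < s" "0 < b'" "b' < s"
      "f (x + s *\<^sub>R axis j 1 + s *\<^sub>R axis i 1) - f (x + s *\<^sub>R axis j 1)
      - f (x + s *\<^sub>R axis i 1) + f x = s * s * Q (x + a' *\<^sub>R axis j 1 + b' *\<^sub>R axis i 1)"
      using second_difference[OF f s] unfolding Q_def by metis
    have "s * s * P (x + a *\<^sub>R axis i 1 + b *\<^sub>R axis j 1) = s * s * Q (x + a' *\<^sub>R axis j 1 + b' *\<^sub>R axis i 1)"
      using 1(5) 2(5) by (simp add: algebra_simps)
    then have "P (x + a *\<^sub>R axis i 1 + b *\<^sub>R axis j 1) = Q (x + a' *\<^sub>R axis j 1 + b' *\<^sub>R axis i 1)"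
      using s by simp
    moreover have "dist (P (x + a *\<^sub>R axis i 1 + b *\<^sub>R axis j 1)) (P x) < e/2"
      using near[OF 1(1-4)] by (intro d1) auto
    moreover have "dist (Q (x + a' *\<^sub>R axis j 1 + b' *\<^sub>R axis i 1)) (Q x) < e/2"
      using near[OF 2(1-4)] by (intro d2) auto
    ultimately show ?thesis unfolding dist_real_def by linarith
  qed
  then have "\<bar>P x - Q x\<bar> \<le> 0" by (rule field_le_epsilon) simp
  then show "partial i (partial j f) x = partial j (partial i f) x"
    by (simp add: P_def Q_def)
qed

lemma pd_partial: "smooth f \<Longrightarrow> pd is (partial i f) = partial i (pd is f)"
  by (induction "is") (auto simp: partial_commute smooth_pd)

lemma pd_commute: "smooth f \<Longrightarrow> pd is (pd js f) = pd js (pd is f)"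
  by (induction js) (auto simp: pd_partial smooth_pd)

subsection \<open>A smooth bump function\<close>

text \<open>The functions exp(-1/t) / t^j, extended by zero to t \<le> 0. The whole family is
  introduced because it is closed under differentiation up to linear combinations, so that
  smoothness of the bump becomes an induction on the order with \<open>j\<close>
  generalised.\<close>

definition flat :: "nat \<Rightarrow> real \<Rightarrow> real" where
  "flat j t = (if t > 0 then exp (- (1/t)) / t ^ j else 0)"

lemma flat_DERIV:
  "(flat j has_real_derivative flat (j + 2) t - j * flat (Suc j) t) (at t)"
proof -
  consider "t > 0" | "t < 0" | "t = 0" by linarith
  then show ?thesis
  proof cases
    case 1
    have "((\<lambda>t. exp (- (1/t)) / t ^ j) has_real_derivative flat (j + 2) t - j * flat (Suc j) t) (at t)"
    proof (cases j)
      case 0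
      then show ?thesis using 1
        by (auto intro!: derivative_eq_intros simp: flat_def field_simps power2_eq_square)
    next
      case (Suc m)
      have "t ^ m = t * t ^ (m - Suc 0) \<or> m = 0" by (cases m) auto
      then show ?thesis using 1 Suc
        by (auto intro!: derivative_eq_intros simp: flat_def field_simps power2_eq_square)
    qed
    then show ?thesis
      by (rule has_field_derivative_transform_within_open[of _ _ _ "{0<..}"]) (use 1 in \<open>auto simp: flat_def\<close>)
  next
    case 2
    have "((\<lambda>t. 0) has_real_derivative flat (j + 2) t - j * flat (Suc j) t) (at t)"
      using 2 by (simp add: flat_def)
    then show ?thesis
      by (rule has_field_derivative_transform_within_open[of _ _ _ "{..<0}"]) (use 2 in \<open>auto simp: flat_def\<close>)
  next
    \<comment> \<open>At the origin the difference quotient is zero from the left; from the right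
      the exponential beats every power of \<open>1/y\<close>.\<close>
    case 3
    have l: "((\<lambda>y. flat j y / y) \<longlongrightarrow> 0) (at_left 0)"
      by (rule Lim_transform_eventually[OF tendsto_const])
        (auto simp: flat_def eventually_at_left_field intro!: exI[of _ "-1"])
    have "((\<lambda>y::real. exp (- (1/y)) / y ^ j / y) \<longlongrightarrow> 0) (at_right 0)"
      by real_asymp
    then have r: "((\<lambda>y. flat j y / y) \<longlongrightarrow> 0) (at_right 0)"
      by (rule Lim_transform_eventually)
        (auto simp: flat_def eventually_at_right_field intro!: exI[of _ 1])
    from l r have "((\<lambda>y. flat j y / y) \<longlongrightarrow> 0) (at 0)"
      by (simp add: filterlim_split_at)
    then show ?thesis
      using 3 by (simp add: DERIV_def flat_def)
  qed
qed

lemma Ck_coord: "Ck n (\<lambda>x. x $ i)"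
proof (cases n)
  case 0
  then show ?thesis by (auto intro: continuous_intros)
next
  case (Suc m)
  have d: "((\<lambda>x. x $ i) has_derivative (\<lambda>x. x $ i)) (at x)" for x :: "real^3"
    by (rule bounded_linear_imp_has_derivative) (rule bounded_linear_vec_nth)
  have "partial j (\<lambda>x. x $ i) = (\<lambda>x. axis j 1 $ i)" for j
    by (rule ext, rule partial_eq[OF d])
  then show ?thesis
    using d Suc by (auto simp: Ck_const differentiable_def)
qed

lemma Ck_flat: "Ck n (\<lambda>x. flat j (1 - x \<bullet> x))"
proof (induction n arbitrary: j)
  case 0
  have "continuous_on UNIV (flat j)"
    by (meson DERIV_isCont flat_DERIV continuous_at_imp_continuous_on)
  then have "continuous_on UNIV (flat j \<circ> (\<lambda>x::real^3. 1 - x \<bullet> x))"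
    by (intro continuous_on_compose) (auto intro!: continuous_intros intro: continuous_on_subset)
  then show ?case by (simp add: o_def)
next
  case (Suc n)
  let ?g = "\<lambda>t. flat (j + 2) t - j * flat (Suc j) t"
  have d: "((\<lambda>x. flat j (1 - x \<bullet> x)) has_derivative (\<lambda>h. - 2 * (x \<bullet> h) * ?g (1 - x \<bullet> x))) (at x)"
    for x :: "real^3"
  proof -
    have "((\<lambda>x. flat j (1 - x \<bullet> x)) has_derivative (\<lambda>h. ?g (1 - x \<bullet> x) * (- 2 * (x \<bullet> h)))) (at x)"
      by (rule has_derivative_compose[where g = "flat j", OF _ flat_DERIV[unfolded has_field_derivative_def]])
        (auto intro!: derivative_eq_intros simp: inner_commute)
    then show ?thesis by (simp add: mult.commute)
  qed
  have p: "partial i (\<lambda>x. flat j (1 - x \<bullet> x)) = 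
      (\<lambda>x. (-2 * x $ i) * (flat (j + 2) (1 - x \<bullet> x) + - real j * flat (Suc j) (1 - x \<bullet> x)))" for i
    by (rule ext, subst partial_eq[OF d]) (simp add: inner_axis algebra_simps)
  have "Ck n (\<lambda>x. (-2 * x $ i) * (flat (j + 2) (1 - x \<bullet> x) + - real j * flat (Suc j) (1 - x \<bullet> x)))" for i
    by (intro Ck_mult Ck_add Ck_const Suc Ck_coord)
  then show ?case
    using d by (auto simp: p differentiable_def)
qed

definition bump :: "real^3 \<Rightarrow> real" where
  "bump x = flat 0 (1 - x \<bullet> x)"

lemma bump_smooth: "smooth bump"
  using Ck_flat[of _ 0] by (simp add: smooth_def bump_def[abs_def])

lemma bump_nonneg: "bump x \<ge> 0"
  by (simp add: bump_def flat_def)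

lemma bump_pos: "norm x < 1 \<Longrightarrow> bump x > 0"
  using abs_square_less_1[of "norm x"] by (simp add: bump_def flat_def dot_square_norm)

lemma bump_zero: "norm x \<ge> 1 \<Longrightarrow> bump x = 0"
  using abs_square_less_1[of "norm x"] by (simp add: bump_def flat_def dot_square_norm)

lemma test0_bump: "test0 bump"
  by (rule test0I[of _ "cball 0 1"]) (auto simp: bump_smooth bump_zero)

subsection \<open>Square-integrable functions\<close>

text \<open>Stated for an arbitrary measure since two are in play:
  \<open>lebesgue_on \<Omega>\<close>, in which the Sobolev spaces are defined, and
  \<open>lborel\<close>, where translation invariance and Fubini are at hand. Elements are
  functions, not classes, so identities between them are often only almost everywhere.\<close>

definition l2 :: "'a measure \<Rightarrow> ('a \<Rightarrow> real) \<Rightarrow> bool" where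
  "l2 M f \<longleftrightarrow> f \<in> borel_measurable M \<and> integrable M (\<lambda>x. (f x)\<^sup>2)"

definition n2 :: "'a measure \<Rightarrow> ('a \<Rightarrow> real) \<Rightarrow> real" where
  "n2 M f = sqrt (\<integral>x. (f x)\<^sup>2 \<partial>M)"

definition ip :: "'a measure \<Rightarrow> ('a \<Rightarrow> real) \<Rightarrow> ('a \<Rightarrow> real) \<Rightarrow> real" where
  "ip M f g = (\<integral>x. f x * g x \<partial>M)"

lemma l2_measurable [measurable_dest]: "l2 M f \<Longrightarrow> f \<in> borel_measurable M"
  by (simp add: l2_def)

lemma l2_mult:
  assumes "l2 M f" "l2 M g"
  shows "integrable M (\<lambda>x. f x * g x)"
proof (rule Bochner_Integration.integrable_bound)
  show "integrable M (\<lambda>x. (f x)\<^sup>2 + (g x)\<^sup>2)"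
    using assms by (auto simp: l2_def)
  show "(\<lambda>x. f x * g x) \<in> borel_measurable M"
    using assms by (auto simp: l2_def)
  have "\<bar>a * b\<bar> \<le> \<bar>a\<^sup>2 + b\<^sup>2\<bar>" for a b :: real
  proof -
    have "2 * \<bar>a * b\<bar> \<le> a\<^sup>2 + b\<^sup>2" using sum_squares_bound[of "\<bar>a\<bar>" "\<bar>b\<bar>"] by (simp add: abs_mult)
    then show ?thesis by linarith
  qed
  then show "AE x in M. norm (f x * g x) \<le> norm ((f x)\<^sup>2 + (g x)\<^sup>2)"
    by simp
qed

lemma l2_add:
  assumes "l2 M f" "l2 M g"
  shows "l2 M (\<lambda>x. f x + g x)"
  unfolding l2_def
proof
  show "(\<lambda>x. f x + g x) \<in> borel_measurable M" using assms by (auto simp: l2_def)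
  have "integrable M (\<lambda>x. (f x)\<^sup>2 + (g x)\<^sup>2 + 2 * (f x * g x))"
    using assms l2_mult[OF assms] by (auto simp: l2_def)
  then show "integrable M (\<lambda>x. (f x + g x)\<^sup>2)"
    by (simp add: power2_sum mult.assoc)
qed

lemma l2_cmult: "l2 M f \<Longrightarrow> l2 M (\<lambda>x. c * f x)"
  by (auto simp: l2_def power_mult_distrib)

lemma l2_uminus: "l2 M f \<Longrightarrow> l2 M (\<lambda>x. - f x)"
  by (auto simp: l2_def)

lemma l2_diff: "l2 M f \<Longrightarrow> l2 M g \<Longrightarrow> l2 M (\<lambda>x. f x - g x)"
  using l2_add[of M f "\<lambda>x. - g x"] l2_uminus[of M g] by simp

lemma l2_zero: "l2 M (\<lambda>x. 0)"
  by (simp add: l2_def)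

lemma l2_sum: "(\<And>a. a \<in> A \<Longrightarrow> l2 M (f a)) \<Longrightarrow> l2 M (\<lambda>x. \<Sum>a\<in>A. f a x)"
  by (induction A rule: infinite_finite_induct) (auto simp: l2_zero l2_add)

lemma l2_abs: "l2 M f \<Longrightarrow> l2 M (\<lambda>x. \<bar>f x\<bar>)"
  by (auto simp: l2_def)

lemma l2_bound:
  assumes "l2 M g" "f \<in> borel_measurable M" "AE x in M. \<bar>f x\<bar> \<le> \<bar>g x\<bar>"
  shows "l2 M f"
  unfolding l2_def
proof
  show "integrable M (\<lambda>x. (f x)\<^sup>2)"
  proof (rule Bochner_Integration.integrable_bound)
    show "integrable M (\<lambda>x. (g x)\<^sup>2)" using assms by (simp add: l2_def)
    show "AE x in M. norm ((f x)\<^sup>2) \<le> norm ((g x)\<^sup>2)"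
      using assms(3) by eventually_elim (simp add: abs_le_square_iff)
  qed (use assms in auto)
qed (use assms in auto)

lemma l2_bounded_mult:
  assumes "l2 M f" "h \<in> borel_measurable M" "\<And>x. \<bar>h x\<bar> \<le> B"
  shows "l2 M (\<lambda>x. h x * f x)"
proof (rule l2_bound)
  show "l2 M (\<lambda>x. B * f x)" by (rule l2_cmult) fact
  have "\<bar>h x * f x\<bar> \<le> \<bar>B * f x\<bar>" for x
    unfolding abs_mult by (intro mult_right_mono order.trans[OF assms(3)]) auto
  then show "AE x in M. \<bar>h x * f x\<bar> \<le> \<bar>B * f x\<bar>" by simp
qed (use assms in \<open>auto simp: l2_def\<close>)

lemma ip_add_left: "l2 M f \<Longrightarrow> l2 M g \<Longrightarrow> l2 M h \<Longrightarrow> ip M (\<lambda>x. f x + g x) h = ip M f h + ip M g h"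
  unfolding ip_def distrib_right by (intro Bochner_Integration.integral_add l2_mult)

lemma ip_diff_left: "l2 M f \<Longrightarrow> l2 M g \<Longrightarrow> l2 M h \<Longrightarrow> ip M (\<lambda>x. f x - g x) h = ip M f h - ip M g h"
  unfolding ip_def left_diff_distrib by (intro Bochner_Integration.integral_diff l2_mult)

lemma ip_sum_left: "(\<And>a. a \<in> A \<Longrightarrow> l2 M (f a)) \<Longrightarrow> l2 M h \<Longrightarrow>
   ip M (\<lambda>x. \<Sum>a\<in>A. f a x) h = (\<Sum>a\<in>A. ip M (f a) h)"
  unfolding ip_def sum_distrib_right by (intro Bochner_Integration.integral_sum l2_mult)

lemma ip_commute: "ip M f g = ip M g f"
  by (simp add: ip_def mult.commute)

lemma ip_add_right: "l2 M f \<Longrightarrow> l2 M g \<Longrightarrow> l2 M h \<Longrightarrow> ip M h (\<lambda>x. f x + g x) = ip M h f + ip M h g"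
  using ip_add_left[of M f g h] by (simp add: ip_commute)

lemma ip_diff_right: "l2 M f \<Longrightarrow> l2 M g \<Longrightarrow> l2 M h \<Longrightarrow> ip M h (\<lambda>x. f x - g x) = ip M h f - ip M h g"
  using ip_diff_left[of M f g h] by (simp add: ip_commute)

lemma ip_sum_right: "(\<And>a. a \<in> A \<Longrightarrow> l2 M (f a)) \<Longrightarrow> l2 M h \<Longrightarrow>
   ip M h (\<lambda>x. \<Sum>a\<in>A. f a x) = (\<Sum>a\<in>A. ip M h (f a))"
  using ip_sum_left[of A M f h] by (simp add: ip_commute)

lemma ip_cmult_left: "ip M (\<lambda>x. c * f x) h = c * ip M f h"
  by (simp add: ip_def mult.assoc)

lemma ip_cmult_right: "ip M h (\<lambda>x. c * f x) = c * ip M h f"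
  by (simp add: ip_def mult.left_commute)

lemma ip_self_nonneg: "ip M f f \<ge> 0"
  by (simp add: ip_def)

lemma n2_ip: "n2 M f = sqrt (ip M f f)"
  by (simp add: n2_def ip_def power2_eq_square)

lemma n2_sq: "(n2 M f)\<^sup>2 = ip M f f"
  by (simp add: n2_ip ip_self_nonneg)

lemma n2_nonneg: "n2 M f \<ge> 0"
  by (simp add: n2_ip ip_self_nonneg)

lemma n2_cmult: "n2 M (\<lambda>x. c * f x) = \<bar>c\<bar> * n2 M f"
proof -
  have "ip M (\<lambda>x. c * f x) (\<lambda>x. c * f x) = c\<^sup>2 * ip M f f"
    by (simp add: ip_cmult_left ip_cmult_right power2_eq_square)
  then show ?thesis by (simp add: n2_ip real_sqrt_mult)
qed

lemma n2_uminus: "n2 M (\<lambda>x. - f x) = n2 M f"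
  by (simp add: n2_def)

lemma n2_diff_commute: "n2 M (\<lambda>x. f x - g x) = n2 M (\<lambda>x. g x - f x)"
  by (simp add: n2_def power2_commute)

lemma Cauchy_Schwarz_ip:
  assumes f: "l2 M f" and g: "l2 M g"
  shows "\<bar>ip M f g\<bar> \<le> n2 M f * n2 M g"
proof -
  define a b c where "a = ip M f f" and "b = ip M f g" and "c = ip M g g"
  have quad: "0 \<le> a - 2 * t * b + t * t * c" for t
  proof -
    have g': "l2 M (\<lambda>x. t * g x)" using g by (rule l2_cmult)
    have "0 \<le> ip M (\<lambda>x. f x - t * g x) (\<lambda>x. f x - t * g x)" by (rule ip_self_nonneg)
    also have "\<dots> = a - 2 * t * b + t * t * c"
      using f g g' by (simp add: ip_diff_left ip_diff_right l2_diff ip_cmult_left ip_cmult_right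
          ip_commute[of M g f] a_def b_def c_def algebra_simps)
    finally show ?thesis .
  qed
  have "b\<^sup>2 \<le> a * c"
  proof (cases "c = 0")
    case True
    have "b = 0"
    proof (rule ccontr)
      assume "b \<noteq> 0"
      \<comment> \<open>The expression is now affine in \<open>t\<close>, and this value of
        \<open>t\<close> makes it equal to -1.\<close>
      with quad[of "(a + 1) / (2 * b)"] True show False by simp
    qed
    with True show ?thesis by simp
  next
    case False
    then have "c > 0" using ip_self_nonneg[of M g] by (simp add: c_def)
    \<comment> \<open>The minimiser of the quadratic polynomial.\<close>
    with quad[of "b / c"] have "b * b / c \<le> a" by (simp add: field_simps)
    with \<open>c > 0\<close> show ?thesis by (simp add: field_simps power2_eq_square)
  qed
  then have "sqrt (b\<^sup>2) \<le> sqrt (a * c)" by (rule real_sqrt_le_mono)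
  then show ?thesis by (simp add: n2_ip a_def b_def c_def real_sqrt_mult)
qed

lemma n2_add_le:
  assumes f: "l2 M f" and g: "l2 M g"
  shows "n2 M (\<lambda>x. f x + g x) \<le> n2 M f + n2 M g"
proof (rule power2_le_imp_le)
  have "(n2 M (\<lambda>x. f x + g x))\<^sup>2 = ip M f f + 2 * ip M f g + ip M g g"
    using f g by (simp add: n2_sq ip_add_left ip_add_right l2_add ip_commute[of M g f])
  also have "\<dots> \<le> (n2 M f)\<^sup>2 + 2 * (n2 M f * n2 M g) + (n2 M g)\<^sup>2"
    using Cauchy_Schwarz_ip[OF f g] by (simp add: n2_sq)
  finally show "(n2 M (\<lambda>x. f x + g x))\<^sup>2 \<le> (n2 M f + n2 M g)\<^sup>2"
    by (simp add: power2_sum algebra_simps)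
qed (simp add: n2_nonneg)

lemma n2_diff_le: "l2 M f \<Longrightarrow> l2 M g \<Longrightarrow> n2 M (\<lambda>x. f x - g x) \<le> n2 M f + n2 M g"
  using n2_add_le[of M f "\<lambda>x. - g x"] l2_uminus[of M g] by (simp add: n2_uminus)

lemma n2_triangle_diff:
  assumes "l2 M f" "l2 M g" "l2 M h"
  shows "n2 M (\<lambda>x. f x - h x) \<le> n2 M (\<lambda>x. f x - g x) + n2 M (\<lambda>x. g x - h x)"
  using n2_add_le[of M "\<lambda>x. f x - g x" "\<lambda>x. g x - h x"] assms by (simp add: l2_diff)

lemma n2_sum_le:
  "finite A \<Longrightarrow> (\<And>a. a \<in> A \<Longrightarrow> l2 M (f a)) \<Longrightarrow> n2 M (\<lambda>x. \<Sum>a\<in>A. f a x) \<le> (\<Sum>a\<in>A. n2 M (f a))"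
proof (induction A rule: finite_induct)
  case empty
  then show ?case by (simp add: n2_def)
next
  case (insert a A)
  then show ?case using n2_add_le[of M "f a" "\<lambda>x. \<Sum>a\<in>A. f a x"] by (force simp: l2_sum)
qed

lemma n2_mono:
  assumes "l2 M g" "AE x in M. \<bar>f x\<bar> \<le> \<bar>g x\<bar>"
  shows "n2 M f \<le> n2 M g"
  unfolding n2_def
proof (intro real_sqrt_le_mono integral_mono_AE')
  show "integrable M (\<lambda>x. (g x)\<^sup>2)" using assms by (simp add: l2_def)
  show "AE x in M. (f x)\<^sup>2 \<le> (g x)\<^sup>2"
    using assms(2) by eventually_elim (simp add: abs_le_square_iff)
qed simp

lemma n2_cong_AE:
  assumes "f \<in> borel_measurable M" "g \<in> borel_measurable M" "AE x in M. f x = g x"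
  shows "n2 M f = n2 M g"
  unfolding n2_def using assms by (intro arg_cong[where f = sqrt] integral_cong_AE) auto

lemma l2_cong_AE:
  assumes "l2 M f" "g \<in> borel_measurable M" "AE x in M. f x = g x"
  shows "l2 M g"
  by (rule l2_bound[OF assms(1,2)]) (use assms(3) in auto)

lemma n2_zero_AE:
  assumes "l2 M f" "n2 M f = 0"
  shows "AE x in M. f x = 0"
proof -
  have "(\<integral>x. (f x)\<^sup>2 \<partial>M) = 0" using assms by (simp add: n2_def)
  then have "AE x in M. (f x)\<^sup>2 = 0"
    using assms by (subst (asm) integral_nonneg_eq_0_iff_AE) (auto simp: l2_def)
  then show ?thesis by auto
qed

lemma ip_tendsto:
  assumes f: "\<And>n. l2 M (F n)" "l2 M f" "(\<lambda>n. n2 M (\<lambda>x. F n x - f x)) \<longlonglongrightarrow> 0" and g: "l2 M g"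
  shows "(\<lambda>n. ip M (F n) g) \<longlonglongrightarrow> ip M f g"
proof -
  have "(\<lambda>n. ip M (F n) g - ip M f g) \<longlonglongrightarrow> 0"
  proof (rule Lim_null_comparison)
    show "eventually (\<lambda>n. norm (ip M (F n) g - ip M f g) \<le> n2 M (\<lambda>x. F n x - f x) * n2 M g) sequentially"
      using Cauchy_Schwarz_ip[OF l2_diff[OF f(1) f(2)] g] f g by (simp add: ip_diff_left)
    show "(\<lambda>n. n2 M (\<lambda>x. F n x - f x) * n2 M g) \<longlonglongrightarrow> 0"
      using tendsto_mult_right[OF f(3), of "n2 M g"] by simp
  qed
  then show ?thesis by (simp add: LIM_zero_iff)
qed

section \<open>Indicators, Fatou's lemma and completeness of L2\<close>

lemma l2_indicator:
  assumes "A \<in> sets M" "emeasure M A < \<infinity>"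
  shows "l2 M (indicat_real A)" "n2 M (indicat_real A) = sqrt (measure M A)"
proof -
  have sq: "(\<lambda>x. (indicat_real A x)\<^sup>2) = indicat_real A" by (auto simp: fun_eq_iff indicator_def)
  show "l2 M (indicat_real A)" using assms by (simp add: l2_def sq integrable_indicator_iff borel_measurable_indicator)
  show "n2 M (indicat_real A) = sqrt (measure M A)"
    using sets.sets_into_space[OF assms(1)] by (simp add: n2_def sq Int_absorb2)
qed

text \<open>Fatou's lemma for the squares. It is used twice to bound a pointwise limit: for
  completeness and for the fundamental lemma \<open>weak_zero\<close>.\<close>

lemma l2_Fatou:
  assumes F: "\<And>n. l2 M (F n)" and f: "f \<in> borel_measurable M"
    and lim: "AE x in M. (\<lambda>n. F n x) \<longlonglongrightarrow> f x"
    and le: "eventually (\<lambda>n. n2 M (F n) \<le> B) sequentially"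
  shows "l2 M f" "n2 M f \<le> B"
proof -
  have B: "B \<ge> 0"
    using le eventually_happens[OF le] n2_nonneg order.trans by (metis trivial_limit_sequentially)
  have nn: "(\<integral>\<^sup>+x. ennreal ((F n x)\<^sup>2) \<partial>M) = ennreal ((n2 M (F n))\<^sup>2)" for n
    using F[of n] by (subst nn_integral_eq_integral) (auto simp: l2_def n2_def)
  have "(\<integral>\<^sup>+x. ennreal ((f x)\<^sup>2) \<partial>M) = (\<integral>\<^sup>+x. liminf (\<lambda>n. ennreal ((F n x)\<^sup>2)) \<partial>M)"
  proof (rule nn_integral_cong_AE)
    show "AE x in M. ennreal ((f x)\<^sup>2) = liminf (\<lambda>n. ennreal ((F n x)\<^sup>2))"
      using lim
    proof eventually_elim
      case (elim x)
      then have "(\<lambda>n. ennreal ((F n x)\<^sup>2)) \<longlonglongrightarrow> ennreal ((f x)\<^sup>2)"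
        by (intro tendsto_ennrealI tendsto_power)
      then show ?case by (intro lim_imp_Liminf[symmetric]) auto
    qed
  qed
  also have "\<dots> \<le> liminf (\<lambda>n. \<integral>\<^sup>+x. ennreal ((F n x)\<^sup>2) \<partial>M)"
    using F by (intro nn_integral_liminf) (auto simp: l2_def)
  also have "\<dots> \<le> ennreal (B\<^sup>2)"
    unfolding nn
  proof (rule order.trans[OF Liminf_mono])
    show "\<forall>\<^sub>F n in sequentially. ennreal ((n2 M (F n))\<^sup>2) \<le> ennreal (B\<^sup>2)"
      using le by eventually_elim (auto intro!: ennreal_leI power_mono n2_nonneg)
  qed (simp add: Liminf_const)
  finally have *: "(\<integral>\<^sup>+x. ennreal ((f x)\<^sup>2) \<partial>M) \<le> ennreal (B\<^sup>2)" .
  then show l: "l2 M f"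
    unfolding l2_def using f le_less_trans[OF *] by (auto intro!: integrableI_bounded)
  have "ennreal ((n2 M f)\<^sup>2) \<le> ennreal (B\<^sup>2)"
    using * l by (subst (asm) nn_integral_eq_integral) (auto simp: l2_def n2_def)
  then have "(n2 M f)\<^sup>2 \<le> B\<^sup>2" by (simp add: ennreal_le_iff)
  with B show "n2 M f \<le> B" using power2_le_imp_le by blast
qed

lemma l2_complete_fast:
  assumes F: "\<And>n. l2 M (F n)"
    and fast: "\<And>n. n2 M (\<lambda>x. F (Suc n) x - F n x) \<le> (1/2) ^ n"
  shows "\<exists>f. f \<in> borel_measurable M \<and> (AE x in M. (\<lambda>n. F n x) \<longlonglongrightarrow> f x)"
proof -
  have M[measurable]: "F n \<in> borel_measurable M" for n using F by (simp add: l2_def)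
  \<comment> \<open>The variation of the sequence up to \<open>n\<close>. The geometric series
    bounds its norm by 2, monotone convergence makes its supremum finite almost everywhere, and a
    real sequence of finite variation converges.\<close>
  define G where "G n x = (\<Sum>i<n. \<bar>F (Suc i) x - F i x\<bar>)" for n x
  have G2: "l2 M (G n)" for n
    unfolding G_def[abs_def] by (intro l2_sum l2_abs l2_diff F)
  have nabs: "n2 M (\<lambda>x. \<bar>h x\<bar>) = n2 M h" for h by (simp add: n2_def)
  have Gn: "n2 M (G n) \<le> 2" for n
  proof -
    have "n2 M (G n) \<le> (\<Sum>i<n. n2 M (\<lambda>x. \<bar>F (Suc i) x - F i x\<bar>))"
      unfolding G_def[abs_def] by (intro n2_sum_le l2_abs l2_diff F) auto
    also have "\<dots> \<le> (\<Sum>i<n. (1/2) ^ i)" unfolding nabs by (intro sum_mono fast)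
    also have "\<dots> \<le> (\<Sum>i. (1/2) ^ i)" by (intro sum_le_suminf) auto
    also have "\<dots> = (2::real)" by (simp add: suminf_geometric)
    finally show ?thesis .
  qed
  have "(\<integral>\<^sup>+x. (SUP n. ennreal ((G n x)\<^sup>2)) \<partial>M) = (SUP n. \<integral>\<^sup>+x. ennreal ((G n x)\<^sup>2) \<partial>M)"
  proof (rule nn_integral_monotone_convergence_SUP)
    have "ennreal ((G n x)\<^sup>2) \<le> ennreal ((G (Suc n) x)\<^sup>2)" for n x
      by (intro ennreal_leI power_mono) (auto simp: G_def intro!: sum_nonneg)
    then show "incseq (\<lambda>n x. ennreal ((G n x)\<^sup>2))"
      by (intro incseq_SucI le_funI)
    show "(\<lambda>x. ennreal ((G i x)\<^sup>2)) \<in> borel_measurable M" for i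
      unfolding G_def by measurable
  qed
  also have "\<dots> \<le> ennreal 4"
  proof (rule SUP_least)
    fix n
    have "(\<integral>\<^sup>+x. ennreal ((G n x)\<^sup>2) \<partial>M) = ennreal ((n2 M (G n))\<^sup>2)"
      using G2[of n] by (subst nn_integral_eq_integral) (auto simp: l2_def n2_def)
    also have "\<dots> \<le> ennreal 4"
      using power_mono[OF Gn[of n] n2_nonneg, of 2] by (intro ennreal_leI) simp
    finally show "(\<integral>\<^sup>+x. ennreal ((G n x)\<^sup>2) \<partial>M) \<le> ennreal 4" .
  qed
  finally have "(\<integral>\<^sup>+x. (SUP n. ennreal ((G n x)\<^sup>2)) \<partial>M) \<noteq> \<infinity>"
    by (metis ennreal_less_top infinity_ennreal_def leD)
  then have "AE x in M. (SUP n. ennreal ((G n x)\<^sup>2)) \<noteq> \<infinity>"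
    by (intro nn_integral_noteq_infinite) (auto simp: G_def)
  then have conv: "AE x in M. convergent (\<lambda>n. F n x)"
  proof eventually_elim
    case (elim x)
    then obtain C where C: "C \<ge> 0" "(SUP n. ennreal ((G n x)\<^sup>2)) = ennreal C"
      by (metis ennreal_cases infinity_ennreal_def)
    have "(G n x)\<^sup>2 \<le> C" for n
    proof -
      have "ennreal ((G n x)\<^sup>2) \<le> ennreal C" unfolding C(2)[symmetric] by (intro SUP_upper) auto
      then show ?thesis using C(1) by (simp add: ennreal_le_iff)
    qed
    then have "G n x \<le> sqrt C" for n by (rule real_le_rsqrt)
    then have "summable (\<lambda>i. \<bar>F (Suc i) x - F i x\<bar>)"
      by (intro summableI_nonneg_bounded) (auto simp: G_def)
    then have "summable (\<lambda>i. F (Suc i) x - F i x)" by (rule summable_rabs_cancel)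
    then have "convergent (\<lambda>n. \<Sum>i<n. F (Suc i) x - F i x)" by (simp add: summable_iff_convergent)
    then have "convergent (\<lambda>n. F n x - F 0 x)" by (simp only: sum_lessThan_telescope[of "\<lambda>i. F i x"])
    from convergent_add[OF this convergent_const[of "F 0 x"]] show ?case by simp
  qed
  show ?thesis
  proof (intro exI conjI)
    show "(\<lambda>x. lim (\<lambda>n. F n x)) \<in> borel_measurable M" by measurable
    show "AE x in M. (\<lambda>n. F n x) \<longlonglongrightarrow> lim (\<lambda>n. F n x)"
      using conv by eventually_elim (simp add: convergent_LIMSEQ_iff)
  qed
qed

lemma l2_complete:
  assumes F: "\<And>n. l2 M (F n)"
    and Cauchy: "\<And>e. e > 0 \<Longrightarrow> \<exists>N. \<forall>m\<ge>N. \<forall>n\<ge>N. n2 M (\<lambda>x. F m x - F n x) < e"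
  obtains f where "l2 M f" "(\<lambda>n. n2 M (\<lambda>x. F n x - f x)) \<longlonglongrightarrow> 0"
proof -
  have "\<exists>N. \<forall>k. \<forall>m\<ge>N k. \<forall>n\<ge>N k. n2 M (\<lambda>x. F m x - F n x) < (1/2)^k"
    using Cauchy by (intro choice allI) simp
  then obtain N where N: "\<And>k m n. m \<ge> N k \<Longrightarrow> n \<ge> N k \<Longrightarrow> n2 M (\<lambda>x. F m x - F n x) < (1/2)^k" by blast
  \<comment> \<open>The maximum serves two purposes: the indices increase strictly, and
    \<open>r k\<close> lies beyond the Cauchy threshold for \<open>(1/2)^k\<close>.\<close>
  define r where "r = rec_nat (N 0) (\<lambda>k a. max (Suc a) (N (Suc k)))"
  have r: "r (Suc k) = max (Suc (r k)) (N (Suc k))" for k by (simp add: r_def)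
  have rN: "r k \<ge> N k" for k by (cases k) (auto simp: r_def)
  have mono: "strict_mono r" by (intro strict_monoI_Suc) (simp add: r)
  have "\<exists>f. f \<in> borel_measurable M \<and> (AE x in M. (\<lambda>n. F (r n) x) \<longlonglongrightarrow> f x)"
  proof (rule l2_complete_fast[OF F])
    fix n
    have "r (Suc n) \<ge> N n" using rN[of n] r[of n] by simp
    then show "n2 M (\<lambda>x. F (r (Suc n)) x - F (r n) x) \<le> (1/2)^n"
      using N rN less_imp_le by blast
  qed
  then obtain f where f[measurable]: "f \<in> borel_measurable M"
    and lim: "AE x in M. (\<lambda>n. F (r n) x) \<longlonglongrightarrow> f x" by blast
  \<comment> \<open>Fixing an arbitrary \<open>m\<close> and letting the subsequence index tend to
    infinity transfers the estimate from the subsequence to the whole sequence.\<close>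
  have key: "l2 M (\<lambda>x. f x - F m x) \<and> n2 M (\<lambda>x. f x - F m x) \<le> (1/2)^k" if "m \<ge> N k" for m k
  proof -
    have ev: "eventually (\<lambda>n. n2 M (\<lambda>x. F (r n) x - F m x) \<le> (1/2)^k) sequentially"
    proof (rule eventually_sequentiallyI[of "N k"])
      fix n assume "N k \<le> n"
      then have "r n \<ge> N k" using seq_suble[OF mono, of n] by simp
      then show "n2 M (\<lambda>x. F (r n) x - F m x) \<le> (1/2)^k" using N that less_imp_le by blast
    qed
    have lim': "AE x in M. (\<lambda>n. F (r n) x - F m x) \<longlonglongrightarrow> f x - F m x"
      using lim by eventually_elim (intro tendsto_intros)
    have m: "(\<lambda>x. f x - F m x) \<in> borel_measurable M" by (rule borel_measurable_diff[OF f l2_measurable[OF F]])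
    show ?thesis using l2_Fatou[OF l2_diff[OF F F] m lim' ev] by blast
  qed
  show thesis
  proof
    have "l2 M (\<lambda>x. (f x - F (N 0) x) + F (N 0) x)" using key[of 0 "N 0"] F by (intro l2_add) auto
    then show "l2 M f" by simp
    show "(\<lambda>n. n2 M (\<lambda>x. F n x - f x)) \<longlonglongrightarrow> 0"
    proof (rule LIMSEQ_I)
      fix e :: real assume "e > 0"
      then obtain k where k: "(1/2)^k < e" using real_arch_pow_inv[of e "1/2"] by auto
      show "\<exists>no. \<forall>n\<ge>no. norm (n2 M (\<lambda>x. F n x - f x) - 0) < e"
      proof (intro exI allI impI)
        fix n assume "n \<ge> N k"
        with key[of k n] k show "norm (n2 M (\<lambda>x. F n x - f x) - 0) < e"
          by (simp add: n2_nonneg n2_diff_commute[of M "F n" f])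
      qed
    qed
  qed
qed

subsection \<open>Lebesgue integrals on $\mathbb{R}^3$\<close>

lemma lborel_integral_affine:
  fixes f :: "real^3 \<Rightarrow> real" and a :: "real^3"
  assumes c: "c \<noteq> 0" and f[measurable]: "f \<in> borel_measurable borel"
  shows "integral\<^sup>L lborel f = \<bar>c\<bar> ^ 3 * (\<integral>x. f (a + c *\<^sub>R x) \<partial>lborel)"
    and "integrable lborel f \<longleftrightarrow> integrable lborel (\<lambda>x. f (a + c *\<^sub>R x))"
proof -
  have eq: "lborel = density (distr lborel borel (\<lambda>x::real^3. a + c *\<^sub>R x)) (\<lambda>_. ennreal (\<bar>c\<bar> ^ 3))"
    using lborel_affine[OF c, of a] by simp
  show "integral\<^sup>L lborel f = \<bar>c\<bar> ^ 3 * (\<integral>x. f (a + c *\<^sub>R x) \<partial>lborel)"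
    by (subst eq) (simp add: integral_density integral_distr)
  have "integrable lborel f \<longleftrightarrow> integrable lborel (\<lambda>x. \<bar>c\<bar> ^ 3 * f (a + c *\<^sub>R x))"
    by (subst eq) (simp add: integrable_density integrable_distr_eq)
  then show "integrable lborel f \<longleftrightarrow> integrable lborel (\<lambda>x. f (a + c *\<^sub>R x))"
    using c by simp
qed

lemma lborel_integral_shift:
  fixes f :: "real^3 \<Rightarrow> real"
  assumes "f \<in> borel_measurable borel"
  shows "(\<integral>x. f (x + a) \<partial>lborel) = integral\<^sup>L lborel f"
    and "integrable lborel (\<lambda>x. f (x + a)) \<longleftrightarrow> integrable lborel f"
  using lborel_integral_affine[of 1 f a] assms by (auto simp: add.commute)

lemma lborel_integral_reflect:
  fixes f :: "real^3 \<Rightarrow> real"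
  assumes "f \<in> borel_measurable borel"
  shows "(\<integral>x. f (a - x) \<partial>lborel) = integral\<^sup>L lborel f"
    and "integrable lborel (\<lambda>x. f (a - x)) \<longleftrightarrow> integrable lborel f"
  using lborel_integral_affine[of "-1" f a] assms by auto

lemma test0_borel [measurable_dest]: "test0 \<phi> \<Longrightarrow> \<phi> \<in> borel_measurable borel"
  using test0D smooth_borel by blast

lemma test0_integrable:
  assumes "test0 \<phi>"
  shows "integrable lborel \<phi>"
proof -
  have "integrable lborel (\<lambda>x. indicator (csupp \<phi>) x *\<^sub>R \<phi> x)"
    by (intro borel_integrable_compact smooth_continuous test0D assms)
  also have "(\<lambda>x. indicator (csupp \<phi>) x *\<^sub>R \<phi> x) = \<phi>"
    by (auto simp: fun_eq_iff indicator_def csupp_nonzero)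
  finally show ?thesis .
qed

lemma test0_l2: "test0 \<phi> \<Longrightarrow> l2 lborel \<phi>"
  using test0_integrable[OF test0_mult[of \<phi> \<phi>]] test0D test0_borel
  by (auto simp: l2_def power2_eq_square)

lemma MVT_line:
  assumes "smooth h"
  obtains s where "0 < s" "s < 1"
    "h (z + v) - h z = (\<Sum>i\<in>UNIV. v $ i * partial i h (z + s *\<^sub>R v))"
proof -
  have "\<exists>s. 0 < s \<and> s < 1 \<and> h (z + 1 *\<^sub>R v) - h (z + 0 *\<^sub>R v)
      = (1 - 0) * (\<Sum>i\<in>UNIV. v $ i * partial i h (z + s *\<^sub>R v))"
    by (rule MVT2) (auto intro: DERIV_line assms)
  with that show ?thesis by auto
qed

lemma test0_lipschitz:
  assumes "test0 \<phi>"
  obtains L where "L > 0" "\<And>x y. \<bar>\<phi> x - \<phi> y\<bar> \<le> L * norm (x - y)"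
proof -
  have "\<exists>B. B > 0 \<and> (\<forall>x. \<bar>partial i \<phi> x\<bar> \<le> B)" for i
    using test0_bounded[OF test0_partial[OF assms]] by metis
  then obtain B where B: "\<And>i. B i > 0" "\<And>i x. \<bar>partial i \<phi> x\<bar> \<le> B i" by metis
  show thesis
  proof
    show "(\<Sum>i\<in>UNIV. B i) > 0" using B by (intro sum_pos) auto
    fix x y
    obtain s where "\<phi> (y + (x - y)) - \<phi> y = (\<Sum>i\<in>UNIV. (x - y) $ i * partial i \<phi> (y + s *\<^sub>R (x - y)))"
      using MVT_line[OF test0D(1)[OF assms]] by metis
    then have "\<bar>\<phi> x - \<phi> y\<bar> \<le> (\<Sum>i\<in>UNIV. \<bar>(x - y) $ i * partial i \<phi> (y + s *\<^sub>R (x - y))\<bar>)"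
      by simp
    also have "\<dots> \<le> (\<Sum>i\<in>UNIV. norm (x - y) * B i)"
      unfolding abs_mult by (intro sum_mono mult_mono B component_le_norm_cart) auto
    finally show "\<bar>\<phi> x - \<phi> y\<bar> \<le> (\<Sum>i\<in>UNIV. B i) * norm (x - y)"
      by (simp add: sum_distrib_right mult.commute)
  qed
qed

text \<open>By translation invariance the difference quotients have integral zero.\<close>
lemma integral_partial:
  assumes \<phi>: "test0 \<phi>"
  shows "integral\<^sup>L lborel (partial i \<phi>) = 0"
proof -
  let ?e = "axis i 1 :: real^3"
  obtain L where L: "L > 0" "\<And>x y. \<bar>\<phi> x - \<phi> y\<bar> \<le> L * norm (x - y)"
    using test0_lipschitz[OF \<phi>] by metis
  obtain R where R: "R > 0" "csupp \<phi> \<subseteq> ball 0 R"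
    using test0D(2)[OF \<phi>] compact_imp_bounded bounded_subset_ballD by blast
  define t where "t n = 1 / real (Suc n)" for n
  have t: "t n > 0" "t n \<le> 1" for n by (auto simp: t_def)
  have t0: "t \<longlonglongrightarrow> 0" unfolding t_def[abs_def] using LIMSEQ_inverse_real_of_nat by (simp add: inverse_eq_divide)
  define q where "q n x = (\<phi> (x + t n *\<^sub>R ?e) - \<phi> x) / t n" for n x
  have [measurable]: "\<phi> \<in> borel_measurable borel" using \<phi> by (rule test0_borel)
  have q0: "integral\<^sup>L lborel (q n) = 0" for n
  proof -
    have "integral\<^sup>L lborel (\<lambda>x. \<phi> (x + t n *\<^sub>R ?e) - \<phi> x) = 0"
      using lborel_integral_shift[OF test0_borel[OF \<phi>], of "t n *\<^sub>R ?e"] test0_integrable[OF \<phi>] by simp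
    then show ?thesis by (simp add: q_def[abs_def])
  qed
  have "(\<lambda>n. integral\<^sup>L lborel (q n)) \<longlonglongrightarrow> integral\<^sup>L lborel (partial i \<phi>)"
  proof (rule integral_dominated_convergence)
    \<comment> \<open>The quotients are bounded by the Lipschitz constant, and since the step is at
      most 1 they are supported within radius \<open>R + 1\<close>.\<close>
    show "integrable lborel (\<lambda>x. indicator (ball 0 (R + 1)) x *\<^sub>R L :: real)"
      by (intro integrable_indicator emeasure_bounded_finite bounded_ball) auto
    show "partial i \<phi> \<in> borel_measurable lborel"
      using test0_borel[OF test0_partial[OF \<phi>]] by simp
    show "q n \<in> borel_measurable lborel" for n unfolding q_def by measurable
    show "AE x in lborel. (\<lambda>n. q n x) \<longlonglongrightarrow> partial i \<phi> x"
    proof (intro AE_I2)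
      fix x
      have "((\<lambda>s. (\<phi> (x + s *\<^sub>R ?e) - \<phi> x) / s) \<longlongrightarrow> partial i \<phi> x) (at 0)"
        using DERIV_axis[OF test0D(1)[OF \<phi>], of x i 0] by (simp add: DERIV_def)
      moreover have "filterlim t (at 0) sequentially"
        using t0 t by (auto simp: filterlim_at less_imp_neq[symmetric] order.strict_implies_not_eq)
      ultimately show "(\<lambda>n. q n x) \<longlonglongrightarrow> partial i \<phi> x"
        unfolding q_def by (rule filterlim_compose)
    qed
    show "AE x in lborel. norm (q n x) \<le> indicator (ball 0 (R + 1)) x *\<^sub>R L" for n
    proof (intro AE_I2)
      fix x
      show "norm (q n x) \<le> indicator (ball 0 (R + 1)) x *\<^sub>R L"
      proof (cases "x \<in> ball 0 (R + 1)")
        case True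
        then show ?thesis using L(2)[of "x + t n *\<^sub>R ?e" x] t[of n] by (simp add: q_def field_simps)
      next
        case False
        have "norm x \<le> norm (x + t n *\<^sub>R ?e) + norm (t n *\<^sub>R ?e)"
          using norm_triangle_ineq4[of "x + t n *\<^sub>R ?e" "t n *\<^sub>R ?e"] by simp
        then have "norm (x + t n *\<^sub>R ?e) \<ge> R" using False t[of n] by simp
        then have "\<phi> (x + t n *\<^sub>R ?e) = 0" using R(2) by (intro csupp_nonzero) auto
        moreover have "\<phi> x = 0" using R False by (intro csupp_nonzero) auto
        ultimately show ?thesis using False by (simp add: q_def)
      qed
    qed
  qed
  then show ?thesis using q0 by (simp add: LIMSEQ_const_iff)
qed

lemma integral_by_parts:
  assumes f: "smooth f" and \<phi>: "test0 \<phi>"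
  shows "(\<integral>x. f x * partial i \<phi> x \<partial>lborel) = - (\<integral>x. partial i f x * \<phi> x \<partial>lborel)"
proof -
  have 1: "integrable lborel (\<lambda>x. f x * partial i \<phi> x)"
    by (intro test0_integrable test0_mult f test0_partial \<phi>)
  have 2: "integrable lborel (\<lambda>x. partial i f x * \<phi> x)"
    by (intro test0_integrable test0_mult smooth_partial f \<phi>)
  have "0 = integral\<^sup>L lborel (partial i (\<lambda>x. f x * \<phi> x))"
    by (rule integral_partial[symmetric]) (intro test0_mult f \<phi>)
  also have "\<dots> = (\<integral>x. partial i f x * \<phi> x \<partial>lborel) + (\<integral>x. f x * partial i \<phi> x \<partial>lborel)"
    using 1 2 f test0D(1)[OF \<phi>] by (simp add: partial_smooth_mult)
  finally show ?thesis by simp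
qed

subsection \<open>Convolution with test functions\<close>

definition conv :: "(real^3 \<Rightarrow> real) \<Rightarrow> (real^3 \<Rightarrow> real) \<Rightarrow> real^3 \<Rightarrow> real" where
  "conv f \<rho> x = (\<integral>y. f y * \<rho> (x - y) \<partial>lborel)"

lemma integrable_mult_test0:
  assumes f: "integrable lborel f" and \<rho>: "test0 \<rho>"
  shows "integrable lborel (\<lambda>y. f y * \<rho> (x - y))"
proof -
  obtain B where B: "B > 0" "\<And>x. \<bar>\<rho> x\<bar> \<le> B" using test0_bounded[OF \<rho>] by metis
  have [measurable]: "\<rho> \<in> borel_measurable borel" using test0_borel[OF \<rho>] .
  have [measurable]: "f \<in> borel_measurable borel" using borel_measurable_integrable[OF f] by simp
  show ?thesis
  proof (rule Bochner_Integration.integrable_bound[of _ "\<lambda>y. B * f y"])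
    show "integrable lborel (\<lambda>y. B * f y)" using f by simp
    have "\<bar>f y * \<rho> (x - y)\<bar> \<le> \<bar>B * f y\<bar>" for y
      using mult_left_mono[OF B(2)[of "x - y"] abs_ge_zero[of "f y"]] B by (simp add: abs_mult mult.commute)
    then show "AE y in lborel. norm (f y * \<rho> (x - y)) \<le> norm (B * f y)" by simp
  qed measurable
qed

text \<open>The mean value theorem together with Lipschitz continuity of the partial derivatives.
  The remainder is uniform in the base point, which is what differentiation under the integral and
  the translation estimate for Rellich's theorem rely on.\<close>

lemma test0_taylor:
  assumes \<rho>: "test0 \<rho>"
  obtains C where "C \<ge> 0"
    "\<And>z h. \<bar>\<rho> (z + h) - \<rho> z - (\<Sum>i\<in>UNIV. h $ i * partial i \<rho> z)\<bar> \<le> C * (norm h)\<^sup>2"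
proof -
  have "\<exists>L. L > 0 \<and> (\<forall>x y. \<bar>partial i \<rho> x - partial i \<rho> y\<bar> \<le> L * norm (x - y))" for i
    using test0_lipschitz[OF test0_partial[OF \<rho>]] by metis
  then obtain L where L: "\<And>i. L i > 0" "\<And>i x y. \<bar>partial i \<rho> x - partial i \<rho> y\<bar> \<le> L i * norm (x - y)"
    by metis
  define C where "C = (\<Sum>i\<in>UNIV. L i)"
  have pt: "\<bar>\<rho> (z + h) - \<rho> z - (\<Sum>i\<in>UNIV. h $ i * partial i \<rho> z)\<bar> \<le> C * (norm h)\<^sup>2" for z h
  proof -
    obtain s where s: "0 < s" "s < 1" "\<rho> (z + h) - \<rho> z = (\<Sum>i\<in>UNIV. h $ i * partial i \<rho> (z + s *\<^sub>R h))"
      using MVT_line[OF test0D(1)[OF \<rho>]] by metis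
    have "\<bar>\<rho> (z + h) - \<rho> z - (\<Sum>i\<in>UNIV. h $ i * partial i \<rho> z)\<bar>
       = \<bar>\<Sum>i\<in>UNIV. h $ i * (partial i \<rho> (z + s *\<^sub>R h) - partial i \<rho> z)\<bar>"
      by (simp add: s(3) sum_subtractf right_diff_distrib)
    also have "\<dots> \<le> (\<Sum>i\<in>UNIV. \<bar>h $ i\<bar> * \<bar>partial i \<rho> (z + s *\<^sub>R h) - partial i \<rho> z\<bar>)"
      by (rule order.trans[OF sum_abs]) (simp add: abs_mult)
    also have "\<dots> \<le> (\<Sum>i\<in>UNIV. norm h * (L i * norm h))"
    proof (intro sum_mono mult_mono component_le_norm_cart)
      fix i
      have "\<bar>partial i \<rho> (z + s *\<^sub>R h) - partial i \<rho> z\<bar> \<le> L i * norm (s *\<^sub>R h)"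
        using L(2)[of i "z + s *\<^sub>R h" z] by simp
      also have "\<dots> \<le> L i * norm h"
        using s L(1)[of i] by (intro mult_left_mono) (auto simp: mult_left_le_one_le)
      finally show "\<bar>partial i \<rho> (z + s *\<^sub>R h) - partial i \<rho> z\<bar> \<le> L i * norm h" .
    qed auto
    also have "\<dots> = C * (norm h)\<^sup>2"
      by (simp add: C_def sum_distrib_right sum_distrib_left power2_eq_square mult_ac)
    finally show ?thesis .
  qed
  have "C \<ge> 0" unfolding C_def using L(1) by (intro sum_nonneg) (auto intro: less_imp_le)
  then show thesis using pt that by blast
qed

text \<open>Integrating the uniform Taylor remainder of \<open>\<rho>\<close> against
  \<open>\<bar>f\<bar>\<close> gives an error quadratic in \<open>h\<close>; integrability of
  \<open>f\<close> is enough and no dominating function has to be found.\<close>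

lemma conv_has_derivative:
  assumes f: "integrable lborel f" and \<rho>: "test0 \<rho>"
  shows "(conv f \<rho> has_derivative (\<lambda>h. \<Sum>i\<in>UNIV. h $ i * conv f (partial i \<rho>) x)) (at x)"
proof -
  obtain C where pt: "\<And>z h. \<bar>\<rho> (z + h) - \<rho> z - (\<Sum>i\<in>UNIV. h $ i * partial i \<rho> z)\<bar> \<le> C * (norm h)\<^sup>2"
    using test0_taylor[OF \<rho>] by metis
  let ?K = "\<integral>y. \<bar>f y\<bar> \<partial>lborel"
  have est: "\<bar>conv f \<rho> (x + h) - conv f \<rho> x - (\<Sum>i\<in>UNIV. h $ i * conv f (partial i \<rho>) x)\<bar>
      \<le> (?K * C) * (norm h)\<^sup>2" for h
  proof -
    have int: "integrable lborel (\<lambda>y. f y * (\<rho> (x + h - y) - \<rho> (x - y) - (\<Sum>i\<in>UNIV. h $ i * partial i \<rho> (x - y))))"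
    proof -
      have "integrable lborel (\<lambda>y. f y * \<rho> (x + h - y) - f y * \<rho> (x - y) - (\<Sum>i\<in>UNIV. h $ i * (f y * partial i \<rho> (x - y))))"
        by (intro Bochner_Integration.integrable_diff Bochner_Integration.integrable_sum
            integrable_mult_right integrable_mult_test0 test0_partial f \<rho>)
      then show ?thesis by (simp add: right_diff_distrib sum_distrib_left mult.left_commute)
    qed
    have eq: "conv f \<rho> (x + h) - conv f \<rho> x - (\<Sum>i\<in>UNIV. h $ i * conv f (partial i \<rho>) x)
      = (\<integral>y. f y * (\<rho> (x + h - y) - \<rho> (x - y) - (\<Sum>i\<in>UNIV. h $ i * partial i \<rho> (x - y))) \<partial>lborel)"
    proof -
      have "(\<integral>y. f y * (\<rho> (x + h - y) - \<rho> (x - y) - (\<Sum>i\<in>UNIV. h $ i * partial i \<rho> (x - y))) \<partial>lborel)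
        = (\<integral>y. f y * \<rho> (x + h - y) - f y * \<rho> (x - y) - (\<Sum>i\<in>UNIV. h $ i * (f y * partial i \<rho> (x - y))) \<partial>lborel)"
        by (simp add: right_diff_distrib sum_distrib_left mult.left_commute)
      also have "\<dots> = conv f \<rho> (x + h) - conv f \<rho> x - (\<Sum>i\<in>UNIV. h $ i * conv f (partial i \<rho>) x)"
        unfolding conv_def using integrable_mult_test0[OF f \<rho>] integrable_mult_test0[OF f test0_partial[OF \<rho>]]
        by simp
      finally show ?thesis by simp
    qed
    have "\<bar>conv f \<rho> (x + h) - conv f \<rho> x - (\<Sum>i\<in>UNIV. h $ i * conv f (partial i \<rho>) x)\<bar>
      \<le> (\<integral>y. \<bar>f y * (\<rho> (x + h - y) - \<rho> (x - y) - (\<Sum>i\<in>UNIV. h $ i * partial i \<rho> (x - y)))\<bar> \<partial>lborel)"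
      unfolding eq by (rule integral_abs_bound)
    also have "\<dots> \<le> (\<integral>y. \<bar>f y\<bar> * (C * (norm h)\<^sup>2) \<partial>lborel)"
    proof (rule integral_mono)
      fix y
      show "\<bar>f y * (\<rho> (x + h - y) - \<rho> (x - y) - (\<Sum>i\<in>UNIV. h $ i * partial i \<rho> (x - y)))\<bar> \<le> \<bar>f y\<bar> * (C * (norm h)\<^sup>2)"
      proof -
        have e: "x + h - y = (x - y) + h" by simp
        show ?thesis unfolding e abs_mult by (rule mult_left_mono[OF pt]) simp
      qed
    qed (use int f in auto)
    also have "\<dots> = (?K * C) * (norm h)\<^sup>2" by simp
    finally show ?thesis .
  qed
  have bl: "bounded_linear (\<lambda>h::real^3. \<Sum>i\<in>UNIV. h $ i * conv f (partial i \<rho>) x)"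
    by (intro bounded_linear_sum bounded_linear_mult_const bounded_linear_vec_nth)
  show ?thesis
    unfolding has_derivative_at
  proof (intro conjI bl)
    show "(\<lambda>h. norm (conv f \<rho> (x + h) - conv f \<rho> x - (\<Sum>i\<in>UNIV. h $ i * conv f (partial i \<rho>) x)) / norm h) \<midarrow>0\<rightarrow> 0"
    proof (rule Lim_null_comparison)
      show "eventually (\<lambda>h. norm (norm (conv f \<rho> (x + h) - conv f \<rho> x
         - (\<Sum>i\<in>UNIV. h $ i * conv f (partial i \<rho>) x)) / norm h) \<le> (?K * C) * norm h) (at 0)"
      proof (rule eventually_mono[OF eventually_neq_at_within[of 0]])
        fix h :: "real^3" assume "h \<noteq> 0"
        then show "norm (norm (conv f \<rho> (x + h) - conv f \<rho> x
         - (\<Sum>i\<in>UNIV. h $ i * conv f (partial i \<rho>) x)) / norm h) \<le> (?K * C) * norm h"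
          using est[of h] by (simp add: divide_le_eq power2_eq_square mult_ac)
      qed
      have "((\<lambda>h::real^3. (?K * C) * norm h) \<longlongrightarrow> (?K * C) * norm (0::real^3)) (at 0)"
        by (intro tendsto_intros)
      then show "((\<lambda>h::real^3. (?K * C) * norm h) \<longlongrightarrow> 0) (at 0)" by simp
    qed
  qed
qed

lemma partial_conv:
  assumes "integrable lborel f" "test0 \<rho>"
  shows "partial i (conv f \<rho>) = conv f (partial i \<rho>)"
proof
  fix x
  show "partial i (conv f \<rho>) x = conv f (partial i \<rho>) x"
    by (subst partial_eq[OF conv_has_derivative[OF assms]])
      (simp add: axis_def if_distrib if_distribR cong: if_cong)
qed

lemma conv_smooth:
  assumes f: "integrable lborel f" and \<rho>: "test0 \<rho>"
  shows "smooth (conv f \<rho>)"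
proof -
  have d: "conv f \<rho> differentiable (at x)" if "test0 \<rho>" for \<rho> x
    using conv_has_derivative[OF f that] by (auto simp: differentiable_def)
  have "Ck n (conv f \<rho>)" for n
    using \<rho>
  proof (induction n arbitrary: \<rho>)
    case 0
    then show ?case using d by (auto simp: continuous_on_eq_continuous_at differentiable_imp_continuous_within)
  next
    case (Suc n)
    then show ?case using d by (auto simp: partial_conv[OF f] test0_partial)
  qed
  then show ?thesis by (simp add: smooth_def)
qed

lemma conv_eq_0:
  assumes "\<And>y. f y \<noteq> 0 \<Longrightarrow> \<rho> (x - y) = 0"
  shows "conv f \<rho> x = 0"
proof -
  have "(\<lambda>y. f y * \<rho> (x - y)) = (\<lambda>y. 0)" using assms by force
  then show ?thesis by (simp add: conv_def)
qed

section \<open>The standard mollifier and smooth cutoffs\<close>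

definition moll :: "real \<Rightarrow> real^3 \<Rightarrow> real" where
  "moll e x = bump (x /\<^sub>R e) / (e ^ 3 * integral\<^sup>L lborel bump)"

text \<open>If the integral vanished, the nonnegative function would be zero almost everywhere; but
  it is positive on the unit ball, which is not negligible.\<close>

lemma bump_integral_pos: "integral\<^sup>L lborel bump > 0"
proof -
  have "integral\<^sup>L lborel bump \<noteq> 0"
  proof
    assume "integral\<^sup>L lborel bump = 0"
    then have "AE x in lborel. bump x = 0"
      using integral_nonneg_eq_0_iff_AE[OF test0_integrable[OF test0_bump]] bump_nonneg by auto
    then have "AE x\<in>ball (0::real^3) 1 in lborel. False"
      by eventually_elim (use bump_pos in force)
    then have "ball (0::real^3) 1 \<in> null_sets lborel"
      by (subst AE_iff_null_sets) auto
    then have "ball (0::real^3) 1 \<in> null_sets lebesgue" by (rule null_sets_completionI)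
    then have "negligible (ball (0::real^3) 1)" by (simp add: negligible_iff_null_sets)
    then show False using open_not_negligible[of "ball (0::real^3) 1"] by auto
  qed
  moreover have "integral\<^sup>L lborel bump \<ge> 0" by (simp add: bump_nonneg)
  ultimately show ?thesis by simp
qed

lemma moll_test0: "e > 0 \<Longrightarrow> test0 (moll e)"
  using test0_mult[OF smooth_const[of "1 / (e ^ 3 * integral\<^sup>L lborel bump)"] test0_affine[OF test0_bump, of "1/e" 0]]
  by (simp add: moll_def[abs_def] inverse_eq_divide)

lemma moll_nonneg: "e > 0 \<Longrightarrow> moll e x \<ge> 0"
  using bump_integral_pos by (simp add: moll_def bump_nonneg)

lemma moll_zero: "e > 0 \<Longrightarrow> norm x \<ge> e \<Longrightarrow> moll e x = 0"
  by (simp add: moll_def bump_zero field_simps)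

lemma moll_integral:
  assumes "e > 0"
  shows "integral\<^sup>L lborel (moll e) = 1"
proof -
  have "integral\<^sup>L lborel bump = \<bar>1/e\<bar> ^ 3 * (\<integral>x. bump (0 + (1/e) *\<^sub>R x) \<partial>lborel)"
    by (rule lborel_integral_affine) (use assms test0_borel[OF test0_bump] in auto)
  then have "(\<integral>x. bump (x /\<^sub>R e) \<partial>lborel) = e ^ 3 * integral\<^sup>L lborel bump"
    using assms by (simp add: inverse_eq_divide field_simps)
  then show ?thesis
    using assms bump_integral_pos by (simp add: moll_def[abs_def])
qed

lemma partial_moll: "e > 0 \<Longrightarrow> partial i (moll e) x = partial i bump (x /\<^sub>R e) / (e ^ 4 * integral\<^sup>L lborel bump)"
  using partial_smooth_cmult[OF smooth_affine[OF bump_smooth, of 0 "1/e"], of i "1 / (e ^ 3 * integral\<^sup>L lborel bump)"]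
    partial_smooth_affine[OF bump_smooth, of i 0 "1/e"]
  by (simp add: moll_def[abs_def] inverse_eq_divide power_numeral_reduce mult_ac)

text \<open>Scaling: the derivative carries the factor \<open>e^-4\<close> and the substitution
  gives back \<open>e^3\<close>, so one power of \<open>1/e\<close> is left and the constant depends
  only on the bump.\<close>

lemma moll_gradient:
  obtains C where "C > 0" "\<And>i e. e > 0 \<Longrightarrow> (\<integral>x. \<bar>partial i (moll e) x\<bar> \<partial>lborel) \<le> C / e"
proof -
  let ?I = "\<lambda>i. \<integral>x. \<bar>partial i bump x\<bar> \<partial>lborel"
  \<comment> \<open>The summand 1 makes positivity of the constant immediate.\<close>
  let ?C = "1 + (\<Sum>i\<in>UNIV. ?I i) / integral\<^sup>L lborel bump"
  show thesis
  proof (rule that[of ?C])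
    have nn: "(\<Sum>i\<in>UNIV. ?I i) \<ge> 0" by (intro sum_nonneg) simp
    then show "?C > 0" using bump_integral_pos by (simp add: add_pos_nonneg)
    fix i and e :: real assume e: "e > 0"
    have [measurable]: "partial i bump \<in> borel_measurable borel"
      using test0_borel[OF test0_partial[OF test0_bump]] .
    have "?I i = \<bar>1/e\<bar> ^ 3 * (\<integral>x. \<bar>partial i bump (0 + (1/e) *\<^sub>R x)\<bar> \<partial>lborel)"
      by (rule lborel_integral_affine) (use e in auto)
    then have "(\<integral>x. \<bar>partial i bump (x /\<^sub>R e)\<bar> \<partial>lborel) = e ^ 3 * ?I i"
      using e by (simp add: inverse_eq_divide field_simps)
    then have "(\<integral>x. \<bar>partial i (moll e) x\<bar> \<partial>lborel) = (?I i / integral\<^sup>L lborel bump) / e"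
      using e bump_integral_pos by (simp add: partial_moll abs_mult field_simps power_numeral_reduce)
    also have "\<dots> \<le> ?C / e"
    proof (intro divide_right_mono)
      have "?I i \<le> (\<Sum>i\<in>UNIV. ?I i)" by (rule member_le_sum) auto
      then have "?I i / integral\<^sup>L lborel bump \<le> (\<Sum>i\<in>UNIV. ?I i) / integral\<^sup>L lborel bump"
        using bump_integral_pos by (intro divide_right_mono) auto
      then show "?I i / integral\<^sup>L lborel bump \<le> ?C" by simp
    qed (use e in simp)
    finally show "(\<integral>x. \<bar>partial i (moll e) x\<bar> \<partial>lborel) \<le> ?C / e" .
  qed
qed

lemma conv_bound:
  assumes f: "f \<in> borel_measurable borel" "\<And>y. \<bar>f y\<bar> \<le> B" and \<rho>: "test0 \<rho>"
  shows "\<bar>conv f \<rho> x\<bar> \<le> B * (\<integral>y. \<bar>\<rho> y\<bar> \<partial>lborel)"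
proof -
  have [measurable]: "\<rho> \<in> borel_measurable borel" using test0_borel[OF \<rho>] .
  have i: "integrable lborel (\<lambda>y. \<bar>\<rho> (x - y)\<bar>)"
    using lborel_integral_reflect(2)[of \<rho> x] test0_integrable[OF \<rho>] by (intro integrable_abs) auto
  have "\<bar>conv f \<rho> x\<bar> \<le> (\<integral>y. \<bar>f y * \<rho> (x - y)\<bar> \<partial>lborel)"
    unfolding conv_def by (rule integral_abs_bound)
  also have "\<dots> \<le> (\<integral>y. B * \<bar>\<rho> (x - y)\<bar> \<partial>lborel)"
  proof (rule integral_mono_AE')
    show "integrable lborel (\<lambda>y. B * \<bar>\<rho> (x - y)\<bar>)" using i by simp
    show "AE y in lborel. \<bar>f y * \<rho> (x - y)\<bar> \<le> B * \<bar>\<rho> (x - y)\<bar>"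
      unfolding abs_mult by (intro AE_I2 mult_right_mono f) auto
    show "AE y in lborel. 0 \<le> B * \<bar>\<rho> (x - y)\<bar>"
      by (intro AE_I2 mult_nonneg_nonneg order.trans[OF abs_ge_zero f(2)]) simp
  qed
  also have "\<dots> = B * (\<integral>y. \<bar>\<rho> y\<bar> \<partial>lborel)"
    using lborel_integral_reflect(1)[of "\<lambda>y. \<bar>\<rho> y\<bar>" x] by simp
  finally show ?thesis .
qed

text \<open>The indicator is convolved with \<open>moll e\<close>; the gradient bound is the L1 norm
  of the gradient of the mollifier. What matters is the order of quantifiers: \<open>C\<close> is
  fixed before \<open>A\<close> and \<open>e\<close>, so the bound survives when neighbourhoods of
  the interface shrink.\<close>

lemma mollified_indicator:
  obtains C where "C > 0" "\<And>A e. A \<in> sets borel \<Longrightarrow> bounded A \<Longrightarrow> e > 0 \<Longrightarrow>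
    \<exists>\<eta>. smooth \<eta> \<and> (\<forall>x. 0 \<le> \<eta> x \<and> \<eta> x \<le> 1) \<and> (\<forall>i x. \<bar>partial i \<eta> x\<bar> \<le> C / e)
      \<and> (\<forall>x. ball x e \<subseteq> A \<longrightarrow> \<eta> x = 1) \<and> (\<forall>x. ball x e \<inter> A = {} \<longrightarrow> \<eta> x = 0)"
proof -
  obtain C where C: "C > 0" "\<And>i e. e > 0 \<Longrightarrow> (\<integral>x. \<bar>partial i (moll e) x\<bar> \<partial>lborel) \<le> C / e"
    using moll_gradient by metis
  show thesis
  proof (rule that[OF C(1)])
    fix A :: "(real^3) set" and e :: real assume A[measurable]: "A \<in> sets borel" and bA: "bounded A" and e: "e > 0"
    have mt: "test0 (moll e)" using moll_test0[OF e] .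
    have [measurable]: "moll e \<in> borel_measurable borel" using test0_borel[OF mt] .
    define \<eta> where "\<eta> = conv (indicator A) (moll e)"
    have iA: "integrable lborel (indicator A :: real^3 \<Rightarrow> real)"
      using bA emeasure_bounded_finite by (simp add: integrable_indicator_iff)
    have i1: "\<bar>indicator A y :: real\<bar> \<le> 1" for y by (simp add: indicator_def)
    have cb: "\<bar>conv (indicator A) \<rho> x\<bar> \<le> 1 * (\<integral>y. \<bar>\<rho> y\<bar> \<partial>lborel)" if "test0 \<rho>" for \<rho> x
      by (rule conv_bound[OF _ i1 that]) simp
    have "\<bar>\<eta> x\<bar> \<le> 1" for x
      using cb[OF mt, of x] moll_integral[OF e] moll_nonneg[OF e] by (simp add: \<eta>_def)
    moreover have "0 \<le> \<eta> x" for x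
      unfolding \<eta>_def conv_def by (intro Bochner_Integration.integral_nonneg) (simp add: moll_nonneg[OF e])
    moreover have "\<bar>partial i \<eta> x\<bar> \<le> C / e" for i x
      using cb[of "partial i (moll e)" x, OF test0_partial[OF mt]] C(2)[OF e, of i]
      by (simp add: \<eta>_def partial_conv[OF iA mt])
    moreover have "\<eta> x = 1" if "ball x e \<subseteq> A" for x
    proof -
      have "indicator A y * moll e (x - y) = moll e (x - y)" for y :: "real^3"
        using that moll_zero[OF e, of "x - y"] by (cases "y \<in> ball x e") (auto simp: dist_norm indicator_def)
      then have "\<eta> x = (\<integral>y. moll e (x - y) \<partial>lborel)" unfolding \<eta>_def conv_def by presburger
      then show ?thesis
        using lborel_integral_reflect(1)[of "moll e" x] moll_integral[OF e] by simp
    qed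
    moreover have "\<eta> x = 0" if "ball x e \<inter> A = {}" for x
      unfolding \<eta>_def
    proof (rule conv_eq_0)
      fix y assume "indicator A y \<noteq> (0::real)"
      then have "y \<in> A" by (auto simp: indicator_def split: if_splits)
      then have "y \<notin> ball x e" using that by blast
      then show "moll e (x - y) = 0" by (intro moll_zero e) (simp add: dist_norm)
    qed
    moreover have "smooth \<eta>" unfolding \<eta>_def by (rule conv_smooth[OF iA mt])
    ultimately show "\<exists>\<eta>. smooth \<eta> \<and> (\<forall>x. 0 \<le> \<eta> x \<and> \<eta> x \<le> 1) \<and> (\<forall>i x. \<bar>partial i \<eta> x\<bar> \<le> C / e)
      \<and> (\<forall>x. ball x e \<subseteq> A \<longrightarrow> \<eta> x = 1) \<and> (\<forall>x. ball x e \<inter> A = {} \<longrightarrow> \<eta> x = 0)"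
      by (intro exI[of _ \<eta>]) (auto simp: abs_le_iff)
  qed
qed

text \<open>The function is 1 on a neighbourhood \<open>V\<close> of \<open>K\<close>, not just on
  \<open>K\<close>, so that after multiplication by it all derivatives at points of \<open>K\<close>
  remain unchanged.\<close>

lemma smooth_cutoff:
  assumes K: "compact K" and U: "open U" "K \<subseteq> U"
  obtains \<eta> V where "test U \<eta>" "open V" "K \<subseteq> V" "\<And>x. x \<in> V \<Longrightarrow> \<eta> x = 1"
    "\<And>x. 0 \<le> \<eta> x \<and> \<eta> x \<le> 1"
proof -
  obtain d where d: "d > 0" "\<And>x y. x \<in> K \<Longrightarrow> dist x y < d \<Longrightarrow> y \<in> U"
  \<comment> \<open>Separate because \<open>setdist\<close> to or from an empty set is 0 and would
    give no positive radius.\<close>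
  proof (cases "K = {} \<or> U = UNIV")
    case True
    then show ?thesis using that[of 1] by auto
  next
    case False
    then have "setdist K (- U) > 0"
      using K U by (subst setdist_gt_0_compact_closed) auto
    moreover have "y \<in> U" if "x \<in> K" "dist x y < setdist K (- U)" for x y
      using setdist_le_dist[of x K y "- U"] that by force
    ultimately show ?thesis using that by blast
  qed
  \<comment> \<open>Mollifying the \<open>d/2\<close>-neighbourhood at scale \<open>d/4\<close>
    gives the value 1 within distance \<open>d/4\<close> of \<open>K\<close> and 0 beyond
    \<open>3*d/4\<close>, still inside \<open>U\<close>.\<close>
  define A where "A = (\<Union>x\<in>K. ball x (d/2))"
  have oA: "open A" by (auto simp: A_def)
  have bA: "bounded A"
  proof -
    obtain R where "\<And>x. x \<in> K \<Longrightarrow> norm x \<le> R"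
      using compact_imp_bounded[OF K] bounded_iff by blast
    then have "norm y \<le> R + d/2" if yA: "y \<in> A" for y
    proof -
      obtain x where x: "x \<in> K" "dist x y < d/2" using yA by (auto simp: A_def)
      then show ?thesis
        using \<open>\<And>x. x \<in> K \<Longrightarrow> norm x \<le> R\<close>[OF x(1)] norm_triangle_sub[of y x]
        by (simp add: dist_norm norm_minus_commute)
    qed
    then show ?thesis by (auto simp: bounded_iff)
  qed
  have d4: "d/4 > 0" using d by simp
  have "A \<in> sets borel" using oA by auto
  then obtain \<eta> where \<eta>: "smooth \<eta>" "\<And>x. 0 \<le> \<eta> x \<and> \<eta> x \<le> 1"
    "\<And>x. ball x (d/4) \<subseteq> A \<Longrightarrow> \<eta> x = 1" "\<And>x. ball x (d/4) \<inter> A = {} \<Longrightarrow> \<eta> x = 0"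
    using mollified_indicator bA d4 by metis
  define S where "S = (\<Union>x\<in>K. cball x (3*d/4))"
  have S: "S = (\<Union>x\<in>K. \<Union>y\<in>cball 0 (3*d/4). {x + y})"
    by (force simp: S_def dist_norm norm_minus_commute intro: bexI[of _ "_ - _"])
  have cS: "compact S"
    unfolding S using compact_sums'[OF K compact_cball[of 0 "3*d/4"]] by simp
  have out: "\<eta> x = 0" if "x \<notin> S" for x
  proof (rule \<eta>(4), rule ccontr)
    assume "ball x (d/4) \<inter> A \<noteq> {}"
    then obtain y z where "dist x y < d/4" "z \<in> K" "dist z y < d/2" by (auto simp: A_def)
    then have "dist z x \<le> 3*d/4" using dist_triangle[of z x y] by (simp add: dist_commute)
    with \<open>z \<in> K\<close> that show False by (auto simp: S_def)
  qed
  show thesis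
  proof
    have "S \<subseteq> U" using d by (force simp: S_def)
    moreover have "csupp \<eta> \<subseteq> S" by (rule csupp_subset[OF compact_imp_closed[OF cS] out])
    ultimately show "test U \<eta>"
      using test0I[OF \<eta>(1) cS out] by (simp add: test_iff)
    show "open (\<Union>x\<in>K. ball x (d/4))" by auto
    show "K \<subseteq> (\<Union>x\<in>K. ball x (d/4))" using d by auto
    fix x assume "x \<in> (\<Union>x\<in>K. ball x (d/4))"
    then obtain z where z: "z \<in> K" "dist z x < d/4" by auto
    have "y \<in> A" if "dist x y < d/4" for y
    proof -
      have "dist z y < d/2" using dist_triangle[of z y x] that z by simp
      with z show ?thesis by (auto simp: A_def)
    qed
    then show "\<eta> x = 1" by (intro \<eta>(3)) auto
  qed (use \<eta> in auto)
qed

subsection \<open>Translations and mollification in $L^2$\<close>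

definition L1_shift_cont :: "(real^3 \<Rightarrow> real) \<Rightarrow> bool" where
  "L1_shift_cont f \<longleftrightarrow> (\<forall>z. z \<longlonglongrightarrow> 0 \<longrightarrow> (\<lambda>n. \<integral>x. \<bar>f (x + z n) - f x\<bar> \<partial>lborel) \<longlonglongrightarrow> 0)"

text \<open>Insert \<open>g\<close> at both points; by translation invariance the two approximation
  errors have the same integral, hence the factor 2.\<close>

lemma L1_shift_bound:
  fixes f g :: "real^3 \<Rightarrow> real"
  assumes f: "integrable lborel f" and g: "integrable lborel g"
  shows "(\<integral>x. \<bar>f (x + z) - f x\<bar> \<partial>lborel)
    \<le> (\<integral>x. \<bar>g (x + z) - g x\<bar> \<partial>lborel) + 2 * (\<integral>x. \<bar>f x - g x\<bar> \<partial>lborel)"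
proof -
  have m[measurable]: "f \<in> borel_measurable borel" "g \<in> borel_measurable borel"
    using f g borel_measurable_integrable by force+
  have fz: "integrable lborel (\<lambda>x. f (x + z))" and gz: "integrable lborel (\<lambda>x. g (x + z))"
    using lborel_integral_shift(2)[OF m(1), of z] lborel_integral_shift(2)[OF m(2), of z] f g by auto
  have "(\<integral>x. \<bar>f (x + z) - f x\<bar> \<partial>lborel)
    \<le> (\<integral>x. \<bar>f (x + z) - g (x + z)\<bar> + \<bar>g (x + z) - g x\<bar> + \<bar>f x - g x\<bar> \<partial>lborel)"
    using f g fz gz by (intro integral_mono) auto
  also have "\<dots> = (\<integral>x. \<bar>f (x + z) - g (x + z)\<bar> \<partial>lborel) + (\<integral>x. \<bar>g (x + z) - g x\<bar> \<partial>lborel) + (\<integral>x. \<bar>f x - g x\<bar> \<partial>lborel)"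
    using f g fz gz by simp
  also have "(\<integral>x. \<bar>f (x + z) - g (x + z)\<bar> \<partial>lborel) = (\<integral>x. \<bar>f x - g x\<bar> \<partial>lborel)"
    using lborel_integral_shift(1)[of "\<lambda>x. \<bar>f x - g x\<bar>" z] by simp
  finally show ?thesis by simp
qed

lemma L1_shift_cont_limit:
  assumes f: "integrable lborel f"
    and approx: "\<And>e. e > 0 \<Longrightarrow> \<exists>g. integrable lborel g \<and> L1_shift_cont g \<and> (\<integral>x. \<bar>f x - g x\<bar> \<partial>lborel) \<le> e"
  shows "L1_shift_cont f"
  unfolding L1_shift_cont_def
proof (intro allI impI LIMSEQ_I)
  fix z :: "nat \<Rightarrow> real^3" and e :: real assume z: "z \<longlonglongrightarrow> 0" and e: "e > 0"
  obtain g where g: "integrable lborel g" "L1_shift_cont g" "(\<integral>x. \<bar>f x - g x\<bar> \<partial>lborel) \<le> e/4"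
    using approx[of "e/4"] e by auto
  have "e/2 > 0" using e by simp
  from LIMSEQ_D[OF g(2)[unfolded L1_shift_cont_def, rule_format, OF z] this] obtain N
    where N: "\<And>n. n \<ge> N \<Longrightarrow> (\<integral>x. \<bar>g (x + z n) - g x\<bar> \<partial>lborel) < e/2" by force
  have "norm ((\<integral>x. \<bar>f (x + z n) - f x\<bar> \<partial>lborel) - 0) < e" if "n \<ge> N" for n
    using L1_shift_bound[OF f g(1), of "z n"] g(3) N[OF that] by simp
  then show "\<exists>N. \<forall>n\<ge>N. norm ((\<integral>x. \<bar>f (x + z n) - f x\<bar> \<partial>lborel) - 0) < e" by blast
qed

lemma L1_shift_cont_cmult: "L1_shift_cont f \<Longrightarrow> L1_shift_cont (\<lambda>x. c * f x)"
  unfolding L1_shift_cont_def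
proof (intro allI impI)
  fix z :: "nat \<Rightarrow> real^3"
  assume *: "\<forall>z. z \<longlonglongrightarrow> 0 \<longrightarrow> (\<lambda>n. \<integral>x. \<bar>f (x + z n) - f x\<bar> \<partial>lborel) \<longlonglongrightarrow> 0" and z: "z \<longlonglongrightarrow> 0"
  have "(\<lambda>n. \<bar>c\<bar> * (\<integral>x. \<bar>f (x + z n) - f x\<bar> \<partial>lborel)) \<longlonglongrightarrow> \<bar>c\<bar> * 0"
    using * z by (intro tendsto_intros) auto
  then show "(\<lambda>n. \<integral>x. \<bar>c * f (x + z n) - c * f x\<bar> \<partial>lborel) \<longlonglongrightarrow> 0"
    by (simp add: right_diff_distrib[symmetric] abs_mult)
qed

text \<open>A translate of an open set has the same measure, so the symmetric difference is twice
  a one-sided difference, and that one tends to zero pointwise.\<close>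
lemma L1_shift_cont_open:
  assumes U: "open U" "emeasure lborel U < \<infinity>"
  shows "L1_shift_cont (indicator U)"
  unfolding L1_shift_cont_def
proof (intro allI impI)
  fix z :: "nat \<Rightarrow> real^3" assume z: "z \<longlonglongrightarrow> 0"
  let ?f = "indicator U :: real^3 \<Rightarrow> real"
  have [measurable]: "U \<in> sets borel" using U by auto
  have i: "integrable lborel ?f" using U by (simp add: integrable_indicator_iff)
  have iz: "integrable lborel (\<lambda>x. ?f (x + z n))" for n
    using lborel_integral_shift(2)[of ?f "z n"] i by simp
  let ?h = "\<lambda>n x. ?f x * (1 - ?f (x + z n))"
  have ih: "integrable lborel (?h n)" for n
    by (rule Bochner_Integration.integrable_bound[OF i]) (auto simp: indicator_def)
  have eq: "(\<integral>x. \<bar>?f (x + z n) - ?f x\<bar> \<partial>lborel) = 2 * (\<integral>x. ?h n x \<partial>lborel)" for n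
  proof -
    have "\<bar>?f (x + z n) - ?f x\<bar> = 2 * ?h n x + (?f (x + z n) - ?f x)" for x
      by (auto simp: indicator_def)
    then show ?thesis using ih[of n] i iz[of n] lborel_integral_shift(1)[of ?f "z n"] by simp
  qed
  have "(\<lambda>n. \<integral>x. ?h n x \<partial>lborel) \<longlonglongrightarrow> (\<integral>x. (0::real) \<partial>(lborel :: (real^3) measure))"
  proof (rule integral_dominated_convergence[where w = ?f])
    show "integrable lborel ?f" by (rule i)
    show "AE x in lborel. (\<lambda>n. ?h n x) \<longlonglongrightarrow> 0"
    proof (intro AE_I2)
      fix x
      show "(\<lambda>n. ?h n x) \<longlonglongrightarrow> 0"
      proof (cases "x \<in> U")
        case True
        have "(\<lambda>n. x + z n) \<longlonglongrightarrow> x + 0" by (intro tendsto_intros z)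
        then have "eventually (\<lambda>n. x + z n \<in> U) sequentially"
          using topological_tendstoD[OF _ U(1)] True by simp
        then have "eventually (\<lambda>n. ?h n x = 0) sequentially" by eventually_elim simp
        then show ?thesis by (rule tendsto_eventually)
      qed simp
    qed
  qed (auto simp: indicator_def)
  then have "(\<lambda>n. \<integral>x. ?h n x \<partial>lborel) \<longlonglongrightarrow> 0" by simp
  from tendsto_mult_left[OF this, of 2] show "(\<lambda>n. \<integral>x. \<bar>?f (x + z n) - ?f x\<bar> \<partial>lborel) \<longlonglongrightarrow> 0"
    unfolding eq by simp
qed

text \<open>Induction over integrable functions. Only indicators need an argument: outer regularity
  approximates the set in measure by open sets, for which the claim is already known.\<close>

lemma L1_shift_cont_integrable:
  fixes f :: "real^3 \<Rightarrow> real"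
  assumes "integrable lborel f"
  shows "L1_shift_cont f"
  using assms
proof (induction rule: integrable_induct)
  case (base A c)
  have [measurable]: "A \<in> sets borel" using base by simp
  have iA: "integrable lborel (indicator A :: real^3 \<Rightarrow> real)"
    using base by (simp add: integrable_indicator_iff)
  have "L1_shift_cont (indicator A)"
  proof (rule L1_shift_cont_limit[OF iA])
    fix e :: real assume e: "e > 0"
    obtain U where U: "open U" "A \<subseteq> U" "emeasure lborel (U - A) < e"
      using outer_regular_lborel[OF _ e, of A] base by auto
    have [measurable]: "U \<in> sets borel" using U by auto
    have "emeasure lborel U \<le> emeasure lborel A + emeasure lborel (U - A)"
      using U(2) by (metis Diff_partition emeasure_subadditive \<open>A \<in> sets borel\<close> \<open>U \<in> sets borel\<close> sets.Diff sets_lborel)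
    also have "\<dots> < \<infinity>" using base(2) U(3) by (auto simp: ennreal_add_less_top less_top[symmetric] top_unique)
    finally have fU: "emeasure lborel U < \<infinity>" .
    have "(\<integral>x. \<bar>indicator A x - indicator U x :: real\<bar> \<partial>lborel) = (\<integral>x. indicator (U - A) x \<partial>lborel)"
      using U(2) by (intro Bochner_Integration.integral_cong) (auto simp: indicator_def)
    also have "\<dots> \<le> e"
      using U(3) e by (simp add: measure_def enn2real_leI)
    finally show "\<exists>g. integrable lborel g \<and> L1_shift_cont g \<and> (\<integral>x. \<bar>indicator A x - g x\<bar> \<partial>lborel) \<le> e"
      using L1_shift_cont_open[OF U(1) fU] fU by (intro exI[of _ "indicator U"]) (auto simp: integrable_indicator_iff)
  qed
  from L1_shift_cont_cmult[OF this, of c] show ?case by (simp add: mult.commute)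
next
  case (add f g)
  have [measurable]: "f \<in> borel_measurable borel" "g \<in> borel_measurable borel"
    using add borel_measurable_integrable by force+
  show ?case
    unfolding L1_shift_cont_def
  proof (intro allI impI)
    fix z :: "nat \<Rightarrow> real^3" assume z: "z \<longlonglongrightarrow> 0"
    have fz: "integrable lborel (\<lambda>x. f (x + z n))" and gz: "integrable lborel (\<lambda>x. g (x + z n))" for n
      using lborel_integral_shift(2)[of f "z n"] lborel_integral_shift(2)[of g "z n"] add by auto
    show "(\<lambda>n. \<integral>x. \<bar>f (x + z n) + g (x + z n) - (f x + g x)\<bar> \<partial>lborel) \<longlonglongrightarrow> 0"
    proof (rule Lim_null_comparison)
      show "(\<lambda>n. (\<integral>x. \<bar>f (x + z n) - f x\<bar> \<partial>lborel) + (\<integral>x. \<bar>g (x + z n) - g x\<bar> \<partial>lborel)) \<longlonglongrightarrow> 0"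
        using add z by (intro tendsto_add_zero) (auto simp: L1_shift_cont_def)
      have "(\<integral>x. \<bar>f (x + z n) + g (x + z n) - (f x + g x)\<bar> \<partial>lborel)
        \<le> (\<integral>x. \<bar>f (x + z n) - f x\<bar> + \<bar>g (x + z n) - g x\<bar> \<partial>lborel)" for n
        using fz gz add by (intro integral_mono) auto
      then show "\<forall>\<^sub>F n in sequentially. norm (\<integral>x. \<bar>f (x + z n) + g (x + z n) - (f x + g x)\<bar> \<partial>lborel)
         \<le> (\<integral>x. \<bar>f (x + z n) - f x\<bar> \<partial>lborel) + (\<integral>x. \<bar>g (x + z n) - g x\<bar> \<partial>lborel)"
        using fz gz add by simp
    qed
  qed
next
  case (lim f s)
  have [measurable]: "f \<in> borel_measurable borel" "s i \<in> borel_measurable borel" for i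
    using lim borel_measurable_integrable by force+
  show ?case
  proof (rule L1_shift_cont_limit[OF lim(4)])
    fix e :: real assume e: "e > 0"
    have "(\<lambda>n. \<integral>x. \<bar>f x - s n x\<bar> \<partial>lborel) \<longlonglongrightarrow> (\<integral>x. (0::real) \<partial>(lborel :: (real^3) measure))"
    proof (rule integral_dominated_convergence)
      show "integrable lborel (\<lambda>x. 3 * \<bar>f x\<bar>)" using lim by simp
      show "AE x in lborel. (\<lambda>n. \<bar>f x - s n x\<bar>) \<longlonglongrightarrow> 0"
      proof (intro AE_I2)
        fix x
        have "(\<lambda>n. \<bar>f x - s n x\<bar>) \<longlonglongrightarrow> \<bar>f x - f x\<bar>" using lim(2) by (intro tendsto_intros) auto
        then show "(\<lambda>n. \<bar>f x - s n x\<bar>) \<longlonglongrightarrow> 0" by simp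
      qed
      show "AE x in lborel. norm (\<bar>f x - s n x\<bar>) \<le> 3 * \<bar>f x\<bar>" for n
      proof (intro AE_I2)
        fix x show "norm (\<bar>f x - s n x\<bar>) \<le> 3 * \<bar>f x\<bar>" using lim(3)[of x n] by simp
      qed
    qed auto
    from LIMSEQ_D[OF this e] obtain n where "(\<integral>x. \<bar>f x - s n x\<bar> \<partial>lborel) < e" by auto
    then show "\<exists>g. integrable lborel g \<and> L1_shift_cont g \<and> (\<integral>x. \<bar>f x - g x\<bar> \<partial>lborel) \<le> e"
      using lim(1,5) by (intro exI[of _ "s n"]) auto
  qed
qed

lemma l2_shift:
  fixes f :: "real^3 \<Rightarrow> real"
  assumes "l2 lborel f"
  shows "l2 lborel (\<lambda>x. f (x + z))" "n2 lborel (\<lambda>x. f (x + z)) = n2 lborel f"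
proof -
  have [measurable]: "f \<in> borel_measurable borel" using assms by (simp add: l2_def)
  show "l2 lborel (\<lambda>x. f (x + z))"
    using assms lborel_integral_shift(2)[of "\<lambda>x. (f x)\<^sup>2" z] by (simp add: l2_def)
  show "n2 lborel (\<lambda>x. f (x + z)) = n2 lborel f"
    using lborel_integral_shift(1)[of "\<lambda>x. (f x)\<^sup>2" z] by (simp add: n2_def)
qed

text \<open>Reduction to L1: after truncation at level \<open>m\<close> the increments are at most
  \<open>2 * m\<close>, so their square is bounded by \<open>2 * m\<close> times their absolute
  value. Truncation costs little in L2 by dominated convergence.\<close>

lemma L2_shift_cont_seq:
  fixes f :: "real^3 \<Rightarrow> real"
  assumes f: "integrable lborel f" "l2 lborel f" and z: "z \<longlonglongrightarrow> 0"
  shows "(\<lambda>n. n2 lborel (\<lambda>x. f (x + z n) - f x)) \<longlonglongrightarrow> 0"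
proof (rule LIMSEQ_I)
  fix e :: real assume e: "e > 0"
  have m[measurable]: "f \<in> borel_measurable borel" using f by (simp add: l2_def)
  define g where "g m x = (if \<bar>f x\<bar> \<le> real m then f x else 0)" for m x
  have gm[measurable]: "g m \<in> borel_measurable borel" for m unfolding g_def[abs_def] by measurable
  have g2: "l2 lborel (g m)" for m
    by (rule l2_bound[OF f(2)]) (auto simp: g_def)
  have gi: "integrable lborel (g m)" for m
    by (rule Bochner_Integration.integrable_bound[OF f(1)]) (auto simp: g_def)
  have "(\<lambda>m. \<integral>x. (g m x - f x)\<^sup>2 \<partial>lborel) \<longlonglongrightarrow> (\<integral>x. (0::real) \<partial>(lborel :: (real^3) measure))"
  proof (rule integral_dominated_convergence)
    show "integrable lborel (\<lambda>x. (f x)\<^sup>2)" using f by (simp add: l2_def)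
    show "AE x in lborel. (\<lambda>m. (g m x - f x)\<^sup>2) \<longlonglongrightarrow> 0"
    proof (intro AE_I2 tendsto_eventually)
      fix x
      obtain M where "\<bar>f x\<bar> \<le> real M" using real_arch_simple by blast
      then have "(g m x - f x)\<^sup>2 = 0" if "m \<ge> M" for m using that by (auto simp: g_def)
      then show "eventually (\<lambda>m. (g m x - f x)\<^sup>2 = 0) sequentially" by (auto simp: eventually_sequentially)
    qed
    show "AE x in lborel. norm ((g m x - f x)\<^sup>2) \<le> (f x)\<^sup>2" for m
      by (auto simp: g_def)
  qed auto
  then have "(\<lambda>m. sqrt (\<integral>x. (g m x - f x)\<^sup>2 \<partial>lborel)) \<longlonglongrightarrow> sqrt 0"
    by (intro tendsto_real_sqrt) simp
  then have "(\<lambda>m. n2 lborel (\<lambda>x. g m x - f x)) \<longlonglongrightarrow> 0" by (simp add: n2_def)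
  moreover have "e/4 > 0" using e by simp
  ultimately have "\<exists>M. \<forall>m\<ge>M. norm (n2 lborel (\<lambda>x. g m x - f x) - 0) < e/4" by (rule LIMSEQ_D)
  then obtain m where gf: "n2 lborel (\<lambda>x. g m x - f x) < e/4" by (auto simp: n2_nonneg)
  have "(\<lambda>n. 2 * real m * (\<integral>x. \<bar>g m (x + z n) - g m x\<bar> \<partial>lborel)) \<longlonglongrightarrow> 2 * real m * 0"
    using L1_shift_cont_integrable[OF gi[of m]] z by (intro tendsto_intros) (auto simp: L1_shift_cont_def)
  moreover have "(e/4)\<^sup>2 > 0" using e by simp
  ultimately have "\<exists>N. \<forall>n\<ge>N. norm (2 * real m * (\<integral>x. \<bar>g m (x + z n) - g m x\<bar> \<partial>lborel) - 2 * real m * 0) < (e/4)\<^sup>2"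
    by (rule LIMSEQ_D)
  then obtain N where N: "\<And>n. n \<ge> N \<Longrightarrow> 2 * real m * (\<integral>x. \<bar>g m (x + z n) - g m x\<bar> \<partial>lborel) < (e/4)\<^sup>2" by auto
  show "\<exists>N. \<forall>n\<ge>N. norm (n2 lborel (\<lambda>x. f (x + z n) - f x) - 0) < e"
  proof (intro exI allI impI)
    fix n assume n: "n \<ge> N"
    have gz: "integrable lborel (\<lambda>x. g m (x + z n))" using lborel_integral_shift(2)[of "g m" "z n"] gi by simp
    have "(n2 lborel (\<lambda>x. g m (x + z n) - g m x))\<^sup>2 = (\<integral>x. (g m (x + z n) - g m x)\<^sup>2 \<partial>lborel)"
      by (simp add: n2_def)
    also have "\<dots> \<le> (\<integral>x. 2 * real m * \<bar>g m (x + z n) - g m x\<bar> \<partial>lborel)"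
    proof (rule integral_mono_AE')
      show "integrable lborel (\<lambda>x. 2 * real m * \<bar>g m (x + z n) - g m x\<bar>)"
        using gz gi by (intro integrable_mult_right integrable_abs Bochner_Integration.integrable_diff) auto
      have "(g m (x + z n) - g m x)\<^sup>2 \<le> 2 * real m * \<bar>g m (x + z n) - g m x\<bar>" for x
      proof -
        have "\<bar>g m (x + z n)\<bar> \<le> real m" "\<bar>g m x\<bar> \<le> real m" by (auto simp: g_def)
        then have "\<bar>g m (x + z n) - g m x\<bar> \<le> 2 * real m" by linarith
        then have "\<bar>g m (x + z n) - g m x\<bar> * \<bar>g m (x + z n) - g m x\<bar> \<le> 2 * real m * \<bar>g m (x + z n) - g m x\<bar>"
          by (intro mult_right_mono) auto
        then show ?thesis by (simp add: power2_eq_square)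
      qed
      then show "AE x in lborel. (g m (x + z n) - g m x)\<^sup>2 \<le> 2 * real m * \<bar>g m (x + z n) - g m x\<bar>" by simp
    qed simp
    also have "\<dots> < (e/4)\<^sup>2" using N[OF n] by simp
    finally have gg: "n2 lborel (\<lambda>x. g m (x + z n) - g m x) < e/4"
      using e by (intro power2_less_imp_less[of _ "e/4"]) auto
    have "n2 lborel (\<lambda>x. f (x + z n) - f x) \<le> n2 lborel (\<lambda>x. f (x + z n) - g m (x + z n)) + n2 lborel (\<lambda>x. g m (x + z n) - f x)"
      using l2_shift(1)[OF f(2)] l2_shift(1)[OF g2] f(2) by (intro n2_triangle_diff) auto
    also have "n2 lborel (\<lambda>x. f (x + z n) - g m (x + z n)) = n2 lborel (\<lambda>x. g m x - f x)"
      using l2_shift(2)[OF l2_diff[OF f(2) g2[of m]], of "z n"] n2_diff_commute[of lborel f "g m"] by simp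
    also have "n2 lborel (\<lambda>x. g m (x + z n) - f x) \<le> n2 lborel (\<lambda>x. g m (x + z n) - g m x) + n2 lborel (\<lambda>x. g m x - f x)"
      using l2_shift(1)[OF g2] f(2) g2 by (intro n2_triangle_diff) auto
    finally show "norm (n2 lborel (\<lambda>x. f (x + z n) - f x) - 0) < e"
      using gf gg e by (simp add: n2_nonneg)
  qed
qed

lemma L2_shift_cont:
  fixes f :: "real^3 \<Rightarrow> real"
  assumes f: "integrable lborel f" "l2 lborel f" and e: "e > 0"
  obtains d where "d > 0" "\<And>z. norm z < d \<Longrightarrow> n2 lborel (\<lambda>x. f (x + z) - f x) < e"
proof (rule ccontr)
  assume "\<not> thesis"
  then have "\<forall>n. \<exists>z. norm z < 1 / real (Suc n) \<and> \<not> n2 lborel (\<lambda>x. f (x + z) - f x) < e"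
    using that by (metis zero_less_divide_1_iff of_nat_0_less_iff zero_less_Suc)
  then obtain z where z: "\<And>n. norm (z n) < 1 / real (Suc n)" "\<And>n. \<not> n2 lborel (\<lambda>x. f (x + z n) - f x) < e"
    by metis
  have "z \<longlonglongrightarrow> 0"
  proof (rule Lim_null_comparison)
    show "\<forall>\<^sub>F n in sequentially. norm (z n) \<le> 1 / real (Suc n)" using z(1) less_imp_le by (intro always_eventually allI) blast
    show "(\<lambda>n. 1 / real (Suc n)) \<longlonglongrightarrow> 0" using LIMSEQ_inverse_real_of_nat by (simp add: inverse_eq_divide)
  qed
  from LIMSEQ_D[OF L2_shift_cont_seq[OF f this] e] z(2) show False
    by (auto simp: n2_nonneg)
qed

lemma conv_reflect:
  fixes f :: "real^3 \<Rightarrow> real"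
  assumes [measurable]: "f \<in> borel_measurable borel" "\<rho> \<in> borel_measurable borel"
  shows "conv f \<rho> x = (\<integral>z. f (x - z) * \<rho> z \<partial>lborel)"
  using lborel_integral_reflect(1)[of "\<lambda>y. f y * \<rho> (x - y)" x] by (simp add: conv_def)

text \<open>Jensen's inequality for the probability density \<open>moll e\<close>, followed by Tonelli.\<close>
lemma moll_error:
  fixes f :: "real^3 \<Rightarrow> real"
  assumes f: "integrable lborel f" "l2 lborel f" and e: "e > 0"
    and \<delta>: "\<And>z. norm z < e \<Longrightarrow> n2 lborel (\<lambda>x. f (x + z) - f x) \<le> \<delta>"
  shows "l2 lborel (\<lambda>x. conv f (moll e) x - f x)" "n2 lborel (\<lambda>x. conv f (moll e) x - f x) \<le> \<delta>"
proof -
  let ?\<rho> = "moll e"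
  have m[measurable]: "f \<in> borel_measurable borel" using f by (simp add: l2_def)
  have mt: "test0 ?\<rho>" by (rule moll_test0[OF e])
  have \<rho>m[measurable]: "?\<rho> \<in> borel_measurable borel" by (rule test0_borel[OF mt])
  have cm[measurable]: "conv f ?\<rho> \<in> borel_measurable borel"
    using smooth_borel[OF conv_smooth[OF f(1) mt]] .
  have \<rho>0: "?\<rho> z \<ge> 0" for z by (rule moll_nonneg[OF e])
  have \<rho>i: "integrable lborel ?\<rho>" by (rule test0_integrable[OF mt])
  have \<rho>1: "(\<integral>\<^sup>+z. ennreal (?\<rho> z) \<partial>lborel) = 1"
    using nn_integral_eq_integral[OF \<rho>i] moll_integral[OF e] \<rho>0 by simp
  have \<delta>0: "\<delta> \<ge> 0" using order.trans[OF n2_nonneg \<delta>[of 0]] e by simp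
  have pt: "ennreal ((conv f ?\<rho> x - f x)\<^sup>2) \<le> (\<integral>\<^sup>+z. ennreal ((f (x - z) - f x)\<^sup>2 * ?\<rho> z) \<partial>lborel)" for x
  proof -
    have i1: "integrable lborel (\<lambda>z. f (x - z) * ?\<rho> z)"
      using lborel_integral_reflect(2)[of "\<lambda>y. f y * ?\<rho> (x - y)" x] integrable_mult_test0[OF f(1) mt] by simp
    have i: "integrable lborel (\<lambda>z. (f (x - z) - f x) * ?\<rho> z)"
      using i1 \<rho>i by (simp add: left_diff_distrib)
    have "conv f ?\<rho> x - f x = (\<integral>z. (f (x - z) - f x) * ?\<rho> z \<partial>lborel)"
      using i1 \<rho>i moll_integral[OF e] by (simp add: conv_reflect left_diff_distrib)
    then have "ennreal \<bar>conv f ?\<rho> x - f x\<bar> \<le> (\<integral>\<^sup>+z. ennreal \<bar>(f (x - z) - f x) * ?\<rho> z\<bar> \<partial>lborel)"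
      using integral_norm_bound_ennreal[OF i] by simp
    \<comment> \<open>Splitting the weight into two square roots prepares Cauchy-Schwarz; the second
      factor then integrates to the unit mass of the mollifier.\<close>
    also have "\<dots> = (\<integral>\<^sup>+z. ennreal (\<bar>f (x - z) - f x\<bar> * sqrt (?\<rho> z)) * ennreal (sqrt (?\<rho> z)) \<partial>lborel)"
      using \<rho>0 by (intro nn_integral_cong) (simp add: ennreal_mult[symmetric] abs_mult mult.assoc)
    finally have "(ennreal \<bar>conv f ?\<rho> x - f x\<bar>)\<^sup>2
      \<le> (\<integral>\<^sup>+z. ennreal (\<bar>f (x - z) - f x\<bar> * sqrt (?\<rho> z)) * ennreal (sqrt (?\<rho> z)) \<partial>lborel)\<^sup>2"
      by (rule power_mono) simp
    also have "\<dots> \<le> (\<integral>\<^sup>+z. (ennreal (\<bar>f (x - z) - f x\<bar> * sqrt (?\<rho> z)))\<^sup>2 \<partial>lborel) * (\<integral>\<^sup>+z. (ennreal (sqrt (?\<rho> z)))\<^sup>2 \<partial>lborel)"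
      by (rule Cauchy_Schwarz_nn_integral) measurable
    also have "(\<integral>\<^sup>+z. (ennreal (sqrt (?\<rho> z)))\<^sup>2 \<partial>lborel) = 1"
      using \<rho>0 by (simp add: ennreal_power \<rho>1)
    also have "(\<integral>\<^sup>+z. (ennreal (\<bar>f (x - z) - f x\<bar> * sqrt (?\<rho> z)))\<^sup>2 \<partial>lborel) = (\<integral>\<^sup>+z. ennreal ((f (x - z) - f x)\<^sup>2 * ?\<rho> z) \<partial>lborel)"
      using \<rho>0 by (simp add: ennreal_power power_mult_distrib)
    finally show ?thesis by (simp add: ennreal_power)
  qed
  have "(\<integral>\<^sup>+x. ennreal ((conv f ?\<rho> x - f x)\<^sup>2) \<partial>lborel)
      \<le> (\<integral>\<^sup>+x. (\<integral>\<^sup>+z. ennreal ((f (x - z) - f x)\<^sup>2 * ?\<rho> z) \<partial>lborel) \<partial>lborel)"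
    by (intro nn_integral_mono pt)
  also have "\<dots> = (\<integral>\<^sup>+z. (\<integral>\<^sup>+x. ennreal ((f (x - z) - f x)\<^sup>2 * ?\<rho> z) \<partial>lborel) \<partial>lborel)"
    by (rule lborel_pair.Fubini') measurable
  also have "\<dots> \<le> (\<integral>\<^sup>+z. ennreal (\<delta>\<^sup>2) * ennreal (?\<rho> z) \<partial>lborel)"
  proof (rule nn_integral_mono)
    fix z :: "real^3"
    show "(\<integral>\<^sup>+x. ennreal ((f (x - z) - f x)\<^sup>2 * ?\<rho> z) \<partial>lborel) \<le> ennreal (\<delta>\<^sup>2) * ennreal (?\<rho> z)"
    proof (cases "norm z < e")
      case True
      have l: "l2 lborel (\<lambda>x. f (x - z) - f x)"
        using l2_shift(1)[OF f(2), of "- z"] f(2) by (auto intro: l2_diff)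
      have "(n2 lborel (\<lambda>x. f (x - z) - f x))\<^sup>2 \<le> \<delta>\<^sup>2"
        using \<delta>[of "- z"] True by (intro power_mono n2_nonneg) auto
      then have "(\<integral>x. (f (x - z) - f x)\<^sup>2 \<partial>lborel) \<le> \<delta>\<^sup>2" by (simp add: n2_def)
      then have "(\<integral>\<^sup>+x. ennreal ((f (x - z) - f x)\<^sup>2) \<partial>lborel) \<le> ennreal (\<delta>\<^sup>2)"
        using l by (subst nn_integral_eq_integral) (auto simp: l2_def ennreal_leI)
      then have "(\<integral>\<^sup>+x. ennreal ((f (x - z) - f x)\<^sup>2) \<partial>lborel) * ennreal (?\<rho> z) \<le> ennreal (\<delta>\<^sup>2) * ennreal (?\<rho> z)"
        by (rule mult_right_mono) simp
      then show ?thesis using \<rho>0 by (subst (asm) nn_integral_multc[symmetric]) (auto simp: ennreal_mult)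
    next
      case False
      then show ?thesis using moll_zero[OF e, of z] by simp
    qed
  qed
  also have "\<dots> = ennreal (\<delta>\<^sup>2)" using \<rho>1 by (subst nn_integral_cmult) auto
  finally have *: "(\<integral>\<^sup>+x. ennreal ((conv f ?\<rho> x - f x)\<^sup>2) \<partial>lborel) \<le> ennreal (\<delta>\<^sup>2)" .
  then show l: "l2 lborel (\<lambda>x. conv f ?\<rho> x - f x)"
    unfolding l2_def using le_less_trans[OF *] by (auto intro!: integrableI_bounded)
  have "ennreal ((n2 lborel (\<lambda>x. conv f ?\<rho> x - f x))\<^sup>2) \<le> ennreal (\<delta>\<^sup>2)"
    using * l by (subst (asm) nn_integral_eq_integral) (auto simp: l2_def n2_def)
  then have "(n2 lborel (\<lambda>x. conv f ?\<rho> x - f x))\<^sup>2 \<le> \<delta>\<^sup>2" by (simp add: ennreal_le_iff)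
  then show "n2 lborel (\<lambda>x. conv f ?\<rho> x - f x) \<le> \<delta>" using \<delta>0 power2_le_imp_le by blast
qed

subsection \<open>Functions on a domain and their extension by zero\<close>

lemma L2_l2: "L2 \<Omega> f \<longleftrightarrow> l2 (lebesgue_on \<Omega>) f"
  by (simp add: L2_def l2_def)

lemma lebesgue_on_borel:
  assumes "open \<Omega>" "f \<in> borel_measurable borel"
  shows "f \<in> borel_measurable (lebesgue_on \<Omega>)"
  using assms by (intro measurable_restrict_space1 measurable_completion) auto

lemma integral_lebesgue_on:
  fixes f :: "real^3 \<Rightarrow> real"
  assumes \<Omega>: "open \<Omega>" and [measurable]: "f \<in> borel_measurable borel" and z: "\<And>x. x \<notin> \<Omega> \<Longrightarrow> f x = 0"
  shows "integral\<^sup>L (lebesgue_on \<Omega>) f = integral\<^sup>L lborel f"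
    and "integrable (lebesgue_on \<Omega>) f \<longleftrightarrow> integrable lborel f"
proof -
  have s: "\<Omega> \<inter> space lebesgue \<in> sets lebesgue" using \<Omega> by auto
  have eq: "(\<lambda>x. indicat_real \<Omega> x *\<^sub>R f x) = f"
  proof
    fix x show "indicat_real \<Omega> x *\<^sub>R f x = f x" by (cases "x \<in> \<Omega>") (auto simp: z)
  qed
  show "integral\<^sup>L (lebesgue_on \<Omega>) f = integral\<^sup>L lborel f"
    using integral_restrict_space[OF s, of f] by (simp add: eq[simplified] integral_completion)
  show "integrable (lebesgue_on \<Omega>) f \<longleftrightarrow> integrable lborel f"
    using integrable_restrict_space[OF s, of f] by (simp add: eq[simplified] integrable_completion)
qed

lemma l2_lebesgue_on:
  fixes f :: "real^3 \<Rightarrow> real"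
  assumes \<Omega>: "open \<Omega>" and m: "f \<in> borel_measurable borel" and z: "\<And>x. x \<notin> \<Omega> \<Longrightarrow> f x = 0"
  shows "l2 (lebesgue_on \<Omega>) f \<longleftrightarrow> l2 lborel f" "n2 (lebesgue_on \<Omega>) f = n2 lborel f"
proof -
  note * = integral_lebesgue_on[OF \<Omega>, of "\<lambda>x. (f x)\<^sup>2"]
  show "l2 (lebesgue_on \<Omega>) f \<longleftrightarrow> l2 lborel f"
    using * m z lebesgue_on_borel[OF \<Omega> m] by (simp add: l2_def)
  show "n2 (lebesgue_on \<Omega>) f = n2 lborel f"
    using * m z by (simp add: n2_def)
qed

lemma l2_restrict:
  fixes f :: "real^3 \<Rightarrow> real"
  assumes \<Omega>: "open \<Omega>" and f: "l2 lborel f"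
  shows "l2 (lebesgue_on \<Omega>) f" "n2 (lebesgue_on \<Omega>) f \<le> n2 lborel f"
proof -
  have m[measurable]: "f \<in> borel_measurable borel" using f by (simp add: l2_def)
  have [measurable]: "\<Omega> \<in> sets borel" using \<Omega> by auto
  let ?g = "\<lambda>x. indicator \<Omega> x * f x"
  have g: "l2 lborel ?g" by (rule l2_bound[OF f]) (auto simp: indicator_def)
  have gO: "l2 (lebesgue_on \<Omega>) ?g" "n2 (lebesgue_on \<Omega>) ?g = n2 lborel ?g"
    using l2_lebesgue_on[OF \<Omega>, of ?g] g by auto
  have ae: "AE x in lebesgue_on \<Omega>. ?g x = f x" by (intro AE_I2) (auto simp: space_restrict_space)
  show "l2 (lebesgue_on \<Omega>) f" using l2_cong_AE[OF gO(1) lebesgue_on_borel[OF \<Omega> m] ae] .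
  have "n2 (lebesgue_on \<Omega>) f = n2 (lebesgue_on \<Omega>) ?g"
    using n2_cong_AE[OF l2_measurable[OF gO(1)] lebesgue_on_borel[OF \<Omega> m] ae] by simp
  also have "\<dots> \<le> n2 lborel f" unfolding gO(2) by (rule n2_mono[OF f]) (auto simp: indicator_def)
  finally show "n2 (lebesgue_on \<Omega>) f \<le> n2 lborel f" .
qed

text \<open>The given function is only Lebesgue measurable on the domain. The extension is chosen
  Borel measurable, at the price of equality almost everywhere, because convolution and Tonelli are
  carried out over \<open>lborel\<close>.\<close>

lemma zero_extension:
  fixes \<Omega> :: "(real^3) set"
  assumes \<Omega>: "open \<Omega>" and f: "l2 (lebesgue_on \<Omega>) f"
  obtains F where "l2 lborel F" "\<And>x. x \<notin> \<Omega> \<Longrightarrow> F x = 0" "AE x in lebesgue_on \<Omega>. f x = F x"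
proof -
  have [measurable]: "\<Omega> \<in> sets borel" using \<Omega> by auto
  have s: "\<Omega> \<in> sets lebesgue" using \<Omega> by auto
  have "(\<lambda>x. if x \<in> \<Omega> then f x else 0) \<in> borel_measurable lebesgue"
    using f s by (intro borel_measurable_if_I) (auto simp: l2_def)
  then obtain g where g: "g \<in> borel_measurable lborel" "AE x in lborel. (if x \<in> \<Omega> then f x else 0) = g x"
    using completion_ex_borel_measurable_real by blast
  define F where "F x = indicator \<Omega> x * g x" for x
  have Fm: "F \<in> borel_measurable borel" using g(1) unfolding F_def by simp
  have z: "\<And>x. x \<notin> \<Omega> \<Longrightarrow> F x = 0" by (simp add: F_def)
  have "AE x in lebesgue. (if x \<in> \<Omega> then f x else 0) = g x" using g(2) by (rule AE_completion)
  then have ae: "AE x in lebesgue_on \<Omega>. f x = F x"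
    using s by (subst AE_restrict_space_iff) (auto simp: F_def elim!: eventually_mono)
  have "l2 (lebesgue_on \<Omega>) F" by (rule l2_cong_AE[OF f lebesgue_on_borel[OF \<Omega> Fm] ae])
  then have "l2 lborel F" using l2_lebesgue_on[OF \<Omega> Fm z] by simp
  with z ae that show ?thesis by blast
qed

lemma l2_integrable:
  fixes f :: "real^3 \<Rightarrow> real"
  assumes f: "l2 lborel f" and b: "bounded \<Omega>" and z: "\<And>x. x \<notin> \<Omega> \<Longrightarrow> f x = 0"
  shows "integrable lborel f"
proof -
  obtain R where R: "\<Omega> \<subseteq> ball 0 R" using bounded_subset_ballD[OF b] by blast
  have "l2 lborel (indicator (ball 0 R :: (real^3) set) :: _ \<Rightarrow> real)"
    using emeasure_bounded_finite[OF bounded_ball[of 0 R]] by (intro l2_indicator) auto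
  from l2_mult[OF f this] have "integrable lborel (\<lambda>x. f x * indicator (ball 0 R) x)" .
  also have "(\<lambda>x. f x * indicator (ball 0 R) x) = f"
  proof
    fix x
    have "x \<notin> ball 0 R \<Longrightarrow> f x = 0" using R z by blast
    then show "f x * indicator (ball 0 R) x = f x" by (cases "x \<in> ball 0 R") auto
  qed
  finally show ?thesis .
qed

lemma moll_tendsto:
  fixes f :: "real^3 \<Rightarrow> real"
  assumes f: "integrable lborel f" "l2 lborel f" and e: "e > 0"
  obtains d where "d > 0" "\<And>r. 0 < r \<Longrightarrow> r < d \<Longrightarrow>
    l2 lborel (\<lambda>x. conv f (moll r) x - f x) \<and> n2 lborel (\<lambda>x. conv f (moll r) x - f x) \<le> e"
proof -
  obtain d where d: "d > 0" "\<And>z. norm z < d \<Longrightarrow> n2 lborel (\<lambda>x. f (x + z) - f x) < e"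
    using L2_shift_cont[OF f e] by blast
  show thesis
  proof (rule that[OF d(1)])
    fix r :: real assume r: "0 < r" "r < d"
    have "n2 lborel (\<lambda>x. f (x + z) - f x) \<le> e" if "norm z < r" for z
      using d(2)[of z] r that by simp
    from moll_error[OF f r(1) this]
    show "l2 lborel (\<lambda>x. conv f (moll r) x - f x) \<and> n2 lborel (\<lambda>x. conv f (moll r) x - f x) \<le> e" by blast
  qed
qed

lemma test_l2: "open \<Omega> \<Longrightarrow> test0 \<phi> \<Longrightarrow> l2 (lebesgue_on \<Omega>) \<phi>"
  by (intro l2_restrict test0_l2)

lemma test_integral:
  assumes \<Omega>: "open \<Omega>" and t: "test \<Omega> \<phi>" and f: "f \<in> borel_measurable borel"
  shows "(\<integral>x. f x * \<phi> x \<partial>lebesgue_on \<Omega>) = (\<integral>x. f x * \<phi> x \<partial>lborel)"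
proof (rule integral_lebesgue_on(1)[OF \<Omega>])
  show "(\<lambda>x. f x * \<phi> x) \<in> borel_measurable borel"
    using f t test0_borel by (auto simp: test_iff)
  show "x \<notin> \<Omega> \<Longrightarrow> f x * \<phi> x = 0" for x
    using t csupp_nonzero[of x \<phi>] by (auto simp: test_iff)
qed

lemma test_zero_off: "test \<Omega> \<phi> \<Longrightarrow> x \<notin> \<Omega> \<Longrightarrow> \<phi> x = 0"
  using csupp_nonzero[of x \<phi>] by (auto simp: test_iff)

text \<open>The fundamental lemma of the calculus of variations. At a point of the domain the
  mollification of the extension \<open>G\<close> vanishes once the radius is smaller than the
  distance to the boundary, since the reflected mollifier is then a test function. So the
  mollification error tends pointwise to \<open>- G\<close>, while its norm is below any prescribed
  \<open>B\<close>; Fatou's lemma gives the same bound for \<open>G\<close>.\<close>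

lemma weak_zero:
  assumes \<Omega>: "open \<Omega>" "bounded \<Omega>" and g: "l2 (lebesgue_on \<Omega>) g"
    and orth: "\<And>\<phi>. test \<Omega> \<phi> \<Longrightarrow> (\<integral>x. g x * \<phi> x \<partial>lebesgue_on \<Omega>) = 0"
  shows "AE x in lebesgue_on \<Omega>. g x = 0"
proof -
  obtain G where G: "l2 lborel G" "\<And>x. x \<notin> \<Omega> \<Longrightarrow> G x = 0" "AE x in lebesgue_on \<Omega>. g x = G x"
    using zero_extension[OF \<Omega>(1) g] by blast
  have Gm[measurable]: "G \<in> borel_measurable borel" using G by (simp add: l2_def)
  have [measurable]: "\<Omega> \<in> sets borel" using \<Omega> by auto
  have Gi: "integrable lborel G" by (rule l2_integrable[OF G(1) \<Omega>(2) G(2)])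
  have orth': "(\<integral>x. G x * \<phi> x \<partial>lborel) = 0" if t: "test \<Omega> \<phi>" for \<phi>
  proof -
    have [measurable]: "\<phi> \<in> borel_measurable (lebesgue_on \<Omega>)"
      using test_l2[OF \<Omega>(1)] t by (auto simp: test_iff l2_def)
    have "(\<integral>x. G x * \<phi> x \<partial>lborel) = (\<integral>x. G x * \<phi> x \<partial>lebesgue_on \<Omega>)"
      by (rule test_integral[OF \<Omega>(1) t Gm, symmetric])
    also have "\<dots> = (\<integral>x. g x * \<phi> x \<partial>lebesgue_on \<Omega>)"
      using G(3) g lebesgue_on_borel[OF \<Omega>(1) Gm]
      by (intro integral_cong_AE) (auto simp: l2_def elim!: eventually_mono)
    finally show ?thesis using orth[OF t] by simp
  qed
  have G0: "n2 lborel G \<le> B" if B: "B > 0" for B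
  proof -
    obtain d where d: "d > 0" "\<And>r. 0 < r \<Longrightarrow> r < d \<Longrightarrow>
      l2 lborel (\<lambda>x. conv G (moll r) x - G x) \<and> n2 lborel (\<lambda>x. conv G (moll r) x - G x) \<le> B"
      using moll_tendsto[OF Gi G(1) B] by blast
    \<comment> \<open>The offset 2 keeps every radius strictly below \<open>d\<close>, including the
      one for \<open>n = 0\<close>.\<close>
    define r where "r n = d / real (n + 2)" for n
    have r: "0 < r n" "r n < d" for n using d(1) by (auto simp: r_def field_simps intro: add_pos_nonneg)
    have r0: "r \<longlonglongrightarrow> 0" unfolding r_def by real_asymp
    define F where "F n x = indicator \<Omega> x * (conv G (moll (r n)) x - G x)" for n x
    have F: "l2 lborel (F n)" "n2 lborel (F n) \<le> B" for n
    proof -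
      have *: "l2 lborel (\<lambda>x. conv G (moll (r n)) x - G x)" "n2 lborel (\<lambda>x. conv G (moll (r n)) x - G x) \<le> B"
        using d(2)[OF r] by auto
      have m: "(\<lambda>x. conv G (moll (r n)) x - G x) \<in> borel_measurable lborel" using * by (simp add: l2_def)
      show "l2 lborel (F n)" unfolding F_def
        by (rule l2_bound[OF *(1)]) (use m in \<open>auto simp: indicator_def\<close>)
      have "n2 lborel (F n) \<le> n2 lborel (\<lambda>x. conv G (moll (r n)) x - G x)"
        unfolding F_def by (rule n2_mono[OF *(1)]) (auto simp: indicator_def)
      with * show "n2 lborel (F n) \<le> B" by simp
    qed
    have lim: "(\<lambda>n. F n x) \<longlonglongrightarrow> - G x" for x
    proof (cases "x \<in> \<Omega>")
      case True
      then obtain s where s: "s > 0" "cball x s \<subseteq> \<Omega>" using \<Omega>(1) open_contains_cball by blast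
      have "eventually (\<lambda>n. r n < s) sequentially" using r0 s(1) by (simp add: order_tendsto_iff)
      then have "eventually (\<lambda>n. F n x = - G x) sequentially"
      proof eventually_elim
        case (elim n)
        let ?\<psi> = "\<lambda>y. moll (r n) (x + (-1) *\<^sub>R y)"
        have z: "?\<psi> y = 0" if "y \<notin> cball x s" for y
          using that elim by (intro moll_zero r(1)) (simp add: dist_norm)
        have "test0 ?\<psi>" by (rule test0_affine[OF moll_test0[OF r(1)]]) simp
        moreover have "csupp ?\<psi> \<subseteq> cball x s" by (rule csupp_subset) (use z in auto)
        ultimately have "test \<Omega> ?\<psi>" using s(2) by (auto simp: test_iff)
        from orth'[OF this] have "conv G (moll (r n)) x = 0" by (simp add: conv_def)
        then show ?case using True by (simp add: F_def)
      qed
      then show ?thesis by (rule tendsto_eventually)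
    qed (simp add: F_def G(2))
    have "n2 lborel (\<lambda>x. - G x) \<le> B"
      by (rule l2_Fatou(2)[of lborel F, OF F(1)]) (use lim F(2) in auto)
    then show ?thesis by (simp add: n2_uminus)
  qed
  have "n2 lborel G \<le> 0" by (rule field_le_epsilon) (use G0 in auto)
  then have n0: "n2 lborel G = 0" using n2_nonneg[of lborel G] by simp
  have lG: "l2 (lebesgue_on \<Omega>) G" "n2 (lebesgue_on \<Omega>) G = 0"
    using l2_lebesgue_on[OF \<Omega>(1) Gm G(2)] G(1) n0 by auto
  show ?thesis using n2_zero_AE[OF lG] G(3) by eventually_elim simp
qed

subsection \<open>Weak derivatives\<close>

lemma wderiv_unique:
  assumes \<Omega>: "open \<Omega>" "bounded \<Omega>" and L: "L2 \<Omega> g" "L2 \<Omega> h" and w: "wderiv \<Omega> is f g" "wderiv \<Omega> is f h"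
  shows "AE x in lebesgue_on \<Omega>. g x = h x"
proof -
  have "AE x in lebesgue_on \<Omega>. g x - h x = 0"
  proof (rule weak_zero[OF \<Omega>])
    show "l2 (lebesgue_on \<Omega>) (\<lambda>x. g x - h x)" using L by (simp add: L2_l2 l2_diff)
    fix \<phi> assume t: "test \<Omega> \<phi>"
    then have l: "l2 (lebesgue_on \<Omega>) \<phi>" using test_l2[OF \<Omega>(1)] by (simp add: test_iff)
    have "(\<integral>x. g x * \<phi> x \<partial>lebesgue_on \<Omega>) = (\<integral>x. h x * \<phi> x \<partial>lebesgue_on \<Omega>)"
      using w t by (auto simp: wderiv_def)
    then show "(\<integral>x. (g x - h x) * \<phi> x \<partial>lebesgue_on \<Omega>) = 0"
      using ip_diff_left[of "lebesgue_on \<Omega>" g h \<phi>] L l by (simp add: ip_def L2_l2)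
  qed
  then show ?thesis by eventually_elim simp
qed

lemma wderiv_ip: "wderiv \<Omega> is f g \<longleftrightarrow> (\<forall>\<phi>. test \<Omega> \<phi> \<longrightarrow>
   ip (lebesgue_on \<Omega>) f (pd is \<phi>) = (-1) ^ length is * ip (lebesgue_on \<Omega>) g \<phi>)"
  by (simp add: wderiv_def ip_def)

lemma wderiv_Nil: "wderiv \<Omega> [] f f"
  by (simp add: wderiv_def)

lemma test_pd_l2: "open \<Omega> \<Longrightarrow> test \<Omega> \<phi> \<Longrightarrow> l2 (lebesgue_on \<Omega>) (pd is \<phi>)"
  by (intro test_l2 test0_pd) (auto simp: test_iff)

lemma wderiv_diff:
  assumes "open \<Omega>" "L2 \<Omega> f" "L2 \<Omega> f'" "L2 \<Omega> g" "L2 \<Omega> g'" "wderiv \<Omega> is f g" "wderiv \<Omega> is f' g'"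
  shows "wderiv \<Omega> is (\<lambda>x. f x - f' x) (\<lambda>x. g x - g' x)"
  unfolding wderiv_ip
proof (intro allI impI)
  fix \<phi> assume t: "test \<Omega> \<phi>"
  show "ip (lebesgue_on \<Omega>) (\<lambda>x. f x - f' x) (pd is \<phi>) = (-1) ^ length is * ip (lebesgue_on \<Omega>) (\<lambda>x. g x - g' x) \<phi>"
    using assms test_pd_l2[OF assms(1) t, of "is"] test_pd_l2[OF assms(1) t, of "[]"] t
    by (simp add: ip_diff_left L2_l2 wderiv_ip right_diff_distrib)
qed

lemma wderiv_add:
  assumes "open \<Omega>" "L2 \<Omega> f" "L2 \<Omega> f'" "L2 \<Omega> g" "L2 \<Omega> g'" "wderiv \<Omega> is f g" "wderiv \<Omega> is f' g'"
  shows "wderiv \<Omega> is (\<lambda>x. f x + f' x) (\<lambda>x. g x + g' x)"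
  unfolding wderiv_ip
proof (intro allI impI)
  fix \<phi> assume t: "test \<Omega> \<phi>"
  show "ip (lebesgue_on \<Omega>) (\<lambda>x. f x + f' x) (pd is \<phi>) = (-1) ^ length is * ip (lebesgue_on \<Omega>) (\<lambda>x. g x + g' x) \<phi>"
    using assms test_pd_l2[OF assms(1) t, of "is"] test_pd_l2[OF assms(1) t, of "[]"] t
    by (simp add: ip_add_left L2_l2 wderiv_ip distrib_left)
qed

lemma wderiv_cmult:
  assumes "wderiv \<Omega> is f g"
  shows "wderiv \<Omega> is (\<lambda>x. c * f x) (\<lambda>x. c * g x)"
  using assms by (simp add: ip_cmult_left wderiv_ip)

lemma wderiv_cong_AE:
  assumes "open \<Omega>" "L2 \<Omega> f" "L2 \<Omega> f'" "AE x in lebesgue_on \<Omega>. f x = f' x" "wderiv \<Omega> is f g"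
  shows "wderiv \<Omega> is f' g"
  unfolding wderiv_ip
proof (intro allI impI)
  fix \<phi> assume t: "test \<Omega> \<phi>"
  have "ip (lebesgue_on \<Omega>) f' (pd is \<phi>) = ip (lebesgue_on \<Omega>) f (pd is \<phi>)"
    unfolding ip_def using assms test_pd_l2[OF assms(1) t, of "is"]
    by (intro integral_cong_AE) (auto simp: L2_l2 l2_def elim!: eventually_mono)
  then show "ip (lebesgue_on \<Omega>) f' (pd is \<phi>) = (-1) ^ length is * ip (lebesgue_on \<Omega>) g \<phi>"
    using assms(5) t by (simp add: wderiv_ip)
qed

lemma wderiv_append:
  assumes "wderiv \<Omega> is f g" "wderiv \<Omega> js g h"
  shows "wderiv \<Omega> (is @ js) f h"
  unfolding wderiv_ip
proof (intro allI impI)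
  fix \<phi> assume t: "test \<Omega> \<phi>"
  show "ip (lebesgue_on \<Omega>) f (pd (is @ js) \<phi>) = (-1) ^ length (is @ js) * ip (lebesgue_on \<Omega>) h \<phi>"
    using assms t test_pd[OF t, of js] by (simp add: wderiv_ip pd_append power_add)
qed

text \<open>A converse to \<open>wderiv_append\<close>: it allows a family of derivatives of
  \<open>f\<close>, indexed by lists, to be reread as the derivatives of one of its members by
  shifting the index.\<close>

lemma wderiv_drop:
  assumes "wderiv \<Omega> is f g" "wderiv \<Omega> (is @ js) f h"
  shows "wderiv \<Omega> js g h"
  unfolding wderiv_ip
proof (intro allI impI)
  fix \<phi> assume t: "test \<Omega> \<phi>"
  have "(-1) ^ length is * ip (lebesgue_on \<Omega>) g (pd js \<phi>) = (-1) ^ length (is @ js) * ip (lebesgue_on \<Omega>) h \<phi>"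
    using assms t test_pd[OF t, of js] by (metis wderiv_ip pd_append)
  then have "(-1) ^ length is * ip (lebesgue_on \<Omega>) g (pd js \<phi>) = (-1) ^ length is * ((-1) ^ length js * ip (lebesgue_on \<Omega>) h \<phi>)"
    by (simp add: power_add mult.assoc)
  then show "ip (lebesgue_on \<Omega>) g (pd js \<phi>) = (-1) ^ length js * ip (lebesgue_on \<Omega>) h \<phi>"
    by (subst (asm) mult_left_cancel) auto
qed

lemma wderiv_test0:
  assumes \<Omega>: "open \<Omega>" and f: "test0 f"
  shows "wderiv \<Omega> is f (pd is f)"
  unfolding wderiv_ip
proof (intro allI impI)
  fix \<phi> assume t: "test \<Omega> \<phi>"
  show "ip (lebesgue_on \<Omega>) f (pd is \<phi>) = (-1) ^ length is * ip (lebesgue_on \<Omega>) (pd is f) \<phi>"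
    using f
  proof (induction "is" arbitrary: f)
    case (Cons i "is")
    have t': "test \<Omega> (pd is \<phi>)" using t by (rule test_pd)
    have m: "f \<in> borel_measurable borel" "partial i f \<in> borel_measurable borel"
      using test0_borel Cons.prems test0_partial by auto
    have "ip (lebesgue_on \<Omega>) f (pd (i # is) \<phi>) = (\<integral>x. f x * partial i (pd is \<phi>) x \<partial>lborel)"
      using test_integral[OF \<Omega> test_partial[OF t'] m(1)] by (simp add: ip_def)
    also have "\<dots> = - (\<integral>x. partial i f x * pd is \<phi> x \<partial>lborel)"
      using integral_by_parts[OF test0D(1)[OF Cons.prems], of "pd is \<phi>" i] t' by (simp add: test_iff)
    also have "\<dots> = - ip (lebesgue_on \<Omega>) (partial i f) (pd is \<phi>)"
      using test_integral[OF \<Omega> t' m(2)] by (simp add: ip_def)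
    finally show ?case
      using Cons.IH[OF test0_partial[OF Cons.prems, of i]] test0D(1)[OF Cons.prems] by (simp add: pd_partial)
  qed simp
qed

lemma wderiv_limit:
  assumes \<Omega>: "open \<Omega>" and F: "\<And>n. L2 \<Omega> (F n)" "L2 \<Omega> f" "(\<lambda>n. n2 (lebesgue_on \<Omega>) (\<lambda>x. F n x - f x)) \<longlonglongrightarrow> 0"
    and G: "\<And>n. L2 \<Omega> (G n)" "L2 \<Omega> g" "(\<lambda>n. n2 (lebesgue_on \<Omega>) (\<lambda>x. G n x - g x)) \<longlonglongrightarrow> 0"
    and w: "\<And>n. wderiv \<Omega> is (F n) (G n)"
  shows "wderiv \<Omega> is f g"
  unfolding wderiv_ip
proof (intro allI impI)
  fix \<phi> assume t: "test \<Omega> \<phi>"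
  let ?M = "lebesgue_on \<Omega>"
  have lF: "(\<lambda>n. ip ?M (F n) (pd is \<phi>)) \<longlonglongrightarrow> ip ?M f (pd is \<phi>)"
    using F test_pd_l2[OF \<Omega> t] by (intro ip_tendsto) (auto simp: L2_l2)
  have lG: "(\<lambda>n. (-1) ^ length is * ip ?M (G n) \<phi>) \<longlonglongrightarrow> (-1) ^ length is * ip ?M g \<phi>"
    using G test_pd_l2[OF \<Omega> t, of "[]"] by (intro tendsto_mult_left ip_tendsto) (auto simp: L2_l2)
  have "(\<lambda>n. ip ?M (F n) (pd is \<phi>)) = (\<lambda>n. (-1) ^ length is * ip ?M (G n) \<phi>)"
    using w t by (simp add: wderiv_ip)
  then show "ip ?M f (pd is \<phi>) = (-1) ^ length is * ip ?M g \<phi>"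
    using LIMSEQ_unique[OF lF] lG by simp
qed

section \<open>Sobolev norms and approximation by smooth functions\<close>

lemma D_props:
  assumes "Hk_mem \<Omega> k f" "length is \<le> k"
  shows "L2 \<Omega> (D \<Omega> is f)" "wderiv \<Omega> is f (D \<Omega> is f)"
proof -
  have "\<exists>g. L2 \<Omega> g \<and> wderiv \<Omega> is f g" using assms by (simp add: Hk_mem_def)
  then have "L2 \<Omega> (D \<Omega> is f) \<and> wderiv \<Omega> is f (D \<Omega> is f)" unfolding D_def by (rule someI_ex)
  then show "L2 \<Omega> (D \<Omega> is f)" "wderiv \<Omega> is f (D \<Omega> is f)" by auto
qed

text \<open>\<open>D\<close> is an arbitrary choice among representatives that agree almost
  everywhere, so its norm can be computed from any weak derivative at hand.\<close>

lemma n2_D: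
  assumes \<Omega>: "open \<Omega>" "bounded \<Omega>" and g: "L2 \<Omega> g" "wderiv \<Omega> is f g"
  shows "n2 (lebesgue_on \<Omega>) (D \<Omega> is f) = n2 (lebesgue_on \<Omega>) g"
proof -
  have "\<exists>g. L2 \<Omega> g \<and> wderiv \<Omega> is f g" using g by blast
  then have D: "L2 \<Omega> (D \<Omega> is f) \<and> wderiv \<Omega> is f (D \<Omega> is f)" unfolding D_def by (rule someI_ex)
  show ?thesis
    by (rule n2_cong_AE) (use D g wderiv_unique[OF \<Omega>] in \<open>auto simp: L2_l2 l2_def\<close>)
qed

lemma finite_lists_le: "finite {is :: 3 list. length is \<le> k}"
  using finite_lists_length_le[of "UNIV :: 3 set" k] by simp

lemma Hk_norm_n2: "Hk_norm \<Omega> k f = sqrt (\<Sum>is\<in>{is. length is \<le> k}. (n2 (lebesgue_on \<Omega>) (D \<Omega> is f))\<^sup>2)"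
  by (simp add: Hk_norm_def n2_def)

lemma n2_D_le_Hk_norm:
  assumes "length is \<le> k"
  shows "n2 (lebesgue_on \<Omega>) (D \<Omega> is f) \<le> Hk_norm \<Omega> k f"
  unfolding Hk_norm_n2
proof (rule real_le_rsqrt)
  show "(n2 (lebesgue_on \<Omega>) (D \<Omega> is f))\<^sup>2 \<le> (\<Sum>is\<in>{is. length is \<le> k}. (n2 (lebesgue_on \<Omega>) (D \<Omega> is f))\<^sup>2)"
    by (rule member_le_sum[where f = "\<lambda>is. (n2 (lebesgue_on \<Omega>) (D \<Omega> is f))\<^sup>2"]) (use assms finite_lists_le in auto)
qed

lemma Hk_norm_le_sum: "Hk_norm \<Omega> k f \<le> (\<Sum>is\<in>{is. length is \<le> k}. n2 (lebesgue_on \<Omega>) (D \<Omega> is f))"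
  unfolding Hk_norm_n2 using L2_set_le_sum[of "{is. length is \<le> k}" "\<lambda>is. n2 (lebesgue_on \<Omega>) (D \<Omega> is f)"]
  by (simp add: L2_set_def n2_nonneg)

lemma Hk_norm_nonneg: "Hk_norm \<Omega> k f \<ge> 0"
  by (auto simp: Hk_norm_n2 intro!: sum_nonneg)

lemma Csig_test0: "Csig \<Sigma> \<phi> \<Longrightarrow> test0 \<phi>"
  by (simp add: Csig_def test0_def)

lemma L2_test0: "open \<Omega> \<Longrightarrow> test0 \<phi> \<Longrightarrow> L2 \<Omega> \<phi>"
  by (simp add: L2_l2 test_l2)

text \<open>Replaces the choice operator \<open>D\<close>, which does not commute with sums or
  limits as an operation on functions. A family of explicitly given representatives does, and by
  \<open>weak_family_norm\<close> it controls the norm from both sides up to a constant.\<close>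

definition weak_family :: "(real^3) set \<Rightarrow> nat \<Rightarrow> (real^3 \<Rightarrow> real) \<Rightarrow> (3 list \<Rightarrow> real^3 \<Rightarrow> real) \<Rightarrow> bool" where
  "weak_family \<Omega> k f G \<longleftrightarrow> L2 \<Omega> f \<and> (\<forall>is. length is \<le> k \<longrightarrow> L2 \<Omega> (G is) \<and> wderiv \<Omega> is f (G is))"

lemma weak_family_Hk_mem: "weak_family \<Omega> k f G \<Longrightarrow> Hk_mem \<Omega> k f"
  by (auto simp: weak_family_def Hk_mem_def)

lemma Hk_mem_family: "Hk_mem \<Omega> k f \<Longrightarrow> weak_family \<Omega> k f (\<lambda>is. D \<Omega> is f)"
  using D_props by (auto simp: weak_family_def Hk_mem_def)

lemma weak_family_diff:
  assumes "open \<Omega>" "weak_family \<Omega> k f G" "weak_family \<Omega> k f' G'"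
  shows "weak_family \<Omega> k (\<lambda>x. f x - f' x) (\<lambda>is x. G is x - G' is x)"
  using assms by (auto simp: weak_family_def L2_l2 intro!: l2_diff wderiv_diff)

lemma weak_family_add:
  assumes "open \<Omega>" "weak_family \<Omega> k f G" "weak_family \<Omega> k f' G'"
  shows "weak_family \<Omega> k (\<lambda>x. f x + f' x) (\<lambda>is x. G is x + G' is x)"
  using assms by (auto simp: weak_family_def L2_l2 intro!: l2_add wderiv_add)

lemma weak_family_cmult:
  assumes "weak_family \<Omega> k f G"
  shows "weak_family \<Omega> k (\<lambda>x. c * f x) (\<lambda>is x. c * G is x)"
  using assms by (auto simp: weak_family_def L2_l2 intro!: l2_cmult wderiv_cmult)

lemma weak_family_test0: "open \<Omega> \<Longrightarrow> test0 \<phi> \<Longrightarrow> weak_family \<Omega> k \<phi> (\<lambda>is. pd is \<phi>)"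
  by (auto simp: weak_family_def L2_test0 test0_pd wderiv_test0)

lemma weak_family_norm:
  assumes "open \<Omega>" "bounded \<Omega>" "weak_family \<Omega> k f G"
  shows "length is \<le> k \<Longrightarrow> n2 (lebesgue_on \<Omega>) (G is) \<le> Hk_norm \<Omega> k f"
    and "Hk_norm \<Omega> k f \<le> (\<Sum>is\<in>{is. length is \<le> k}. n2 (lebesgue_on \<Omega>) (G is))"
proof -
  have *: "n2 (lebesgue_on \<Omega>) (D \<Omega> is f) = n2 (lebesgue_on \<Omega>) (G is)" if "length is \<le> k" for "is"
    using n2_D[OF assms(1,2)] assms(3) that by (auto simp: weak_family_def)
  show "length is \<le> k \<Longrightarrow> n2 (lebesgue_on \<Omega>) (G is) \<le> Hk_norm \<Omega> k f"
    using n2_D_le_Hk_norm[of "is" k \<Omega> f] * by simp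
  show "Hk_norm \<Omega> k f \<le> (\<Sum>is\<in>{is. length is \<le> k}. n2 (lebesgue_on \<Omega>) (G is))"
    using Hk_norm_le_sum[of \<Omega> k f] * by simp
qed

lemma Hk_approx:
  assumes \<Omega>: "open \<Omega>" "bounded \<Omega>" and f: "Hk \<Omega> k \<Sigma> f" "weak_family \<Omega> k f G"
  obtains \<phi> where "\<And>n. Csig \<Sigma> (\<phi> n)"
    "\<And>is. length is \<le> k \<Longrightarrow> (\<lambda>n. n2 (lebesgue_on \<Omega>) (\<lambda>x. pd is (\<phi> n) x - G is x)) \<longlonglongrightarrow> 0"
proof -
  obtain \<phi> where \<phi>: "\<And>n. Csig \<Sigma> (\<phi> n)" "(\<lambda>n. Hk_norm \<Omega> k (\<lambda>x. \<phi> n x - f x)) \<longlonglongrightarrow> 0"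
    using f(1) by (auto simp: Hk_def)
  show thesis
  proof (rule that[OF \<phi>(1)])
    fix "is" :: "3 list" assume l: "length is \<le> k"
    show "(\<lambda>n. n2 (lebesgue_on \<Omega>) (\<lambda>x. pd is (\<phi> n) x - G is x)) \<longlonglongrightarrow> 0"
    proof (rule Lim_null_comparison[OF _ \<phi>(2)])
      have "weak_family \<Omega> k (\<lambda>x. \<phi> n x - f x) (\<lambda>is x. pd is (\<phi> n) x - G is x)" for n
        using \<Omega> f(2) \<phi>(1) by (intro weak_family_diff weak_family_test0 Csig_test0)
      from weak_family_norm(1)[OF \<Omega> this l]
      show "\<forall>\<^sub>F n in sequentially. norm (n2 (lebesgue_on \<Omega>) (\<lambda>x. pd is (\<phi> n) x - G is x)) \<le> Hk_norm \<Omega> k (\<lambda>x. \<phi> n x - f x)"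
        by (simp add: n2_nonneg)
    qed
  qed
qed

text \<open>It suffices to find one approximant per tolerance that serves all multi-indices: there
  are finitely many of them, so the norm of the error is at most their number times the
  tolerance.\<close>

lemma HkI:
  assumes \<Omega>: "open \<Omega>" "bounded \<Omega>" and f: "weak_family \<Omega> k f G"
    and approx: "\<And>e. e > 0 \<Longrightarrow> \<exists>\<phi>. Csig \<Sigma> \<phi> \<and>
      (\<forall>is. length is \<le> k \<longrightarrow> n2 (lebesgue_on \<Omega>) (\<lambda>x. pd is \<phi> x - G is x) \<le> e)"
  shows "Hk \<Omega> k \<Sigma> f"
  unfolding Hk_def
proof
  show "Hk_mem \<Omega> k f" using f by (rule weak_family_Hk_mem)
  have "\<forall>n. \<exists>\<phi>. Csig \<Sigma> \<phi> \<and>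
      (\<forall>is. length is \<le> k \<longrightarrow> n2 (lebesgue_on \<Omega>) (\<lambda>x. pd is \<phi> x - G is x) \<le> 1 / real (Suc n))"
    using approx by simp
  then obtain \<phi> where \<phi>: "\<And>n. Csig \<Sigma> (\<phi> n)" "\<And>n is. length is \<le> k \<Longrightarrow>
      n2 (lebesgue_on \<Omega>) (\<lambda>x. pd is (\<phi> n) x - G is x) \<le> 1 / real (Suc n)" by metis
  show "\<exists>\<phi>. (\<forall>n. Csig \<Sigma> (\<phi> n)) \<and> (\<lambda>n. Hk_norm \<Omega> k (\<lambda>x. \<phi> n x - f x)) \<longlonglongrightarrow> 0"
  proof (intro exI conjI allI)
    show "Csig \<Sigma> (\<phi> n)" for n by (rule \<phi>)
    let ?N = "real (card {is::3 list. length is \<le> k})"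
    have "Hk_norm \<Omega> k (\<lambda>x. \<phi> n x - f x) \<le> ?N * (1 / real (Suc n))" for n
    proof -
      have "weak_family \<Omega> k (\<lambda>x. \<phi> n x - f x) (\<lambda>is x. pd is (\<phi> n) x - G is x)"
        using \<Omega> f \<phi>(1) by (intro weak_family_diff weak_family_test0 Csig_test0)
      from weak_family_norm(2)[OF \<Omega> this]
      have "Hk_norm \<Omega> k (\<lambda>x. \<phi> n x - f x) \<le> (\<Sum>is\<in>{is::3 list. length is \<le> k}. 1 / real (Suc n))"
        by (rule order.trans) (intro sum_mono \<phi>(2), simp)
      then show ?thesis by simp
    qed
    then have "\<forall>\<^sub>F n in sequentially. norm (Hk_norm \<Omega> k (\<lambda>x. \<phi> n x - f x)) \<le> ?N * (1 / real (Suc n))"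
      by (simp add: Hk_norm_nonneg)
    moreover have "(\<lambda>n. ?N * (1 / real (Suc n))) \<longlonglongrightarrow> 0"
      using tendsto_mult_left[OF LIMSEQ_inverse_real_of_nat, of ?N] by (simp add: inverse_eq_divide)
    ultimately show "(\<lambda>n. Hk_norm \<Omega> k (\<lambda>x. \<phi> n x - f x)) \<longlonglongrightarrow> 0" by (rule Lim_null_comparison)
  qed
qed

lemma csupp_pd_Csig: "Csig \<Sigma> \<phi> \<Longrightarrow> Csig \<Sigma> (pd is \<phi>)"
  using csupp_pd[of "is" \<phi>] test0_pd[of \<phi> "is"] by (force simp: Csig_def test0_def)

lemma Hk_HkI_eps:
  assumes \<Omega>: "open \<Omega>" "bounded \<Omega>" and f: "Hk \<Omega> k \<Sigma> f" "weak_family \<Omega> k f G" and e: "e > 0"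
  obtains \<phi> where "Csig \<Sigma> \<phi>" "\<And>is. length is \<le> k \<Longrightarrow> n2 (lebesgue_on \<Omega>) (\<lambda>x. pd is \<phi> x - G is x) \<le> e"
proof -
  obtain \<phi> where \<phi>: "\<And>n. Csig \<Sigma> (\<phi> n)"
    "\<And>is. length is \<le> k \<Longrightarrow> (\<lambda>n. n2 (lebesgue_on \<Omega>) (\<lambda>x. pd is (\<phi> n) x - G is x)) \<longlonglongrightarrow> 0"
    using Hk_approx[OF \<Omega> f] by blast
  have "\<forall>\<^sub>F n in sequentially. \<forall>is\<in>{is. length is \<le> k}. n2 (lebesgue_on \<Omega>) (\<lambda>x. pd is (\<phi> n) x - G is x) < e"
    using \<phi>(2) e by (subst eventually_ball_finite_distrib[OF finite_lists_le]) (auto simp: order_tendsto_iff)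
  then obtain n where "\<forall>is\<in>{is. length is \<le> k}. n2 (lebesgue_on \<Omega>) (\<lambda>x. pd is (\<phi> n) x - G is x) < e"
    using eventually_happens[of _ sequentially] by (auto simp: trivial_limit_sequentially)
  with \<phi>(1) that[of "\<phi> n"] show thesis by force
qed

text \<open>Differentiating an approximant does not enlarge its support, so the boundary condition
  passes to derivatives; \<open>pd_commute\<close> brings the indices into the order in which the
  family is indexed.\<close>

lemma Hk_deriv:
  assumes \<Omega>: "open \<Omega>" "bounded \<Omega>" and f: "Hk \<Omega> k \<Sigma> f"
    and g: "L2 \<Omega> g" "wderiv \<Omega> js f g" and l: "length js + m \<le> k"
  shows "Hk \<Omega> m \<Sigma> g"
proof -
  define G where "G is = D \<Omega> is f" for "is"
  have G: "weak_family \<Omega> k f G" using f Hk_mem_family unfolding G_def by (auto simp: Hk_def)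
  have w: "weak_family \<Omega> m g (\<lambda>is. G (js @ is))"
    using G g l wderiv_drop[OF g(2)] by (auto simp: weak_family_def)
  show ?thesis
  proof (rule HkI[OF \<Omega> w])
    fix e :: real assume "e > 0"
    then obtain \<phi> where \<phi>: "Csig \<Sigma> \<phi>" "\<And>is. length is \<le> k \<Longrightarrow> n2 (lebesgue_on \<Omega>) (\<lambda>x. pd is \<phi> x - G is x) \<le> e"
      using Hk_HkI_eps[OF \<Omega> f G] by blast
    have "pd is (pd js \<phi>) = pd (js @ is) \<phi>" for "is"
      using pd_commute[OF test0D(1)[OF Csig_test0[OF \<phi>(1)]]] by (simp add: pd_append)
    then show "\<exists>\<phi>. Csig \<Sigma> \<phi> \<and> (\<forall>is. length is \<le> m \<longrightarrow> n2 (lebesgue_on \<Omega>) (\<lambda>x. pd is \<phi> x - G (js @ is) x) \<le> e)"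
      using \<phi> l csupp_pd_Csig[OF \<phi>(1), of js] by (intro exI[of _ "pd js \<phi>"]) auto
  qed
qed

subsection \<open>Geometry of Lipschitz domains\<close>

text \<open>The constant in \<open>lipschitz2\<close> carries no sign, hence \<open>max L 0\<close>;
  the Euclidean length is replaced by the sum of the coordinate increments to keep later estimates
  linear.\<close>

lemma lipschitz2_nonneg:
  assumes "lipschitz2 h"
  obtains L where "L \<ge> 0" "\<And>a b c d. \<bar>h a b - h c d\<bar> \<le> L * (\<bar>a - c\<bar> + \<bar>b - d\<bar>)"
proof -
  obtain L where L: "\<And>a b c d. \<bar>h a b - h c d\<bar> \<le> L * sqrt ((a - c)\<^sup>2 + (b - d)\<^sup>2)"
    using assms by (auto simp: lipschitz2_def)
  show thesis
  proof (rule that[of "max L 0"])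
    fix a b c d
    have "\<bar>h a b - h c d\<bar> \<le> max L 0 * sqrt ((a - c)\<^sup>2 + (b - d)\<^sup>2)"
      by (rule order.trans[OF L]) (intro mult_right_mono, auto)
    also have "\<dots> \<le> max L 0 * (\<bar>a - c\<bar> + \<bar>b - d\<bar>)"
      by (intro mult_left_mono sqrt_sum_squares_le_sum_abs) auto
    finally show "\<bar>h a b - h c d\<bar> \<le> max L 0 * (\<bar>a - c\<bar> + \<bar>b - d\<bar>)" .
  qed simp
qed

lemma lipschitz1_nonneg:
  assumes "lipschitz1 g"
  obtains L where "L \<ge> 0" "\<And>a b. \<bar>g a - g b\<bar> \<le> L * \<bar>a - b\<bar>"
proof -
  obtain L where L: "\<And>a b. \<bar>g a - g b\<bar> \<le> L * \<bar>a - b\<bar>" using assms by (auto simp: lipschitz1_def)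
  have "\<bar>g a - g b\<bar> \<le> max L 0 * \<bar>a - b\<bar>" for a b
    by (rule order.trans[OF L]) (intro mult_right_mono, auto)
  then show thesis using that[of "max L 0"] by simp
qed

text \<open>The segment property, in a form that leaves room for mollification.\<close>
definition push_in :: "(real^3) set \<Rightarrow> real^3 \<Rightarrow> real \<Rightarrow> real^3 \<Rightarrow> bool" where
  "push_in \<Omega> x r w \<longleftrightarrow> (\<exists>t0>0. \<forall>t. 0 < t \<and> t < t0 \<longrightarrow>
     (\<exists>e>0. \<forall>z\<in>\<Omega> \<inter> ball x r. ball (z + t *\<^sub>R w) e \<subseteq> \<Omega>))"

lemma lip_chart_push_in:
  assumes c: "lip_chart \<Omega> x U T h"
  shows "\<exists>r>0. \<exists>w. push_in \<Omega> x r w"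
proof -
  have U: "open U" "x \<in> U" and T: "orthogonal_transformation T" and lip: "lipschitz2 h"
    and \<Omega>U: "\<Omega> \<inter> U = {z\<in>U. T (z - x) $ 3 < h (T (z - x) $ 1) (T (z - x) $ 2)}"
    using c by (auto simp: lip_chart_def)
  obtain L where L: "L \<ge> 0" "\<And>a b c d. \<bar>h a b - h c d\<bar> \<le> L * (\<bar>a - c\<bar> + \<bar>b - d\<bar>)"
    using lipschitz2_nonneg[OF lip] by metis
  have lin: "linear T" and nT: "\<And>v. norm (T v) = norm v"
    using T by (auto simp: orthogonal_transformation_def orthogonal_transformation_norm[OF T])
  \<comment> \<open>In the chart this is the direction straight down, away from the graph and into
    the domain.\<close>
  obtain w where w: "T w = - axis 3 1"
    using orthogonal_transformation_surj[OF T] by (metis surj_def)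
  have nw: "norm w = 1" using nT[of w] by (simp add: w)
  obtain r where r: "r > 0" "ball x (2 * r) \<subseteq> U"
    using U open_contains_ball by (metis half_gt_zero field_sum_of_halves mult_2)
  have "push_in \<Omega> x r w"
    unfolding push_in_def
  \<comment> \<open>The shift \<open>t\<close> and the radius \<open>e \<le> t\<close> together stay
    below \<open>r\<close>, so points starting in \<open>ball x r\<close> do not leave
    \<open>ball x (2 * r)\<close>, where the chart is valid.\<close>
  proof (rule exI[of _ "r / 2"], intro conjI allI impI)
    show "r / 2 > 0" using r by simp
    fix t assume t: "0 < t \<and> t < r / 2"
    \<comment> \<open>A displacement by less than \<open>e\<close> raises the point by less than
      \<open>e\<close> and changes the height of the graph by at most \<open>2 * L * e\<close>;
      together this is compensated exactly by the descent \<open>t\<close>.\<close>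
    define e where "e = t / (1 + 2 * L)"
    have e: "e > 0" "e * (1 + 2 * L) = t" using t L by (auto simp: e_def add_pos_nonneg)
    have et: "e \<le> t" using e L mult_left_mono[of 1 "1 + 2 * L" e] by simp
    show "\<exists>e>0. \<forall>z\<in>\<Omega> \<inter> ball x r. ball (z + t *\<^sub>R w) e \<subseteq> \<Omega>"
    proof (intro exI[of _ e] conjI ballI subsetI)
      show "e > 0" by (rule e)
      fix z p assume z: "z \<in> \<Omega> \<inter> ball x r" and p: "p \<in> ball (z + t *\<^sub>R w) e"
      have n: "norm (p - z - t *\<^sub>R w) < e" using p by (simp add: dist_norm norm_minus_commute algebra_simps)
      let ?v = "T (p - z - t *\<^sub>R w)"
      have q: "T (p - x) = T (z - x) - t *\<^sub>R axis 3 1 + ?v"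
      proof -
        have "p - x = (z - x) + t *\<^sub>R w + (p - z - t *\<^sub>R w)" by simp
        then have "T (p - x) = T ((z - x) + t *\<^sub>R w + (p - z - t *\<^sub>R w))" by simp
        also have "\<dots> = T (z - x) + t *\<^sub>R T w + ?v"
          using lin by (simp only: linear_add linear_cmul)
        finally show ?thesis by (simp add: w)
      qed
      have v: "\<bar>?v $ i\<bar> < e" for i using component_le_norm_cart[of ?v i] n nT[of "p - z - t *\<^sub>R w"] by simp
      have "dist x p \<le> dist x z + (t + e)"
      proof -
        have "dist z p \<le> norm (t *\<^sub>R w) + norm (p - z - t *\<^sub>R w)"
          using norm_triangle_ineq[of "t *\<^sub>R w" "p - z - t *\<^sub>R w"] by (simp add: dist_norm norm_minus_commute)
        then show ?thesis using dist_triangle[of x p z] n nw t by simp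
      qed
      then have "p \<in> U" using z t et r by auto
      have zU: "z \<in> \<Omega> \<inter> U" using z r by auto
      then have y: "T (z - x) $ 3 < h (T (z - x) $ 1) (T (z - x) $ 2)" using \<Omega>U by auto
      have comp: "T (p - x) $ 1 = T (z - x) $ 1 + ?v $ 1" "T (p - x) $ 2 = T (z - x) $ 2 + ?v $ 2"
        "T (p - x) $ 3 = T (z - x) $ 3 - t + ?v $ 3"
        unfolding q by (simp_all add: axis_def)
      have "\<bar>h (T (z - x) $ 1) (T (z - x) $ 2) - h (T (p - x) $ 1) (T (p - x) $ 2)\<bar> \<le> L * (e + e)"
        by (rule order.trans[OF L(2)]) (use v[of 1] v[of 2] L(1) comp in \<open>auto intro!: mult_left_mono add_mono\<close>)
      then have "T (p - x) $ 3 < h (T (p - x) $ 1) (T (p - x) $ 2)"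
        using y comp(3) v[of 3] e(2) by (simp add: algebra_simps abs_le_iff abs_less_iff)
      then show "p \<in> \<Omega>" using \<Omega>U \<open>p \<in> U\<close> by blast
    qed
  qed
  with r show ?thesis by blast
qed

text \<open>Only frontier points need a chart: around interior points the shift 0 works, and around
  exterior points a small ball misses the domain. Treating all points alike lets the covering
  argument avoid this distinction.\<close>

lemma push_in_exists:
  assumes \<Omega>: "strong_lipschitz_domain \<Omega>"
  shows "\<exists>r>0. \<exists>w. push_in \<Omega> x r w"
proof -
  have o: "open \<Omega>" using \<Omega> by (simp add: strong_lipschitz_domain_def)
  consider "x \<in> frontier \<Omega>" | "x \<in> \<Omega>" | "x \<notin> closure \<Omega>"
    using o by (auto simp: frontier_def interior_open)
  then show ?thesis
  proof cases
    case 1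
    then show ?thesis using \<Omega> lip_chart_push_in by (metis strong_lipschitz_domain_def)
  next
    case 2
    then obtain s where s: "s > 0" "ball x s \<subseteq> \<Omega>" using o open_contains_ball by blast
    have b: "ball z (s/2) \<subseteq> \<Omega>" if "z \<in> ball x (s/2)" for z
    proof
      fix y assume "y \<in> ball z (s/2)"
      then have "dist x y < s" using dist_triangle[of x y z] that by simp
      with s show "y \<in> \<Omega>" by auto
    qed
    have "push_in \<Omega> x (s/2) 0"
      unfolding push_in_def
      by (intro exI[of _ 1] conjI allI impI exI[of _ "s/2"] ballI) (use b s(1) in simp_all)
    then show ?thesis using s(1) by (intro exI[of _ "s/2"]) auto
  next
    case 3
    then have "x \<in> - closure \<Omega>" "open (- closure \<Omega>)" by auto
    then obtain s where s: "s > 0" "ball x s \<subseteq> - closure \<Omega>" using open_contains_ball by blast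
    then have "\<Omega> \<inter> ball x s = {}" using closure_subset by blast
    then have "push_in \<Omega> x s 0" unfolding push_in_def by (auto intro!: exI[of _ 1])
    with s show ?thesis by blast
  qed
qed

text \<open>Covering numbers of order \<open>1/e\<close>, that is, finite one-dimensional upper
  Minkowski content. In dimension three this bounds the volume of the \<open>e\<close>-neighbourhood
  by a multiple of \<open>e^2\<close>, the only property of a curve needed later.\<close>

definition curve_like :: "(real^3) set \<Rightarrow> bool" where
  "curve_like S \<longleftrightarrow> (\<exists>C>0. \<forall>e. 0 < e \<and> e \<le> 1 \<longrightarrow>
     (\<exists>P. finite P \<and> real (card P) \<le> C / e \<and> S \<subseteq> (\<Union>p\<in>P. ball p e)))"

lemma curve_like_Un:
  assumes "curve_like S" "curve_like T"
  shows "curve_like (S \<union> T)"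
proof -
  obtain C where C: "C > 0" "\<And>e. 0 < e \<Longrightarrow> e \<le> 1 \<Longrightarrow> \<exists>P. finite P \<and> real (card P) \<le> C / e \<and> S \<subseteq> (\<Union>p\<in>P. ball p e)"
    using assms(1) by (auto simp: curve_like_def)
  obtain C' where C': "C' > 0" "\<And>e. 0 < e \<Longrightarrow> e \<le> 1 \<Longrightarrow> \<exists>P. finite P \<and> real (card P) \<le> C' / e \<and> T \<subseteq> (\<Union>p\<in>P. ball p e)"
    using assms(2) by (auto simp: curve_like_def)
  show ?thesis unfolding curve_like_def
  proof (intro exI[of _ "C + C'"] conjI allI impI)
    fix e :: real assume e: "0 < e \<and> e \<le> 1"
    obtain P where P: "finite P" "real (card P) \<le> C / e" "S \<subseteq> (\<Union>p\<in>P. ball p e)" using C(2) e by blast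
    obtain Q where Q: "finite Q" "real (card Q) \<le> C' / e" "T \<subseteq> (\<Union>p\<in>Q. ball p e)" using C'(2) e by blast
    have "real (card (P \<union> Q)) \<le> real (card P) + real (card Q)" using card_Un_le[of P Q] by linarith
    then have "real (card (P \<union> Q)) \<le> (C + C') / e" using P Q by (simp add: add_divide_distrib)
    then show "\<exists>P. finite P \<and> real (card P) \<le> (C + C') / e \<and> S \<union> T \<subseteq> (\<Union>p\<in>P. ball p e)"
      using P Q by (intro exI[of _ "P \<union> Q"]) auto
  qed (use C C' in simp)
qed

lemma curve_like_UN: "finite A \<Longrightarrow> (\<And>a. a \<in> A \<Longrightarrow> curve_like (S a)) \<Longrightarrow> curve_like (\<Union>a\<in>A. S a)"
proof (induction A rule: finite_induct)
  case empty
  then show ?case by (auto simp: curve_like_def intro!: exI[of _ 1] exI[of _ "{}"])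
next
  case (insert a A)
  then show ?case using curve_like_Un[of "S a" "\<Union>a\<in>A. S a"] by auto
qed

lemma curve_like_mono: "curve_like T \<Longrightarrow> S \<subseteq> T \<Longrightarrow> curve_like S"
  unfolding curve_like_def by (meson order.trans)

lemma curve_like_compact:
  assumes S: "compact S" and loc: "\<And>x. x \<in> S \<Longrightarrow> \<exists>r>0. curve_like (S \<inter> ball x r)"
  shows "curve_like S"
proof -
  obtain r where r: "\<And>x. x \<in> S \<Longrightarrow> r x > 0" "\<And>x. x \<in> S \<Longrightarrow> curve_like (S \<inter> ball x (r x))" using loc by metis
  have "S \<subseteq> (\<Union>x\<in>S. ball x (r x))" using r(1) by force
  then obtain F where F: "F \<subseteq> S" "finite F" "S \<subseteq> (\<Union>x\<in>F. ball x (r x))"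
    using compactE_image[OF S, of S "\<lambda>x. ball x (r x)"] by auto
  have "curve_like (\<Union>x\<in>F. S \<inter> ball x (r x))" by (rule curve_like_UN[OF F(2)]) (use F r in auto)
  then show ?thesis by (rule curve_like_mono) (use F in auto)
qed

lemma curve_like_lipschitz:
  fixes c :: "real \<Rightarrow> real^3"
  assumes M: "M > 0" "\<And>s s'. norm (c s - c s') \<le> M * \<bar>s - s'\<bar>" and r: "r > 0"
  shows "curve_like (c ` {-r..r})"
  unfolding curve_like_def
\<comment> \<open>Nodes at spacing \<open>e / (2 * M)\<close> have images within
  \<open>e / 2\<close> of every curve point. There are \<open>2 * N + 1\<close> indices, at most
  \<open>4 * r * M / e + 5\<close> of them, and \<open>e \<le> 1\<close> absorbs the 5 into the
  quotient.\<close>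
proof (intro exI[of _ "4 * r * M + 5"] conjI allI impI)
  show "4 * r * M + 5 > 0" using M r by (simp add: add_pos_nonneg)
  fix e :: real assume e: "0 < e \<and> e \<le> 1"
  define \<delta> where "\<delta> = e / (2 * M)"
  have \<delta>: "\<delta> > 0" "M * \<delta> = e / 2" using e M by (auto simp: \<delta>_def)
  define N where "N = \<lceil>r / \<delta>\<rceil> + 1"
  have N: "real_of_int N \<le> r / \<delta> + 2" "N \<ge> 1"
  proof -
    have "0 < r / \<delta>" using r \<delta> by simp
    then show "real_of_int N \<le> r / \<delta> + 2" "N \<ge> 1" unfolding N_def by linarith+
  qed
  let ?P = "(\<lambda>j. c (\<delta> * of_int j)) ` {-N..N}"
  show "\<exists>P. finite P \<and> real (card P) \<le> (4 * r * M + 5) / e \<and> c ` {-r..r} \<subseteq> (\<Union>p\<in>P. ball p e)"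
  proof (intro exI[of _ ?P] conjI subsetI)
    show "finite ?P" by simp
    have "real (card ?P) \<le> real (card {-N..N})" using card_image_le[of "{-N..N}"] by simp
    also have "\<dots> = 2 * real_of_int N + 1" using N(2) by simp
    also have "\<dots> \<le> 2 * (r / \<delta>) + 5" using N(1) by simp
    also have "2 * (r / \<delta>) = 4 * r * M / e" using e M by (simp add: \<delta>_def field_simps)
    also have "4 * r * M / e + 5 \<le> (4 * r * M + 5) / e" using e by (simp add: field_simps)
    finally show "real (card ?P) \<le> (4 * r * M + 5) / e" .
    fix z assume "z \<in> c ` {-r..r}"
    then obtain s where s: "z = c s" "\<bar>s\<bar> \<le> r" by (auto simp: abs_le_iff)
    define j where "j = \<lfloor>s / \<delta>\<rfloor>"
    have j: "of_int j \<le> s / \<delta>" "s / \<delta> < of_int j + 1" by (auto simp: j_def)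
    then have "\<delta> * of_int j \<le> s" "s < \<delta> * of_int j + \<delta>"
      using \<delta>(1) by (auto simp: field_simps)
    then have close: "\<bar>\<delta> * of_int j - s\<bar> \<le> \<delta>" by simp
    have "s / \<delta> \<le> r / \<delta>" "- (r / \<delta>) \<le> s / \<delta>"
      using s divide_right_mono[of s r \<delta>] divide_right_mono[of "- r" s \<delta>] \<delta> by auto
    then have "- N \<le> j" "j \<le> N" using j unfolding N_def by linarith+
    moreover have "dist (c (\<delta> * of_int j)) z < e"
    proof -
      have "norm (c (\<delta> * of_int j) - c s) \<le> M * \<delta>"
        by (rule order.trans[OF M(2)]) (use close M in auto)
      then show ?thesis using \<delta> e by (simp add: dist_norm s)
    qed
    ultimately show "z \<in> (\<Union>p\<in>?P. ball p e)" by auto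
  qed
qed

text \<open>In the chart a limit point of the boundary part still lies on the graph and satisfies
  the weak form of the strict inequality. If it is not in the part itself, equality holds in both,
  so it lies on a Lipschitz curve over the second coordinate. Compactness then makes the local
  covering bound global.\<close>

lemma interface_curve_like:
  assumes \<Omega>: "strong_lipschitz_domain \<Omega>" and \<Gamma>: "strong_lipschitz_boundary_part \<Omega> \<Gamma>"
  shows "compact (closure \<Gamma> - \<Gamma>)" "curve_like (closure \<Gamma> - \<Gamma>)"
proof -
  have sub: "\<Gamma> \<subseteq> frontier \<Omega>" and op: "openin (top_of_set (frontier \<Omega>)) \<Gamma>"
    using \<Gamma> by (auto simp: strong_lipschitz_boundary_part_def)
  have "closure \<Gamma> \<subseteq> frontier \<Omega>" using sub by (simp add: closure_minimal)
  then have eq: "closure \<Gamma> - \<Gamma> = closure \<Gamma> \<inter> (frontier \<Omega> - \<Gamma>)" by blast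
  have "closedin (top_of_set (frontier \<Omega>)) (frontier \<Omega> - \<Gamma>)"
    using op by (simp add: closedin_diff)
  then have "closed (frontier \<Omega> - \<Gamma>)" using closedin_closed_trans frontier_closed by blast
  moreover have "bounded (closure \<Gamma>)"
  proof -
    have "bounded (closure \<Omega>)" using \<Omega> by (simp add: strong_lipschitz_domain_def bounded_closure)
    then have "bounded \<Gamma>" by (rule bounded_subset) (use sub in \<open>auto simp: frontier_def\<close>)
    then show ?thesis by (rule bounded_closure)
  qed
  ultimately show comp: "compact (closure \<Gamma> - \<Gamma>)"
    unfolding eq by (simp add: compact_eq_bounded_closed bounded_Int closed_Int)
  show "curve_like (closure \<Gamma> - \<Gamma>)"
  proof (rule curve_like_compact[OF comp])
    fix x assume x: "x \<in> closure \<Gamma> - \<Gamma>"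
    have "\<forall>x\<in>closure \<Gamma> - \<Gamma>. \<exists>U T h g. lip_chart \<Omega> x U T h \<and> lipschitz1 g \<and>
        \<Gamma> \<inter> U = {z\<in>U. T (z - x) $ 3 = h (T (z - x) $ 1) (T (z - x) $ 2) \<and>
                        T (z - x) $ 1 < g (T (z - x) $ 2)}"
      using \<Gamma> unfolding strong_lipschitz_boundary_part_def by (elim conjE)
    from bspec[OF this x] obtain U T h g where c: "lip_chart \<Omega> x U T h" and g: "lipschitz1 g"
      and \<Gamma>U: "\<Gamma> \<inter> U = {z\<in>U. T (z - x) $ 3 = h (T (z - x) $ 1) (T (z - x) $ 2) \<and>
                        T (z - x) $ 1 < g (T (z - x) $ 2)}"
      by (elim exE conjE)
    have U: "open U" "x \<in> U" and T: "orthogonal_transformation T" and lip: "lipschitz2 h"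
      using c by (auto simp: lip_chart_def)
    obtain L where L: "L \<ge> 0" "\<And>a b c d. \<bar>h a b - h c d\<bar> \<le> L * (\<bar>a - c\<bar> + \<bar>b - d\<bar>)"
      using lipschitz2_nonneg[OF lip] by metis
    obtain K where K: "K \<ge> 0" "\<And>a b. \<bar>g a - g b\<bar> \<le> K * \<bar>a - b\<bar>"
      using lipschitz1_nonneg[OF g] by metis
    have lin: "linear T" and nT: "\<And>v. norm (T v) = norm v"
      using T by (auto simp: orthogonal_transformation_def orthogonal_transformation_norm[OF T])
    have blT: "bounded_linear T" using lin by (simp add: linear_conv_bounded_linear)
    define S where "S = inv T"
    have S: "T (S y) = y" for y
      unfolding S_def by (rule surj_f_inv_f[OF orthogonal_transformation_surj[OF T]])
    obtain r where r: "r > 0" "ball x r \<subseteq> U" using U open_contains_ball by metis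
    \<comment> \<open>The relative boundary in chart coordinates, parametrised by the second
      coordinate: the first is prescribed by \<open>g\<close>, the third by the graph.\<close>
    define q where "q s = (vector [g s, s, h (g s) s] :: real^3)" for s
    define c where "c s = x + S (q s)" for s
    have Tc: "T (c s - x) = q s" for s by (simp add: c_def S)
    define M where "M = K + 1 + L * (K + 1)"
    have nc: "norm (c s - c s') \<le> M * \<bar>s - s'\<bar>" for s s'
    proof -
      have "norm (c s - c s') = norm (T (c s - c s'))" by (simp add: nT)
      also have "T (c s - c s') = T ((c s - x) - (c s' - x))" by simp
      also have "\<dots> = q s - q s'" using linear_diff[OF lin, of "c s - x" "c s' - x"] by (simp only: Tc)
      also have "norm (q s - q s') \<le> (\<Sum>i\<in>UNIV. \<bar>(q s - q s') $ i\<bar>)" by (rule norm_le_l1_cart)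
      also have "\<dots> = \<bar>g s - g s'\<bar> + \<bar>s - s'\<bar> + \<bar>h (g s) s - h (g s') s'\<bar>"
        by (simp add: sum_3 q_def vector_3)
      also have "\<dots> \<le> K * \<bar>s - s'\<bar> + \<bar>s - s'\<bar> + L * (K * \<bar>s - s'\<bar> + \<bar>s - s'\<bar>)"
        by (intro add_mono K order_refl order.trans[OF L(2)] mult_left_mono L(1))
      also have "\<dots> = M * \<bar>s - s'\<bar>" by (simp add: M_def algebra_simps)
      finally show ?thesis .
    qed
    have "M > 0" using K L by (simp add: M_def add_pos_nonneg add_nonneg_pos)
    then have cl: "curve_like (c ` {-r..r})" using nc r(1) by (rule curve_like_lipschitz)
    have conth: "continuous_on UNIV (\<lambda>z. h (T (z - x) $ 1) (T (z - x) $ 2))"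
    proof -
      have "continuous_on UNIV (\<lambda>p. h (fst p) (snd p))"
      proof (rule lipschitz_on_continuous_on)
        show "(2 * L)-lipschitz_on UNIV (\<lambda>p. h (fst p) (snd p))"
        proof (rule lipschitz_onI)
          fix p p' :: "real \<times> real"
          have "\<bar>fst p - fst p'\<bar> \<le> dist p p'" "\<bar>snd p - snd p'\<bar> \<le> dist p p'"
            using dist_fst_le[of p p'] dist_snd_le[of p p'] by (auto simp: dist_real_def)
          then have "L * (\<bar>fst p - fst p'\<bar> + \<bar>snd p - snd p'\<bar>) \<le> L * (dist p p' + dist p p')"
            by (intro mult_left_mono add_mono L(1))
          then show "dist (h (fst p) (snd p)) (h (fst p') (snd p')) \<le> 2 * L * dist p p'"
            using L(2)[of "fst p" "snd p" "fst p'" "snd p'"] by (simp add: dist_real_def)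
        qed (use L in simp)
      qed
      moreover have "continuous_on UNIV (\<lambda>z. (T (z - x) $ 1, T (z - x) $ 2))"
        by (intro continuous_intros bounded_linear.continuous_on[OF blT])
      ultimately have "continuous_on UNIV ((\<lambda>p. h (fst p) (snd p)) \<circ> (\<lambda>z. (T (z - x) $ 1, T (z - x) $ 2)))"
        by (intro continuous_on_compose) (auto intro: continuous_on_subset)
      then show ?thesis by (simp add: o_def)
    qed
    have contg: "continuous_on UNIV (\<lambda>z. g (T (z - x) $ 2))"
    proof -
      have "continuous_on UNIV g"
        by (rule lipschitz_on_continuous_on[of K]) (rule lipschitz_onI, use K in \<open>auto simp: dist_real_def\<close>)
      moreover have "continuous_on UNIV (\<lambda>z. T (z - x) $ 2)"
        by (intro continuous_intros bounded_linear.continuous_on[OF blT])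
      ultimately have "continuous_on UNIV (g \<circ> (\<lambda>z. T (z - x) $ 2))"
        by (intro continuous_on_compose) (auto intro: continuous_on_subset)
      then show ?thesis by (simp add: o_def)
    qed
    have cT: "continuous_on UNIV (\<lambda>z. T (z - x) $ i)" for i
      by (intro continuous_intros bounded_linear.continuous_on[OF blT])
    \<comment> \<open>A closed set containing the boundary part near \<open>x\<close>, hence also
      its limit points there; the strict inequality turns into a weak one.\<close>
    let ?F = "{z. T (z - x) $ 3 = h (T (z - x) $ 1) (T (z - x) $ 2)} \<inter> {z. T (z - x) $ 1 \<le> g (T (z - x) $ 2)}"
    have "closed ?F"
      by (intro closed_Int closed_Collect_eq closed_Collect_le cT conth contg)
    moreover have "U \<inter> \<Gamma> \<subseteq> ?F"
    proof
      fix z assume "z \<in> U \<inter> \<Gamma>"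
      then have "z \<in> {z\<in>U. T (z - x) $ 3 = h (T (z - x) $ 1) (T (z - x) $ 2) \<and> T (z - x) $ 1 < g (T (z - x) $ 2)}"
        using \<Gamma>U by blast
      then show "z \<in> ?F" by (simp add: less_imp_le)
    qed
    ultimately have "closure (U \<inter> \<Gamma>) \<subseteq> ?F" by (rule closure_minimal[rotated])
    then have clF: "U \<inter> closure \<Gamma> \<subseteq> ?F" using open_Int_closure_subset[OF U(1)] by blast
    have "(closure \<Gamma> - \<Gamma>) \<inter> ball x r \<subseteq> c ` {-r..r}"
    proof
      fix z assume z: "z \<in> (closure \<Gamma> - \<Gamma>) \<inter> ball x r"
      then have "z \<in> U" using r by auto
      with z clF \<Gamma>U have y: "T (z - x) $ 3 = h (T (z - x) $ 1) (T (z - x) $ 2)" "T (z - x) $ 1 = g (T (z - x) $ 2)"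
        by force+
      let ?s = "T (z - x) $ 2"
      have "T (z - x) = q ?s"
        unfolding vec_eq_iff forall_3 q_def vector_3 using y by simp
      then have "T (z - c ?s) = 0"
        using linear_diff[OF lin, of "z - x" "c ?s - x"] by (simp add: Tc)
      then have "z = c ?s" using nT[of "z - c ?s"] by simp
      moreover have "\<bar>?s\<bar> \<le> r"
        using component_le_norm_cart[of "T (z - x)" 2] z nT[of "z - x"] by (simp add: dist_norm norm_minus_commute)
      ultimately show "z \<in> c ` {-r..r}" by (auto simp: abs_le_iff)
    qed
    then have "curve_like ((closure \<Gamma> - \<Gamma>) \<inter> ball x r)" by (rule curve_like_mono[OF cl])
    then show "\<exists>r>0. curve_like ((closure \<Gamma> - \<Gamma>) \<inter> ball x r)" using r(1) by blast
  qed
qed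

subsection \<open>Extension by zero across the boundary\<close>

text \<open>A weak derivative on the whole space: the test functions may cross the boundary of the
  domain. For extensions by zero this is how vanishing boundary values are expressed without a
  trace.\<close>

definition wd :: "3 \<Rightarrow> (real^3 \<Rightarrow> real) \<Rightarrow> (real^3 \<Rightarrow> real) \<Rightarrow> bool" where
  "wd i f g \<longleftrightarrow> (\<forall>\<phi>. test0 \<phi> \<longrightarrow> ip lborel f (partial i \<phi>) = - ip lborel g \<phi>)"

lemma l2_abs_cont:
  assumes f: "l2 M f" and e: "e > 0"
  obtains d where "d > 0"
    "\<And>A. A \<in> sets M \<Longrightarrow> emeasure M A < ennreal d \<Longrightarrow> n2 M (\<lambda>x. indicator A x * f x) \<le> e"
proof -
  have [measurable]: "f \<in> borel_measurable M" using f by (simp add: l2_def)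
  define g where "g m x = (if \<bar>f x\<bar> \<le> real m then 0 else f x)" for m x
  have gm: "g m \<in> borel_measurable M" for m unfolding g_def by measurable
  have g2: "l2 M (g m)" for m
    by (rule l2_bound[OF f gm]) (simp add: g_def)
  have "(\<lambda>m. \<integral>x. (g m x)\<^sup>2 \<partial>M) \<longlonglongrightarrow> (\<integral>x. (0::real) \<partial>M)"
  proof (rule integral_dominated_convergence)
    show "integrable M (\<lambda>x. (f x)\<^sup>2)" using f by (simp add: l2_def)
    show "AE x in M. (\<lambda>m. (g m x)\<^sup>2) \<longlonglongrightarrow> 0"
    proof (intro AE_I2 tendsto_eventually)
      fix x
      obtain N where "\<bar>f x\<bar> \<le> real N" using real_arch_simple by blast
      then have "(g m x)\<^sup>2 = 0" if "m \<ge> N" for m using that by (auto simp: g_def)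
      then show "eventually (\<lambda>m. (g m x)\<^sup>2 = 0) sequentially" by (auto simp: eventually_sequentially)
    qed
    show "(\<lambda>x. (g m x)\<^sup>2) \<in> borel_measurable M" for m using gm by simp
  qed (auto simp: g_def)
  then have "(\<lambda>m. sqrt (\<integral>x. (g m x)\<^sup>2 \<partial>M)) \<longlonglongrightarrow> sqrt 0"
    by (intro tendsto_real_sqrt) simp
  then have "(\<lambda>m. n2 M (g m)) \<longlonglongrightarrow> 0" by (simp add: n2_def)
  moreover have "e/2 > 0" using e by simp
  ultimately have "\<exists>N. \<forall>m\<ge>N. norm (n2 M (g m) - 0) < e/2" by (rule LIMSEQ_D)
  then obtain m where m: "n2 M (g m) < e/2" by (auto simp: n2_nonneg)
  \<comment> \<open>Chosen so that the bounded part, of size at most \<open>m\<close> on a set of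
    measure below \<open>d\<close>, has norm at most \<open>m * sqrt d \<le> e/2\<close>; the
    unbounded part contributes the other half.\<close>
  define d where "d = (e / (2 * (real m + 1)))\<^sup>2"
  show thesis
  proof (rule that)
    show "d > 0" using e by (simp add: d_def)
    fix A assume A[measurable]: "A \<in> sets M" and mA: "emeasure M A < ennreal d"
    have fin: "emeasure M A < \<infinity>" using mA by (rule order.strict_trans) simp
    have iA: "l2 M (indicat_real A)" and nA: "n2 M (indicat_real A) = sqrt (measure M A)"
      using l2_indicator[OF A fin] by auto
    have n2A: "n2 M (indicator A) \<le> e / (2 * (real m + 1))"
    proof -
      have "measure M A \<le> d"
        using mA e by (simp add: measure_def enn2real_leI d_def)
      then show ?thesis
        using real_sqrt_le_mono[of "measure M A" d] e by (simp add: d_def nA)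
    qed
    have "n2 M (\<lambda>x. indicator A x * f x) \<le> n2 M (\<lambda>x. real m * indicator A x + \<bar>g m x\<bar>)"
      by (intro n2_mono l2_add l2_cmult iA l2_abs g2) (auto simp: indicator_def g_def)
    also have "\<dots> \<le> n2 M (\<lambda>x. real m * indicator A x) + n2 M (\<lambda>x. \<bar>g m x\<bar>)"
      by (intro n2_add_le l2_cmult iA l2_abs g2)
    also have "n2 M (\<lambda>x. \<bar>g m x\<bar>) = n2 M (g m)" by (simp add: n2_def)
    also have "n2 M (\<lambda>x. real m * indicator A x) = real m * n2 M (indicator A)"
      by (simp add: n2_cmult)
    also have "real m * n2 M (indicator A) \<le> real m * (e / (2 * (real m + 1)))"
      by (intro mult_left_mono n2A) simp
    also have "\<dots> \<le> e/2" using e by (simp add: field_simps)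
    finally show "n2 M (\<lambda>x. indicator A x * f x) \<le> e" using m by simp
  qed
qed

text \<open>If the supports of \<open>\<phi>\<close> and \<open>\<psi>\<close> do not meet on the boundary, the product is a test function
  of \<open>\<Omega>\<close>, so no boundary term arises.\<close>
lemma ibp_disjoint_on_frontier:
  assumes \<Omega>: "open \<Omega>" and \<phi>: "test0 \<phi>" and \<psi>: "test0 \<psi>"
    and disj: "csupp \<phi> \<inter> csupp \<psi> \<inter> frontier \<Omega> = {}"
  shows "ip (lebesgue_on \<Omega>) \<phi> (partial i \<psi>) = - ip (lebesgue_on \<Omega>) (partial i \<phi>) \<psi>"
proof -
  let ?M = "lebesgue_on \<Omega>"
  \<comment> \<open>By \<open>disj\<close> this compact set lies in the open domain, so a cutoff
    equal to 1 near it changes neither product inside the domain.\<close>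
  define K where "K = csupp \<phi> \<inter> csupp \<psi> \<inter> closure \<Omega>"
  have K: "compact K" unfolding K_def
    using test0D[OF \<phi>] closed_csupp by (intro compact_Int_closed) auto
  have K\<Omega>: "K \<subseteq> \<Omega>" using disj \<Omega> by (auto simp: K_def frontier_def interior_open)
  obtain \<eta> V where \<eta>: "test \<Omega> \<eta>" "open V" "K \<subseteq> V" "\<And>x. x \<in> V \<Longrightarrow> \<eta> x = 1"
    using smooth_cutoff[OF K \<Omega> K\<Omega>] by metis
  let ?\<psi> = "\<lambda>x. \<psi> x * \<eta> x"
  have t: "test \<Omega> ?\<psi>" by (rule test_mult[OF test0D(1)[OF \<psi>] \<eta>(1)])
  have cs: "csupp ?\<psi> \<subseteq> csupp \<psi>"
    by (rule csupp_subset[OF closed_csupp]) (simp add: csupp_nonzero)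
  have "\<phi> x * partial i \<psi> x = \<phi> x * partial i ?\<psi> x \<and> partial i \<phi> x * \<psi> x = partial i \<phi> x * ?\<psi> x"
    if x: "x \<in> \<Omega>" for x
  proof -
    consider "x \<notin> csupp \<phi>" | "x \<notin> csupp \<psi>" | "x \<in> csupp \<phi>" "x \<in> csupp \<psi>" by blast
    then show ?thesis
    proof cases
      case 1
      then show ?thesis using csupp_nonzero[of x \<phi>] pd_zero_off_csupp[of x \<phi> "[i]"] by simp
    next
      case 2
      then have "x \<notin> csupp ?\<psi>" using cs by blast
      then show ?thesis using 2 csupp_nonzero[of x \<psi>] pd_zero_off_csupp[of x \<psi> "[i]"] pd_zero_off_csupp[of x ?\<psi> "[i]"] by simp
    next
      case 3
      then have xV: "x \<in> V" using x closure_subset \<eta>(3) by (auto simp: K_def)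
      have "partial i \<psi> x = partial i ?\<psi> x"
        by (rule partial_cong_open[OF \<eta>(2) xV]) (simp add: \<eta>(4))
      then show ?thesis using \<eta>(4)[OF xV] by simp
    qed
  qed
  then have "ip ?M \<phi> (partial i \<psi>) = ip ?M \<phi> (partial i ?\<psi>)" "ip ?M (partial i \<phi>) \<psi> = ip ?M (partial i \<phi>) ?\<psi>"
    unfolding ip_def by (auto intro!: Bochner_Integration.integral_cong simp: space_restrict_space)
  then show ?thesis
    using wderiv_test0[OF \<Omega> \<phi>, of "[i]"] t by (simp add: wderiv_ip)
qed

lemma Hk1_ibp:
  assumes \<Omega>: "open \<Omega>" "bounded \<Omega>" and u: "Hk \<Omega> 1 \<Sigma> u" and g: "L2 \<Omega> g" "wderiv \<Omega> [i] u g" and \<psi>: "test0 \<psi>"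
    and disj: "\<And>\<phi>. Csig \<Sigma> \<phi> \<Longrightarrow> csupp \<phi> \<inter> csupp \<psi> \<inter> frontier \<Omega> = {}"
  shows "ip (lebesgue_on \<Omega>) u (partial i \<psi>) = - ip (lebesgue_on \<Omega>) g \<psi>"
proof -
  let ?M = "lebesgue_on \<Omega>"
  \<comment> \<open>The prescribed \<open>u\<close> and \<open>g\<close> replace the choices made by
    \<open>D\<close>, so that the approximants converge to exactly these functions.\<close>
  define G where "G js = (if js = [] then u else if js = [i] then g else D \<Omega> js u)" for js
  have mem: "Hk_mem \<Omega> 1 u" using u by (simp add: Hk_def)
  have uL: "L2 \<Omega> u" using mem by (simp add: Hk_mem_def)
  have wf: "weak_family \<Omega> 1 u G"
    using g uL D_props[OF mem] by (auto simp: weak_family_def G_def wderiv_Nil)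
  obtain \<phi> where \<phi>: "\<And>n. Csig \<Sigma> (\<phi> n)"
    "\<And>is. length is \<le> 1 \<Longrightarrow> (\<lambda>n. n2 ?M (\<lambda>x. pd is (\<phi> n) x - G is x)) \<longlonglongrightarrow> 0"
    using Hk_approx[OF \<Omega> u wf] by blast
  have t: "test0 (\<phi> n)" for n using \<phi>(1) by (rule Csig_test0)
  have 1: "(\<lambda>n. ip ?M (\<phi> n) (partial i \<psi>)) \<longlonglongrightarrow> ip ?M u (partial i \<psi>)"
    using \<phi>(2)[of "[]"] uL t \<psi> \<Omega>(1)
    by (intro ip_tendsto) (auto simp: G_def L2_l2[symmetric] L2_test0 test0_partial)
  have 2: "(\<lambda>n. - ip ?M (partial i (\<phi> n)) \<psi>) \<longlonglongrightarrow> - ip ?M g \<psi>"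
    using \<phi>(2)[of "[i]"] g t \<psi> \<Omega>(1)
    by (intro tendsto_minus ip_tendsto) (auto simp: G_def L2_l2[symmetric] L2_test0 test0_partial)
  have "(\<lambda>n. ip ?M (\<phi> n) (partial i \<psi>)) = (\<lambda>n. - ip ?M (partial i (\<phi> n)) \<psi>)"
    using ibp_disjoint_on_frontier[OF \<Omega>(1) t \<psi> disj[OF \<phi>(1)]] by simp
  then show ?thesis using LIMSEQ_unique[OF 1] 2 by simp
qed

lemma Csig_csupp_disjoint:
  assumes "Csig \<Sigma> \<phi>"
  shows "csupp \<phi> \<inter> \<Sigma> = {}"
  using assms by (fastforce simp: Csig_def)

text \<open>A cutoff splits \<open>\<psi>\<close> in two. On the frontier, \<open>\<psi>2\<close>
  meets only \<open>\<Gamma>\<close>, where the first kind of approximants vanishes, and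
  \<open>\<psi>1\<close> meets only the part off the closure of \<open>\<Gamma>\<close>, handled by
  the second kind. The split is possible because \<open>K1\<close> and \<open>K2\<close> are
  disjoint, which is the assumption that the support misses the interface.\<close>

lemma ibp_off_interface:
  assumes \<Omega>: "open \<Omega>" "bounded \<Omega>"
    and \<Gamma>: "\<Gamma> \<subseteq> frontier \<Omega>" "openin (top_of_set (frontier \<Omega>)) \<Gamma>"
    and u: "Hk \<Omega> 1 \<Gamma> u" "Hk \<Omega> 1 (frontier \<Omega> - closure \<Gamma>) u"
    and g: "L2 \<Omega> g" "wderiv \<Omega> [i] u g" and \<psi>: "test0 \<psi>"
    and off: "csupp \<psi> \<inter> (closure \<Gamma> - \<Gamma>) = {}"
  shows "ip (lebesgue_on \<Omega>) u (partial i \<psi>) = - ip (lebesgue_on \<Omega>) g \<psi>"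
proof -
  let ?M = "lebesgue_on \<Omega>"
  have cl: "closed (frontier \<Omega> - \<Gamma>)"
    using \<Gamma>(2) closedin_closed_trans[OF _ frontier_closed] by (metis closedin_diff closedin_subtopology_refl openin_closedin_eq topspace_euclidean_subtopology)
  have "closure \<Gamma> \<subseteq> frontier \<Omega>" using \<Gamma>(1) by (simp add: closure_minimal)
  define K1 where "K1 = csupp \<psi> \<inter> (frontier \<Omega> - \<Gamma>)"
  define K2 where "K2 = csupp \<psi> \<inter> closure \<Gamma>"
  have K: "closed K1" "compact K2"
    unfolding K1_def K2_def using test0D[OF \<psi>] cl by (auto intro: closed_Int closed_csupp compact_Int_closed)
  have "K2 \<subseteq> - K1" using off by (auto simp: K1_def K2_def)
  then obtain \<eta> V where \<eta>: "test (- K1) \<eta>" "open V" "K2 \<subseteq> V" "\<And>x. x \<in> V \<Longrightarrow> \<eta> x = 1"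
    using smooth_cutoff[OF K(2) open_Compl[OF K(1)]] by metis
  have s\<eta>: "smooth \<eta>" using \<eta>(1) by (simp add: test_def)
  define \<psi>1 where "\<psi>1 x = (1 - \<eta> x) * \<psi> x" for x
  define \<psi>2 where "\<psi>2 x = \<eta> x * \<psi> x" for x
  have t1: "test0 \<psi>1" unfolding \<psi>1_def by (intro test0_mult smooth_diff smooth_const s\<eta> \<psi>)
  have t2: "test0 \<psi>2" unfolding \<psi>2_def by (intro test0_mult s\<eta> \<psi>)
  have c1: "csupp \<psi>1 \<subseteq> csupp \<psi> \<inter> - V"
    by (rule csupp_subset) (use \<eta>(2,4) in \<open>auto simp: \<psi>1_def csupp_nonzero closed_csupp\<close>)
  have c2: "csupp \<psi>2 \<subseteq> csupp \<psi> \<inter> csupp \<eta>"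
    by (rule csupp_subset) (auto simp: \<psi>2_def csupp_nonzero closed_csupp)
  have 2: "ip ?M u (partial i \<psi>2) = - ip ?M g \<psi>2"
  proof (rule Hk1_ibp[OF \<Omega> u(1) g t2])
    fix \<phi> assume "Csig \<Gamma> \<phi>"
    then show "csupp \<phi> \<inter> csupp \<psi>2 \<inter> frontier \<Omega> = {}"
      using Csig_csupp_disjoint[of \<Gamma> \<phi>] c2 \<eta>(1) by (auto simp: test_def K1_def)
  qed
  have 1: "ip ?M u (partial i \<psi>1) = - ip ?M g \<psi>1"
  proof (rule Hk1_ibp[OF \<Omega> u(2) g t1])
    fix \<phi> assume "Csig (frontier \<Omega> - closure \<Gamma>) \<phi>"
    then show "csupp \<phi> \<inter> csupp \<psi>1 \<inter> frontier \<Omega> = {}"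
      using Csig_csupp_disjoint[of "frontier \<Omega> - closure \<Gamma>" \<phi>] c1 \<eta>(3) by (auto simp: K2_def)
  qed
  have eq: "\<psi> = (\<lambda>x. \<psi>1 x + \<psi>2 x)" by (auto simp: \<psi>1_def \<psi>2_def algebra_simps)
  have l: "l2 ?M u" "l2 ?M g" using u g by (auto simp: Hk_def Hk_mem_def L2_l2)
  have lt: "l2 ?M \<psi>1" "l2 ?M \<psi>2" "l2 ?M (partial i \<psi>1)" "l2 ?M (partial i \<psi>2)"
    using t1 t2 \<Omega>(1) by (auto intro: test_l2 test0_partial)
  have "partial i \<psi> = (\<lambda>x. partial i \<psi>1 x + partial i \<psi>2 x)"
    by (subst eq) (rule partial_smooth_add[OF test0D(1)[OF t1] test0D(1)[OF t2]])
  then show ?thesis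
    using 1 2 l lt by (subst (2) eq) (simp add: ip_add_right)
qed

lemma ip_zero_extension:
  fixes \<Omega> :: "(real^3) set"
  assumes \<Omega>: "open \<Omega>" and u: "l2 (lebesgue_on \<Omega>) u" and U: "l2 lborel U" "\<And>x. x \<notin> \<Omega> \<Longrightarrow> U x = 0"
    "AE x in lebesgue_on \<Omega>. u x = U x" and \<psi>: "l2 lborel \<psi>"
  shows "ip (lebesgue_on \<Omega>) u \<psi> = ip lborel U \<psi>"
proof -
  have m: "U \<in> borel_measurable borel" "\<psi> \<in> borel_measurable borel" using U \<psi> by (auto simp: l2_def)
  have "ip (lebesgue_on \<Omega>) u \<psi> = ip (lebesgue_on \<Omega>) U \<psi>"
    unfolding ip_def using U(3) u lebesgue_on_borel[OF \<Omega> m(1)] lebesgue_on_borel[OF \<Omega> m(2)]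
    by (intro integral_cong_AE) (auto simp: l2_def elim!: eventually_mono)
  also have "\<dots> = ip lborel U \<psi>"
    unfolding ip_def by (rule integral_lebesgue_on(1)[OF \<Omega>]) (use m U(2) in auto)
  finally show ?thesis .
qed

text \<open>Cauchy-Schwarz localised to \<open>A\<close>: the norm of \<open>f\<close> is taken over
  \<open>A\<close> only, and this is the factor that becomes small when \<open>A\<close>
  shrinks.\<close>

lemma n2_indicator_mult:
  assumes f: "l2 M f" and A: "A \<in> sets M" "emeasure M A < \<infinity>" and bd: "\<And>x. x \<notin> A \<Longrightarrow> h x = 0" "\<And>x. \<bar>h x\<bar> \<le> B"
    and h: "h \<in> borel_measurable M" and B: "B \<ge> 0"
  shows "\<bar>ip M f h\<bar> \<le> n2 M (\<lambda>x. indicator A x * f x) * (B * sqrt (measure M A))"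
proof -
  have iA: "l2 M (indicat_real A)" using A by (rule l2_indicator)
  have hA: "\<bar>h x\<bar> \<le> \<bar>B * indicator A x\<bar>" for x using bd[of x] B by (cases "x \<in> A") auto
  have h2: "l2 M h" by (rule l2_bound[OF l2_cmult[OF iA, of B] h]) (use hA in simp)
  have "n2 M h \<le> n2 M (\<lambda>x. B * indicator A x)" by (rule n2_mono[OF l2_cmult[OF iA]]) (use hA in simp)
  also have "\<dots> = B * n2 M (indicator A)" using B by (simp add: n2_cmult)
  also have "n2 M (indicator A) = sqrt (measure M A)" using A by (rule l2_indicator)
  finally have nh: "n2 M h \<le> B * sqrt (measure M A)" .
  have fA: "l2 M (\<lambda>x. indicator A x * f x)"
    by (rule l2_bound[OF f]) (use A f in \<open>auto simp: indicator_def l2_def\<close>)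
  have "(\<lambda>x. f x * h x) = (\<lambda>x. indicator A x * f x * h x)"
  proof
    fix x show "f x * h x = indicator A x * f x * h x" using bd(1)[of x] by (cases "x \<in> A") auto
  qed
  then have "ip M f h = ip M (\<lambda>x. indicator A x * f x) h"
    by (simp add: ip_def)
  then have "\<bar>ip M f h\<bar> \<le> n2 M (\<lambda>x. indicator A x * f x) * n2 M h"
    using Cauchy_Schwarz_ip[OF fA h2] by simp
  also have "\<dots> \<le> n2 M (\<lambda>x. indicator A x * f x) * (B * sqrt (measure M A))"
    by (intro mult_left_mono nh n2_nonneg)
  finally show ?thesis .
qed

text \<open>The interface has codimension two: cutoffs vanishing within distance \<open>\<epsilon>\<close> have gradient of
  order \<open>1/\<epsilon>\<close> on a set of volume of order \<open>\<epsilon>\<^sup>2\<close>, so the commutator term vanishes in the limit.\<close>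
lemma zero_extension_wd:
  assumes \<Omega>: "open \<Omega>" "bounded \<Omega>"
    and \<Gamma>: "\<Gamma> \<subseteq> frontier \<Omega>" "openin (top_of_set (frontier \<Omega>)) \<Gamma>" "curve_like (closure \<Gamma> - \<Gamma>)"
    and u: "Hk \<Omega> 1 \<Gamma> u" "Hk \<Omega> 1 (frontier \<Omega> - closure \<Gamma>) u"
    and g: "L2 \<Omega> g" "wderiv \<Omega> [i] u g"
    and U: "l2 lborel U" "\<And>x. x \<notin> \<Omega> \<Longrightarrow> U x = 0" "AE x in lebesgue_on \<Omega>. u x = U x"
    and G: "l2 lborel G" "\<And>x. x \<notin> \<Omega> \<Longrightarrow> G x = 0" "AE x in lebesgue_on \<Omega>. g x = G x"
  shows "wd i U G"
  unfolding wd_def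
proof (intro allI impI)
  fix \<psi> assume \<psi>: "test0 \<psi>"
  have lu: "l2 (lebesgue_on \<Omega>) u" "l2 (lebesgue_on \<Omega>) g" using u g by (auto simp: Hk_def Hk_mem_def L2_l2)
  have off: "ip lborel U (partial i \<theta>) = - ip lborel G \<theta>"
    if "test0 \<theta>" "csupp \<theta> \<inter> (closure \<Gamma> - \<Gamma>) = {}" for \<theta>
    using ibp_off_interface[OF \<Omega> \<Gamma>(1,2) u g that] ip_zero_extension[OF \<Omega>(1) lu(1) U test0_l2[OF test0_partial[OF that(1)]]]
      ip_zero_extension[OF \<Omega>(1) lu(2) G test0_l2[OF that(1)]] by simp
  obtain B0 where B0: "B0 > 0" "\<And>x. \<bar>\<psi> x\<bar> \<le> B0" using test0_bounded[OF \<psi>] by metis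
  obtain B1 where B1: "B1 > 0" "\<And>x. \<bar>partial i \<psi> x\<bar> \<le> B1" using test0_bounded[OF test0_partial[OF \<psi>]] by metis
  obtain Cg where Cg: "Cg > 0" "\<And>A e. A \<in> sets borel \<Longrightarrow> bounded A \<Longrightarrow> e > 0 \<Longrightarrow>
    \<exists>\<eta>. smooth \<eta> \<and> (\<forall>x. 0 \<le> \<eta> x \<and> \<eta> x \<le> 1) \<and> (\<forall>i x. \<bar>partial i \<eta> x\<bar> \<le> Cg / e)
      \<and> (\<forall>x. ball x e \<subseteq> A \<longrightarrow> \<eta> x = 1) \<and> (\<forall>x. ball x e \<inter> A = {} \<longrightarrow> \<eta> x = 0)"
    using mollified_indicator by metis
  obtain Cc where Cc: "Cc > 0" "\<And>e. 0 < e \<Longrightarrow> e \<le> 1 \<Longrightarrow>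
     \<exists>P. finite P \<and> real (card P) \<le> Cc / e \<and> closure \<Gamma> - \<Gamma> \<subseteq> (\<Union>p\<in>P. ball p e)"
    using \<Gamma>(3) by (auto simp: curve_like_def)
  \<comment> \<open>A ball of radius \<open>3 * e\<close> has volume
    \<open>v * e ^ 3\<close>.\<close>
  define v where "v = 27 * unit_ball_vol 3"
  have v: "v > 0" by (simp add: v_def)
  \<comment> \<open>Collects the constants of both error terms, so that the total error is
    \<open>e1 * Q = r / 2\<close>.\<close>
  define Q where "Q = (B0 * Cg + B1 + B0) * sqrt (Cc * v)"
  have Q: "Q > 0" using B0 B1 Cg Cc v by (simp add: Q_def add_pos_pos)
  let ?X = "ip lborel U (partial i \<psi>) + ip lborel G \<psi>"
  have "\<bar>?X\<bar> \<le> r" if r: "r > 0" for r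
  proof -
    define e1 where "e1 = r / (2 * Q)"
    have e1: "e1 > 0" using r Q by (simp add: e1_def)
    obtain d1 where d1: "d1 > 0" "\<And>A. A \<in> sets lborel \<Longrightarrow> emeasure lborel A < ennreal d1 \<Longrightarrow> n2 lborel (\<lambda>x. indicator A x * U x) \<le> e1"
      using l2_abs_cont[OF U(1) e1] by metis
    obtain d2 where d2: "d2 > 0" "\<And>A. A \<in> sets lborel \<Longrightarrow> emeasure lborel A < ennreal d2 \<Longrightarrow> n2 lborel (\<lambda>x. indicator A x * G x) \<le> e1"
      using l2_abs_cont[OF G(1) e1] by metis
    define d where "d = min d1 d2"
    have d: "d > 0" using d1 d2 by (simp add: d_def)
    \<comment> \<open>The left-hand side bounds the volume of the neighbourhood: at most
      \<open>Cc / e\<close> balls of volume \<open>v * e ^ 3\<close>.\<close>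
    obtain e where e: "0 < e" "e \<le> 1" "Cc * v * e\<^sup>2 < d"
    proof -
      define e where "e = min 1 (d / (2 * (Cc * v)))"
      have *: "0 < e" "e \<le> 1" using d Cc v by (auto simp: e_def)
      have "Cc * v * e\<^sup>2 \<le> Cc * v * e"
        using * Cc v by (intro mult_left_mono) (auto simp: power2_eq_square mult_left_le)
      also have "\<dots> \<le> Cc * v * (d / (2 * (Cc * v)))" using Cc v by (intro mult_left_mono) (auto simp: e_def)
      also have "\<dots> < d" using d Cc v by (simp add: field_simps)
      finally show thesis using * that by blast
    qed
    obtain P where P: "finite P" "real (card P) \<le> Cc / e" "closure \<Gamma> - \<Gamma> \<subseteq> (\<Union>p\<in>P. ball p e)"
      using Cc(2) e by blast
    \<comment> \<open>Mollifying the union of the \<open>2 * e\<close>-balls at scale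
      \<open>e\<close> gives 1 on the \<open>e\<close>-balls, which cover the interface, and 0 off
      the \<open>3 * e\<close>-balls.\<close>
    define A where "A = (\<Union>p\<in>P. ball p (2 * e))"
    define A3 where "A3 = (\<Union>p\<in>P. ball p (3 * e))"
    have oA: "open A" and bA: "bounded A" using P(1) by (auto simp: A_def)
    have oA3: "open A3" by (auto simp: A3_def)
    then have sA3[measurable]: "A3 \<in> sets borel" by auto
    have em: "emeasure lborel A3 \<le> ennreal (Cc * v * e\<^sup>2)"
    proof -
      have "emeasure lborel A3 \<le> (\<Sum>p\<in>P. emeasure lborel (ball p (3 * e)))"
        unfolding A3_def by (rule emeasure_subadditive_finite) (use P in auto)
      also have "\<dots> = (\<Sum>p\<in>P. ennreal (v * e ^ 3))"
        using e by (intro sum.cong) (auto simp: emeasure_ball v_def power_mult_distrib mult_ac)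
      also have "\<dots> = ennreal (real (card P) * (v * e ^ 3))"
        using v e by (subst sum_ennreal) auto
      also have "\<dots> \<le> ennreal (Cc * v * e\<^sup>2)"
      proof (rule ennreal_leI)
        have "real (card P) * (v * e ^ 3) \<le> Cc / e * (v * e ^ 3)"
          using P v e by (intro mult_right_mono) auto
        also have "\<dots> = Cc * v * e\<^sup>2" using e by (simp add: power2_eq_square power3_eq_cube)
        finally show "real (card P) * (v * e ^ 3) \<le> Cc * v * e\<^sup>2" .
      qed
      finally show ?thesis .
    qed
    have small: "emeasure lborel A3 < ennreal d1" "emeasure lborel A3 < ennreal d2"
      using em e(3) d1 d2 Cc v by (auto simp: d_def intro!: le_less_trans[OF em] ennreal_lessI)
    have fin: "emeasure lborel A3 < \<infinity>" using small(1) by (rule order.strict_trans) simp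
    have sq: "sqrt (measure lborel A3) \<le> sqrt (Cc * v) * e"
    proof -
      have "measure lborel A3 \<le> Cc * v * e\<^sup>2"
        using em Cc v by (simp add: measure_def enn2real_leI)
      then have "sqrt (measure lborel A3) \<le> sqrt (Cc * v * e\<^sup>2)" by (rule real_sqrt_le_mono)
      then show ?thesis using e by (simp add: real_sqrt_mult)
    qed
    obtain \<eta> where \<eta>: "smooth \<eta>" "\<And>x. 0 \<le> \<eta> x \<and> \<eta> x \<le> 1" "\<And>i x. \<bar>partial i \<eta> x\<bar> \<le> Cg / e"
      "\<And>x. ball x e \<subseteq> A \<Longrightarrow> \<eta> x = 1" "\<And>x. ball x e \<inter> A = {} \<Longrightarrow> \<eta> x = 0"
      using Cg(2)[OF borel_open[OF oA] bA e(1)] by blast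
    define W where "W = (\<Union>p\<in>P. ball p e)"
    have oW: "open W" by (auto simp: W_def)
    have \<eta>1: "\<eta> x = 1" if xW: "x \<in> W" for x
    proof (rule \<eta>(4), rule subsetI)
      fix y assume "y \<in> ball x e"
      moreover obtain p where "p \<in> P" "dist p x < e" using xW by (auto simp: W_def)
      ultimately have "dist p y < 2 * e" using dist_triangle[of p y x] by simp
      with \<open>p \<in> P\<close> show "y \<in> A" by (auto simp: A_def)
    qed
    have \<eta>0: "\<eta> x = 0" if "x \<notin> A3" for x
    proof (rule \<eta>(5), rule ccontr)
      assume "ball x e \<inter> A \<noteq> {}"
      then obtain y p where "dist x y < e" "p \<in> P" "dist p y < 2 * e" by (auto simp: A_def)
      then have "dist p x < 3 * e" using dist_triangle[of p x y] by (simp add: dist_commute)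
      with \<open>p \<in> P\<close> that show False by (auto simp: A3_def)
    qed
    \<comment> \<open>A point off \<open>A3\<close> may lie on its boundary, where locality says
      nothing; but there \<open>\<eta>\<close> attains its minimum 0.\<close>
    have pz: "partial i \<eta> x = 0" if "x \<notin> A3" for x
    proof -
      have "((\<lambda>t. \<eta> (x + t *\<^sub>R axis i 1)) has_real_derivative partial i \<eta> (x + 0 *\<^sub>R axis i 1)) (at 0)"
        by (rule DERIV_axis[OF \<eta>(1)])
      then have "partial i \<eta> (x + 0 *\<^sub>R axis i 1) = 0"
        by (rule DERIV_local_min[where d = 1]) (use \<eta>0[OF that] \<eta>(2) in auto)
      then show ?thesis by simp
    qed
    define \<theta> where "\<theta> x = (1 - \<eta> x) * \<psi> x" for x
    have t\<theta>: "test0 \<theta>" unfolding \<theta>_def by (intro test0_mult smooth_diff smooth_const \<eta>(1) \<psi>)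
    have cW: "csupp \<theta> \<subseteq> - W" by (rule csupp_subset) (use oW \<eta>1 in \<open>auto simp: \<theta>_def\<close>)
    have W\<Gamma>: "closure \<Gamma> - \<Gamma> \<subseteq> W" using P(3) by (simp add: W_def)
    have off\<theta>: "ip lborel U (partial i \<theta>) = - ip lborel G \<theta>"
      by (rule off[OF t\<theta>]) (use cW W\<Gamma> in blast)
    \<comment> \<open>The derivative of the removed part \<open>\<eta> * \<psi>\<close>; its first
      summand is the commutator of size \<open>1/e\<close>.\<close>
    define h where "h x = partial i \<eta> x * \<psi> x + \<eta> x * partial i \<psi> x" for x
    define k where "k x = \<eta> x * \<psi> x" for x
    have th: "test0 h" unfolding h_def
      by (intro test0_add test0_mult smooth_partial \<eta>(1) \<psi> test0_partial)
    have tk: "test0 k" unfolding k_def by (intro test0_mult \<eta>(1) \<psi>)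
    have \<theta>k: "\<theta> = (\<lambda>x. \<psi> x - k x)" by (auto simp: \<theta>_def k_def algebra_simps)
    have p\<theta>: "partial i \<theta> = (\<lambda>x. partial i \<psi> x - h x)"
      unfolding \<theta>k by (subst partial_smooth_diff[OF test0D(1)[OF \<psi>] test0D(1)[OF tk]])
        (simp add: k_def[abs_def] h_def partial_smooth_mult[OF \<eta>(1) test0D(1)[OF \<psi>]] fun_eq_iff)
    have X: "?X = ip lborel U h + ip lborel G k"
    proof -
      have "ip lborel U (partial i \<theta>) = ip lborel U (partial i \<psi>) - ip lborel U h"
        unfolding p\<theta> by (intro ip_diff_right test0_l2 test0_partial \<psi> th U(1))
      moreover have "ip lborel G \<theta> = ip lborel G \<psi> - ip lborel G k"
        unfolding \<theta>k by (intro ip_diff_right test0_l2 \<psi> tk G(1))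
      ultimately show ?thesis using off\<theta> by simp
    qed
    have hb: "\<bar>h x\<bar> \<le> Cg / e * B0 + B1" for x
    proof -
      have "\<bar>h x\<bar> \<le> \<bar>partial i \<eta> x\<bar> * \<bar>\<psi> x\<bar> + \<bar>\<eta> x\<bar> * \<bar>partial i \<psi> x\<bar>"
        unfolding h_def by (metis abs_mult abs_triangle_ineq)
      also have "\<dots> \<le> Cg / e * B0 + 1 * B1"
        using \<eta>(2)[of x] Cg e by (intro add_mono mult_mono \<eta>(3) B0 B1) auto
      finally show ?thesis by simp
    qed
    have kb: "\<bar>k x\<bar> \<le> B0" for x
    proof -
      have "\<bar>\<eta> x\<bar> * \<bar>\<psi> x\<bar> \<le> 1 * B0" using \<eta>(2)[of x] by (intro mult_mono B0) auto
      then show ?thesis by (simp add: k_def abs_mult)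
    qed
    have nU: "n2 lborel (\<lambda>x. indicator A3 x * U x) \<le> e1" and nG: "n2 lborel (\<lambda>x. indicator A3 x * G x) \<le> e1"
      using d1(2) d2(2) small sA3 by auto
    have "\<bar>ip lborel U h\<bar> \<le> n2 lborel (\<lambda>x. indicator A3 x * U x) * ((Cg / e * B0 + B1) * sqrt (measure lborel A3))"
    proof (rule n2_indicator_mult[OF U(1) _ fin _ hb])
      show "h x = 0" if "x \<notin> A3" for x using \<eta>0[OF that] pz[OF that] by (simp add: h_def)
    qed (use sA3 test0_borel[OF th] Cg e B0 B1 in auto)
    also have "\<dots> \<le> e1 * ((Cg / e * B0 + B1) * (sqrt (Cc * v) * e))"
      using Cg e B0 B1 e1 Cc v by (intro mult_mono nU sq order_refl) (auto simp: n2_nonneg)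
    \<comment> \<open>The \<open>e\<close> from the square root of the volume cancels the
      \<open>1/e\<close> of the gradient. This leaves a bounded factor only; the smallness is that
      of \<open>e1\<close>, the norm of \<open>U\<close> near the interface.\<close>
    also have "\<dots> \<le> e1 * ((Cg * B0 + B1) * sqrt (Cc * v))"
    proof (rule mult_left_mono)
      have "(Cg / e * B0 + B1) * (sqrt (Cc * v) * e) = (Cg * B0 + B1 * e) * sqrt (Cc * v)"
        using e by (simp add: field_simps)
      also have "\<dots> \<le> (Cg * B0 + B1) * sqrt (Cc * v)"
        using e B1 Cc v by (intro mult_right_mono add_left_mono) (auto simp: mult_left_le)
      finally show "(Cg / e * B0 + B1) * (sqrt (Cc * v) * e) \<le> (Cg * B0 + B1) * sqrt (Cc * v)" .
    qed (use e1 in simp)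
    finally have 1: "\<bar>ip lborel U h\<bar> \<le> e1 * ((Cg * B0 + B1) * sqrt (Cc * v))" .
    have "\<bar>ip lborel G k\<bar> \<le> n2 lborel (\<lambda>x. indicator A3 x * G x) * (B0 * sqrt (measure lborel A3))"
    proof (rule n2_indicator_mult[OF G(1) _ fin _ kb])
      show "k x = 0" if "x \<notin> A3" for x using \<eta>0[OF that] by (simp add: k_def)
    qed (use sA3 test0_borel[OF tk] B0 in auto)
    also have "\<dots> \<le> e1 * (B0 * (sqrt (Cc * v) * 1))"
    proof (intro mult_mono nG order_refl)
      show "sqrt (measure lborel A3) \<le> sqrt (Cc * v) * 1"
        by (rule order.trans[OF sq]) (use e Cc v in \<open>auto intro!: mult_left_mono\<close>)
    qed (use B0 e1 Cc v in \<open>auto simp: n2_nonneg\<close>)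
    finally have 2: "\<bar>ip lborel G k\<bar> \<le> e1 * (B0 * sqrt (Cc * v))" by simp
    have "\<bar>?X\<bar> \<le> e1 * ((Cg * B0 + B1) * sqrt (Cc * v)) + e1 * (B0 * sqrt (Cc * v))"
      unfolding X using 1 2 by linarith
    also have "\<dots> = e1 * Q" by (simp add: Q_def algebra_simps)
    also have "\<dots> = r / 2" using Q by (simp add: e1_def)
    finally show ?thesis using r by simp
  qed
  then have "\<bar>?X\<bar> \<le> 0" by (rule field_le_epsilon) simp
  then show "ip lborel U (partial i \<psi>) = - ip lborel G \<psi>" by simp
qed

subsection \<open>Density of test functions\<close>

text \<open>The zero boundary condition is encoded by vanishing off \<open>A\<close>, as functions on $\mathbb{R}^3$.\<close>
fun Hk0 :: "(real^3) set \<Rightarrow> nat \<Rightarrow> (real^3 \<Rightarrow> real) \<Rightarrow> bool" where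
  "Hk0 A 0 f = (l2 lborel f \<and> (\<forall>x. x \<notin> A \<longrightarrow> f x = 0))"
| "Hk0 A (Suc k) f = (l2 lborel f \<and> (\<forall>x. x \<notin> A \<longrightarrow> f x = 0) \<and> (\<forall>i. \<exists>g. wd i f g \<and> Hk0 A k g))"

lemma Hk0_l2: "Hk0 A k f \<Longrightarrow> l2 lborel f" and Hk0_zero: "Hk0 A k f \<Longrightarrow> x \<notin> A \<Longrightarrow> f x = 0"
  by (cases k; simp)+

lemma Hk0_SucD: "Hk0 A (Suc k) f \<Longrightarrow> Hk0 A k f"
proof (induction k arbitrary: f)
  case (Suc k)
  have "\<forall>i. \<exists>g. wd i f g \<and> Hk0 A (Suc k) g" using Suc.prems unfolding Hk0.simps(2)[of A "Suc k" f] by blast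
  then have "\<forall>i. \<exists>g. wd i f g \<and> Hk0 A k g" using Suc.IH by blast
  moreover have "l2 lborel f \<and> (\<forall>x. x \<notin> A \<longrightarrow> f x = 0)" using Suc.prems by simp
  ultimately show ?case unfolding Hk0.simps(2)[of A k f] by blast
qed simp

lemma Hk0_mono: "Hk0 A k f \<Longrightarrow> A \<subseteq> B \<Longrightarrow> Hk0 B k f"
proof (induction k arbitrary: f)
  case (Suc k)
  then have "\<exists>g. wd i f g \<and> Hk0 B k g" for i by (metis Hk0.simps(2))
  with Suc.prems show ?case by auto
qed auto

lemma wd_add:
  assumes "l2 lborel f" "l2 lborel f'" "l2 lborel g" "l2 lborel g'" "wd i f g" "wd i f' g'"
  shows "wd i (\<lambda>x. f x + f' x) (\<lambda>x. g x + g' x)"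
  unfolding wd_def
proof (intro allI impI)
  fix \<phi> assume t: "test0 \<phi>"
  show "ip lborel (\<lambda>x. f x + f' x) (partial i \<phi>) = - ip lborel (\<lambda>x. g x + g' x) \<phi>"
    using assms t test0_l2[OF t] test0_l2[OF test0_partial[OF t, of i]] by (simp add: ip_add_left wd_def)
qed

lemma Hk0_add: "Hk0 A k f \<Longrightarrow> Hk0 A k g \<Longrightarrow> Hk0 A k (\<lambda>x. f x + g x)"
proof (induction k arbitrary: f g)
  case (Suc k)
  have "\<exists>h. wd i (\<lambda>x. f x + g x) h \<and> Hk0 A k h" for i
  proof -
    obtain f' where f': "wd i f f'" "Hk0 A k f'" using Suc.prems(1) by (meson Hk0.simps(2))
    obtain g' where g': "wd i g g'" "Hk0 A k g'" using Suc.prems(2) by (meson Hk0.simps(2))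
    show ?thesis
      using wd_add[OF Hk0_l2 Hk0_l2 Hk0_l2 Hk0_l2 f'(1) g'(1)] Suc f' g' by blast
  qed
  with Suc.prems show ?case by (auto intro: l2_add)
qed (auto intro: l2_add)

text \<open>Multipliers that include both a cutoff and its complement to 1, the latter not compactly
  supported. The class is stable under partial derivatives, which the induction in
  \<open>Hk0_mult\<close> requires.\<close>

definition tame :: "(real^3 \<Rightarrow> real) \<Rightarrow> bool" where
  "tame \<eta> \<longleftrightarrow> smooth \<eta> \<and> (\<exists>B. \<forall>x. \<bar>\<eta> x\<bar> \<le> B) \<and> (\<forall>i. test0 (partial i \<eta>))"

lemma tame_test0: "test0 \<eta> \<Longrightarrow> tame \<eta>"
  using test0_bounded[of \<eta>] by (auto simp: tame_def test0D test0_partial)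

lemma tame_compl:
  assumes "test0 \<eta>"
  shows "tame (\<lambda>x. 1 - \<eta> x)"
proof -
  obtain B where B: "B > 0" "\<And>x. \<bar>\<eta> x\<bar> \<le> B" using test0_bounded[OF assms] by metis
  have "\<bar>1 - \<eta> x\<bar> \<le> 1 + B" for x using B(2)[of x] by linarith
  moreover have "partial i (\<lambda>x. 1 - \<eta> x) = (\<lambda>x. -1 * partial i \<eta> x)" for i
    using test0D[OF assms] by (simp add: partial_smooth_diff smooth_const partial_const)
  moreover have "test0 (\<lambda>x. -1 * partial i \<eta> x)" for i
    by (intro test0_mult smooth_const test0_partial assms)
  ultimately show ?thesis
    using test0D[OF assms] by (auto simp: tame_def smooth_diff smooth_const)
qed

text \<open>The multiplier is moved onto the test function, where the classical product rule
  applies.\<close>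

lemma wd_mult:
  assumes f: "l2 lborel f" "l2 lborel g" "wd i f g" and \<eta>: "tame \<eta>"
  shows "wd i (\<lambda>x. \<eta> x * f x) (\<lambda>x. partial i \<eta> x * f x + \<eta> x * g x)"
  unfolding wd_def
proof (intro allI impI)
  fix \<phi> assume t: "test0 \<phi>"
  have s\<eta>: "smooth \<eta>" using \<eta> by (simp add: tame_def)
  have t1: "test0 (\<lambda>x. \<eta> x * \<phi> x)" by (intro test0_mult s\<eta> t)
  have t2: "test0 (\<lambda>x. partial i \<eta> x * \<phi> x)" by (intro test0_mult smooth_partial s\<eta> t)
  have t3: "test0 (\<lambda>x. \<eta> x * partial i \<phi> x)" by (intro test0_mult s\<eta> t test0_partial)
  have "ip lborel f (partial i (\<lambda>x. \<eta> x * \<phi> x)) = - ip lborel g (\<lambda>x. \<eta> x * \<phi> x)"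
    using f(3) t1 by (simp add: wd_def)
  then have "ip lborel f (\<lambda>x. partial i \<eta> x * \<phi> x + \<eta> x * partial i \<phi> x) = - ip lborel g (\<lambda>x. \<eta> x * \<phi> x)"
    unfolding partial_smooth_mult[OF s\<eta> test0D(1)[OF t]] .
  then have "ip lborel f (\<lambda>x. \<eta> x * partial i \<phi> x) = - (ip lborel f (\<lambda>x. partial i \<eta> x * \<phi> x) + ip lborel g (\<lambda>x. \<eta> x * \<phi> x))"
    using f t2 t3 by (simp add: ip_add_right test0_l2)
  moreover have "ip lborel (\<lambda>x. \<eta> x * f x) (partial i \<phi>) = ip lborel f (\<lambda>x. \<eta> x * partial i \<phi> x)"
    by (simp add: ip_def mult_ac)
  moreover have "ip lborel (\<lambda>x. partial i \<eta> x * f x + \<eta> x * g x) \<phi>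
      = ip lborel f (\<lambda>x. partial i \<eta> x * \<phi> x) + ip lborel g (\<lambda>x. \<eta> x * \<phi> x)"
  proof -
    have "integrable lborel (\<lambda>x. f x * (partial i \<eta> x * \<phi> x))" "integrable lborel (\<lambda>x. g x * (\<eta> x * \<phi> x))"
      using f t1 t2 by (auto intro!: l2_mult test0_l2)
    then show ?thesis unfolding ip_def
      by (subst Bochner_Integration.integral_add[symmetric]) (auto simp: algebra_simps)
  qed
  ultimately show "ip lborel (\<lambda>x. \<eta> x * f x) (partial i \<phi>) = - ip lborel (\<lambda>x. partial i \<eta> x * f x + \<eta> x * g x) \<phi>"
    by simp
qed

lemma tame_l2_mult:
  assumes "tame \<eta>" "l2 lborel f"
  shows "l2 lborel (\<lambda>x. \<eta> x * f x)"
proof -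
  obtain B where "\<And>x. \<bar>\<eta> x\<bar> \<le> B" using assms(1) by (auto simp: tame_def)
  moreover have "\<eta> \<in> borel_measurable lborel" using assms(1) smooth_borel by (auto simp: tame_def)
  ultimately show ?thesis using l2_bounded_mult[OF assms(2)] by blast
qed

text \<open>Induction with the multiplier generalised, since the product rule produces
  \<open>f\<close> times a derivative of \<open>\<eta>\<close>. Closedness of \<open>B\<close> makes
  that derivative vanish off \<open>B\<close> too.\<close>

lemma Hk0_mult:
  assumes "Hk0 A k f" "tame \<eta>" "closed B" "\<And>x. x \<notin> B \<Longrightarrow> \<eta> x = 0"
  shows "Hk0 (A \<inter> B) k (\<lambda>x. \<eta> x * f x)"
  using assms
proof (induction k arbitrary: f \<eta>)
  case 0
  then show ?case by (auto intro: tame_l2_mult)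
next
  case (Suc k)
  have fA: "x \<notin> A \<Longrightarrow> f x = 0" for x using Suc.prems(1) by simp
  have "\<exists>h. wd i (\<lambda>x. \<eta> x * f x) h \<and> Hk0 (A \<inter> B) k h" for i
  proof -
    obtain g where g: "wd i f g" "Hk0 A k g" using Suc.prems(1) by (meson Hk0.simps(2))
    have z: "partial i \<eta> x = 0" if "x \<notin> B" for x
    proof -
      have "partial i \<eta> x = partial i (\<lambda>_. 0) x"
        by (rule partial_cong_open[of "- B"]) (use that Suc.prems in auto)
      then show ?thesis by (simp add: partial_const)
    qed
    have tp: "tame (partial i \<eta>)" using Suc.prems(2) tame_test0 by (auto simp: tame_def)
    have "Hk0 (A \<inter> B) k (\<lambda>x. partial i \<eta> x * f x + \<eta> x * g x)"
      by (intro Hk0_add Suc.IH Hk0_SucD[OF Suc.prems(1)] tp Suc.prems g(2) z)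
    then show ?thesis
      using wd_mult[OF Hk0_l2[OF Suc.prems(1)] Hk0_l2[OF g(2)] g(1) Suc.prems(2)] by blast
  qed
  moreover have "l2 lborel (\<lambda>x. \<eta> x * f x)"
    using tame_l2_mult[OF Suc.prems(2) Hk0_l2[OF Suc.prems(1)]] .
  moreover have "\<forall>x. x \<notin> A \<inter> B \<longrightarrow> \<eta> x * f x = 0" using fA Suc.prems(4) by auto
  ultimately show ?case by simp
qed

text \<open>The recursion mirrors \<open>Hk0\<close>: classical derivatives of the first function
  are compared with weak derivatives of the second along every chain of indices, the latter being
  quantified existentially rather than chosen.\<close>

fun near :: "nat \<Rightarrow> (real^3 \<Rightarrow> real) \<Rightarrow> (real^3 \<Rightarrow> real) \<Rightarrow> real \<Rightarrow> bool" where
  "near 0 \<phi> f e = (n2 lborel (\<lambda>x. \<phi> x - f x) \<le> e)"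
| "near (Suc k) \<phi> f e = (n2 lborel (\<lambda>x. \<phi> x - f x) \<le> e \<and>
     (\<forall>i. \<exists>g. l2 lborel g \<and> wd i f g \<and> near k (partial i \<phi>) g e))"

lemma near_add:
  "near k \<phi> f e \<Longrightarrow> near k \<psi> g e' \<Longrightarrow> test0 \<phi> \<Longrightarrow> test0 \<psi> \<Longrightarrow> l2 lborel f \<Longrightarrow> l2 lborel g \<Longrightarrow>
    near k (\<lambda>x. \<phi> x + \<psi> x) (\<lambda>x. f x + g x) (e + e')"
proof (induction k arbitrary: \<phi> \<psi> f g)
  have base: "n2 lborel (\<lambda>x. \<phi> x + \<psi> x - (f x + g x)) \<le> e + e'"
    if "n2 lborel (\<lambda>x. \<phi> x - f x) \<le> e" "n2 lborel (\<lambda>x. \<psi> x - g x) \<le> e'"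
      "test0 \<phi>" "test0 \<psi>" "l2 lborel f" "l2 lborel g" for \<phi> \<psi> f g
  proof -
    have "n2 lborel (\<lambda>x. (\<phi> x - f x) + (\<psi> x - g x)) \<le> n2 lborel (\<lambda>x. \<phi> x - f x) + n2 lborel (\<lambda>x. \<psi> x - g x)"
      using that by (intro n2_add_le l2_diff) (auto intro: test0_l2)
    then show ?thesis using that by (simp add: algebra_simps)
  qed
  {
    case 0
    then show ?case using base by simp
  next
    case (Suc k)
    have "\<exists>h. l2 lborel h \<and> wd i (\<lambda>x. f x + g x) h \<and> near k (partial i (\<lambda>x. \<phi> x + \<psi> x)) h (e + e')" for i
    proof -
      obtain f' where f': "l2 lborel f'" "wd i f f'" "near k (partial i \<phi>) f' e" using Suc.prems(1) by auto
      obtain g' where g': "l2 lborel g'" "wd i g g'" "near k (partial i \<psi>) g' e'" using Suc.prems(2) by auto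
      have "near k (\<lambda>x. partial i \<phi> x + partial i \<psi> x) (\<lambda>x. f' x + g' x) (e + e')"
        using Suc.prems f' g' by (intro Suc.IH test0_partial)
      moreover have "partial i (\<lambda>x. \<phi> x + \<psi> x) = (\<lambda>x. partial i \<phi> x + partial i \<psi> x)"
        using Suc.prems by (intro partial_smooth_add test0D)
      ultimately show ?thesis
        using wd_add[OF Suc.prems(5,6) f'(1) g'(1) f'(2) g'(2)] l2_add[OF f'(1) g'(1)] by auto
    qed
    with Suc.prems base show ?case by simp
  }
qed

definition approximable :: "(real^3) set \<Rightarrow> nat \<Rightarrow> (real^3 \<Rightarrow> real) \<Rightarrow> bool" where
  "approximable \<Omega> k f \<longleftrightarrow> l2 lborel f \<and> (\<forall>e>0. \<exists>\<phi>. test \<Omega> \<phi> \<and> near k \<phi> f e)"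

lemma approximable_add:
  assumes "approximable \<Omega> k f" "approximable \<Omega> k g"
  shows "approximable \<Omega> k (\<lambda>x. f x + g x)"
  unfolding approximable_def
proof (intro conjI allI impI)
  show "l2 lborel (\<lambda>x. f x + g x)" using assms by (auto simp: approximable_def intro: l2_add)
  fix e :: real assume "e > 0"
  then have "e/2 > 0" by simp
  then obtain \<phi> \<psi> where "test \<Omega> \<phi>" "near k \<phi> f (e/2)" "test \<Omega> \<psi>" "near k \<psi> g (e/2)"
    using assms unfolding approximable_def by meson
  then have "test \<Omega> (\<lambda>x. \<phi> x + \<psi> x)" "near k (\<lambda>x. \<phi> x + \<psi> x) (\<lambda>x. f x + g x) (e/2 + e/2)"
    using assms near_add[of k \<phi> f "e/2" \<psi> g "e/2"] test_add[of \<Omega> \<phi> \<psi>]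
    by (auto simp: test_iff approximable_def)
  then show "\<exists>\<phi>. test \<Omega> \<phi> \<and> near k \<phi> (\<lambda>x. f x + g x) e" by auto
qed

lemma near_zero: "e \<ge> 0 \<Longrightarrow> near k (\<lambda>x. 0) (\<lambda>x. 0) e"
proof (induction k)
  case (Suc k)
  have "wd i (\<lambda>x. 0) (\<lambda>x. 0)" for i by (simp add: wd_def ip_def)
  with Suc show ?case by (auto simp: n2_def partial_const l2_zero intro!: exI[of _ "\<lambda>x. 0"])
qed (simp add: n2_def)

lemma integrable_shift: "integrable lborel f \<Longrightarrow> integrable lborel (\<lambda>x. f (x + a))" for f :: "real^3 \<Rightarrow> real"
  using lborel_integral_shift(2)[of f a] borel_measurable_integrable[of lborel f] by simp

text \<open>The weak derivative is tested with the reflected and shifted kernel; the sign from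
  reflection cancels the one from integration by parts.\<close>

lemma conv_shift_partial:
  assumes f: "integrable lborel f" "l2 lborel f" and g: "l2 lborel g" "wd i f g" and \<rho>: "test0 \<rho>"
  shows "conv (\<lambda>y. f (y + a)) (partial i \<rho>) = conv (\<lambda>y. g (y + a)) \<rho>"
proof
  fix x
  have m[measurable]: "f \<in> borel_measurable borel" "g \<in> borel_measurable borel" "\<rho> \<in> borel_measurable borel"
    "partial i \<rho> \<in> borel_measurable borel"
    using f g \<rho> test0_borel test0_partial by (auto simp: l2_def)
  let ?\<theta> = "\<lambda>y. \<rho> ((x + a) + (-1) *\<^sub>R y)"
  have t: "test0 ?\<theta>" by (rule test0_affine[OF \<rho>]) simp
  have p: "partial i ?\<theta> = (\<lambda>y. -1 * partial i \<rho> ((x + a) + (-1) *\<^sub>R y))"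
    by (rule partial_smooth_affine[OF test0D(1)[OF \<rho>]])
  have "conv (\<lambda>y. f (y + a)) (partial i \<rho>) x = (\<integral>y. f y * partial i \<rho> (x + a - y) \<partial>lborel)"
    using lborel_integral_shift(1)[of "\<lambda>y. f y * partial i \<rho> (x + a - y)" a] by (simp add: conv_def)
  also have "\<dots> = - ip lborel f (\<lambda>y. -1 * partial i \<rho> ((x + a) + (-1) *\<^sub>R y))" by (simp add: ip_def)
  also have "\<dots> = - ip lborel f (partial i ?\<theta>)" by (simp only: p)
  also have "\<dots> = ip lborel g ?\<theta>" using g(2) t by (simp add: wd_def)
  also have "\<dots> = (\<integral>y. g y * \<rho> (x + a - y) \<partial>lborel)" by (simp add: ip_def)
  also have "\<dots> = conv (\<lambda>y. g (y + a)) \<rho> x"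
    using lborel_integral_shift(1)[of "\<lambda>y. g y * \<rho> (x + a - y)" a] by (simp add: conv_def)
  finally show "conv (\<lambda>y. f (y + a)) (partial i \<rho>) x = conv (\<lambda>y. g (y + a)) \<rho> x" .
qed

text \<open>Shift and mollification are controlled by a common threshold but otherwise
  independently. This is essential later, where the mollification radius is chosen after the shift
  and depends on it.\<close>

lemma near_conv_shift:
  assumes "Hk0 A k f" "bounded A" "e > 0"
  shows "\<exists>d>0. \<forall>a \<rho>. norm a < d \<longrightarrow> 0 < \<rho> \<longrightarrow> \<rho> < d \<longrightarrow> near k (conv (\<lambda>y. f (y + a)) (moll \<rho>)) f e"
  using assms(1)
proof (induction k arbitrary: f)
  have base: "\<exists>d>0. \<forall>a \<rho>. norm a < d \<longrightarrow> 0 < \<rho> \<longrightarrow> \<rho> < d \<longrightarrow>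
      n2 lborel (\<lambda>x. conv (\<lambda>y. f (y + a)) (moll \<rho>) x - f x) \<le> e"
    if f2: "l2 lborel f" and z: "\<And>x. x \<notin> A \<Longrightarrow> f x = 0" for f
  proof -
    have fi: "integrable lborel f" by (rule l2_integrable[OF f2 assms(2) z])
    obtain d where d: "d > 0" "\<And>z. norm z < d \<Longrightarrow> n2 lborel (\<lambda>x. f (x + z) - f x) < e/2"
      using L2_shift_cont[OF fi f2, of "e/2"] assms(3) by auto
    show ?thesis
    proof (intro exI conjI allI impI)
      show "d > 0" by (rule d)
      fix a :: "real^3" and \<rho> :: real assume a: "norm a < d" and \<rho>: "0 < \<rho>" "\<rho> < d"
      let ?f = "\<lambda>y. f (y + a)"
      have fa: "integrable lborel ?f" "l2 lborel ?f" using integrable_shift[OF fi] l2_shift(1)[OF f2] by auto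
      have "n2 lborel (\<lambda>x. ?f (x + z) - ?f x) \<le> e/2" if "norm z < \<rho>" for z
      proof -
        have "n2 lborel (\<lambda>x. f (x + a + z) - f (x + a)) = n2 lborel (\<lambda>x. f (x + z) - f x)"
          using l2_shift(2)[OF l2_diff[OF l2_shift(1)[OF f2, of z] f2], of a] by simp
        then show ?thesis using d(2)[of z] that \<rho> by (simp add: add_ac)
      qed
      from moll_error[OF fa \<rho>(1) this]
      have m: "l2 lborel (\<lambda>x. conv ?f (moll \<rho>) x - ?f x)" "n2 lborel (\<lambda>x. conv ?f (moll \<rho>) x - ?f x) \<le> e/2" by auto
      have "n2 lborel (\<lambda>x. (conv ?f (moll \<rho>) x - ?f x) + (?f x - f x)) \<le> e/2 + e/2"
        using n2_add_le[OF m(1) l2_diff[OF fa(2) f2]] m(2) d(2)[OF a] by linarith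
      then show "n2 lborel (\<lambda>x. conv ?f (moll \<rho>) x - f x) \<le> e" by simp
    qed
  qed
  {
    case 0
    then show ?case using base by simp
  next
    case (Suc k)
    have "\<forall>i. \<exists>g. wd i f g \<and> Hk0 A k g" using Suc.prems by simp
    then obtain g where g: "\<And>i. wd i f (g i)" "\<And>i. Hk0 A k (g i)" by metis
    have "\<forall>i. \<exists>d>0. \<forall>a \<rho>. norm a < d \<longrightarrow> 0 < \<rho> \<longrightarrow> \<rho> < d \<longrightarrow> near k (conv (\<lambda>y. g i (y + a)) (moll \<rho>)) (g i) e"
      using Suc.IH g(2) by blast
    then obtain d where d: "\<And>i. d i > 0"
      "\<And>i a \<rho>. norm a < d i \<Longrightarrow> 0 < \<rho> \<Longrightarrow> \<rho> < d i \<Longrightarrow> near k (conv (\<lambda>y. g i (y + a)) (moll \<rho>)) (g i) e"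
      by metis
    obtain d0 where d0: "d0 > 0" "\<And>a \<rho>. norm a < d0 \<Longrightarrow> 0 < \<rho> \<Longrightarrow> \<rho> < d0 \<Longrightarrow>
      n2 lborel (\<lambda>x. conv (\<lambda>y. f (y + a)) (moll \<rho>) x - f x) \<le> e"
      using base[of f] Suc.prems by auto
    \<comment> \<open>Each of the three partial derivatives has its own threshold from the induction
      hypothesis.\<close>
    define m where "m = min d0 (Min (range d))"
    have m: "m > 0" "m \<le> d0" "\<And>i. m \<le> d i" using d0 d(1) by (auto simp: m_def min_le_iff_disj)
    have fi: "integrable lborel f"
      by (rule l2_integrable[OF Hk0_l2[OF Suc.prems] assms(2) Hk0_zero[OF Suc.prems]])
    show ?case
    proof (intro exI conjI allI impI)
      show "m > 0" by (rule m)
      fix a :: "real^3" and \<rho> :: real assume a: "norm a < m" and \<rho>: "0 < \<rho>" "\<rho> < m"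
      have "partial i (conv (\<lambda>y. f (y + a)) (moll \<rho>)) = conv (\<lambda>y. g i (y + a)) (moll \<rho>)" for i
        using partial_conv[OF integrable_shift[OF fi] moll_test0[OF \<rho>(1)]]
          conv_shift_partial[OF fi Hk0_l2[OF Suc.prems] Hk0_l2[OF g(2)] g(1) moll_test0[OF \<rho>(1)]] by simp
      moreover have "near k (conv (\<lambda>y. g i (y + a)) (moll \<rho>)) (g i) e" for i
        using m(3)[of i] a \<rho> by (intro d) auto
      ultimately show "near (Suc k) (conv (\<lambda>y. f (y + a)) (moll \<rho>)) f e"
        using g(1) Hk0_l2[OF g(2)] d0(2)[of a \<rho>] a \<rho> m(2) by (auto intro!: exI[of _ "g _"])
    qed
  }
qed

text \<open>Shifting along \<open>w\<close> moves the support into the domain with room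
  \<open>\<epsilon>\<close> to spare, and a mollification finer than this room keeps it there; both
  operations are close to the identity in all derivatives.\<close>

lemma approximable_local:
  assumes \<Omega>: "open \<Omega>" "bounded \<Omega>" and p: "push_in \<Omega> x r w" and f: "Hk0 (\<Omega> \<inter> ball x r) k f"
  shows "approximable \<Omega> k f"
  unfolding approximable_def
proof (intro conjI allI impI)
  show f2: "l2 lborel f" using f by (rule Hk0_l2)
  have b: "bounded (\<Omega> \<inter> ball x r)" using \<Omega>(2) by (simp add: bounded_Int)
  have fi: "integrable lborel f" by (rule l2_integrable[OF f2 b Hk0_zero[OF f]])
  fix e :: real assume e: "e > 0"
  obtain d where d: "d > 0" "\<And>a \<rho>. norm a < d \<Longrightarrow> 0 < \<rho> \<Longrightarrow> \<rho> < d \<Longrightarrow> near k (conv (\<lambda>y. f (y + a)) (moll \<rho>)) f e"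
    using near_conv_shift[OF f b e] by blast
  obtain t0 where t0: "t0 > 0" "\<And>t. 0 < t \<Longrightarrow> t < t0 \<Longrightarrow> \<exists>e>0. \<forall>z\<in>\<Omega> \<inter> ball x r. ball (z + t *\<^sub>R w) e \<subseteq> \<Omega>"
    using p by (auto simp: push_in_def)
  \<comment> \<open>Admissible for \<open>push_in\<close> and short enough for the shift to stay
    below \<open>d\<close>; the added 1 covers the case \<open>w = 0\<close>.\<close>
  define t where "t = min (t0 / 2) (d / (2 * (norm w + 1)))"
  have nw: "norm w + 1 > 0" by (simp add: add_nonneg_pos)
  have t: "0 < t" "t < t0" using t0 d nw by (auto simp: t_def min_less_iff_disj)
  have "norm (t *\<^sub>R w) \<le> t * (norm w + 1)" using t by (simp add: algebra_simps)
  also have "\<dots> \<le> d / (2 * (norm w + 1)) * (norm w + 1)" using nw by (intro mult_right_mono) (auto simp: t_def)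
  also have "\<dots> = d / 2"
  proof -
    have "d / (2 * c) * c = d / 2" if "c \<noteq> 0" for c :: real using that by simp
    then show ?thesis using nw by (metis less_irrefl)
  qed
  also have "\<dots> < d" using d by simp
  finally have tw: "norm (- (t *\<^sub>R w)) < d" by simp
  obtain \<epsilon> where \<epsilon>: "\<epsilon> > 0" "\<And>z. z \<in> \<Omega> \<inter> ball x r \<Longrightarrow> ball (z + t *\<^sub>R w) \<epsilon> \<subseteq> \<Omega>" using t0(2)[OF t] by blast
  \<comment> \<open>Half of the room goes to the radius of the mollifier, the other half to passing
    to the closure of the support.\<close>
  define \<rho> where "\<rho> = min d \<epsilon> / 2"
  have \<rho>: "0 < \<rho>" "\<rho> < d" "2 * \<rho> \<le> \<epsilon>" using d \<epsilon> by (auto simp: \<rho>_def)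
  define \<phi> where "\<phi> = conv (\<lambda>y. f (y + - (t *\<^sub>R w))) (moll \<rho>)"
  have sm: "smooth \<phi>" unfolding \<phi>_def
    by (rule conv_smooth[OF integrable_shift[OF fi] moll_test0[OF \<rho>(1)]])
  have sub: "csupp \<phi> \<subseteq> \<Omega>"
  proof
    fix y assume "y \<in> csupp \<phi>"
    then have "\<forall>e>0. \<exists>y'\<in>{x. \<phi> x \<noteq> 0}. dist y' y < e"
      unfolding csupp_def closure_approachable .
    then obtain y' where y': "\<phi> y' \<noteq> 0" "dist y' y < \<rho>" using \<rho>(1) by auto
    have "\<exists>z. f (z + - (t *\<^sub>R w)) \<noteq> 0 \<and> moll \<rho> (y' - z) \<noteq> 0"
    proof (rule ccontr)
      assume "\<not> ?thesis"
      then have "\<phi> y' = 0" unfolding \<phi>_def by (intro conv_eq_0) blast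
      with y'(1) show False ..
    qed
    then obtain z where z: "f (z + - (t *\<^sub>R w)) \<noteq> 0" "moll \<rho> (y' - z) \<noteq> 0" by blast
    have "z + - (t *\<^sub>R w) \<in> \<Omega> \<inter> ball x r" using z(1) Hk0_zero[OF f] by blast
    from \<epsilon>(2)[OF this] have "ball z \<epsilon> \<subseteq> \<Omega>" by simp
    moreover have "norm (y' - z) < \<rho>" using z(2) moll_zero[OF \<rho>(1)] by (meson not_le)
    then have "dist z y < \<epsilon>" using y'(2) dist_triangle[of z y y'] \<rho>(3) by (simp add: dist_norm norm_minus_commute)
    ultimately show "y \<in> \<Omega>" by auto
  qed
  have "compact (csupp \<phi>)"
    using bounded_subset[OF \<Omega>(2) sub] closed_csupp by (simp add: compact_eq_bounded_closed)
  with sm sub have "test \<Omega> \<phi>" by (simp add: test_def)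
  moreover have "near k \<phi> f e" unfolding \<phi>_def by (rule d(2)[OF tw \<rho>(1,2)])
  ultimately show "\<exists>\<phi>. test \<Omega> \<phi> \<and> near k \<phi> f e" by blast
qed

text \<open>Takes the place of a partition of unity: one ball is peeled off at a time. The cutoff is
  1 near the closed half-ball, so the remainder lives on a set covered by the other half-balls,
  while the peeled part stays in the full ball, where pushing in applies.\<close>

lemma approximable_cover:
  assumes \<Omega>: "open \<Omega>" "bounded \<Omega>" and F: "finite F"
    and p: "\<And>x. x \<in> F \<Longrightarrow> push_in \<Omega> x (r x) (w x)"
    and r: "\<And>x. x \<in> F \<Longrightarrow> r x > 0"
  shows "Hk0 A k f \<Longrightarrow> A \<subseteq> \<Omega> \<Longrightarrow> A \<subseteq> (\<Union>x\<in>F. ball x (r x / 2)) \<Longrightarrow> approximable \<Omega> k f"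
  using F p r
proof (induction F arbitrary: A f rule: finite_induct)
  case empty
  then have "f = (\<lambda>x. 0)" using Hk0_zero[of A k f] by auto
  moreover have "test \<Omega> (\<lambda>x. 0)" by (auto simp: test_def smooth_const csupp_def)
  ultimately show ?case by (auto simp: approximable_def l2_zero near_zero intro!: exI[of _ "\<lambda>x. 0"])
next
  case (insert x F)
  have rx: "r x > 0" using insert.prems by simp
  have "cball x (r x / 2) \<subseteq> ball x (r x)" using rx by auto
  then obtain \<eta> V where \<eta>: "test (ball x (r x)) \<eta>" "open V" "cball x (r x / 2) \<subseteq> V" "\<And>y. y \<in> V \<Longrightarrow> \<eta> y = 1"
    using smooth_cutoff[OF compact_cball open_ball] by metis
  have t: "test0 \<eta>" and cs: "csupp \<eta> \<subseteq> ball x (r x)" using \<eta>(1) by (auto simp: test_iff)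
  have "Hk0 (A \<inter> csupp \<eta>) k (\<lambda>y. \<eta> y * f y)"
    by (rule Hk0_mult[of A k f \<eta> "csupp \<eta>"])
      (use insert.prems(1) tame_test0[OF t] in \<open>auto simp: closed_csupp csupp_nonzero\<close>)
  then have "Hk0 (\<Omega> \<inter> ball x (r x)) k (\<lambda>y. \<eta> y * f y)"
    by (rule Hk0_mono) (use cs insert.prems(2) in auto)
  then have 1: "approximable \<Omega> k (\<lambda>y. \<eta> y * f y)"
    by (rule approximable_local[OF \<Omega> insert.prems(4)[of x], rotated]) simp
  have "Hk0 (A \<inter> - V) k (\<lambda>y. (1 - \<eta> y) * f y)"
    by (rule Hk0_mult[OF insert.prems(1) tame_compl[OF t]]) (use \<eta> in auto)
  moreover have "A \<inter> - V \<subseteq> (\<Union>x\<in>F. ball x (r x / 2))"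
    using insert.prems(3) \<eta>(3) ball_subset_cball by (auto simp: subset_iff)
  ultimately have 2: "approximable \<Omega> k (\<lambda>y. (1 - \<eta> y) * f y)"
    using insert.prems by (intro insert.IH[of "A \<inter> - V"]) auto
  have "(\<lambda>y. \<eta> y * f y + (1 - \<eta> y) * f y) = f" by (auto simp: algebra_simps)
  with approximable_add[OF 1 2] show ?case by simp
qed

lemma Hk0_approximable:
  assumes \<Omega>: "strong_lipschitz_domain \<Omega>" and f: "Hk0 \<Omega> k f"
  shows "approximable \<Omega> k f"
proof -
  have o: "open \<Omega>" "bounded \<Omega>" using \<Omega> by (auto simp: strong_lipschitz_domain_def)
  have "\<forall>x. \<exists>r w. r > 0 \<and> push_in \<Omega> x r w" using push_in_exists[OF \<Omega>] by blast
  then obtain r w where rw: "\<And>x. r x > 0" "\<And>x. push_in \<Omega> x (r x) (w x)" by metis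
  have c: "compact (closure \<Omega>)" using o by (simp add: compact_closure)
  have "closure \<Omega> \<subseteq> (\<Union>x\<in>closure \<Omega>. ball x (r x / 2))" using rw(1) by force
  then obtain F where "F \<subseteq> closure \<Omega>" and F: "finite F" "closure \<Omega> \<subseteq> (\<Union>x\<in>F. ball x (r x / 2))"
    using compactE_image[OF c, of "closure \<Omega>" "\<lambda>x. ball x (r x / 2)"] by auto
  show ?thesis
    by (rule approximable_cover[OF o F(1) rw(2) rw(1) f]) (use F closure_subset[of \<Omega>] in auto)
qed

text \<open>Derivatives of \<open>u\<close> satisfy both boundary conditions again to one order
  less, so the removability of the interface for first derivatives can be iterated; \<open>u\<close>
  and its extension are generalised for this.\<close>

lemma Hk_zero_extension:
  assumes \<Omega>: "strong_lipschitz_domain \<Omega>" and \<Gamma>: "strong_lipschitz_boundary_part \<Omega> \<Gamma>"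
  shows "Hk \<Omega> k \<Gamma> u \<Longrightarrow> Hk \<Omega> k (frontier \<Omega> - closure \<Gamma>) u \<Longrightarrow> l2 lborel U \<Longrightarrow>
    (\<And>x. x \<notin> \<Omega> \<Longrightarrow> U x = 0) \<Longrightarrow> (AE x in lebesgue_on \<Omega>. u x = U x) \<Longrightarrow> Hk0 \<Omega> k U"
proof (induction k arbitrary: u U)
  case (Suc k)
  have o: "open \<Omega>" "bounded \<Omega>" using \<Omega> by (auto simp: strong_lipschitz_domain_def)
  have \<Gamma>': "\<Gamma> \<subseteq> frontier \<Omega>" "openin (top_of_set (frontier \<Omega>)) \<Gamma>"
    using \<Gamma> by (auto simp: strong_lipschitz_boundary_part_def)
  have mem: "Hk_mem \<Omega> (Suc k) u" using Suc.prems(1) by (simp add: Hk_def)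
  then have uL: "L2 \<Omega> u" by (simp add: Hk_mem_def)
  have "\<exists>G. wd i U G \<and> Hk0 \<Omega> k G" for i
  proof -
    define g where "g = D \<Omega> [i] u"
    have g: "L2 \<Omega> g" "wderiv \<Omega> [i] u g" using D_props[OF mem, of "[i]"] by (auto simp: g_def)
    obtain G where G: "l2 lborel G" "\<And>x. x \<notin> \<Omega> \<Longrightarrow> G x = 0" "AE x in lebesgue_on \<Omega>. g x = G x"
      using zero_extension[OF o(1)] g(1) L2_l2 by metis
    have u1: "Hk \<Omega> 1 \<Gamma> u" "Hk \<Omega> 1 (frontier \<Omega> - closure \<Gamma>) u"
      using Hk_deriv[OF o Suc.prems(1) uL wderiv_Nil, of 1] Hk_deriv[OF o Suc.prems(2) uL wderiv_Nil, of 1] by auto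
    have "wd i U G"
      by (rule zero_extension_wd[OF o \<Gamma>' interface_curve_like(2)[OF \<Omega> \<Gamma>] u1 g Suc.prems(3-5) G])
    moreover have "Hk0 \<Omega> k G"
      using Hk_deriv[OF o Suc.prems(1) g, of k] Hk_deriv[OF o Suc.prems(2) g, of k] G by (intro Suc.IH) auto
    ultimately show ?thesis by blast
  qed
  with Suc.prems show ?case by simp
qed simp

lemma wd_wderiv:
  assumes \<Omega>: "open \<Omega>" and f: "l2 lborel f" "l2 lborel g" "wd i f g"
  shows "wderiv \<Omega> [i] f g"
  unfolding wderiv_def
proof (intro allI impI)
  fix \<phi> assume t: "test \<Omega> \<phi>"
  have m: "f \<in> borel_measurable borel" "g \<in> borel_measurable borel" using f by (auto simp: l2_def)
  show "(LINT x|lebesgue_on \<Omega>. f x * pd [i] \<phi> x) = (-1) ^ length [i] * (LINT x|lebesgue_on \<Omega>. g x * \<phi> x)"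
    using test_integral[OF \<Omega> test_partial[OF t] m(1), of i] test_integral[OF \<Omega> t m(2)] f(3) t
    by (simp add: wd_def ip_def test_iff)
qed

text \<open>Follows the recursion of \<open>near\<close> along a single multi-index and composes the
  first-order weak derivatives met on the way.\<close>

lemma near_wderiv:
  assumes \<Omega>: "open \<Omega>"
  shows "near k \<phi> f e \<Longrightarrow> test0 \<phi> \<Longrightarrow> l2 lborel f \<Longrightarrow> length is \<le> k \<Longrightarrow>
    \<exists>g. l2 lborel g \<and> wderiv \<Omega> is f g \<and> n2 lborel (\<lambda>x. pd is \<phi> x - g x) \<le> e"
proof (induction "is" arbitrary: k \<phi> f)
  case Nil
  then show ?case by (cases k) (auto intro!: exI[of _ f] simp: wderiv_Nil)
next
  case (Cons i "is")
  then obtain k' where k: "k = Suc k'" "length is \<le> k'" by (cases k) auto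
  then obtain h where h: "l2 lborel h" "wd i f h" "near k' (partial i \<phi>) h e" using Cons.prems by auto
  obtain g where g: "l2 lborel g" "wderiv \<Omega> is h g" "n2 lborel (\<lambda>x. pd is (partial i \<phi>) x - g x) \<le> e"
    using Cons.IH[OF h(3) test0_partial[OF Cons.prems(2)] h(1) k(2)] by blast
  have "wderiv \<Omega> ([i] @ is) f g" by (rule wderiv_append[OF wd_wderiv[OF \<Omega> Cons.prems(3) h(1,2)] g(2)])
  then show ?case using g pd_partial[OF test0D(1)[OF Cons.prems(2)]] by auto
qed

lemma test_Csig_frontier:
  assumes "open \<Omega>" "test \<Omega> \<phi>"
  shows "Csig (frontier \<Omega>) \<phi>"
proof -
  have c: "compact (csupp \<phi>)" "csupp \<phi> \<subseteq> \<Omega>" "smooth \<phi>" using assms by (auto simp: test_def)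
  have "csupp \<phi> \<inter> frontier \<Omega> = {}" using c assms by (auto simp: frontier_def interior_open)
  have "\<exists>e>0. \<forall>x\<in>csupp \<phi>. \<forall>y\<in>frontier \<Omega>. e \<le> dist x y"
    using separate_compact_closed[OF c(1) frontier_closed \<open>csupp \<phi> \<inter> frontier \<Omega> = {}\<close>] by metis
  with c show ?thesis by (simp add: Csig_def)
qed

text \<open>The extension by zero is approximated by test functions of the domain, whose supports
  keep a positive distance from the frontier. Uniqueness of weak derivatives identifies the limits
  with the chosen derivatives of \<open>u\<close>.\<close>

lemma Hk_frontier:
  assumes \<Omega>: "strong_lipschitz_domain \<Omega>" and \<Gamma>: "strong_lipschitz_boundary_part \<Omega> \<Gamma>"
    and u: "Hk \<Omega> k \<Gamma> u" "Hk \<Omega> k (frontier \<Omega> - closure \<Gamma>) u"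
  shows "Hk \<Omega> k (frontier \<Omega>) u"
proof -
  have o: "open \<Omega>" "bounded \<Omega>" using \<Omega> by (auto simp: strong_lipschitz_domain_def)
  have mem: "Hk_mem \<Omega> k u" using u by (simp add: Hk_def)
  then have lu: "L2 \<Omega> u" by (simp add: Hk_mem_def)
  obtain U where U: "l2 lborel U" "\<And>x. x \<notin> \<Omega> \<Longrightarrow> U x = 0" "AE x in lebesgue_on \<Omega>. u x = U x"
    using zero_extension[OF o(1)] lu L2_l2 by metis
  have UL: "L2 \<Omega> U" using l2_restrict(1)[OF o(1) U(1)] by (simp add: L2_l2)
  have ap: "approximable \<Omega> k U"
    by (rule Hk0_approximable[OF \<Omega> Hk_zero_extension[OF \<Omega> \<Gamma> u U]])
  show ?thesis
  proof (rule HkI[OF o Hk_mem_family[OF mem]])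
    fix e :: real assume "e > 0"
    then obtain \<phi> where \<phi>: "test \<Omega> \<phi>" "near k \<phi> U e" using ap by (auto simp: approximable_def)
    have t: "test0 \<phi>" using \<phi>(1) by (simp add: test_iff)
    have "n2 (lebesgue_on \<Omega>) (\<lambda>x. pd is \<phi> x - D \<Omega> is u x) \<le> e" if l: "length is \<le> k" for "is"
    proof -
      obtain g where g: "l2 lborel g" "wderiv \<Omega> is U g" "n2 lborel (\<lambda>x. pd is \<phi> x - g x) \<le> e"
        using near_wderiv[OF o(1) \<phi>(2) t U(1) l] by blast
      have gL: "L2 \<Omega> g" using l2_restrict(1)[OF o(1) g(1)] by (simp add: L2_l2)
      have wU: "wderiv \<Omega> is U (D \<Omega> is u)"
        by (rule wderiv_cong_AE[OF o(1) lu UL U(3) D_props(2)[OF mem l]])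
      have ae: "AE x in lebesgue_on \<Omega>. D \<Omega> is u x = g x"
        by (rule wderiv_unique[OF o D_props(1)[OF mem l] gL wU g(2)])
      have "n2 (lebesgue_on \<Omega>) (\<lambda>x. pd is \<phi> x - D \<Omega> is u x) = n2 (lebesgue_on \<Omega>) (\<lambda>x. pd is \<phi> x - g x)"
        using ae l2_measurable[OF test_pd_l2[OF o(1) \<phi>(1)]] D_props(1)[OF mem l] gL
        by (intro n2_cong_AE borel_measurable_diff) (auto simp: L2_l2 l2_def elim!: eventually_mono)
      also have "\<dots> \<le> n2 lborel (\<lambda>x. pd is \<phi> x - g x)"
        by (rule l2_restrict(2)[OF o(1)]) (intro l2_diff test0_l2 test0_pd t g(1))
      finally show ?thesis using g(3) by simp
    qed
    then show "\<exists>\<phi>. Csig (frontier \<Omega>) \<phi> \<and> (\<forall>is. length is \<le> k \<longrightarrow> n2 (lebesgue_on \<Omega>) (\<lambda>x. pd is \<phi> x - D \<Omega> is u x) \<le> e)"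
      using test_Csig_frontier[OF o(1) \<phi>(1)] by blast
  qed
qed

text \<open>A function supported away from the frontier may still live outside the domain as well.
  Since its support meets the closure of the domain in a compact subset of the domain, a cutoff
  removes the outer part without changing the inner one.\<close>

lemma Csig_frontier_test:
  assumes \<Omega>: "open \<Omega>" and \<phi>: "Csig (frontier \<Omega>) \<phi>"
  obtains \<psi> where "test \<Omega> \<psi>" "\<And>is x. x \<in> \<Omega> \<Longrightarrow> pd is \<psi> x = pd is \<phi> x"
proof -
  have t: "test0 \<phi>" using \<phi> by (rule Csig_test0)
  define K where "K = csupp \<phi> \<inter> closure \<Omega>"
  have K: "compact K" using t by (simp add: K_def test0_def compact_Int_closed)
  have "K \<subseteq> \<Omega>" using Csig_csupp_disjoint[OF \<phi>] \<Omega> by (auto simp: K_def frontier_def interior_open)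
  then obtain \<eta> V where \<eta>: "test \<Omega> \<eta>" "K \<subseteq> V" "\<And>x. x \<in> V \<Longrightarrow> \<eta> x = 1"
    using smooth_cutoff[OF K \<Omega>] by metis
  have eq: "\<phi> x * \<eta> x = \<phi> x" if "x \<in> \<Omega>" for x
  proof (cases "x \<in> csupp \<phi>")
    case True
    then have "x \<in> K" using that closure_subset by (auto simp: K_def)
    then show ?thesis using \<eta> by auto
  qed (simp add: csupp_nonzero)
  show thesis
  proof (rule that)
    show "test \<Omega> (\<lambda>x. \<phi> x * \<eta> x)" by (rule test_mult[OF test0D(1)[OF t] \<eta>(1)])
    show "pd is (\<lambda>x. \<phi> x * \<eta> x) x = pd is \<phi> x" if "x \<in> \<Omega>" for "is" x
      by (rule pd_cong_open[OF \<Omega> that eq])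
  qed
qed

lemma Hk_test_approx:
  assumes \<Omega>: "open \<Omega>" "bounded \<Omega>" and f: "Hk \<Omega> k (frontier \<Omega>) f" "weak_family \<Omega> k f G"
  obtains \<phi> where "\<And>n. test \<Omega> (\<phi> n)"
    "\<And>is. length is \<le> k \<Longrightarrow> (\<lambda>n. n2 (lebesgue_on \<Omega>) (\<lambda>x. pd is (\<phi> n) x - G is x)) \<longlonglongrightarrow> 0"
proof -
  obtain \<psi> where \<psi>: "\<And>n. Csig (frontier \<Omega>) (\<psi> n)"
    "\<And>is. length is \<le> k \<Longrightarrow> (\<lambda>n. n2 (lebesgue_on \<Omega>) (\<lambda>x. pd is (\<psi> n) x - G is x)) \<longlonglongrightarrow> 0"
    using Hk_approx[OF \<Omega> f] by blast
  have "\<forall>n. \<exists>\<phi>. test \<Omega> \<phi> \<and> (\<forall>is. \<forall>x\<in>\<Omega>. pd is \<phi> x = pd is (\<psi> n) x)"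
    using Csig_frontier_test[OF \<Omega>(1) \<psi>(1)] by metis
  then obtain \<phi> where \<phi>: "\<And>n. test \<Omega> (\<phi> n)" "\<And>n is x. x \<in> \<Omega> \<Longrightarrow> pd is (\<phi> n) x = pd is (\<psi> n) x" by metis
  have "n2 (lebesgue_on \<Omega>) (\<lambda>x. pd is (\<phi> n) x - G is x) = n2 (lebesgue_on \<Omega>) (\<lambda>x. pd is (\<psi> n) x - G is x)" for n "is"
    unfolding n2_def using \<phi>(2)
    by (intro arg_cong[where f = sqrt] Bochner_Integration.integral_cong) (auto simp: space_restrict_space)
  with \<psi>(2) \<phi>(1) show thesis by (intro that[of \<phi>]) auto
qed

subsection \<open>Rellich's theorem\<close>

text \<open>The translation is split into \<open>m\<close> small steps; to each of them Taylor's formula applies,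
  and the remainders add up to something of order \<open>1/m\<close>.\<close>
lemma test0_translation:
  assumes t: "test0 \<psi>"
  shows "n2 lborel (\<lambda>x. \<psi> (x + z) - \<psi> x) \<le> norm z * (\<Sum>i\<in>UNIV. n2 lborel (partial i \<psi>))"
proof (rule field_le_epsilon)
  fix e :: real assume e: "e > 0"
  obtain C where C: "C \<ge> 0" "\<And>y h. \<bar>\<psi> (y + h) - \<psi> y - (\<Sum>i\<in>UNIV. h $ i * partial i \<psi> y)\<bar> \<le> C * (norm h)\<^sup>2"
    using test0_taylor[OF t] by metis
  obtain R where R: "R > 0" "csupp \<psi> \<subseteq> ball 0 R"
    using test0D(2)[OF t] compact_imp_bounded bounded_subset_ballD by blast
  \<comment> \<open>Contains the support of \<open>\<psi>\<close> and of its translate by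
    \<open>h\<close>, since \<open>norm h \<le> norm z\<close>.\<close>
  define S where "S = ball (0::real^3) (R + norm z)"
  have Sfin: "emeasure lborel S < \<infinity>" unfolding S_def using emeasure_bounded_finite[OF bounded_ball] by blast
  have iS: "l2 lborel (indicat_real S)"
    using Sfin by (intro l2_indicator) (auto simp: S_def)
  \<comment> \<open>Each of the \<open>m\<close> steps has a remainder of order
    \<open>1/m^2\<close>, so the sum is at most \<open>e\<close> for this \<open>m\<close>.\<close>
  obtain m :: nat where m: "m > 0" "C * (norm z)\<^sup>2 * n2 lborel (indicat_real S) \<le> e * real m"
  proof -
    obtain m :: nat where "C * (norm z)\<^sup>2 * n2 lborel (indicat_real S) / e < real m" using reals_Archimedean2 by blast
    then have "C * (norm z)\<^sup>2 * n2 lborel (indicat_real S) \<le> e * real (Suc m)"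
      using e by (simp add: field_simps)
    then show thesis using that[of "Suc m"] by simp
  qed
  define h where "h = z /\<^sub>R real m"
  have nh: "norm h = norm z / real m" "real m *\<^sub>R h = z" using m by (auto simp: h_def divide_inverse)
  have l: "l2 lborel \<psi>" "l2 lborel (partial i \<psi>)" for i using t by (auto intro: test0_l2 test0_partial)
  let ?r = "\<lambda>x. \<psi> (x + h) - \<psi> x - (\<Sum>i\<in>UNIV. h $ i * partial i \<psi> x)"
  have lr: "l2 lborel ?r" by (intro l2_diff l2_shift l2_sum l2_cmult l)
  have rS: "\<bar>?r x\<bar> \<le> \<bar>C * (norm h)\<^sup>2 * indicat_real S x\<bar>" for x
  proof (cases "x \<in> S")
    case True
    then show ?thesis using C by simp
  next
    case False
    have "norm h \<le> norm z" using m mult_left_mono[of 1 "real m" "norm z"] by (simp add: nh divide_le_eq)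
    moreover have "norm x \<le> norm (x + h) + norm h" using norm_triangle_ineq4[of "x + h" h] by simp
    moreover have "norm x \<ge> R + norm z" using False by (simp add: S_def)
    ultimately have "norm (x + h) \<ge> R" "norm x \<ge> R" using norm_ge_zero[of z] by linarith+
    then have "x + h \<notin> csupp \<psi>" "x \<notin> csupp \<psi>" using R(2) by auto
    then show ?thesis using csupp_nonzero[of _ \<psi>] pd_zero_off_csupp[of x \<psi> "[_]"] by simp
  qed
  have "n2 lborel ?r \<le> n2 lborel (\<lambda>x. C * (norm h)\<^sup>2 * indicat_real S x)"
    by (rule n2_mono[OF l2_cmult[OF iS]]) (use rS in simp)
  then have nr: "n2 lborel ?r \<le> C * (norm h)\<^sup>2 * n2 lborel (indicat_real S)" using C by (simp add: n2_cmult)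
  have step: "n2 lborel (\<lambda>x. \<psi> (x + h) - \<psi> x) \<le> norm h * (\<Sum>i\<in>UNIV. n2 lborel (partial i \<psi>)) + C * (norm h)\<^sup>2 * n2 lborel (indicat_real S)"
  proof -
    have "n2 lborel (\<lambda>x. \<psi> (x + h) - \<psi> x) = n2 lborel (\<lambda>x. (\<Sum>i\<in>UNIV. h $ i * partial i \<psi> x) + ?r x)" by simp
    also have "\<dots> \<le> n2 lborel (\<lambda>x. \<Sum>i\<in>UNIV. h $ i * partial i \<psi> x) + n2 lborel ?r"
      by (intro n2_add_le lr l2_sum l2_cmult l)
    also have "n2 lborel (\<lambda>x. \<Sum>i\<in>UNIV. h $ i * partial i \<psi> x) \<le> (\<Sum>i\<in>UNIV. n2 lborel (\<lambda>x. h $ i * partial i \<psi> x))"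
      by (intro n2_sum_le l2_cmult l) auto
    also have "\<dots> \<le> (\<Sum>i\<in>UNIV. norm h * n2 lborel (partial i \<psi>))"
      unfolding n2_cmult by (intro sum_mono mult_right_mono component_le_norm_cart n2_nonneg)
    finally show ?thesis using nr by (simp add: sum_distrib_left)
  qed
  have "\<psi> (x + z) - \<psi> x = (\<Sum>j<m. \<psi> (x + real j *\<^sub>R h + h) - \<psi> (x + real j *\<^sub>R h))" for x
    using sum_lessThan_telescope[of "\<lambda>j. \<psi> (x + real j *\<^sub>R h)" m] nh(2) by (simp add: algebra_simps)
  then have "n2 lborel (\<lambda>x. \<psi> (x + z) - \<psi> x) = n2 lborel (\<lambda>x. \<Sum>j<m. \<psi> (x + real j *\<^sub>R h + h) - \<psi> (x + real j *\<^sub>R h))"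
    by simp
  also have "\<dots> \<le> (\<Sum>j<m. n2 lborel (\<lambda>x. \<psi> (x + real j *\<^sub>R h + h) - \<psi> (x + real j *\<^sub>R h)))"
  proof (rule n2_sum_le)
    fix j
    show "l2 lborel (\<lambda>x. \<psi> (x + real j *\<^sub>R h + h) - \<psi> (x + real j *\<^sub>R h))"
      using l2_shift(1)[OF l2_diff[OF l2_shift(1)[OF l(1), of h] l(1)], of "real j *\<^sub>R h"] .
  qed simp
  also have "\<dots> = (\<Sum>j<m. n2 lborel (\<lambda>x. \<psi> (x + h) - \<psi> x))"
    using l2_shift(2)[OF l2_diff[OF l2_shift(1)[OF l(1), of h] l(1)]] by simp
  also have "\<dots> \<le> real m * (norm h * (\<Sum>i\<in>UNIV. n2 lborel (partial i \<psi>)) + C * (norm h)\<^sup>2 * n2 lborel (indicat_real S))"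
    using step m by simp
  also have "\<dots> = norm z * (\<Sum>i\<in>UNIV. n2 lborel (partial i \<psi>)) + C * (norm z)\<^sup>2 * n2 lborel (indicat_real S) / real m"
    using m by (simp add: nh field_simps power2_eq_square)
  also have "\<dots> \<le> norm z * (\<Sum>i\<in>UNIV. n2 lborel (partial i \<psi>)) + e"
    using m by (simp add: divide_le_eq)
  finally show "n2 lborel (\<lambda>x. \<psi> (x + z) - \<psi> x) \<le> norm z * (\<Sum>i\<in>UNIV. n2 lborel (partial i \<psi>)) + e" .
qed

lemma conv_l2_bound:
  assumes f: "l2 lborel f" and \<rho>: "test0 \<rho>"
  shows "\<bar>conv f \<rho> x\<bar> \<le> n2 lborel f * n2 lborel \<rho>"
proof -
  have t: "test0 (\<lambda>y. \<rho> (x + (-1) *\<^sub>R y))" by (rule test0_affine[OF \<rho>]) simp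
  have "n2 lborel (\<lambda>y. \<rho> (x + (-1) *\<^sub>R y)) = n2 lborel \<rho>"
    using lborel_integral_reflect(1)[of "\<lambda>y. (\<rho> y)\<^sup>2" x] test0_borel[OF \<rho>] by (simp add: n2_def)
  then show ?thesis using Cauchy_Schwarz_ip[OF f test0_l2[OF t]] by (simp add: conv_def ip_def)
qed

text \<open>The translation estimate makes the mollification error uniform in \<open>n\<close>, and
  at a fixed scale the mollified functions are equibounded and equicontinuous, so Arzela-Ascoli
  applies. The scale depends on \<open>e\<close>; hence the Cauchy property only up to
  \<open>e\<close>.\<close>

lemma rellich_eps:
  fixes \<psi> :: "nat \<Rightarrow> real^3 \<Rightarrow> real"
  assumes \<Omega>: "bounded \<Omega>" and \<psi>: "\<And>n. test \<Omega> (\<psi> n)"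
    and K: "\<And>n. n2 lborel (\<psi> n) \<le> K" "\<And>n i. n2 lborel (partial i (\<psi> n)) \<le> K" and e: "e > 0"
  shows "\<exists>r :: nat \<Rightarrow> nat. strict_mono r \<and> (\<exists>N. \<forall>m\<ge>N. \<forall>n\<ge>N. n2 lborel (\<lambda>x. \<psi> (r m) x - \<psi> (r n) x) < e)"
proof -
  have K0: "K \<ge> 0" using order.trans[OF n2_nonneg K(1)] .
  have t: "test0 (\<psi> n)" for n using \<psi> by (simp add: test_iff)
  have i: "integrable lborel (\<psi> n)" and l: "l2 lborel (\<psi> n)" for n using t test0_integrable test0_l2 by auto
  \<comment> \<open>The quotient makes the mollification error at most \<open>e / 4\<close>; the
    bound 1 keeps all supports in a fixed ball of radius \<open>R + 1\<close>.\<close>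
  define \<epsilon> where "\<epsilon> = min 1 (e / (4 * (3 * K + 1)))"
  have \<epsilon>: "0 < \<epsilon>" "\<epsilon> \<le> 1" "\<epsilon> * (3 * K) \<le> e / 4"
  proof -
    show "0 < \<epsilon>" "\<epsilon> \<le> 1" using e K0 by (auto simp: \<epsilon>_def)
    have "\<epsilon> * (3 * K) \<le> e / (4 * (3 * K + 1)) * (3 * K + 1)"
      using K0 e by (intro mult_mono) (auto simp: \<epsilon>_def)
    also have "\<dots> = e / 4" using K0 by (simp add: field_simps)
    finally show "\<epsilon> * (3 * K) \<le> e / 4" .
  qed
  let ?\<rho> = "moll \<epsilon>"
  have t\<rho>: "test0 ?\<rho>" by (rule moll_test0[OF \<epsilon>(1)])
  define F where "F n = conv (\<psi> n) ?\<rho>" for n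
  have err: "l2 lborel (\<lambda>x. F n x - \<psi> n x)" "n2 lborel (\<lambda>x. F n x - \<psi> n x) \<le> e / 4" for n
  proof -
    have *: "n2 lborel (\<lambda>x. \<psi> n (x + z) - \<psi> n x) \<le> \<epsilon> * (3 * K)" if "norm z < \<epsilon>" for z
    proof -
      have "(\<Sum>i\<in>(UNIV::3 set). n2 lborel (partial i (\<psi> n))) \<le> (\<Sum>i\<in>(UNIV::3 set). K)"
        by (intro sum_mono K)
      then have "norm z * (\<Sum>i\<in>UNIV. n2 lborel (partial i (\<psi> n))) \<le> \<epsilon> * (3 * K)"
        using that \<epsilon>(1) by (intro mult_mono sum_nonneg n2_nonneg) auto
      then show ?thesis using test0_translation[OF t, of n z] by simp
    qed
    from moll_error[OF i l \<epsilon>(1) *]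
    show "l2 lborel (\<lambda>x. F n x - \<psi> n x)" "n2 lborel (\<lambda>x. F n x - \<psi> n x) \<le> e / 4"
      using \<epsilon>(3) by (auto simp: F_def)
  qed
  have smF: "smooth (F n)" for n unfolding F_def by (rule conv_smooth[OF i t\<rho>])
  obtain R where R: "\<Omega> \<subseteq> ball 0 R" using bounded_subset_ballD[OF \<Omega>] by blast
  define S where "S = cball (0::real^3) (R + 1)"
  have Fz: "F n x = 0" if "x \<notin> S" for n x
    unfolding F_def
  proof (rule conv_eq_0)
    fix y assume "\<psi> n y \<noteq> 0"
    then have "y \<in> \<Omega>" using test_zero_off[OF \<psi>] by blast
    then have "norm y < R" using R by auto
    then have "norm (x - y) \<ge> \<epsilon>" using that \<epsilon>(2) norm_triangle_sub[of x y] by (simp add: S_def)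
    then show "?\<rho> (x - y) = 0" by (rule moll_zero[OF \<epsilon>(1)])
  qed
  \<comment> \<open>A Lipschitz constant common to all mollified functions: the derivative falls on
    the fixed kernel, and Cauchy-Schwarz leaves only the norm bound \<open>K\<close>.\<close>
  define L where "L = (\<Sum>i\<in>UNIV. K * n2 lborel (partial i ?\<rho>))"
  have L0: "L \<ge> 0" unfolding L_def using K0 by (intro sum_nonneg mult_nonneg_nonneg n2_nonneg)
  have lip: "\<bar>F n x - F n y\<bar> \<le> L * norm (x - y)" for n x y
  proof -
    obtain s where "F n (y + (x - y)) - F n y = (\<Sum>i\<in>UNIV. (x - y) $ i * partial i (F n) (y + s *\<^sub>R (x - y)))"
      using MVT_line[OF smF] by metis
    then have "\<bar>F n x - F n y\<bar> \<le> (\<Sum>i\<in>UNIV. \<bar>(x - y) $ i\<bar> * \<bar>partial i (F n) (y + s *\<^sub>R (x - y))\<bar>)"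
      using sum_abs[of "\<lambda>i. (x - y) $ i * partial i (F n) (y + s *\<^sub>R (x - y))" UNIV] by (simp add: abs_mult)
    also have "\<dots> \<le> (\<Sum>i\<in>UNIV. norm (x - y) * (K * n2 lborel (partial i ?\<rho>)))"
    proof (intro sum_mono mult_mono component_le_norm_cart)
      fix i
      have "\<bar>conv (\<psi> n) (partial i ?\<rho>) (y + s *\<^sub>R (x - y))\<bar> \<le> n2 lborel (\<psi> n) * n2 lborel (partial i ?\<rho>)"
        by (rule conv_l2_bound[OF l test0_partial[OF t\<rho>]])
      also have "\<dots> \<le> K * n2 lborel (partial i ?\<rho>)" by (intro mult_right_mono K n2_nonneg)
      finally show "\<bar>partial i (F n) (y + s *\<^sub>R (x - y))\<bar> \<le> K * n2 lborel (partial i ?\<rho>)"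
        by (simp add: F_def partial_conv[OF i t\<rho>])
    qed auto
    finally show ?thesis by (simp add: L_def sum_distrib_left mult_ac)
  qed
  have bd: "\<bar>F n x\<bar> \<le> K * n2 lborel ?\<rho>" for n x
    unfolding F_def by (rule order.trans[OF conv_l2_bound[OF l t\<rho>]]) (intro mult_right_mono K n2_nonneg)
  obtain g k where k: "strict_mono (k :: nat \<Rightarrow> nat)"
    and unif: "\<And>d. 0 < d \<Longrightarrow> \<exists>N. \<forall>n x. n \<ge> N \<and> x \<in> S \<longrightarrow> norm (F (k n) x - g x) < d"
  proof (rule Arzela_Ascoli[of S F "K * n2 lborel ?\<rho>"])
    show "compact S" by (simp add: S_def)
    show "norm (F n x) \<le> K * n2 lborel ?\<rho>" for n x using bd by simp
    fix x :: "real^3" and d :: real assume d: "0 < d"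
    show "\<exists>c>0. \<forall>n y. y \<in> S \<and> norm (x - y) < c \<longrightarrow> norm (F n x - F n y) < d"
    proof (intro exI conjI allI impI)
      show "d / (L + 1) > 0" using d L0 by simp
      fix n y assume "y \<in> S \<and> norm (x - y) < d / (L + 1)"
      then have "norm (x - y) * (L + 1) < d" using L0 by (simp add: field_simps)
      moreover have "L * norm (x - y) \<le> norm (x - y) * (L + 1)" by (simp add: algebra_simps)
      ultimately show "norm (F n x - F n y) < d" using lip[of n x y] by simp
    qed
  qed blast
  have "emeasure lborel S < \<infinity>" unfolding S_def using emeasure_bounded_finite[OF bounded_cball] by blast
  then have iS: "l2 lborel (indicat_real S)"
    by (intro l2_indicator) (auto simp: S_def)
  define d where "d = e / (8 * (n2 lborel (indicat_real S) + 1))"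
  have nS: "n2 lborel (indicat_real S) + 1 > 0" by (simp add: add_nonneg_pos n2_nonneg)
  have d: "d > 0" using e nS by (simp add: d_def)
  obtain N where N: "\<And>n x. n \<ge> N \<Longrightarrow> x \<in> S \<Longrightarrow> norm (F (k n) x - g x) < d" using unif[OF d] by blast
  have "n2 lborel (\<lambda>x. \<psi> (k m) x - \<psi> (k n) x) < e" if mn: "m \<ge> N" "n \<ge> N" for m n
  proof -
    have lF: "l2 lborel (F n)" for n using l2_add[OF err(1)[of n] l[of n]] by simp
    have "\<bar>F (k m) x - F (k n) x\<bar> \<le> \<bar>2 * d * indicat_real S x\<bar>" for x
    proof (cases "x \<in> S")
      case True
      then show ?thesis using N[OF mn(1) True] N[OF mn(2) True] d by (simp add: abs_less_iff abs_le_iff)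
    qed (simp add: Fz)
    then have "n2 lborel (\<lambda>x. F (k m) x - F (k n) x) \<le> n2 lborel (\<lambda>x. 2 * d * indicat_real S x)"
      by (intro n2_mono l2_cmult iS) simp
    also have "\<dots> = 2 * d * n2 lborel (indicat_real S)" using d by (simp add: n2_cmult)
    also have "\<dots> \<le> 2 * d * (n2 lborel (indicat_real S) + 1)" using d by simp
    also have "\<dots> = e / 4"
    proof -
      have "2 * (e / (8 * c)) * c = e / 4" if "c \<noteq> 0" for c :: real using that by simp
      then show ?thesis using nS unfolding d_def by (metis less_irrefl)
    qed
    finally have FF: "n2 lborel (\<lambda>x. F (k m) x - F (k n) x) \<le> e / 4" .
    have "n2 lborel (\<lambda>x. \<psi> (k m) x - \<psi> (k n) x)
        \<le> n2 lborel (\<lambda>x. \<psi> (k m) x - F (k m) x) + n2 lborel (\<lambda>x. F (k m) x - \<psi> (k n) x)"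
      by (intro n2_triangle_diff l lF)
    also have "n2 lborel (\<lambda>x. F (k m) x - \<psi> (k n) x)
        \<le> n2 lborel (\<lambda>x. F (k m) x - F (k n) x) + n2 lborel (\<lambda>x. F (k n) x - \<psi> (k n) x)"
      by (intro n2_triangle_diff l lF)
    finally show ?thesis
      using FF err(2)[of "k m"] err(2)[of "k n"] e n2_diff_commute[of lborel "\<psi> (k m)" "F (k m)"] by linarith
  qed
  then have "\<exists>N. \<forall>m\<ge>N. \<forall>n\<ge>N. n2 lborel (\<lambda>x. \<psi> (k m) x - \<psi> (k n) x) < e" by blast
  with k show ?thesis by (intro exI[of _ k] conjI)
qed

text \<open>A diagonal sequence over the tolerances \<open>1 / (j + 1)\<close>.\<close>

lemma rellich_tests:
  fixes \<psi> :: "nat \<Rightarrow> real^3 \<Rightarrow> real"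
  assumes \<Omega>: "bounded \<Omega>" and \<psi>: "\<And>n. test \<Omega> (\<psi> n)"
    and K: "\<And>n. n2 lborel (\<psi> n) \<le> K" "\<And>n i. n2 lborel (partial i (\<psi> n)) \<le> K"
  shows "\<exists>r :: nat \<Rightarrow> nat. strict_mono r \<and> (\<forall>e>0. \<exists>N. \<forall>m\<ge>N. \<forall>n\<ge>N. n2 lborel (\<lambda>x. \<psi> (r m) x - \<psi> (r n) x) < e)"
proof -
  define P where "P j s = (\<exists>N. \<forall>m\<ge>N. \<forall>n\<ge>N. n2 lborel (\<lambda>x. \<psi> (s m) x - \<psi> (s n) x) < 1 / real (Suc j))"
    for j and s :: "nat \<Rightarrow> nat"
  interpret subseqs P
  proof
    fix j and s :: "nat \<Rightarrow> nat" assume "strict_mono s"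
    have "\<exists>r :: nat \<Rightarrow> nat. strict_mono r \<and> (\<exists>N. \<forall>m\<ge>N. \<forall>n\<ge>N. n2 lborel (\<lambda>x. \<psi> (s (r m)) x - \<psi> (s (r n)) x) < 1 / real (Suc j))"
      by (rule rellich_eps[OF \<Omega>, of "\<lambda>n. \<psi> (s n)"]) (use \<psi> K in auto)
    then show "\<exists>r'. strict_mono r' \<and> P j (s \<circ> r')" by (simp add: P_def o_def)
  qed
  have stable: "P j (s \<circ> r)" if r: "strict_mono r" and Ps: "P j s" for r s j
  proof -
    obtain N where N: "\<And>m n. m \<ge> N \<Longrightarrow> n \<ge> N \<Longrightarrow> n2 lborel (\<lambda>x. \<psi> (s m) x - \<psi> (s n) x) < 1 / real (Suc j)"
      using Ps by (auto simp: P_def)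
    have "r m \<ge> N" if "m \<ge> N" for m using seq_suble[OF r, of m] that by simp
    then have "\<forall>m\<ge>N. \<forall>n\<ge>N. n2 lborel (\<lambda>x. \<psi> ((s \<circ> r) m) x - \<psi> ((s \<circ> r) n) x) < 1 / real (Suc j)"
      using N by simp
    then show ?thesis unfolding P_def by blast
  qed
  show ?thesis
  proof (rule exI[of _ diagseq], intro conjI allI impI)
    show "strict_mono diagseq" by (rule subseq_diagseq)
    fix e :: real assume "e > 0"
    then obtain j where j: "1 / real (Suc j) < e" using nat_approx_posE by blast
    \<comment> \<open>The diagonal sequence is a subsequence of the \<open>j\<close>-th extraction
      only after its first \<open>Suc j\<close> terms; the shift is undone at the end.\<close>
    have "P j (diagseq \<circ> (+) (Suc j))" by (rule diagseq_holds[OF stable])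
    then obtain N where N: "\<And>m n. m \<ge> N \<Longrightarrow> n \<ge> N \<Longrightarrow>
        n2 lborel (\<lambda>x. \<psi> (diagseq (Suc j + m)) x - \<psi> (diagseq (Suc j + n)) x) < 1 / real (Suc j)"
      by (auto simp: P_def)
    show "\<exists>N. \<forall>m\<ge>N. \<forall>n\<ge>N. n2 lborel (\<lambda>x. \<psi> (diagseq m) x - \<psi> (diagseq n) x) < e"
    proof (intro exI allI impI)
      fix m n assume mn: "m \<ge> Suc j + N" "n \<ge> Suc j + N"
      then have "m - Suc j \<ge> N" "n - Suc j \<ge> N" by arith+
      with mn show "n2 lborel (\<lambda>x. \<psi> (diagseq m) x - \<psi> (diagseq n) x) < e"
        using N[of "m - Suc j" "n - Suc j"] j by simp
    qed
  qed
qed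

text \<open>Each \<open>v n\<close> is replaced by a test function that is within
  \<open>1 / (n + 1)\<close> up to first derivatives. This raises the bound by at most 1, and the
  errors vanish along any subsequence.\<close>

lemma rellich:
  fixes v :: "nat \<Rightarrow> real^3 \<Rightarrow> real"
  assumes \<Omega>: "open \<Omega>" "bounded \<Omega>" and v: "\<And>n. Hk \<Omega> 1 (frontier \<Omega>) (v n)" "\<And>n. Hk_norm \<Omega> 1 (v n) \<le> C"
  shows "\<exists>r :: nat \<Rightarrow> nat. strict_mono r \<and> (\<forall>e>0. \<exists>N. \<forall>m\<ge>N. \<forall>n\<ge>N. n2 (lebesgue_on \<Omega>) (\<lambda>x. v (r m) x - v (r n) x) < e)"
proof -
  let ?M = "lebesgue_on \<Omega>"
  define G where "G n js = (if js = [] then v n else D \<Omega> js (v n))" for n js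
  have mem: "Hk_mem \<Omega> 1 (v n)" for n using v(1) by (simp add: Hk_def)
  then have vL: "L2 \<Omega> (v n)" for n by (simp add: Hk_mem_def)
  have wf: "weak_family \<Omega> 1 (v n) (G n)" for n
    using vL D_props[OF mem] by (auto simp: weak_family_def G_def wderiv_Nil)
  have "\<exists>\<phi>. test \<Omega> \<phi> \<and> (\<forall>is. length is \<le> 1 \<longrightarrow> n2 ?M (\<lambda>x. pd is \<phi> x - G n is x) < 1 / real (Suc n))" for n
  proof -
    obtain \<phi> where \<phi>: "\<And>j. test \<Omega> (\<phi> j)"
      "\<And>is. length is \<le> 1 \<Longrightarrow> (\<lambda>j. n2 ?M (\<lambda>x. pd is (\<phi> j) x - G n is x)) \<longlonglongrightarrow> 0"
      using Hk_test_approx[OF \<Omega> v(1) wf] by blast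
    have "\<forall>\<^sub>F j in sequentially. \<forall>is\<in>{is. length is \<le> 1}. n2 ?M (\<lambda>x. pd is (\<phi> j) x - G n is x) < 1 / real (Suc n)"
      using \<phi>(2) by (subst eventually_ball_finite_distrib[OF finite_lists_le]) (auto simp: order_tendsto_iff)
    then obtain j where "\<forall>is\<in>{is. length is \<le> 1}. n2 ?M (\<lambda>x. pd is (\<phi> j) x - G n is x) < 1 / real (Suc n)"
      using eventually_happens[of _ sequentially] by (auto simp: trivial_limit_sequentially)
    with \<phi>(1) show ?thesis by blast
  qed
  then obtain \<psi> where \<psi>: "\<And>n. test \<Omega> (\<psi> n)"
    "\<And>n is. length is \<le> 1 \<Longrightarrow> n2 ?M (\<lambda>x. pd is (\<psi> n) x - G n is x) < 1 / real (Suc n)" by metis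
  have GL: "l2 ?M (G n is)" if "length is \<le> 1" for n "is" using wf[of n] that by (simp add: weak_family_def L2_l2)
  have pL: "l2 ?M (pd is (\<psi> n))" for n "is" by (rule test_pd_l2[OF \<Omega>(1) \<psi>(1)])
  have ntest: "n2 ?M \<phi> = n2 lborel \<phi>" if "test \<Omega> \<phi>" for \<phi>
    using l2_lebesgue_on(2)[OF \<Omega>(1), of \<phi>] that test_zero_off[OF that] test0_borel by (auto simp: test_iff)
  have bd: "n2 lborel (pd is (\<psi> n)) \<le> C + 1" if l: "length is \<le> 1" for n "is"
  proof -
    have "n2 ?M (\<lambda>x. (pd is (\<psi> n) x - G n is x) + G n is x) \<le> n2 ?M (\<lambda>x. pd is (\<psi> n) x - G n is x) + n2 ?M (G n is)"
      by (intro n2_add_le l2_diff pL GL l)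
    moreover have "n2 ?M (G n is) \<le> C" using weak_family_norm(1)[OF \<Omega> wf l] v(2) order.trans by blast
    moreover have "n2 ?M (\<lambda>x. pd is (\<psi> n) x - G n is x) < 1"
      by (rule less_le_trans[OF \<psi>(2)[OF l, of n]]) simp
    ultimately show ?thesis using ntest[OF test_pd[OF \<psi>(1)]] by simp
  qed
  have "\<exists>r :: nat \<Rightarrow> nat. strict_mono r \<and> (\<forall>e>0. \<exists>N. \<forall>m\<ge>N. \<forall>n\<ge>N. n2 lborel (\<lambda>x. \<psi> (r m) x - \<psi> (r n) x) < e)"
    by (rule rellich_tests[OF \<Omega>(2) \<psi>(1), where K = "C + 1"]) (use bd[of "[]"] bd[of "[_]"] in auto)
  then obtain r :: "nat \<Rightarrow> nat" where r: "strict_mono r"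
    and Cau: "\<And>e. e > 0 \<Longrightarrow> \<exists>N. \<forall>m\<ge>N. \<forall>n\<ge>N. n2 lborel (\<lambda>x. \<psi> (r m) x - \<psi> (r n) x) < e"
    by blast
  show ?thesis
  proof (rule exI[of _ r], intro conjI allI impI)
    show "strict_mono r" by (rule r)
    fix e :: real assume e: "e > 0"
    obtain N where N: "\<And>m n. m \<ge> N \<Longrightarrow> n \<ge> N \<Longrightarrow> n2 lborel (\<lambda>x. \<psi> (r m) x - \<psi> (r n) x) < e/2"
      using Cau[of "e/2"] e by auto
    obtain j where j: "1 / real (Suc j) < e/4" using nat_approx_posE[of "e/4"] e by auto
    have close: "n2 ?M (\<lambda>x. \<psi> (r n) x - v (r n) x) < e/4" if "n \<ge> j" for n
    proof -
      have "r n \<ge> j" using seq_suble[OF r, of n] that by simp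
      then have "1 / real (Suc (r n)) \<le> 1 / real (Suc j)" by (simp add: frac_le)
      then show ?thesis using \<psi>(2)[of "[]" "r n"] j by (simp add: G_def)
    qed
    show "\<exists>N. \<forall>m\<ge>N. \<forall>n\<ge>N. n2 ?M (\<lambda>x. v (r m) x - v (r n) x) < e"
    proof (intro exI allI impI)
      fix m n assume mn: "m \<ge> max N j" "n \<ge> max N j"
      have lv: "l2 ?M (v n)" and lp: "l2 ?M (\<psi> n)" for n using vL pL[of "[]" n] by (auto simp: L2_l2)
      have "n2 ?M (\<lambda>x. v (r m) x - v (r n) x) \<le> n2 ?M (\<lambda>x. v (r m) x - \<psi> (r m) x) + n2 ?M (\<lambda>x. \<psi> (r m) x - v (r n) x)"
        by (intro n2_triangle_diff lv lp)
      also have "n2 ?M (\<lambda>x. \<psi> (r m) x - v (r n) x) \<le> n2 ?M (\<lambda>x. \<psi> (r m) x - \<psi> (r n) x) + n2 ?M (\<lambda>x. \<psi> (r n) x - v (r n) x)"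
        by (intro n2_triangle_diff lv lp)
      also have "n2 ?M (\<lambda>x. \<psi> (r m) x - \<psi> (r n) x) \<le> n2 lborel (\<lambda>x. \<psi> (r m) x - \<psi> (r n) x)"
        using \<psi>(1) by (intro l2_restrict(2) \<Omega> l2_diff test0_l2) (auto simp: test_iff)
      finally show "n2 ?M (\<lambda>x. v (r m) x - v (r n) x) < e"
        using N[of m n] close[of m] close[of n] mn n2_diff_commute[of ?M "v (r m)" "\<psi> (r m)"] by simp
    qed
  qed
qed

subsection \<open>The a priori estimate\<close>

lemma H1_test_approx:
  assumes \<Omega>: "open \<Omega>" "bounded \<Omega>" and u: "Hk \<Omega> 1 (frontier \<Omega>) u"
    and du: "\<And>k. L2 \<Omega> (du k)" "\<And>k. wderiv \<Omega> [k] u (du k)"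
  obtains \<phi> where "\<And>n. test \<Omega> (\<phi> n)" "(\<lambda>n. n2 (lebesgue_on \<Omega>) (\<lambda>x. \<phi> n x - u x)) \<longlonglongrightarrow> 0"
    "\<And>k. (\<lambda>n. n2 (lebesgue_on \<Omega>) (\<lambda>x. partial k (\<phi> n) x - du k x)) \<longlonglongrightarrow> 0"
proof -
  define G where "G is = (if is = [] then u else du (hd is))" for "is"
  have uL: "L2 \<Omega> u" using u by (simp add: Hk_def Hk_mem_def)
  have "weak_family \<Omega> 1 u G"
    unfolding weak_family_def
  proof (intro conjI allI impI uL)
    fix "is" :: "3 list" assume "length is \<le> 1"
    then consider "is = []" | k where "is = [k]" by (cases "is") auto
    then show "L2 \<Omega> (G is)" "wderiv \<Omega> is u (G is)"
      by (cases; simp add: G_def uL du wderiv_Nil)+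
  qed
  then obtain \<phi> where \<phi>: "\<And>n. test \<Omega> (\<phi> n)"
    "\<And>is. length is \<le> 1 \<Longrightarrow> (\<lambda>n. n2 (lebesgue_on \<Omega>) (\<lambda>x. pd is (\<phi> n) x - G is x)) \<longlonglongrightarrow> 0"
    using Hk_test_approx[OF \<Omega> u] by blast
  show thesis
    by (rule that[OF \<phi>(1)]) (use \<phi>(2)[of "[]"] \<phi>(2)[of "[_]"] in \<open>auto simp: G_def\<close>)
qed

text \<open>The vanishing boundary values of \<open>u\<close> alone remove the boundary term;
  \<open>w\<close> may be arbitrary at the boundary. This is how \<open>Rot T\<close> enters the
  estimate, without a boundary condition of its own.\<close>

lemma H1_ibp:
  assumes \<Omega>: "open \<Omega>" "bounded \<Omega>" and u: "Hk \<Omega> 1 (frontier \<Omega>) u"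
    and du: "\<And>k. L2 \<Omega> (du k)" "\<And>k. wderiv \<Omega> [k] u (du k)"
    and w: "L2 \<Omega> w" "L2 \<Omega> w'" "wderiv \<Omega> [k] w w'"
  shows "ip (lebesgue_on \<Omega>) w (du k) = - ip (lebesgue_on \<Omega>) w' u"
proof -
  let ?M = "lebesgue_on \<Omega>"
  obtain \<phi> where \<phi>: "\<And>n. test \<Omega> (\<phi> n)" "(\<lambda>n. n2 ?M (\<lambda>x. \<phi> n x - u x)) \<longlonglongrightarrow> 0"
    "\<And>k. (\<lambda>n. n2 ?M (\<lambda>x. partial k (\<phi> n) x - du k x)) \<longlonglongrightarrow> 0"
    using H1_test_approx[OF \<Omega> u du] by blast
  have l: "l2 ?M (\<phi> n)" "l2 ?M (partial k (\<phi> n))" "l2 ?M u" "l2 ?M (du k)" for n k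
    using test_pd_l2[OF \<Omega>(1) \<phi>(1), of "[]" n] test_pd_l2[OF \<Omega>(1) \<phi>(1), of "[k]" n] u du
    by (auto simp: Hk_def Hk_mem_def L2_l2)
  have 1: "(\<lambda>n. ip ?M (partial k (\<phi> n)) w) \<longlonglongrightarrow> ip ?M (du k) w"
    using w by (intro ip_tendsto l \<phi>(3)) (simp add: L2_l2)
  have 2: "(\<lambda>n. - ip ?M (\<phi> n) w') \<longlonglongrightarrow> - ip ?M u w'"
    using w by (intro tendsto_minus ip_tendsto l \<phi>(2)) (simp add: L2_l2)
  have "ip ?M (partial k (\<phi> n)) w = - ip ?M (\<phi> n) w'" for n
    using w(3) \<phi>(1)[of n] by (simp add: wderiv_ip ip_commute)
  then show ?thesis using LIMSEQ_unique[OF 1] 2 by (simp add: ip_commute)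
qed

text \<open>For a test function in place of \<open>u\<close>, both sides are the pairing of
  \<open>v\<close> with the same mixed second derivative. This exchange of indices is behind the
  splitting of the gradient into curl and divergence.\<close>

lemma H1_swap:
  assumes \<Omega>: "open \<Omega>" "bounded \<Omega>" and u: "Hk \<Omega> 1 (frontier \<Omega>) u"
    and du: "\<And>k. L2 \<Omega> (du k)" "\<And>k. wderiv \<Omega> [k] u (du k)"
    and dv: "\<And>k. L2 \<Omega> (dv k)" "\<And>k. wderiv \<Omega> [k] v (dv k)"
  shows "ip (lebesgue_on \<Omega>) (du j) (dv k) = ip (lebesgue_on \<Omega>) (du k) (dv j)"
proof -
  let ?M = "lebesgue_on \<Omega>"
  obtain \<phi> where \<phi>: "\<And>n. test \<Omega> (\<phi> n)" "(\<lambda>n. n2 ?M (\<lambda>x. \<phi> n x - u x)) \<longlonglongrightarrow> 0"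
    "\<And>k. (\<lambda>n. n2 ?M (\<lambda>x. partial k (\<phi> n) x - du k x)) \<longlonglongrightarrow> 0"
    using H1_test_approx[OF \<Omega> u du] by blast
  have l: "l2 ?M (partial k (\<phi> n))" "l2 ?M (du k)" "l2 ?M (dv k)" for n k
    using test_pd_l2[OF \<Omega>(1) \<phi>(1), of "[k]" n] du dv by (auto simp: L2_l2)
  have lim: "(\<lambda>n. ip ?M (partial j (\<phi> n)) (dv k)) \<longlonglongrightarrow> ip ?M (du j) (dv k)" for j k
    by (intro ip_tendsto l \<phi>(3))
  have v: "ip ?M (dv k) \<psi> = - ip ?M v (partial k \<psi>)" if "test \<Omega> \<psi>" for \<psi> k
    using dv(2)[of k] that by (simp add: wderiv_ip)
  have "ip ?M (partial j (\<phi> n)) (dv k) = ip ?M (partial k (\<phi> n)) (dv j)" for n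
    using v[OF test_partial[OF \<phi>(1)], of k j n] v[OF test_partial[OF \<phi>(1)], of j k n]
      partial_commute[of "\<phi> n" j k] \<phi>(1)[of n] by (simp add: ip_commute test_def)
  then show ?thesis using LIMSEQ_unique[OF lim[of j k]] lim[of k j] by simp
qed

lemma Hk_diff:
  assumes \<Omega>: "open \<Omega>" "bounded \<Omega>" and "Hk \<Omega> k \<Sigma> f" "Hk \<Omega> k \<Sigma> g"
  shows "Hk \<Omega> k \<Sigma> (\<lambda>x. f x - g x)"
proof -
  define F where "F is = D \<Omega> is f" for "is"
  define G where "G is = D \<Omega> is g" for "is"
  have w: "weak_family \<Omega> k f F" "weak_family \<Omega> k g G"
    using assms Hk_mem_family unfolding F_def G_def by (auto simp: Hk_def)
  show ?thesis
  proof (rule HkI[OF \<Omega> weak_family_diff[OF \<Omega>(1) w]])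
    fix e :: real assume "e > 0"
    then have e2: "e/2 > 0" by simp
    obtain \<phi> where \<phi>: "Csig \<Sigma> \<phi>" "\<And>is. length is \<le> k \<Longrightarrow> n2 (lebesgue_on \<Omega>) (\<lambda>x. pd is \<phi> x - F is x) \<le> e/2"
      using Hk_HkI_eps[OF \<Omega> assms(3) w(1) e2] by blast
    obtain \<psi> where \<psi>: "Csig \<Sigma> \<psi>" "\<And>is. length is \<le> k \<Longrightarrow> n2 (lebesgue_on \<Omega>) (\<lambda>x. pd is \<psi> x - G is x) \<le> e/2"
      using Hk_HkI_eps[OF \<Omega> assms(4) w(2) e2] by blast
    have t: "test0 \<phi>" "test0 \<psi>" using \<phi> \<psi> Csig_test0 by auto
    have pdd: "pd is (\<lambda>x. \<phi> x - \<psi> x) = (\<lambda>x. pd is \<phi> x - pd is \<psi> x)" for "is"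
      using pd_add[OF test0D(1)[OF t(1)] smooth_cmult[OF test0D(1)[OF t(2)], of "-1"], of "is"]
        pd_cmult[OF test0D(1)[OF t(2)], of "is" "-1"] by simp
    have "n2 (lebesgue_on \<Omega>) (\<lambda>x. pd is (\<lambda>x. \<phi> x - \<psi> x) x - (F is x - G is x)) \<le> e" if l: "length is \<le> k" for "is"
    proof -
      have L: "l2 (lebesgue_on \<Omega>) (pd is \<phi>)" "l2 (lebesgue_on \<Omega>) (pd is \<psi>)" "l2 (lebesgue_on \<Omega>) (F is)" "l2 (lebesgue_on \<Omega>) (G is)"
        using t w l \<Omega>(1) by (auto simp: weak_family_def L2_l2 intro: test_l2 test0_pd)
      have "n2 (lebesgue_on \<Omega>) (\<lambda>x. (pd is \<phi> x - F is x) - (pd is \<psi> x - G is x)) \<le> e/2 + e/2"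
        using n2_diff_le[OF l2_diff[OF L(1,3)] l2_diff[OF L(2,4)]] \<phi>(2)[OF l] \<psi>(2)[OF l] by linarith
      then show ?thesis by (simp add: pdd algebra_simps)
    qed
    moreover have "Csig \<Sigma> (\<lambda>x. \<phi> x - \<psi> x)"
    proof -
      have cs: "csupp (\<lambda>x. \<phi> x - \<psi> x) \<subseteq> csupp \<phi> \<union> csupp \<psi>"
        by (rule csupp_subset) (auto simp: closed_csupp csupp_nonzero)
      obtain e1 where e1: "e1 > 0" "\<And>x y. x \<in> csupp \<phi> \<Longrightarrow> y \<in> \<Sigma> \<Longrightarrow> e1 \<le> dist x y" using \<phi>(1) by (auto simp: Csig_def)
      obtain e2 where e2: "e2 > 0" "\<And>x y. x \<in> csupp \<psi> \<Longrightarrow> y \<in> \<Sigma> \<Longrightarrow> e2 \<le> dist x y" using \<psi>(1) by (auto simp: Csig_def)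
      have "\<forall>x\<in>csupp (\<lambda>x. \<phi> x - \<psi> x). \<forall>y\<in>\<Sigma>. min e1 e2 \<le> dist x y"
        using cs e1(2) e2(2) by (auto simp: min_le_iff_disj)
      moreover have "min e1 e2 > 0" using e1 e2 by simp
      moreover have "smooth (\<lambda>x. \<phi> x - \<psi> x)" using t by (intro smooth_diff test0D)
      moreover have "compact (csupp (\<lambda>x. \<phi> x - \<psi> x))"
        by (rule compact_csupp_subset[of "csupp \<phi> \<union> csupp \<psi>"]) (use t in \<open>auto simp: test0_def csupp_nonzero\<close>)
      ultimately show ?thesis unfolding Csig_def by blast
    qed
    ultimately show "\<exists>\<phi>. Csig \<Sigma> \<phi> \<and> (\<forall>is. length is \<le> k \<longrightarrow> n2 (lebesgue_on \<Omega>) (\<lambda>x. pd is \<phi> x - (F is x - G is x)) \<le> e)"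
      by blast
  qed
qed

text \<open>Row-wise, the gradient splits into curl and divergence. By symmetry the divergence differs from the
  gradient of the trace only by curl terms, and the trace is an admissible test function for
  the double divergence.\<close>
lemma gradient_estimate:
  fixes T :: "3 \<Rightarrow> 3 \<Rightarrow> real^3 \<Rightarrow> real" and d :: "3 \<Rightarrow> 3 \<Rightarrow> 3 \<Rightarrow> real^3 \<Rightarrow> real"
  assumes \<Omega>: "open \<Omega>" "bounded \<Omega>"
    and T: "\<And>i j. Hk \<Omega> 1 (frontier \<Omega>) (T i j)"
    and d: "\<And>k i j. L2 \<Omega> (d k i j)" "\<And>k i j. wderiv \<Omega> [k] (T i j) (d k i j)"
    and sym: "\<And>k i j. AE x in lebesgue_on \<Omega>. d k i j x = d k j i x"
    and curl: "\<And>i k j l. \<exists>g. L2 \<Omega> g \<and> wderiv \<Omega> [l] (\<lambda>x. d k i j x - d j i k x) g \<and> n2 (lebesgue_on \<Omega>) g \<le> B"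
    and g: "L2 \<Omega> g" "n2 (lebesgue_on \<Omega>) g \<le> G"
    and divdiv: "\<And>\<phi>. test \<Omega> \<phi> \<Longrightarrow> (\<Sum>i\<in>UNIV. \<Sum>j\<in>UNIV. ip (lebesgue_on \<Omega>) (T i j) (pd [i, j] \<phi>)) = ip (lebesgue_on \<Omega>) g \<phi>"
    and \<tau>: "\<And>i j. n2 (lebesgue_on \<Omega>) (T i j) \<le> \<tau>"
  shows "(n2 (lebesgue_on \<Omega>) (d k i j))\<^sup>2 \<le> \<tau> * (81 * B + 6 * G)"
proof -
  let ?M = "lebesgue_on \<Omega>"
  have dl: "l2 ?M (d k i j)" for k i j using d by (simp add: L2_l2)
  have Tl: "l2 ?M (T i j)" for i j using T by (auto simp: Hk_def Hk_mem_def L2_l2)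
  have gl: "l2 ?M g" using g by (simp add: L2_l2)
  have \<tau>0: "\<tau> \<ge> 0" using order.trans[OF n2_nonneg \<tau>] .
  have B0: "B \<ge> 0" using curl order.trans[OF n2_nonneg] by blast
  have G0: "G \<ge> 0" using order.trans[OF n2_nonneg g(2)] .
  \<comment> \<open>With \<open>d k i j\<close> the derivative of \<open>T i j\<close> in direction
    \<open>k\<close>, these are up to sign the entries of the curl of row \<open>i\<close>,
    antisymmetric in \<open>k\<close> and \<open>j\<close>.\<close>
  define c where "c i k j x = d k i j x - d j i k x" for i k j x
  have cl: "l2 ?M (c i k j)" for i k j unfolding c_def[abs_def] by (intro l2_diff dl)
  have csq: "ip ?M (c i k j) (c i k j) \<le> 2 * B * \<tau>" for i k j
  proof -
    obtain g1 where g1: "L2 \<Omega> g1" "wderiv \<Omega> [k] (c i k j) g1" "n2 ?M g1 \<le> B"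
      using curl[of k k i j] by (auto simp: c_def[abs_def])
    obtain g2 where g2: "L2 \<Omega> g2" "wderiv \<Omega> [j] (c i k j) g2" "n2 ?M g2 \<le> B"
      using curl[of j k i j] by (auto simp: c_def[abs_def])
    have cL: "L2 \<Omega> (c i k j)" using cl by (simp add: L2_l2)
    \<comment> \<open>One factor is expanded, and its two derivatives are integrated by parts onto
      the other. What remains are derivatives of the curl, bounded by \<open>B\<close>, paired with
      entries of \<open>T\<close>.\<close>
    have "ip ?M (c i k j) (c i k j) = ip ?M (c i k j) (d k i j) - ip ?M (c i k j) (d j i k)"
      unfolding c_def[of i k j, abs_def] using cl[of i k j, unfolded c_def[abs_def]] by (intro ip_diff_right dl) auto
    also have "\<dots> = - ip ?M g1 (T i j) + ip ?M g2 (T i k)"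
      using H1_ibp[OF \<Omega> T d cL g1(1,2)] H1_ibp[OF \<Omega> T d cL g2(1,2)] by simp
    also have "\<dots> \<le> \<bar>ip ?M g1 (T i j)\<bar> + \<bar>ip ?M g2 (T i k)\<bar>" by linarith
    also have "\<dots> \<le> B * \<tau> + B * \<tau>"
      by (intro add_mono order.trans[OF Cauchy_Schwarz_ip] mult_mono g1(3) g2(3) \<tau> B0 n2_nonneg Tl)
        (use g1 g2 in \<open>auto simp: L2_l2\<close>)
    finally show ?thesis by simp
  qed
  \<comment> \<open>\<open>v\<close> is the row-wise divergence, \<open>t\<close> the trace and
    \<open>dt\<close> its gradient; \<open>w\<close> consists of the curl entries by which, for
    symmetric \<open>T\<close>, the divergence differs from \<open>dt\<close>.\<close>
  define v where "v i x = (\<Sum>j\<in>UNIV. d j i j x)" for i x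
  define w where "w i x = (\<Sum>j\<in>UNIV. c j j i x)" for i x
  define t where "t x = (\<Sum>j\<in>UNIV. T j j x)" for x
  define dt where "dt i x = (\<Sum>j\<in>UNIV. d i j j x)" for i x
  have vl: "l2 ?M (v i)" and wl: "l2 ?M (w i)" and dtl: "l2 ?M (dt i)" and tl: "l2 ?M t" for i
    unfolding v_def[abs_def] w_def[abs_def] dt_def[abs_def] t_def[abs_def] by (intro l2_sum dl cl Tl)+
  \<comment> \<open>The factor 1/2 appears because each unordered pair of indices is counted twice
    in the curl sum. After exchanging derivatives by \<open>H1_swap\<close>, the mixed products add
    up to the squared norm of the divergence.\<close>
  have row: "(\<Sum>k\<in>UNIV. \<Sum>j\<in>UNIV. ip ?M (d k i j) (d k i j))
     = 1/2 * (\<Sum>k\<in>UNIV. \<Sum>j\<in>UNIV. ip ?M (c i k j) (c i k j)) + ip ?M (v i) (v i)" for i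
  proof -
    have "ip ?M (c i k j) (c i k j) = ip ?M (d k i j) (d k i j) + ip ?M (d j i k) (d j i k) - 2 * ip ?M (d k i j) (d j i k)" for k j
      unfolding c_def[abs_def]
      by (simp add: ip_diff_left ip_diff_right dl l2_diff ip_commute[of ?M "d j i k" "d k i j"])
    moreover have "ip ?M (d k i j) (d j i k) = ip ?M (d j i j) (d k i k)" for k j
      by (rule H1_swap[OF \<Omega> T[of i j] d(1)[of _ i j] d(2)[of _ i j] d(1)[of _ i k] d(2)[of _ i k]])
    moreover have "ip ?M (v i) (v i) = (\<Sum>j\<in>UNIV. \<Sum>k\<in>UNIV. ip ?M (d j i j) (d k i k))"
      unfolding v_def[abs_def] by (subst ip_sum_left) (auto intro!: dl l2_sum sum.cong ip_sum_right)
    ultimately show ?thesis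
      by (simp add: sum_3 ip_commute add_divide_distrib diff_divide_distrib)
  qed
  have vdt: "AE x in ?M. v i x = dt i x + w i x" for i
  proof -
    have "AE x in ?M. \<forall>j\<in>UNIV. d j i j x = d j j i x"
      by (rule AE_finite_allI) (auto intro: sym)
    then show ?thesis
      by eventually_elim (simp add: v_def dt_def w_def c_def sum.distrib[symmetric])
  qed
  have ipv: "ip ?M (v i) f = ip ?M (dt i) f + ip ?M (w i) f" if f: "l2 ?M f" for i f
  proof -
    have "ip ?M (v i) f = ip ?M (\<lambda>x. dt i x + w i x) f"
      unfolding ip_def using vdt[of i] vl[of i] wl[of i] dtl[of i] f
      by (intro integral_cong_AE) (auto simp: l2_def elim!: eventually_mono)
    then show ?thesis using ip_add_left[OF dtl wl f] by simp
  qed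
  have tr: "(\<Sum>i\<in>UNIV. ip ?M (v i) (dt i)) = - ip ?M g t"
  proof -
    \<comment> \<open>The equation for the double divergence holds against test functions only, so
      the diagonal entry is first replaced by its approximants; for these the outer derivative of
      \<open>v i\<close> moves onto the test function.\<close>
    have each: "(\<Sum>i\<in>UNIV. ip ?M (v i) (d i a a)) = - ip ?M g (T a a)" for a
    proof -
      obtain \<phi> where \<phi>: "\<And>n. test \<Omega> (\<phi> n)" "(\<lambda>n. n2 ?M (\<lambda>x. \<phi> n x - T a a x)) \<longlonglongrightarrow> 0"
        "\<And>k. (\<lambda>n. n2 ?M (\<lambda>x. partial k (\<phi> n) x - d k a a x)) \<longlonglongrightarrow> 0"
        using H1_test_approx[OF \<Omega> T[of a a] d(1)[of _ a a] d(2)[of _ a a]] by blast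
      have pl: "l2 ?M (\<phi> n)" "l2 ?M (partial k (\<phi> n))" for n k
        using test_pd_l2[OF \<Omega>(1) \<phi>(1), of "[]" n] test_pd_l2[OF \<Omega>(1) \<phi>(1), of "[k]" n] by auto
      have 1: "(\<lambda>n. \<Sum>i\<in>UNIV. ip ?M (partial i (\<phi> n)) (v i)) \<longlonglongrightarrow> (\<Sum>i\<in>UNIV. ip ?M (d i a a) (v i))"
        by (intro tendsto_sum ip_tendsto pl dl \<phi>(3) vl)
      have 2: "(\<lambda>n. - ip ?M (\<phi> n) g) \<longlonglongrightarrow> - ip ?M (T a a) g"
        by (intro tendsto_minus ip_tendsto pl Tl \<phi>(2) gl)
      have "(\<Sum>i\<in>UNIV. ip ?M (partial i (\<phi> n)) (v i)) = - ip ?M (\<phi> n) g" for n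
      proof -
        have "ip ?M (v i) (partial i (\<phi> n)) = (\<Sum>j\<in>UNIV. - ip ?M (T i j) (pd [i, j] (\<phi> n)))" for i
        proof -
          have "ip ?M (v i) (partial i (\<phi> n)) = (\<Sum>j\<in>UNIV. ip ?M (d j i j) (partial i (\<phi> n)))"
            unfolding v_def[abs_def] by (intro ip_sum_left dl pl)
          moreover have "ip ?M (d j i j) (partial i (\<phi> n)) = - ip ?M (T i j) (pd [i, j] (\<phi> n))" for j
            using d(2)[of j i j] test_partial[OF \<phi>(1)[of n], of i] partial_commute[of "\<phi> n" i j] \<phi>(1)[of n]
            by (simp add: wderiv_ip test_def)
          ultimately show ?thesis by simp
        qed
        then show ?thesis
          using divdiv[OF \<phi>(1)[of n]] by (simp add: ip_commute[of ?M "partial _ (\<phi> n)"] ip_commute[of ?M "\<phi> n"] sum_negf)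
      qed
      then have "(\<Sum>i\<in>UNIV. ip ?M (d i a a) (v i)) = - ip ?M (T a a) g"
        using LIMSEQ_unique[OF 1] 2 by simp
      then show ?thesis by (simp add: ip_commute)
    qed
    have "(\<Sum>i\<in>UNIV. ip ?M (v i) (dt i)) = (\<Sum>i\<in>UNIV. \<Sum>a\<in>UNIV. ip ?M (v i) (d i a a))"
      unfolding dt_def[abs_def] by (intro sum.cong refl ip_sum_right dl vl)
    also have "\<dots> = (\<Sum>a\<in>UNIV. \<Sum>i\<in>UNIV. ip ?M (v i) (d i a a))" by (rule sum.swap)
    also have "\<dots> = (\<Sum>a\<in>UNIV. - ip ?M g (T a a))" by (simp add: each)
    also have "\<dots> = - ip ?M g t"
      unfolding t_def[abs_def] using ip_sum_right[of UNIV ?M "\<lambda>a. T a a" g] Tl gl by (simp add: sum_negf)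
    finally show ?thesis .
  qed
  \<comment> \<open>Three curl entries give nine products, each at most
    \<open>2 * B * \<tau>\<close>.\<close>
  have wn: "ip ?M (w i) (w i) \<le> 18 * B * \<tau>" for i
  proof -
    have cs: "ip ?M (c a a i) (c b b i) \<le> 2 * B * \<tau>" for a b
    proof -
      have "ip ?M (c a a i) (c b b i) \<le> n2 ?M (c a a i) * n2 ?M (c b b i)"
        using Cauchy_Schwarz_ip[OF cl cl] abs_le_D1 by blast
      also have "\<dots> \<le> sqrt (2 * B * \<tau>) * sqrt (2 * B * \<tau>)"
        unfolding n2_ip using B0 \<tau>0 by (intro mult_mono real_sqrt_le_mono csq) (auto simp: ip_self_nonneg)
      also have "\<dots> = 2 * B * \<tau>" using B0 \<tau>0 by simp
      finally show ?thesis .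
    qed
    have "ip ?M (w i) (w i) = (\<Sum>a\<in>UNIV. \<Sum>b\<in>UNIV. ip ?M (c a a i) (c b b i))"
      unfolding w_def[abs_def] by (subst ip_sum_left) (auto intro!: cl l2_sum sum.cong ip_sum_right)
    also have "\<dots> \<le> (\<Sum>a\<in>(UNIV::3 set). \<Sum>b\<in>(UNIV::3 set). 2 * B * \<tau>)" by (intro sum_mono cs)
    finally show ?thesis by simp
  qed
  \<comment> \<open>Young's inequality with weight 1/2, so that the divergence term can be absorbed
    into the left-hand side below.\<close>
  have vw: "ip ?M (v i) (w i) \<le> 1/2 * ip ?M (v i) (v i) + 9 * B * \<tau>" for i
  proof -
    have "0 \<le> ip ?M (\<lambda>x. v i x - w i x) (\<lambda>x. v i x - w i x)" by (rule ip_self_nonneg)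
    also have "\<dots> = ip ?M (v i) (v i) - 2 * ip ?M (v i) (w i) + ip ?M (w i) (w i)"
      by (simp add: ip_diff_left ip_diff_right vl wl l2_diff ip_commute[of ?M "w i" "v i"])
    finally show ?thesis using wn[of i] by simp
  qed
  have gt: "\<bar>ip ?M g t\<bar> \<le> 3 * \<tau> * G"
  proof -
    have "\<bar>ip ?M g t\<bar> \<le> n2 ?M g * n2 ?M t" by (rule Cauchy_Schwarz_ip[OF gl tl])
    also have "\<dots> \<le> G * (3 * \<tau>)"
    proof (intro mult_mono g(2) G0 n2_nonneg)
      have "n2 ?M t \<le> (\<Sum>j\<in>UNIV. n2 ?M (T j j))" unfolding t_def[abs_def] by (intro n2_sum_le Tl) auto
      also have "\<dots> \<le> (\<Sum>j\<in>(UNIV::3 set). \<tau>)" by (intro sum_mono \<tau>)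
      finally show "n2 ?M t \<le> 3 * \<tau>" by simp
    qed
    finally show ?thesis by (simp add: mult_ac)
  qed
  have "ip ?M (v i) (v i) = ip ?M (v i) (dt i) + ip ?M (v i) (w i)" for i
    using ipv[OF vl, of i i] ip_commute[of ?M "dt i" "v i"] ip_commute[of ?M "w i" "v i"] by simp
  then have "(\<Sum>i\<in>UNIV. ip ?M (v i) (v i)) = (\<Sum>i\<in>UNIV. ip ?M (v i) (dt i)) + (\<Sum>i\<in>UNIV. ip ?M (v i) (w i))"
    by (simp only: sum.distrib)
  also have "\<dots> \<le> 3 * \<tau> * G + (\<Sum>i\<in>(UNIV::3 set). 1/2 * ip ?M (v i) (v i) + 9 * B * \<tau>)"
    using gt unfolding tr by (intro add_mono sum_mono vw) (auto simp: abs_le_iff)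
  also have "\<dots> = 3 * \<tau> * G + 1/2 * (\<Sum>i\<in>UNIV. ip ?M (v i) (v i)) + 27 * B * \<tau>"
    by (simp add: sum.distrib sum_divide_distrib)
  finally have V: "(\<Sum>i\<in>UNIV. ip ?M (v i) (v i)) \<le> 6 * \<tau> * G + 54 * B * \<tau>" by simp
  have "(n2 ?M (d k i j))\<^sup>2 \<le> (\<Sum>i\<in>UNIV. \<Sum>k\<in>UNIV. \<Sum>j\<in>UNIV. ip ?M (d k i j) (d k i j))"
  proof -
    have "ip ?M (d k i j) (d k i j) \<le> (\<Sum>j\<in>UNIV. ip ?M (d k i j) (d k i j))"
      by (rule member_le_sum) (auto simp: ip_self_nonneg)
    also have "\<dots> \<le> (\<Sum>k\<in>UNIV. \<Sum>j\<in>UNIV. ip ?M (d k i j) (d k i j))"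
      by (rule member_le_sum[where f = "\<lambda>k. \<Sum>j\<in>UNIV. ip ?M (d k i j) (d k i j)"]) (auto simp: ip_self_nonneg sum_nonneg)
    also have "\<dots> \<le> (\<Sum>i\<in>UNIV. \<Sum>k\<in>UNIV. \<Sum>j\<in>UNIV. ip ?M (d k i j) (d k i j))"
      by (rule member_le_sum[where f = "\<lambda>i. \<Sum>k\<in>UNIV. \<Sum>j\<in>UNIV. ip ?M (d k i j) (d k i j)"]) (auto simp: ip_self_nonneg sum_nonneg)
    finally show ?thesis by (simp add: n2_sq)
  qed
  also have "\<dots> = (\<Sum>i\<in>UNIV. 1/2 * (\<Sum>k\<in>UNIV. \<Sum>j\<in>UNIV. ip ?M (c i k j) (c i k j))) + (\<Sum>i\<in>UNIV. ip ?M (v i) (v i))"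
    by (simp only: row sum.distrib)
  also have "\<dots> \<le> (\<Sum>i\<in>(UNIV::3 set). 1/2 * (\<Sum>k\<in>(UNIV::3 set). \<Sum>j\<in>(UNIV::3 set). 2 * B * \<tau>)) + (6 * \<tau> * G + 54 * B * \<tau>)"
    by (intro add_mono V sum_mono mult_left_mono csq) simp
  \<comment> \<open>Of the 81, the curl terms contribute 27, half of 3 * 9 * 2, and the divergence
    54.\<close>
  also have "\<dots> = \<tau> * (81 * B + 6 * G)" by (simp add: algebra_simps)
  finally show ?thesis .
qed

section \<open>Weak rotation and double divergence in components\<close>

lemma D_cong:
  assumes "\<And>x. x \<in> \<Omega> \<Longrightarrow> f x = g x"
  shows "D \<Omega> is f = D \<Omega> is g"
proof -
  have "(LINT x|lebesgue_on \<Omega>. f x * pd is \<phi> x) = (LINT x|lebesgue_on \<Omega>. g x * pd is \<phi> x)" for \<phi>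
    using assms by (intro Bochner_Integration.integral_cong) (auto simp: space_restrict_space)
  then have "wderiv \<Omega> is f = wderiv \<Omega> is g" by (simp add: wderiv_def fun_eq_iff)
  then show ?thesis by (simp add: D_def)
qed

text \<open>Index arithmetic takes place in the type \<open>3\<close>, that is, modulo 3.\<close>
lemma mod3_simps: "(4::3) = 1" "(5::3) = 2" "(6::3) = 3" "(7::3) = 1"
  by simp_all

text \<open>Tested with the matrix field whose only nonzero entry, at position
  \<open>(i, p)\<close>, is \<open>\<psi>\<close>. The absence of signs in \<open>weak_Rot\<close>
  reflects that the curl is formally self-adjoint.\<close>

lemma weak_Rot_component:
  assumes \<Omega>: "open \<Omega>" and S: "ML2 \<Omega> S" and R: "weak_Rot \<Omega> S R" and \<psi>: "test \<Omega> \<psi>"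
  shows "ip (lebesgue_on \<Omega>) (comp R i p) \<psi> = ip (lebesgue_on \<Omega>) (comp S i (p + 1)) (partial (p + 2) \<psi>)
    - ip (lebesgue_on \<Omega>) (comp S i (p + 2)) (partial (p + 1) \<psi>)"
proof -
  let ?M = "lebesgue_on \<Omega>"
  define \<Phi> :: "real^3 \<Rightarrow> real^3^3" where "\<Phi> x = (\<chi> a b. if a = i \<and> b = p then \<psi> x else 0)" for x
  have c: "comp \<Phi> a b = (if a = i \<and> b = p then \<psi> else (\<lambda>_. 0))" for a b
    by (auto simp: comp_def \<Phi>_def)
  have "test \<Omega> (\<lambda>_. 0)" by (simp add: test_def smooth_const csupp_def)
  then have "test \<Omega> (comp \<Phi> a b)" for a b using \<psi> by (simp add: c)
  then have eq: "(LINT x|?M. frob (S x) (Rot_c \<Phi> x)) = (LINT x|?M. frob (R x) (\<Phi> x))"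
    using R by (simp add: weak_Rot_def)
  have pc: "partial a (comp \<Phi> b e) x = (if b = i \<and> e = p then partial a \<psi> x else 0)" for a b e x
    by (simp add: c partial_const)
  have "frob (S x) (Rot_c \<Phi> x) = comp S i (p + 1) x * partial (p + 2) \<psi> x - comp S i (p + 2) x * partial (p + 1) \<psi> x" for x
  proof -
    have "frob (S x) (Rot_c \<Phi> x) = (\<Sum>a\<in>UNIV. if a = i then (\<Sum>b\<in>UNIV. S x $ i $ b *
        ((if b + 2 = p then partial (b + 1) \<psi> x else 0) - (if b + 1 = p then partial (b + 2) \<psi> x else 0))) else 0)"
      unfolding frob_def by (rule sum.cong) (auto simp: Rot_c_def pc intro!: sum.cong)
    also have "\<dots> = (\<Sum>b\<in>UNIV. S x $ i $ b *
        ((if b + 2 = p then partial (b + 1) \<psi> x else 0) - (if b + 1 = p then partial (b + 2) \<psi> x else 0)))"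
      by simp
    also have "\<dots> = comp S i (p + 1) x * partial (p + 2) \<psi> x - comp S i (p + 2) x * partial (p + 1) \<psi> x"
      using exhaust_3[of p] by (auto simp: sum_3 comp_def mod3_simps)
    finally show ?thesis .
  qed
  moreover have "frob (R x) (\<Phi> x) = comp R i p x * \<psi> x" for x
  proof -
    have "frob (R x) (\<Phi> x) = (\<Sum>a\<in>UNIV. if a = i then (\<Sum>b\<in>UNIV. R x $ i $ b * (if b = p then \<psi> x else 0)) else 0)"
      unfolding frob_def by (rule sum.cong) (auto simp: \<Phi>_def)
    then show ?thesis by (simp add: comp_def if_distrib cong: if_cong)
  qed
  moreover have "l2 ?M (comp S a b)" for a b using S by (simp add: ML2_def L2_l2)
  ultimately show ?thesis
    using eq test_pd_l2[OF \<Omega> \<psi>, of "[_]"]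
    by (simp add: ip_def Bochner_Integration.integral_diff[OF l2_mult l2_mult])
qed

lemma weak_divDiv_ip:
  assumes \<Omega>: "open \<Omega>" and S: "ML2 \<Omega> S" and g: "weak_divDiv \<Omega> S g" and \<psi>: "test \<Omega> \<psi>"
  shows "(\<Sum>i\<in>UNIV. \<Sum>j\<in>UNIV. ip (lebesgue_on \<Omega>) (comp S i j) (pd [i, j] \<psi>)) = ip (lebesgue_on \<Omega>) g \<psi>"
proof -
  have "integrable (lebesgue_on \<Omega>) (\<lambda>x. S x $ i $ j * pd [i, j] \<psi> x)" for i j
    using l2_mult[of "lebesgue_on \<Omega>" "comp S i j" "pd [i, j] \<psi>"] S test_pd_l2[OF \<Omega> \<psi>, of "[i, j]"]
    by (simp add: ML2_def L2_l2 comp_def)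
  moreover have "(LINT x|lebesgue_on \<Omega>. (\<Sum>i\<in>UNIV. \<Sum>j\<in>UNIV. S x $ i $ j * pd [i, j] \<psi> x)) = ip (lebesgue_on \<Omega>) g \<psi>"
    using g \<psi> by (simp add: weak_divDiv_def ip_def)
  ultimately show ?thesis by (simp add: ip_def comp_def)
qed

lemma RotW_props:
  assumes "H_Rot \<Omega> \<Sigma> S"
  shows "ML2 \<Omega> (RotW \<Omega> S)" "weak_Rot \<Omega> S (RotW \<Omega> S)"
proof -
  have "\<exists>R. ML2 \<Omega> R \<and> weak_Rot \<Omega> S R" using assms by (auto simp: H_Rot_def)
  then have "ML2 \<Omega> (RotW \<Omega> S) \<and> weak_Rot \<Omega> S (RotW \<Omega> S)" unfolding RotW_def by (rule someI_ex)
  then show "ML2 \<Omega> (RotW \<Omega> S)" "weak_Rot \<Omega> S (RotW \<Omega> S)" by auto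
qed

lemma divDivW_props:
  assumes "H_divDiv \<Omega> \<Sigma> S"
  shows "L2 \<Omega> (divDivW \<Omega> S)" "weak_divDiv \<Omega> S (divDivW \<Omega> S)"
proof -
  have "\<exists>g. L2 \<Omega> g \<and> weak_divDiv \<Omega> S g" using assms by (auto simp: H_divDiv_def)
  then have "L2 \<Omega> (divDivW \<Omega> S) \<and> weak_divDiv \<Omega> S (divDivW \<Omega> S)" unfolding divDivW_def by (rule someI_ex)
  then show "L2 \<Omega> (divDivW \<Omega> S)" "weak_divDiv \<Omega> S (divDivW \<Omega> S)" by auto
qed

lemma Hk_norm_le_MHk_norm: "Hk_norm \<Omega> k (comp S i j) \<le> MHk_norm \<Omega> k S"
  unfolding MHk_norm_def
proof (rule real_le_rsqrt)
  have "(Hk_norm \<Omega> k (comp S i j))\<^sup>2 \<le> (\<Sum>j\<in>UNIV. (Hk_norm \<Omega> k (comp S i j))\<^sup>2)"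
    by (rule member_le_sum) auto
  also have "\<dots> \<le> (\<Sum>i\<in>UNIV. \<Sum>j\<in>UNIV. (Hk_norm \<Omega> k (comp S i j))\<^sup>2)"
    by (rule member_le_sum[where f = "\<lambda>i. \<Sum>j\<in>UNIV. (Hk_norm \<Omega> k (comp S i j))\<^sup>2"]) (auto intro: sum_nonneg)
  finally show "(Hk_norm \<Omega> k (comp S i j))\<^sup>2 \<le> (\<Sum>i\<in>UNIV. \<Sum>j\<in>UNIV. (Hk_norm \<Omega> k (comp S i j))\<^sup>2)" .
qed

lemma MHk_norm_nonneg: "MHk_norm \<Omega> k S \<ge> 0"
  by (simp add: MHk_norm_def sum_nonneg)

text \<open>Up to sign the difference is zero or an entry of the derivative \<open>\<alpha>\<close> of \<open>R\<close>.\<close>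
lemma curl_entry:
  assumes \<Omega>: "open \<Omega>" "bounded \<Omega>" and S: "ML2 \<Omega> S" and R: "ML2 \<Omega> R" "weak_Rot \<Omega> S R"
    and V: "\<And>i j. weak_family \<Omega> k (comp S i j) (V i j)" and W: "\<And>i j. weak_family \<Omega> k (comp R i j) (W i j)"
    and WC: "\<And>i j is. length is \<le> k \<Longrightarrow> n2 (lebesgue_on \<Omega>) (W i j is) \<le> C"
    and \<alpha>: "length \<alpha> < k" and C: "C \<ge> 0"
  shows "\<exists>g. L2 \<Omega> g \<and> wderiv \<Omega> [l] (\<lambda>x. V i j (\<alpha> @ [a]) x - V i a (\<alpha> @ [j]) x) g \<and> n2 (lebesgue_on \<Omega>) g \<le> C"
proof -
  let ?M = "lebesgue_on \<Omega>"
  have VL: "L2 \<Omega> (V i j is)" and Vw: "wderiv \<Omega> is (comp S i j) (V i j is)" if "length is \<le> k" for i j "is"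
    using V[of i j] that by (auto simp: weak_family_def)
  have WL: "L2 \<Omega> (W i j is)" and Ww: "wderiv \<Omega> is (comp R i j) (W i j is)" if "length is \<le> k" for i j "is"
    using W[of i j] that by (auto simp: weak_family_def)
  have la: "length (\<alpha> @ [a]) \<le> k" for a :: 3 using \<alpha> by simp
  have lc: "l2 ?M (V i j (\<alpha> @ [a]))" for i j a using VL[OF la] by (simp add: L2_l2)
  \<comment> \<open>Testing with \<open>pd \<alpha> \<phi>\<close> in place of \<open>\<phi>\<close>
    carries the derivative \<open>\<alpha>\<close> through the curl; \<open>weak_zero\<close> then
    turns the weak identity into one almost everywhere.\<close>
  have key: "AE x in ?M. V i (p + 2) (\<alpha> @ [p + 1]) x - V i (p + 1) (\<alpha> @ [p + 2]) x = W i p \<alpha> x" for p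
  proof -
    have "AE x in ?M. V i (p + 2) (\<alpha> @ [p + 1]) x - V i (p + 1) (\<alpha> @ [p + 2]) x - W i p \<alpha> x = 0"
    proof (rule weak_zero[OF \<Omega>])
      have WLl: "l2 ?M (W i p \<alpha>)" using WL[of \<alpha>] \<alpha> by (simp add: L2_l2)
      show "l2 ?M (\<lambda>x. V i (p + 2) (\<alpha> @ [p + 1]) x - V i (p + 1) (\<alpha> @ [p + 2]) x - W i p \<alpha> x)"
        by (intro l2_diff lc WLl)
      fix \<phi> assume t: "test \<Omega> \<phi>"
      have tl: "l2 ?M \<phi>" using test_pd_l2[OF \<Omega>(1) t, of "[]"] by simp
      have sm: "smooth \<phi>" using t by (simp add: test_def)
      have Vip: "ip ?M (V i j (\<alpha> @ [a])) \<phi> = - ((-1) ^ length \<alpha> * ip ?M (comp S i j) (partial a (pd \<alpha> \<phi>)))" for j a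
      proof -
        have "ip ?M (comp S i j) (pd (\<alpha> @ [a]) \<phi>) = (-1) ^ length (\<alpha> @ [a]) * ip ?M (V i j (\<alpha> @ [a])) \<phi>"
          using Vw[OF la] t by (simp add: wderiv_ip)
        moreover have "pd (\<alpha> @ [a]) \<phi> = partial a (pd \<alpha> \<phi>)" using pd_partial[OF sm] by (simp add: pd_append)
        ultimately show ?thesis by (cases "even (length \<alpha>)") auto
      qed
      have Wip: "ip ?M (W i p \<alpha>) \<phi> = (-1) ^ length \<alpha> * ip ?M (comp R i p) (pd \<alpha> \<phi>)"
        using Ww[of \<alpha> i p] \<alpha> t by (cases "even (length \<alpha>)") (auto simp: wderiv_ip)
      have "ip ?M (\<lambda>x. V i (p + 2) (\<alpha> @ [p + 1]) x - V i (p + 1) (\<alpha> @ [p + 2]) x - W i p \<alpha> x) \<phi>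
        = ip ?M (V i (p + 2) (\<alpha> @ [p + 1])) \<phi> - ip ?M (V i (p + 1) (\<alpha> @ [p + 2])) \<phi> - ip ?M (W i p \<alpha>) \<phi>"
        by (simp add: ip_diff_left l2_diff lc WLl tl)
      also have "\<dots> = 0"
        unfolding Vip Wip weak_Rot_component[OF \<Omega>(1) S R(2) test_pd[OF t]] by (simp add: algebra_simps)
      finally show "(\<integral>x. (V i (p + 2) (\<alpha> @ [p + 1]) x - V i (p + 1) (\<alpha> @ [p + 2]) x - W i p \<alpha> x) * \<phi> x \<partial>?M) = 0"
        by (simp add: ip_def)
    qed
    then show ?thesis by eventually_elim simp
  qed
  have Wd: "wderiv \<Omega> [l] (W i p \<alpha>) (W i p (\<alpha> @ [l]))" for p
    by (rule wderiv_drop[OF Ww Ww]) (use \<alpha> in auto)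
  have pos: "\<exists>g. L2 \<Omega> g \<and> wderiv \<Omega> [l] (\<lambda>x. V i (p + 2) (\<alpha> @ [p + 1]) x - V i (p + 1) (\<alpha> @ [p + 2]) x) g \<and> n2 ?M g \<le> C" for p
  proof (intro exI conjI)
    show "wderiv \<Omega> [l] (\<lambda>x. V i (p + 2) (\<alpha> @ [p + 1]) x - V i (p + 1) (\<alpha> @ [p + 2]) x) (W i p (\<alpha> @ [l]))"
      by (rule wderiv_cong_AE[OF \<Omega>(1) _ _ _ Wd[of p]])
        (use WL[of \<alpha>] \<alpha> lc key[of p] in \<open>auto simp: L2_l2 intro!: l2_diff elim!: eventually_mono\<close>)
  qed (use WL[OF la] WC[OF la] in auto)
  have neg: "\<exists>g. L2 \<Omega> g \<and> wderiv \<Omega> [l] (\<lambda>x. V i (p + 1) (\<alpha> @ [p + 2]) x - V i (p + 2) (\<alpha> @ [p + 1]) x) g \<and> n2 ?M g \<le> C" for p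
  proof -
    obtain g where g: "L2 \<Omega> g" "wderiv \<Omega> [l] (\<lambda>x. V i (p + 2) (\<alpha> @ [p + 1]) x - V i (p + 1) (\<alpha> @ [p + 2]) x) g" "n2 ?M g \<le> C"
      using pos by blast
    have "wderiv \<Omega> [l] (\<lambda>x. V i (p + 1) (\<alpha> @ [p + 2]) x - V i (p + 2) (\<alpha> @ [p + 1]) x) (\<lambda>x. - g x)"
      using wderiv_cmult[OF g(2), of "-1"] by simp
    then show ?thesis using g by (intro exI[of _ "\<lambda>x. - g x"]) (auto simp: L2_l2 l2_uminus n2_uminus)
  qed
  show ?thesis
  \<comment> \<open>Two distinct indices modulo 3 are \<open>p + 1\<close> and \<open>p + 2\<close>
    in one of the two orders, with \<open>p\<close> the third index.\<close>
  proof (cases "a = j")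
    case True
    have "wderiv \<Omega> [l] (\<lambda>x. 0) (\<lambda>x. 0)" by (simp add: wderiv_def)
    then show ?thesis using True C by (intro exI[of _ "\<lambda>x. 0"]) (auto simp: L2_l2 l2_zero n2_def)
  next
    case False
    then show ?thesis
      using exhaust_3[of a] exhaust_3[of j] pos[of 1] pos[of 2] pos[of 3] neg[of 1] neg[of 2] neg[of 3]
      by (auto simp: mod3_simps)
  qed
qed

text \<open>Successive extraction for finitely many indices: \<open>stable\<close> preserves what
  has been secured under further thinning, so no diagonal sequence is involved.\<close>

lemma common_subsequence:
  fixes Q :: "'a \<Rightarrow> (nat \<Rightarrow> nat) \<Rightarrow> bool"
  assumes "finite I"
    and ex: "\<And>a s. a \<in> I \<Longrightarrow> strict_mono (s :: nat \<Rightarrow> nat) \<Longrightarrow> \<exists>r. strict_mono r \<and> Q a (s \<circ> r)"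
    and stable: "\<And>a s r. Q a s \<Longrightarrow> strict_mono r \<Longrightarrow> Q a (s \<circ> r)"
  shows "\<exists>r. strict_mono r \<and> (\<forall>a\<in>I. Q a r)"
  using assms(1) ex
proof (induction I rule: finite_induct)
  case empty
  show ?case by (intro exI[of _ id]) (simp add: strict_mono_def)
next
  case (insert a I)
  then obtain r where r: "strict_mono r" "\<forall>a\<in>I. Q a r" by auto
  obtain r' where r': "strict_mono r'" "Q a (r \<circ> r')" using insert.prems[of a r] r(1) by blast
  have "strict_mono (r \<circ> r')" using r(1) r'(1) by (rule strict_mono_o)
  moreover have "\<forall>b\<in>insert a I. Q b (r \<circ> r')" using r(2) r'(2) stable[OF _ r'(1)] by blast
  ultimately show ?case by (intro exI[of _ "r \<circ> r'"] conjI)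
qed

lemma D_Hk_norm_le:
  assumes \<Omega>: "open \<Omega>" "bounded \<Omega>" and f: "weak_family \<Omega> k f V" and le: "Hk_norm \<Omega> k f \<le> C"
    and \<alpha>: "length \<alpha> < k"
  shows "Hk_norm \<Omega> 1 (V \<alpha>) \<le> real (card {is :: 3 list. length is \<le> 1}) * C"
proof -
  have V: "L2 \<Omega> (V is)" "wderiv \<Omega> is f (V is)" if "length is \<le> k" for "is"
    using f that by (auto simp: weak_family_def)
  have "weak_family \<Omega> 1 (V \<alpha>) (\<lambda>is. V (\<alpha> @ is))"
    unfolding weak_family_def using \<alpha> by (auto intro!: V wderiv_drop[OF V(2) V(2)])
  from weak_family_norm(2)[OF \<Omega> this]
  have "Hk_norm \<Omega> 1 (V \<alpha>) \<le> (\<Sum>is\<in>{is. length is \<le> 1}. n2 (lebesgue_on \<Omega>) (V (\<alpha> @ is)))" .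
  also have "\<dots> \<le> (\<Sum>is\<in>{is :: 3 list. length is \<le> 1}. C)"
  proof (rule sum_mono)
    fix "is" :: "3 list" assume "is \<in> {is. length is \<le> 1}"
    then have "length (\<alpha> @ is) \<le> k" using \<alpha> by simp
    then show "n2 (lebesgue_on \<Omega>) (V (\<alpha> @ is)) \<le> C" using weak_family_norm(1)[OF \<Omega> f] le order.trans by blast
  qed
  finally have "Hk_norm \<Omega> 1 (V \<alpha>) \<le> (\<Sum>is\<in>{is :: 3 list. length is \<le> 1}. C)" .
  then show ?thesis by simp
qed

text \<open>Orders up to \<open>k - 1\<close> come from Rellich's theorem, one extraction for each
  entry and multi-index. For the top order no further subsequence is taken:
  \<open>gradient_estimate\<close>, applied to differences, bounds it by the order below.\<close>

lemma derivatives_Cauchy: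
  fixes Sq :: "nat \<Rightarrow> real^3 \<Rightarrow> real^3^3"
  assumes \<Omega>: "open \<Omega>" "bounded \<Omega>" and k: "k \<ge> 1" and C: "C \<ge> 0"
    and u: "\<And>n i j. Hk \<Omega> k (frontier \<Omega>) (comp (Sq n) i j)" "\<And>n i j. Hk_norm \<Omega> k (comp (Sq n) i j) \<le> C"
    and sym: "\<And>n. symfield \<Omega> (Sq n)"
    and R: "\<And>n. ML2 \<Omega> (R n)" "\<And>n. weak_Rot \<Omega> (Sq n) (R n)"
      "\<And>n i j. Hk_mem \<Omega> k (comp (R n) i j)" "\<And>n i j. Hk_norm \<Omega> k (comp (R n) i j) \<le> C"
    and g: "\<And>n. L2 \<Omega> (g n)" "\<And>n. weak_divDiv \<Omega> (Sq n) (g n)"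
      "\<And>n. Hk_mem \<Omega> (k - 1) (g n)" "\<And>n. Hk_norm \<Omega> (k - 1) (g n) \<le> C"
  shows "\<exists>r :: nat \<Rightarrow> nat. strict_mono r \<and> (\<forall>i j \<beta>. length \<beta> \<le> k \<longrightarrow> (\<forall>e>0. \<exists>N. \<forall>m\<ge>N. \<forall>n\<ge>N.
    n2 (lebesgue_on \<Omega>) (\<lambda>x. D \<Omega> \<beta> (comp (Sq (r m)) i j) x - D \<Omega> \<beta> (comp (Sq (r n)) i j) x) < e))"
proof -
  let ?M = "lebesgue_on \<Omega>"
  define V where "V n i j \<beta> = D \<Omega> \<beta> (comp (Sq n) i j)" for n i j \<beta>
  have wf: "weak_family \<Omega> k (comp (Sq n) i j) (V n i j)" for n i j
    unfolding V_def using u(1) Hk_mem_family by (auto simp: Hk_def)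
  have VL: "L2 \<Omega> (V n i j is)" and Vw: "wderiv \<Omega> is (comp (Sq n) i j) (V n i j is)" if "length is \<le> k" for n i j "is"
    using wf[of n i j] that by (auto simp: weak_family_def)
  have Vl: "l2 ?M (V n i j is)" if "length is \<le> k" for n i j "is" using VL[OF that] by (simp add: L2_l2)
  have SM: "ML2 \<Omega> (Sq n)" for n using u(1) by (auto simp: ML2_def Hk_def Hk_mem_def)
  have Vsym: "V n i j \<beta> = V n j i \<beta>" for n i j \<beta>
  proof -
    have "comp (Sq n) i j x = comp (Sq n) j i x" if "x \<in> \<Omega>" for x
    proof -
      have "transpose (Sq n x) $ i $ j = Sq n x $ i $ j" using sym[of n] that by (simp add: symfield_def)
      then show ?thesis by (simp add: comp_def transpose_def)
    qed
    \<comment> \<open>Entries equal on the domain lead to the very same choice in \<open>D\<close>,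
      so the symmetry is an identity of functions and not just almost everywhere.\<close>
    then show ?thesis unfolding V_def by (rule D_cong)
  qed
  define Q where "Q a s = (\<forall>e>0. \<exists>N. \<forall>m\<ge>N. \<forall>n\<ge>N.
      n2 ?M (\<lambda>x. V (s m) (fst a) (fst (snd a)) (snd (snd a)) x - V (s n) (fst a) (fst (snd a)) (snd (snd a)) x) < e)"
    for a :: "3 \<times> 3 \<times> 3 list" and s :: "nat \<Rightarrow> nat"
  have "\<exists>r. strict_mono r \<and> (\<forall>a\<in>UNIV \<times> UNIV \<times> {\<alpha>. length \<alpha> \<le> k - 1}. Q a r)"
  proof (rule common_subsequence)
    show "finite (UNIV \<times> UNIV \<times> {\<alpha> :: 3 list. length \<alpha> \<le> k - 1} :: (3 \<times> 3 \<times> 3 list) set)"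
      by (intro finite_cartesian_product finite_lists_le) auto
    show "\<exists>r. strict_mono r \<and> Q a (s \<circ> r)"
      if a: "a \<in> UNIV \<times> UNIV \<times> {\<alpha>. length \<alpha> \<le> k - 1}" and s: "strict_mono s" for a and s :: "nat \<Rightarrow> nat"
    proof -
      obtain i j \<alpha> where a': "a = (i, j, \<alpha>)" and l: "length \<alpha> < k" using a k by (cases a) auto
      have l1: "length \<alpha> + 1 \<le> k" using l by simp
      have "\<exists>r :: nat \<Rightarrow> nat. strict_mono r \<and> (\<forall>e>0. \<exists>N. \<forall>m\<ge>N. \<forall>n\<ge>N. n2 ?M (\<lambda>x. V (s (r m)) i j \<alpha> x - V (s (r n)) i j \<alpha> x) < e)"
      proof (rule rellich[OF \<Omega>])
        show "Hk \<Omega> 1 (frontier \<Omega>) (V (s n) i j \<alpha>)" for n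
          using l by (intro Hk_deriv[OF \<Omega> u(1) VL Vw l1]) auto
        show "Hk_norm \<Omega> 1 (V (s n) i j \<alpha>) \<le> real (card {is :: 3 list. length is \<le> 1}) * C" for n
          by (rule D_Hk_norm_le[OF \<Omega> wf u(2) l])
      qed
      then show ?thesis by (simp add: Q_def a' o_def)
    qed
    show "Q a (s \<circ> r)" if "Q a s" and r: "strict_mono r" for a s r
      unfolding Q_def
    proof (intro allI impI)
      fix e :: real assume "e > 0"
      then obtain N where N: "\<And>m n. m \<ge> N \<Longrightarrow> n \<ge> N \<Longrightarrow>
        n2 ?M (\<lambda>x. V (s m) (fst a) (fst (snd a)) (snd (snd a)) x - V (s n) (fst a) (fst (snd a)) (snd (snd a)) x) < e"
        using \<open>Q a s\<close> unfolding Q_def by blast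
      have "r m \<ge> N" if "m \<ge> N" for m using seq_suble[OF r, of m] that by simp
      then show "\<exists>N. \<forall>m\<ge>N. \<forall>n\<ge>N. n2 ?M (\<lambda>x. V ((s \<circ> r) m) (fst a) (fst (snd a)) (snd (snd a)) x
          - V ((s \<circ> r) n) (fst a) (fst (snd a)) (snd (snd a)) x) < e"
        using N by (intro exI[of _ N]) simp
    qed
  qed
  then obtain r :: "nat \<Rightarrow> nat" where r: "strict_mono r"
    and Cr: "\<And>i j \<alpha> e. length \<alpha> \<le> k - 1 \<Longrightarrow> e > 0 \<Longrightarrow> \<exists>N. \<forall>m\<ge>N. \<forall>n\<ge>N.
      n2 ?M (\<lambda>x. V (r m) i j \<alpha> x - V (r n) i j \<alpha> x) < e"
    by (auto simp: Q_def)
  have top: "\<exists>N. \<forall>m\<ge>N. \<forall>n\<ge>N. n2 ?M (\<lambda>x. V (r m) i j (\<alpha> @ [l]) x - V (r n) i j (\<alpha> @ [l]) x) < e"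
    if \<alpha>: "length \<alpha> = k - 1" and e: "e > 0" for i j \<alpha> l e
  proof -
    have lk: "length \<alpha> < k" "length \<alpha> \<le> k" "\<And>a. length (\<alpha> @ [a]) \<le> k" using \<alpha> k by auto
    \<comment> \<open>The number 174 is 81 * 2 + 6 * 2, the constant of
      \<open>gradient_estimate\<close> with both bounds doubled by passing to differences; the added
      1 avoids division by zero when \<open>C = 0\<close>.\<close>
    define \<tau> where "\<tau> = e\<^sup>2 / (174 * C + 1) / 2"
    have \<tau>: "\<tau> > 0" "\<tau> * (174 * C) < e\<^sup>2"
    proof -
      have c: "174 * C + 1 > 0" using C by simp
      show \<tau>: "\<tau> > 0" using e c by (simp add: \<tau>_def)
      have "\<tau> * (174 * C) < 2 * (\<tau> * (174 * C + 1))" using \<tau> C by (simp add: algebra_simps add_pos_nonneg)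
      also have "\<dots> = e\<^sup>2"
      proof -
        have "2 * (e\<^sup>2 / c / 2 * c) = e\<^sup>2" if "c \<noteq> 0" for c :: real using that by simp
        then show ?thesis unfolding \<tau>_def using c by (metis less_irrefl)
      qed
      finally show "\<tau> * (174 * C) < e\<^sup>2" .
    qed
    define I where "I = (UNIV :: (3 \<times> 3) set)"
    have "\<forall>p\<in>I. \<exists>N. \<forall>m\<ge>N. \<forall>n\<ge>N. n2 ?M (\<lambda>x. V (r m) (fst p) (snd p) \<alpha> x - V (r n) (fst p) (snd p) \<alpha> x) < \<tau>"
      using Cr[OF _ \<tau>(1)] \<alpha> by auto
    then obtain N where N: "\<And>i j m n. m \<ge> N (i, j) \<Longrightarrow> n \<ge> N (i, j) \<Longrightarrow> n2 ?M (\<lambda>x. V (r m) i j \<alpha> x - V (r n) i j \<alpha> x) < \<tau>"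
      unfolding I_def by (metis UNIV_I fst_conv snd_conv)
    define N0 where "N0 = Max (range N)"
    have N0: "N p \<le> N0" for p unfolding N0_def by (rule Max_ge) auto
    have "n2 ?M (\<lambda>x. V (r m) i j (\<alpha> @ [l]) x - V (r n) i j (\<alpha> @ [l]) x) < e" if mn: "m \<ge> N0" "n \<ge> N0" for m n
    proof -
      let ?a = "r m" and ?b = "r n"
      define W where "W n i j \<beta> = D \<Omega> \<beta> (comp (R n) i j)" for n i j \<beta>
      have wW: "weak_family \<Omega> k (comp (R n) i j) (W n i j)" for n i j
        unfolding W_def using R(3) Hk_mem_family by auto
      have WC: "n2 ?M (W n i j is) \<le> C" if "length is \<le> k" for n i j "is"
        using order.trans[OF weak_family_norm(1)[OF \<Omega> wW that] R(4)] .
      define h where "h n = D \<Omega> \<alpha> (g n)" for n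
      have h: "L2 \<Omega> (h n)" "wderiv \<Omega> \<alpha> (g n) (h n)" "n2 ?M (h n) \<le> C" for n
        using D_props[OF g(3), of \<alpha> n] order.trans[OF n2_D_le_Hk_norm g(4), of \<alpha> n] \<alpha> by (auto simp: h_def)
      \<comment> \<open>The double divergence commutes with the derivative \<open>\<alpha>\<close>:
        the equation for the field itself is tested with \<open>pd \<alpha> \<phi>\<close>, and the
        same sign appears on both sides.\<close>
      have dd: "(\<Sum>i\<in>UNIV. \<Sum>j\<in>UNIV. ip ?M (V n i j \<alpha>) (pd [i, j] \<phi>)) = ip ?M (h n) \<phi>" if t: "test \<Omega> \<phi>" for n \<phi>
      proof -
        have sm: "smooth \<phi>" using t by (simp add: test_def)
        have inv: "x = (-1) ^ length \<alpha> * y \<longleftrightarrow> y = (-1) ^ length \<alpha> * x" for x y :: real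
          by (cases "even (length \<alpha>)") auto
        have "ip ?M (V n i j \<alpha>) (pd [i, j] \<phi>) = (-1) ^ length \<alpha> * ip ?M (comp (Sq n) i j) (pd [i, j] (pd \<alpha> \<phi>))" for i j
          using Vw[OF lk(2), of n i j] test_pd[OF t, of "[i, j]"] pd_commute[OF sm, of \<alpha> "[i, j]"]
          by (simp add: wderiv_ip inv)
        then have "(\<Sum>i\<in>UNIV. \<Sum>j\<in>UNIV. ip ?M (V n i j \<alpha>) (pd [i, j] \<phi>))
          = (-1) ^ length \<alpha> * (\<Sum>i\<in>UNIV. \<Sum>j\<in>UNIV. ip ?M (comp (Sq n) i j) (pd [i, j] (pd \<alpha> \<phi>)))"
          by (simp add: sum_distrib_left)
        also have "\<dots> = (-1) ^ length \<alpha> * ip ?M (g n) (pd \<alpha> \<phi>)"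
          using weak_divDiv_ip[OF \<Omega>(1) SM g(2) test_pd[OF t]] by simp
        also have "\<dots> = ip ?M (h n) \<phi>" using h(2)[of n] t by (simp add: wderiv_ip inv[symmetric])
        finally show ?thesis .
      qed
      let ?T = "\<lambda>i j x. V ?a i j \<alpha> x - V ?b i j \<alpha> x"
      let ?d = "\<lambda>l i j x. V ?a i j (\<alpha> @ [l]) x - V ?b i j (\<alpha> @ [l]) x"
      have "(n2 ?M (?d l i j))\<^sup>2 \<le> \<tau> * (81 * (2 * C) + 6 * (2 * C))"
      proof (rule gradient_estimate[OF \<Omega>, where T = ?T and d = ?d and g = "\<lambda>x. h ?a x - h ?b x"])
        show "Hk \<Omega> 1 (frontier \<Omega>) (?T i j)" for i j
          using lk(1) by (intro Hk_diff[OF \<Omega>] Hk_deriv[OF \<Omega> u(1) VL Vw]) auto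
        show "L2 \<Omega> (?d l i j)" for l i j using Vl[OF lk(3)] by (auto simp: L2_l2 intro: l2_diff)
        show "wderiv \<Omega> [l] (?T i j) (?d l i j)" for l i j
          using lk by (intro wderiv_diff \<Omega>(1) VL wderiv_drop[OF Vw Vw]) auto
        show "AE x in ?M. ?d l i j x = ?d l j i x" for l i j using Vsym by simp
        show "\<exists>g. L2 \<Omega> g \<and> wderiv \<Omega> [l] (\<lambda>x. ?d k i j x - ?d j i k x) g \<and> n2 ?M g \<le> 2 * C" for i k j l
        proof -
          have "\<exists>g. L2 \<Omega> g \<and> wderiv \<Omega> [l] (\<lambda>x. V n i j (\<alpha> @ [k]) x - V n i k (\<alpha> @ [j]) x) g \<and> n2 ?M g \<le> C" for n
            by (rule curl_entry[OF \<Omega> SM R(1,2) wf wW WC lk(1) C])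
          then obtain G where G: "\<And>n. L2 \<Omega> (G n)" "\<And>n. n2 ?M (G n) \<le> C"
            "\<And>n. wderiv \<Omega> [l] (\<lambda>x. V n i j (\<alpha> @ [k]) x - V n i k (\<alpha> @ [j]) x) (G n)" by metis
          have "wderiv \<Omega> [l] (\<lambda>x. (V ?a i j (\<alpha> @ [k]) x - V ?a i k (\<alpha> @ [j]) x) - (V ?b i j (\<alpha> @ [k]) x - V ?b i k (\<alpha> @ [j]) x))
            (\<lambda>x. G ?a x - G ?b x)"
            using Vl[OF lk(3)] by (intro wderiv_diff \<Omega>(1) G) (auto simp: L2_l2 intro: l2_diff)
          moreover have "n2 ?M (\<lambda>x. G ?a x - G ?b x) \<le> 2 * C"
            using n2_diff_le[of ?M "G ?a" "G ?b"] G(1,2)[of ?a] G(1,2)[of ?b] by (simp add: L2_l2)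
          ultimately show ?thesis
            using G(1) by (intro exI[of _ "\<lambda>x. G ?a x - G ?b x"]) (auto simp: L2_l2 l2_diff algebra_simps)
        qed
        show "L2 \<Omega> (\<lambda>x. h ?a x - h ?b x)" using h(1) by (simp add: L2_l2 l2_diff)
        show "n2 ?M (\<lambda>x. h ?a x - h ?b x) \<le> 2 * C"
          using n2_diff_le[of ?M "h ?a" "h ?b"] h(1,3)[of ?a] h(1,3)[of ?b] by (simp add: L2_l2)
        show "(\<Sum>i\<in>UNIV. \<Sum>j\<in>UNIV. ip ?M (?T i j) (pd [i, j] \<phi>)) = ip ?M (\<lambda>x. h ?a x - h ?b x) \<phi>" if t: "test \<Omega> \<phi>" for \<phi>
        proof -
          have hl: "l2 ?M (h n)" for n using h(1) by (simp add: L2_l2)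
          have tl: "l2 ?M \<phi>" using test_pd_l2[OF \<Omega>(1) t, of "[]"] by simp
          have "ip ?M (?T i j) (pd [i, j] \<phi>) = ip ?M (V ?a i j \<alpha>) (pd [i, j] \<phi>) - ip ?M (V ?b i j \<alpha>) (pd [i, j] \<phi>)" for i j
            by (rule ip_diff_left[OF Vl[OF lk(2)] Vl[OF lk(2)] test_pd_l2[OF \<Omega>(1) t]])
          then show ?thesis
            using dd[OF t, of ?a] dd[OF t, of ?b] ip_diff_left[OF hl hl tl, of ?a ?b]
            by (simp only: sum_subtractf)
        qed
        show "n2 ?M (?T i j) \<le> \<tau>" for i j
          using N[of i j m n] mn N0[of "(i, j)"] by simp
      qed
      also have "\<dots> = \<tau> * (174 * C)" by simp
      also have "\<dots> < e\<^sup>2" by (rule \<tau>)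
      finally show ?thesis using e power2_less_imp_less by fastforce
    qed
    then show ?thesis by blast
  qed
  have all: "\<exists>N. \<forall>m\<ge>N. \<forall>n\<ge>N. n2 ?M (\<lambda>x. V (r m) i j \<beta> x - V (r n) i j \<beta> x) < e"
    if \<beta>: "length \<beta> \<le> k" and e: "e > 0" for i j \<beta> e
  proof (cases "length \<beta> \<le> k - 1")
    case True
    then show ?thesis using Cr e by blast
  next
    case False
    \<comment> \<open>The last index of a list of full length serves as gradient direction; what
      precedes it is a derivative of order \<open>k - 1\<close>.\<close>
    then have "\<beta> \<noteq> []" "length (butlast \<beta>) = k - 1" using \<beta> k by auto
    then show ?thesis using top[of "butlast \<beta>" e i j "last \<beta>"] e by simp
  qed
  show ?thesis
    using r all unfolding V_def by (intro exI[of _ r]) blast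
qed

text \<open>Compactness is expressed by sequences. Continuity of the embedding is implicit, because
  the norm of the target is a summand of the norm of the intersection. The limit is assembled from
  L2 limits of all derivatives, using that weak derivatives are closed under L2 convergence.\<close>

theorem theorem3p21:
  fixes \<Omega> \<Gamma>t :: "(real^3) set" and k :: nat
  assumes "strong_lipschitz_domain \<Omega>"
    and "\<Gamma>t \<subseteq> frontier \<Omega>"
    and "openin (top_of_set (frontier \<Omega>)) \<Gamma>t"
    and "strong_lipschitz_boundary_part \<Omega> \<Gamma>t"
    and "k \<ge> 1"
  shows "(\<forall>S. HkRot \<Omega> k \<Gamma>t S \<and> HkdivDiv \<Omega> k (frontier \<Omega> - closure \<Gamma>t) S
              \<longrightarrow> HkS \<Omega> k (frontier \<Omega>) S) \<and>
         (\<forall>(Sq :: nat \<Rightarrow> real^3 \<Rightarrow> real^3^3) C.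
            (\<forall>n. HkRot \<Omega> k \<Gamma>t (Sq n) \<and> HkdivDiv \<Omega> k (frontier \<Omega> - closure \<Gamma>t) (Sq n)) \<and>
            (\<forall>n. MHk_norm \<Omega> k (Sq n) + MHk_norm \<Omega> k (RotW \<Omega> (Sq n))
                 + Hk_norm \<Omega> (k - 1) (divDivW \<Omega> (Sq n)) \<le> C)
            \<longrightarrow> (\<exists>r S. strict_mono r \<and> HkS \<Omega> k (frontier \<Omega>) S \<and>
                   (\<lambda>n. MHk_norm \<Omega> k (\<lambda>x. Sq (r n) x - S x)) \<longlonglongrightarrow> 0))"
proof (intro conjI allI impI)
  have o: "open \<Omega>" "bounded \<Omega>" using assms(1) by (auto simp: strong_lipschitz_domain_def)
  have emb: "HkS \<Omega> k (frontier \<Omega>) S"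
    if "HkRot \<Omega> k \<Gamma>t S" "HkdivDiv \<Omega> k (frontier \<Omega> - closure \<Gamma>t) S" for S
    using that Hk_frontier[OF assms(1,4)] by (auto simp: HkS_def HkRot_def HkdivDiv_def MHk_def H_Rot_def)
  show "HkS \<Omega> k (frontier \<Omega>) S"
    if "HkRot \<Omega> k \<Gamma>t S \<and> HkdivDiv \<Omega> k (frontier \<Omega> - closure \<Gamma>t) S" for S
    using emb that by blast
  fix Sq :: "nat \<Rightarrow> real^3 \<Rightarrow> real^3^3" and C
  assume a: "(\<forall>n. HkRot \<Omega> k \<Gamma>t (Sq n) \<and> HkdivDiv \<Omega> k (frontier \<Omega> - closure \<Gamma>t) (Sq n)) \<and>
            (\<forall>n. MHk_norm \<Omega> k (Sq n) + MHk_norm \<Omega> k (RotW \<Omega> (Sq n))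
                 + Hk_norm \<Omega> (k - 1) (divDivW \<Omega> (Sq n)) \<le> C)"
  then have rot: "\<And>n. HkRot \<Omega> k \<Gamma>t (Sq n)" and div: "\<And>n. HkdivDiv \<Omega> k (frontier \<Omega> - closure \<Gamma>t) (Sq n)"
    and bd: "\<And>n. MHk_norm \<Omega> k (Sq n) + MHk_norm \<Omega> k (RotW \<Omega> (Sq n)) + Hk_norm \<Omega> (k - 1) (divDivW \<Omega> (Sq n)) \<le> C"
    by auto
  let ?M = "lebesgue_on \<Omega>"
  have u: "Hk \<Omega> k (frontier \<Omega>) (comp (Sq n) i j)" for n i j
    using emb[OF rot div] by (simp add: HkS_def MHk_def)
  have nn: "MHk_norm \<Omega> k (Sq n) \<le> C" "MHk_norm \<Omega> k (RotW \<Omega> (Sq n)) \<le> C" "Hk_norm \<Omega> (k - 1) (divDivW \<Omega> (Sq n)) \<le> C" for n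
    using bd[of n] MHk_norm_nonneg[of \<Omega> k "Sq n"] MHk_norm_nonneg[of \<Omega> k "RotW \<Omega> (Sq n)"]
      Hk_norm_nonneg[of \<Omega> "k - 1" "divDivW \<Omega> (Sq n)"] by linarith+
  have C: "C \<ge> 0" using order.trans[OF MHk_norm_nonneg nn(1)] .
  have "\<exists>r :: nat \<Rightarrow> nat. strict_mono r \<and> (\<forall>i j \<beta>. length \<beta> \<le> k \<longrightarrow> (\<forall>e>0. \<exists>N. \<forall>m\<ge>N. \<forall>n\<ge>N.
    n2 ?M (\<lambda>x. D \<Omega> \<beta> (comp (Sq (r m)) i j) x - D \<Omega> \<beta> (comp (Sq (r n)) i j) x) < e))"
  proof (rule derivatives_Cauchy[OF o assms(5) C u, where R = "\<lambda>n. RotW \<Omega> (Sq n)" and g = "\<lambda>n. divDivW \<Omega> (Sq n)"])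
    fix n i j
    show "Hk_norm \<Omega> k (comp (Sq n) i j) \<le> C" "Hk_norm \<Omega> k (comp (RotW \<Omega> (Sq n)) i j) \<le> C"
      using order.trans[OF Hk_norm_le_MHk_norm nn(1)] order.trans[OF Hk_norm_le_MHk_norm nn(2)] by auto
    show "symfield \<Omega> (Sq n)" using rot[of n] by (simp add: HkRot_def H_Rot_def)
    show "ML2 \<Omega> (RotW \<Omega> (Sq n))" "weak_Rot \<Omega> (Sq n) (RotW \<Omega> (Sq n))"
      using RotW_props rot[of n] unfolding HkRot_def by blast+
    show "Hk_mem \<Omega> k (comp (RotW \<Omega> (Sq n)) i j)" using rot[of n] by (simp add: HkRot_def MHk_def Hk_def)
    show "L2 \<Omega> (divDivW \<Omega> (Sq n))" "weak_divDiv \<Omega> (Sq n) (divDivW \<Omega> (Sq n))"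
      using divDivW_props div[of n] unfolding HkdivDiv_def by blast+
    show "Hk_mem \<Omega> (k - 1) (divDivW \<Omega> (Sq n))" using div[of n] by (simp add: HkdivDiv_def Hk_def)
  qed (rule nn)
  then obtain r :: "nat \<Rightarrow> nat" where r: "strict_mono r"
    and Cau: "\<And>i j \<beta> e. length \<beta> \<le> k \<Longrightarrow> e > 0 \<Longrightarrow> \<exists>N. \<forall>m\<ge>N. \<forall>n\<ge>N.
      n2 ?M (\<lambda>x. D \<Omega> \<beta> (comp (Sq (r m)) i j) x - D \<Omega> \<beta> (comp (Sq (r n)) i j) x) < e"
    by blast
  define V where "V n i j \<beta> = D \<Omega> \<beta> (comp (Sq (r n)) i j)" for n i j \<beta>
  have wf: "weak_family \<Omega> k (comp (Sq (r n)) i j) (V n i j)" for n i j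
    unfolding V_def using u Hk_mem_family by (auto simp: Hk_def)
  have VL: "L2 \<Omega> (V n i j is)" and Vw: "wderiv \<Omega> is (comp (Sq (r n)) i j) (V n i j is)" if "length is \<le> k" for n i j "is"
    using wf[of n i j] that by (auto simp: weak_family_def)
  have Vsym: "V n i j \<beta> = V n j i \<beta>" for n i j \<beta>
  proof -
    have "comp (Sq (r n)) i j x = comp (Sq (r n)) j i x" if "x \<in> \<Omega>" for x
    proof -
      have "transpose (Sq (r n) x) $ i $ j = Sq (r n) x $ i $ j"
        using rot[of "r n"] that by (simp add: HkRot_def H_Rot_def symfield_def)
      then show ?thesis by (simp add: comp_def transpose_def)
    qed
    then show ?thesis unfolding V_def by (rule D_cong)
  qed
  \<comment> \<open>Limits are chosen separately for every entry and multi-index; that they belong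
    together is shown afterwards.\<close>
  define f where "f i j \<beta> = (SOME h. L2 \<Omega> h \<and> (\<lambda>n. n2 ?M (\<lambda>x. V n i j \<beta> x - h x)) \<longlonglongrightarrow> 0)" for i j \<beta>
  have f: "L2 \<Omega> (f i j \<beta>)" "(\<lambda>n. n2 ?M (\<lambda>x. V n i j \<beta> x - f i j \<beta> x)) \<longlonglongrightarrow> 0"
    if \<beta>: "length \<beta> \<le> k" for i j \<beta>
  proof -
    obtain h where h: "l2 ?M h" "(\<lambda>n. n2 ?M (\<lambda>x. V n i j \<beta> x - h x)) \<longlonglongrightarrow> 0"
    proof (rule l2_complete[of ?M "\<lambda>n. V n i j \<beta>"])
      show "l2 ?M (V n i j \<beta>)" for n using VL[OF \<beta>] by (simp add: L2_l2)
      show "\<exists>N. \<forall>m\<ge>N. \<forall>n\<ge>N. n2 ?M (\<lambda>x. V m i j \<beta> x - V n i j \<beta> x) < e" if "e > 0" for e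
        using Cau[OF \<beta> that] by (simp add: V_def)
    qed
    then have "\<exists>h. L2 \<Omega> h \<and> (\<lambda>n. n2 ?M (\<lambda>x. V n i j \<beta> x - h x)) \<longlonglongrightarrow> 0" by (auto simp: L2_l2)
    then have "L2 \<Omega> (f i j \<beta>) \<and> (\<lambda>n. n2 ?M (\<lambda>x. V n i j \<beta> x - f i j \<beta> x)) \<longlonglongrightarrow> 0"
      unfolding f_def by (rule someI_ex)
    then show "L2 \<Omega> (f i j \<beta>)" "(\<lambda>n. n2 ?M (\<lambda>x. V n i j \<beta> x - f i j \<beta> x)) \<longlonglongrightarrow> 0" by auto
  qed
  have fw: "weak_family \<Omega> k (f i j []) (f i j)" for i j
    unfolding weak_family_def
  proof (intro conjI allI impI f(1))
    fix \<beta> :: "3 list" assume \<beta>: "length \<beta> \<le> k"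
    show "wderiv \<Omega> \<beta> (f i j []) (f i j \<beta>)"
    proof (rule wderiv_limit[OF o(1)])
      show "(\<lambda>n. n2 ?M (\<lambda>x. V n i j [] x - f i j [] x)) \<longlonglongrightarrow> 0" "(\<lambda>n. n2 ?M (\<lambda>x. V n i j \<beta> x - f i j \<beta> x)) \<longlonglongrightarrow> 0"
        using f(2)[of "[]"] f(2)[OF \<beta>] by auto
      \<comment> \<open>\<open>V n i j []\<close> is the representative chosen by \<open>D\<close>
        for the empty list, in general only almost everywhere equal to the entry itself, hence the
        detour through \<open>wderiv_drop\<close>.\<close>
      show "wderiv \<Omega> \<beta> (V n i j []) (V n i j \<beta>)" for n
        using wderiv_drop[of \<Omega> "[]" "comp (Sq (r n)) i j" "V n i j []" \<beta> "V n i j \<beta>"]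
          Vw[of "[]" n i j] Vw[OF \<beta>, of n i j] by simp
    qed (use \<beta> VL f(1) in auto)
  qed auto
  \<comment> \<open>The limits of transposed entries agree only almost everywhere, whereas
    \<open>symfield\<close> demands symmetry at every point. Averaging enforces it, and the limit is
    unaffected because the approximating derivatives are exactly symmetric.\<close>
  define F where "F i j \<beta> x = 1/2 * (f i j \<beta> x + f j i \<beta> x)" for i j \<beta> x
  define S :: "real^3 \<Rightarrow> real^3^3" where "S x = (\<chi> i j. F i j [] x)" for x
  have cS: "comp S i j = F i j []" for i j by (simp add: comp_def S_def)
  have Fw: "weak_family \<Omega> k (comp S i j) (F i j)" for i j
    unfolding cS F_def[abs_def] using weak_family_cmult[OF weak_family_add[OF o(1) fw fw], of "1/2" i j j i] by simp
  have conv: "(\<lambda>n. n2 ?M (\<lambda>x. V n i j \<beta> x - F i j \<beta> x)) \<longlonglongrightarrow> 0" if \<beta>: "length \<beta> \<le> k" for i j \<beta>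
  proof (rule Lim_null_comparison)
    have l: "l2 ?M (V n i j \<beta>)" "l2 ?M (f i j \<beta>)" for n i j using VL[OF \<beta>] f(1)[OF \<beta>] by (auto simp: L2_l2)
    have "n2 ?M (\<lambda>x. V n i j \<beta> x - F i j \<beta> x) \<le> 1/2 * n2 ?M (\<lambda>x. V n i j \<beta> x - f i j \<beta> x) + 1/2 * n2 ?M (\<lambda>x. V n j i \<beta> x - f j i \<beta> x)" for n
    proof -
      have "n2 ?M (\<lambda>x. V n i j \<beta> x - F i j \<beta> x)
          = n2 ?M (\<lambda>x. 1/2 * (V n i j \<beta> x - f i j \<beta> x) + 1/2 * (V n j i \<beta> x - f j i \<beta> x))"
        using Vsym[of n j i \<beta>] by (simp add: F_def algebra_simps)
      also have "\<dots> \<le> n2 ?M (\<lambda>x. 1/2 * (V n i j \<beta> x - f i j \<beta> x)) + n2 ?M (\<lambda>x. 1/2 * (V n j i \<beta> x - f j i \<beta> x))"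
        by (intro n2_add_le l2_cmult l2_diff l)
      finally show ?thesis unfolding n2_cmult by simp
    qed
    then show "\<forall>\<^sub>F n in sequentially. norm (n2 ?M (\<lambda>x. V n i j \<beta> x - F i j \<beta> x))
      \<le> 1/2 * n2 ?M (\<lambda>x. V n i j \<beta> x - f i j \<beta> x) + 1/2 * n2 ?M (\<lambda>x. V n j i \<beta> x - f j i \<beta> x)"
      by (simp add: n2_nonneg)
    show "(\<lambda>n. 1/2 * n2 ?M (\<lambda>x. V n i j \<beta> x - f i j \<beta> x) + 1/2 * n2 ?M (\<lambda>x. V n j i \<beta> x - f j i \<beta> x)) \<longlonglongrightarrow> 0"
      by (intro tendsto_add_zero tendsto_mult_right_zero f(2) \<beta>)
  qed
  have "Hk \<Omega> k (frontier \<Omega>) (comp S i j)" for i j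
  proof (rule HkI[OF o Fw])
    fix e :: real assume "e > 0"
    then have e2: "e/2 > 0" by simp
    have "\<forall>\<^sub>F n in sequentially. \<forall>\<beta>\<in>{\<beta>. length \<beta> \<le> k}. n2 ?M (\<lambda>x. V n i j \<beta> x - F i j \<beta> x) < e/2"
      using order_tendstoD(2)[OF conv e2] by (subst eventually_ball_finite_distrib[OF finite_lists_le]) blast
    then obtain n where n: "\<forall>\<beta>\<in>{\<beta>. length \<beta> \<le> k}. n2 ?M (\<lambda>x. V n i j \<beta> x - F i j \<beta> x) < e/2"
      using eventually_happens[of _ sequentially] by (auto simp: trivial_limit_sequentially)
    obtain \<phi> where \<phi>: "Csig (frontier \<Omega>) \<phi>" "\<And>is. length is \<le> k \<Longrightarrow> n2 ?M (\<lambda>x. pd is \<phi> x - V n i j is x) \<le> e/2"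
      using Hk_HkI_eps[OF o u wf e2] by blast
    have "n2 ?M (\<lambda>x. pd \<beta> \<phi> x - F i j \<beta> x) \<le> e" if \<beta>: "length \<beta> \<le> k" for \<beta>
    proof -
      have "n2 ?M (\<lambda>x. pd \<beta> \<phi> x - F i j \<beta> x) \<le> n2 ?M (\<lambda>x. pd \<beta> \<phi> x - V n i j \<beta> x) + n2 ?M (\<lambda>x. V n i j \<beta> x - F i j \<beta> x)"
        using VL[OF \<beta>] Fw \<beta> test_l2[OF o(1) test0_pd[OF Csig_test0[OF \<phi>(1)]]]
        by (intro n2_triangle_diff) (auto simp: L2_l2 weak_family_def)
      then show ?thesis using \<phi>(2)[OF \<beta>] n \<beta> by fastforce
    qed
    with \<phi>(1) show "\<exists>\<phi>. Csig (frontier \<Omega>) \<phi> \<and> (\<forall>is. length is \<le> k \<longrightarrow> n2 ?M (\<lambda>x. pd is \<phi> x - F i j is x) \<le> e)" by blast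
  qed
  then have "MHk \<Omega> k (frontier \<Omega>) S" by (simp add: MHk_def)
  moreover have "symfield \<Omega> S"
    by (auto simp: symfield_def S_def transpose_def vec_eq_iff F_def add.commute)
  ultimately have HS: "HkS \<Omega> k (frontier \<Omega>) S" by (simp add: HkS_def)
  have "(\<lambda>n. Hk_norm \<Omega> k (comp (\<lambda>x. Sq (r n) x - S x) i j)) \<longlonglongrightarrow> 0" for i j
  proof (rule Lim_null_comparison)
    have "comp (\<lambda>x. Sq (r n) x - S x) i j = (\<lambda>x. comp (Sq (r n)) i j x - comp S i j x)" for n
      by (simp add: comp_def)
    then have "Hk_norm \<Omega> k (comp (\<lambda>x. Sq (r n) x - S x) i j) \<le> (\<Sum>\<beta>\<in>{\<beta>. length \<beta> \<le> k}. n2 ?M (\<lambda>x. V n i j \<beta> x - F i j \<beta> x))" for n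
      using weak_family_norm(2)[OF o weak_family_diff[OF o(1) wf Fw]] by simp
    then show "\<forall>\<^sub>F n in sequentially. norm (Hk_norm \<Omega> k (comp (\<lambda>x. Sq (r n) x - S x) i j))
        \<le> (\<Sum>\<beta>\<in>{\<beta>. length \<beta> \<le> k}. n2 ?M (\<lambda>x. V n i j \<beta> x - F i j \<beta> x))"
      by (simp add: Hk_norm_nonneg)
    show "(\<lambda>n. \<Sum>\<beta>\<in>{\<beta>. length \<beta> \<le> k}. n2 ?M (\<lambda>x. V n i j \<beta> x - F i j \<beta> x)) \<longlonglongrightarrow> 0"
      by (rule tendsto_null_sum) (simp add: conv)
  qed
  then have "(\<lambda>n. sqrt (\<Sum>i\<in>UNIV. \<Sum>j\<in>UNIV. (Hk_norm \<Omega> k (comp (\<lambda>x. Sq (r n) x - S x) i j))\<^sup>2)) \<longlonglongrightarrow> sqrt (\<Sum>i\<in>(UNIV::3 set). \<Sum>j\<in>(UNIV::3 set). 0\<^sup>2)"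
    by (intro tendsto_intros)
  then have "(\<lambda>n. MHk_norm \<Omega> k (\<lambda>x. Sq (r n) x - S x)) \<longlonglongrightarrow> 0" by (simp add: MHk_norm_def)
  with r HS show "\<exists>r S. strict_mono r \<and> HkS \<Omega> k (frontier \<Omega>) S \<and>
                   (\<lambda>n. MHk_norm \<Omega> k (\<lambda>x. Sq (r n) x - S x)) \<longlonglongrightarrow> 0"
    by (intro exI[of _ r] exI[of _ S] conjI)
qed

end
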